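(* Let $R=k[x,y,z]/(h)$, where $h$ is a regular trinomial of degree $d$ and $k$ is an algebraically closed field of characteristic $p>0$. Let $p\equiv\pm1\pmod{2\lambda_h}$ and $p\ge d^2$. Then: (1) $V_1$ is strongly semistable; and (2) if, in addition, $p\ge n$, then (a) either $V_n$ is strongly semistable, or (b) $V_n$ itself is not semistable and has the Harder–Narasimhan filtration $$0\subset\mathcal{L}_n\subset V_n,\qquad\text{where}\quad \deg\mathcal{L}_n=-\frac{3nd}{2}+\frac{\lambda}{2}(1-t),$$ where $t=\left|\frac{\alpha n}{\lambda}-u_1\right|+\left|\frac{\beta n}{\lambda}-u_2\right|+\left|\frac{\nu n}{\lambda}-u_3\right|<1$ for a unique $(u_1,u_2,u_3)\in L_{odd}$.
   Context: A trinomial of degree $d$ is a homogeneous irreducible polynomial $h=M_1+M_2+M_3$, where the $M_i$ are monomials of degree $d$ in $x,y,z$. It is irregular if one or more of the points $(1,0,0),(0,1,0),(0,0,1)$ has multiplicity $\ge d/2$ on the curve $h=0$, and regular otherwise. After a permutation of $x,y,z$, a regular trinomial has one of the forms Type (I): $h=x^{a_1}y^{a_2}+y^{b_1}z^{b_2}+z^{c_1}x^{c_2}$ with $a_1,b_1,c_1>d/2$; put $\alpha=a_1+b_1-d$, $\beta=a_1+c_1-d$, $\nu=b_1+c_1-d$, $\lambda=a_1b_1+a_2c_2-b_1c_2$. Type (II): $h=x^d+x^{a_1}y^{a_2}z^{a_3}+y^bz^c$ with $a_2,c>d/2$; put $\alpha=a_2$, $\beta=c$, $\nu=a_2+c-d$,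 $\lambda=a_2c-a_3b$. These are positive integers. Put $a=\gcd(\alpha,\beta,\nu,\lambda)$, $\lambda_h=\lambda/a$. $L_{odd}=\{u\in\mathbb{Z}^3:u_1+u_2+u_3\text{ odd}\}$. $C=\mathrm{Proj}\,R$, $\pi:X\to C$ is the normalization; for $n\ge1$, $W_n$ is the kernel of the surjection $\mathcal{O}_C^{\oplus3}\to\mathcal{O}_C(n)$, $(s_1,s_2,s_3)\mapsto s_1x^n+s_2y^n+s_3z^n$, and $V_n=\pi^*W_n$. $F$ is the Frobenius morphism of $X$; a bundle $V$ is strongly semistable if $F^{s*}V$ is semistable for all $s\ge0$.
   Formalization: The degree of L_n is corrected to -nd/2 + (λ/2)(1-t), since with V_n the pullback of ker(O^3→O(n)) the printed -3nd/2 is wrong (x^2+y^2+z^2, n=2, p=5: deg L_n=0, not -4); and d≥2 is assumed, since for the line x+y+z=0 the bundle V_1 is not semistable. *)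

theory Defs
  imports
    "HOL-Analysis.Finite_Cartesian_Product"
    "HOL-Library.Poly_Mapping"
    "HOL-Library.Numeral_Type"
    "HOL-Combinatorics.Permutations"
    "HOL-Computational_Algebra.Computational_Algebra"
    "HOL-Number_Theory.Cong"
begin

section \<open>Trinomials\<close>

text \<open>
  \<^typ>\<open>nat ^ 3\<close> is the monoid of exponent vectors, so the following monoid algebra is the polynomial
  ring in three variables, which are indexed by the three-element type \<^typ>\<open>3\<close>.
\<close>

type_synonym 'k poly3 = "(nat ^ 3) \<Rightarrow>\<^sub>0 'k"

definition Const3 :: "'k::comm_ring_1 \<Rightarrow> 'k poly3" where
  "Const3 c = Poly_Mapping.single 0 c"

definition monom3 :: "nat ^ 3 \<Rightarrow> 'k::comm_ring_1 poly3" where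
  "monom3 e = Poly_Mapping.single e 1"

definition Var3 :: "3 \<Rightarrow> 'k::comm_ring_1 poly3" where
  "Var3 i = monom3 (axis i 1)"

definition deg3 :: "nat ^ 3 \<Rightarrow> nat" where
  "deg3 e = (\<Sum>i\<in>UNIV. e $ i)"

definition homogeneous :: "nat \<Rightarrow> 'k::comm_ring_1 poly3 \<Rightarrow> bool" where
  "homogeneous m f \<longleftrightarrow> (\<forall>e\<in>Poly_Mapping.keys f. deg3 e = m)"

definition eval3 :: "'k::comm_ring_1 poly3 \<Rightarrow> 'k ^ 3 \<Rightarrow> 'k" where
  "eval3 f c = (\<Sum>e\<in>Poly_Mapping.keys f. Poly_Mapping.lookup f e * (\<Prod>i\<in>UNIV. (c $ i) ^ (e $ i)))"

definition trinomial :: "nat \<Rightarrow> 'k::comm_ring_1 poly3 \<Rightarrow> bool" where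
  "trinomial d h \<longleftrightarrow> irreducible h \<and>
     (\<exists>e1 e2 e3. deg3 e1 = d \<and> deg3 e2 = d \<and> deg3 e3 = d \<and>
        h = monom3 e1 + monom3 e2 + monom3 e3)"

text \<open>
  Multiplicity at the \<open>i\<close>-th coordinate point of the curve \<open>h = 0\<close>, for homogeneous \<open>h\<close>: the lowest
  degree of a term of the dehomogenization of \<open>h\<close> at the \<open>i\<close>-th variable (no terms merge, as \<open>h\<close> is
  homogeneous).
\<close>

definition coord_point_mult :: "3 \<Rightarrow> 'k::comm_ring_1 poly3 \<Rightarrow> nat" where
  "coord_point_mult i h = Min ((\<lambda>e. \<Sum>j\<in>- {i}. e $ j) ` Poly_Mapping.keys h)"

definition irregular :: "nat \<Rightarrow> 'k::comm_ring_1 poly3 \<Rightarrow> bool" where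
  "irregular d h \<longleftrightarrow> (\<exists>i. real (coord_point_mult i h) \<ge> real d / 2)"

definition regular_trinomial :: "nat \<Rightarrow> 'k::comm_ring_1 poly3 \<Rightarrow> bool" where
  "regular_trinomial d h \<longleftrightarrow> trinomial d h \<and> \<not> irregular d h"

text \<open>
  \<open>trinomial_invariants d h \<alpha> \<beta> \<nu> lam\<close>: after the permutation of the variables that gives them the names
  \<open>x\<close>, \<open>y\<close>, \<open>z\<close>, \<open>h\<close> is of type (I) or (II) with these numbers.
\<close>

inductive trinomial_invariants ::
    "nat \<Rightarrow> 'k::comm_ring_1 poly3 \<Rightarrow> int \<Rightarrow> int \<Rightarrow> int \<Rightarrow> int \<Rightarrow> bool"
  for d :: nat and h :: "'k poly3" where
  type_I:
    "\<lbrakk>distinct [x, y, z];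
      h = Var3 x ^ a1 * Var3 y ^ a2 + Var3 y ^ b1 * Var3 z ^ b2 + Var3 z ^ c1 * Var3 x ^ c2;
      a1 + a2 = d; b1 + b2 = d; c1 + c2 = d;
      real a1 > real d / 2; real b1 > real d / 2; real c1 > real d / 2;
      \<alpha> = int a1 + int b1 - int d; \<beta> = int a1 + int c1 - int d; \<nu> = int b1 + int c1 - int d;
      lam = int a1 * int b1 + int a2 * int c2 - int b1 * int c2\<rbrakk>
     \<Longrightarrow> trinomial_invariants d h \<alpha> \<beta> \<nu> lam"
| type_II:
    "\<lbrakk>distinct [x, y, z];
      h = Var3 x ^ d + Var3 x ^ a1 * Var3 y ^ a2 * Var3 z ^ a3 + Var3 y ^ b * Var3 z ^ c;
      a1 + a2 + a3 = d; b + c = d;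
      real a2 > real d / 2; real c > real d / 2;
      \<alpha> = int a2; \<beta> = int c; \<nu> = int a2 + int c - int d;
      lam = int a2 * int c - int a3 * int b\<rbrakk>
     \<Longrightarrow> trinomial_invariants d h \<alpha> \<beta> \<nu> lam"

definition L_odd :: "(int \<times> int \<times> int) set" where
  "L_odd = {(u1, u2, u3). odd (u1 + u2 + u3)}"

definition taxicab :: "real \<times> real \<times> real \<Rightarrow> int \<times> int \<times> int \<Rightarrow> real" where
  "taxicab = (\<lambda>(v1, v2, v3) (u1, u2, u3). \<bar>v1 - u1\<bar> + \<bar>v2 - u2\<bar> + \<bar>v3 - u3\<bar>)"


section \<open>The plane curve and its normalization\<close>

text \<open>
  The coordinate ring \<open>R = k[x,y,z]/(h)\<close> is a domain; it is given by its quotient map \<open>\<iota>\<close>, onto a subring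
  of a field \<open>'l\<close>. So \<open>Frac R\<close> is the subfield of all \<open>\<iota> f / \<iota> g\<close>. The field \<open>'l\<close> need not be equal to
  \<open>Frac R\<close>, so that a single field, e.g. an algebraic closure of \<open>k(s,t)\<close>, serves for every \<open>h\<close>.
\<close>

definition coordinate_ring_map :: "'k::field poly3 \<Rightarrow> ('k poly3 \<Rightarrow> 'l::field) \<Rightarrow> bool" where
  "coordinate_ring_map h \<iota> \<longleftrightarrow>
     \<iota> 1 = 1 \<and> (\<forall>f g. \<iota> (f + g) = \<iota> f + \<iota> g) \<and> (\<forall>f g. \<iota> (f * g) = \<iota> f * \<iota> g) \<and>
     (\<forall>f. \<iota> f = 0 \<longleftrightarrow> h dvd f)"

text \<open>The function field of \<open>C = Proj R\<close>.\<close>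

definition function_field :: "('k::field poly3 \<Rightarrow> 'l::field) \<Rightarrow> 'l set" where
  "function_field \<iota> = {\<iota> f / \<iota> g | f g m. homogeneous m f \<and> homogeneous m g \<and> \<iota> g \<noteq> 0}"

text \<open>
  Closed points of \<open>C\<close> are given by homogeneous coordinates (\<open>k\<close> is algebraically closed). The local
  rings are subrings of the function field.
\<close>

definition on_curve :: "'k::field poly3 \<Rightarrow> 'k ^ 3 \<Rightarrow> bool" where
  "on_curve h c \<longleftrightarrow> c \<noteq> 0 \<and> eval3 h c = 0"

definition curve_local_ring :: "('k::field poly3 \<Rightarrow> 'l::field) \<Rightarrow> 'k ^ 3 \<Rightarrow> 'l set" where
  "curve_local_ring \<iota> c =
     {\<iota> f / \<iota> g | f g m. homogeneous m f \<and> homogeneous m g \<and> eval3 g c \<noteq> 0}"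

definition integral_closure_in :: "'l::field set \<Rightarrow> 'l set \<Rightarrow> 'l set" where
  "integral_closure_in K A =
     {f \<in> K. \<exists>q :: 'l poly. lead_coeff q = 1 \<and> (\<forall>i. coeff q i \<in> A) \<and> poly q f = 0}"

definition ideal_of :: "'l::field set \<Rightarrow> 'l set \<Rightarrow> bool" where
  "ideal_of B I \<longleftrightarrow> I \<subseteq> B \<and> 0 \<in> I \<and> (\<forall>f\<in>I. \<forall>g\<in>I. f + g \<in> I) \<and> (\<forall>b\<in>B. \<forall>f\<in>I. b * f \<in> I)"

definition maximal_ideal_of :: "'l::field set \<Rightarrow> 'l set \<Rightarrow> bool" where
  "maximal_ideal_of B I \<longleftrightarrow> ideal_of B I \<and> I \<noteq> B \<and>
     (\<forall>J. ideal_of B J \<and> I \<subseteq> J \<longrightarrow> J = I \<or> J = B)"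

definition localization_at :: "'l::field set \<Rightarrow> 'l set \<Rightarrow> 'l set" where
  "localization_at B I = {b / s | b s. b \<in> B \<and> s \<in> B - I}"

text \<open>
  The fibre of the normalization \<open>\<pi> : X \<rightarrow> C\<close> over \<open>c\<close> consists of the maximal ideals of the integral
  closure of the local ring at \<open>c\<close> in the function field. A closed point of \<open>X\<close> is represented by its
  local ring, a discrete valuation ring of the function field; \<open>X\<close> is separated, so distinct points
  have distinct local rings. \<open>lies_over \<iota> h P c\<close> says \<open>\<pi> P = c\<close>.
\<close>

definition lies_over :: "('k::field poly3 \<Rightarrow> 'l::field) \<Rightarrow> 'k poly3 \<Rightarrow> 'l set \<Rightarrow> 'k ^ 3 \<Rightarrow> bool" where
  "lies_over \<iota> h P c \<longleftrightarrow> on_curve h c \<and>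
     (let B = integral_closure_in (function_field \<iota>) (curve_local_ring \<iota> c)
      in \<exists>I. maximal_ideal_of B I \<and> P = localization_at B I)"

record 'l curve =
  fun_field :: "'l set"
  points :: "'l set set"

definition normalized_curve :: "('k::field poly3 \<Rightarrow> 'l::field) \<Rightarrow> 'k poly3 \<Rightarrow> 'l curve" where
  "normalized_curve \<iota> h = \<lparr>fun_field = function_field \<iota>, points = {P. \<exists>c. lies_over \<iota> h P c}\<rparr>"

definition unit_of :: "'l::field set \<Rightarrow> 'l \<Rightarrow> bool" where
  "unit_of P f \<longleftrightarrow> f \<noteq> 0 \<and> f \<in> P \<and> inverse f \<in> P"

definition uniformizer :: "'l::field set \<Rightarrow> 'l \<Rightarrow> bool" where
  "uniformizer P t \<longleftrightarrow> t \<noteq> 0 \<and> {f \<in> P. \<not> unit_of P f} = {t * g | g. g \<in> P}"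

definition ord_at :: "'l::field set \<Rightarrow> 'l \<Rightarrow> int" where
  "ord_at P f = (THE m. \<exists>t u. uniformizer P t \<and> unit_of P u \<and> f = t powi m * u)"


section \<open>Vector bundles on a smooth projective curve\<close>

text \<open>
  A vector bundle is given by its stalks: the stalk at the generic point is a subspace of \<open>K\<^sup>m\<close>, where
  \<open>K\<close> is the function field, and the stalks at the closed points are lattices in it, i.e. free modules
  of full rank over the local rings. They are the stalks of a locally free sheaf if and only if all but
  finitely many of them are spanned by one fixed basis of the generic stalk.
\<close>

record ('l, 'm::finite) vbundle =
  generic_stalk :: "('l ^ 'm) set"
  stalk :: "'l set \<Rightarrow> ('l ^ 'm) set"

definition lin_span :: "'l::field set \<Rightarrow> ('l ^ 'm::finite) set \<Rightarrow> ('l ^ 'm) set" where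
  "lin_span A S = {\<Sum>v\<in>T. c v *s v | c T. finite T \<and> T \<subseteq> S \<and> (\<forall>v\<in>T. c v \<in> A)}"

definition is_basis :: "'l::field set \<Rightarrow> nat \<Rightarrow> (nat \<Rightarrow> 'l ^ 'm::finite) \<Rightarrow> ('l ^ 'm) set \<Rightarrow> bool" where
  "is_basis A r b M \<longleftrightarrow>
     M = {\<Sum>i<r. c i *s b i | c. \<forall>i<r. c i \<in> A} \<and>
     (\<forall>c. (\<forall>i<r. c i \<in> A) \<and> (\<Sum>i<r. c i *s b i) = 0 \<longrightarrow> (\<forall>i<r. c i = 0))"

definition vector_bundle :: "'l::field curve \<Rightarrow> ('l, 'm::finite) vbundle \<Rightarrow> bool" where
  "vector_bundle X E \<longleftrightarrow>
     generic_stalk E \<subseteq> {v. \<forall>i. v $ i \<in> fun_field X} \<and>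
     (\<exists>r e. is_basis (fun_field X) r e (generic_stalk E) \<and>
        (\<forall>P\<in>points X. (\<exists>b. is_basis P r b (stalk E P)) \<and>
           generic_stalk E = lin_span (fun_field X) (stalk E P)) \<and>
        finite {P \<in> points X. stalk E P \<noteq> lin_span P (e ` {..<r})})"

definition bundle_rank :: "'l::field curve \<Rightarrow> ('l, 'm::finite) vbundle \<Rightarrow> nat" where
  "bundle_rank X E = (THE r. \<exists>e. is_basis (fun_field X) r e (generic_stalk E))"

definition leibniz_det :: "nat \<Rightarrow> (nat \<Rightarrow> nat \<Rightarrow> 'l::field) \<Rightarrow> 'l" where
  "leibniz_det r A = (\<Sum>\<sigma> | \<sigma> permutes {..<r}. of_int (sign \<sigma>) * (\<Prod>i<r. A i (\<sigma> i)))"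

text \<open>
  The degree of \<open>det E\<close>, i.e. of the divisor of its rational section \<open>e\<^sub>0 \<and> \<dots> \<and> e\<^sub>r\<^sub>-\<^sub>1\<close>, for a basis \<open>e\<close>
  of the generic stalk: if \<open>e = A b\<close> for a basis \<open>b\<close> of the stalk at \<open>P\<close>, then this section is
  \<open>det A\<close> times the generator \<open>b\<^sub>0 \<and> \<dots> \<and> b\<^sub>r\<^sub>-\<^sub>1\<close> of the stalk of \<open>det E\<close> at \<open>P\<close>.
\<close>

definition bundle_degree :: "'l::field curve \<Rightarrow> ('l, 'm::finite) vbundle \<Rightarrow> int" where
  "bundle_degree X E = (THE m. \<exists>r e b A.
     is_basis (fun_field X) r e (generic_stalk E) \<and>
     (\<forall>P\<in>points X. is_basis P r (b P) (stalk E P) \<and>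
        (\<forall>i<r. (\<forall>j<r. A P i j \<in> fun_field X) \<and> e i = (\<Sum>j<r. A P i j *s b P j))) \<and>
     m = (\<Sum>P | P \<in> points X \<and> ord_at P (leibniz_det r (A P)) \<noteq> 0. ord_at P (leibniz_det r (A P))))"

definition bundle_slope :: "'l::field curve \<Rightarrow> ('l, 'm::finite) vbundle \<Rightarrow> real" where
  "bundle_slope X E = real_of_int (bundle_degree X E) / real (bundle_rank X E)"

definition subsheaf :: "'l::field curve \<Rightarrow> ('l, 'm::finite) vbundle \<Rightarrow> ('l, 'm) vbundle \<Rightarrow> bool" where
  "subsheaf X F E \<longleftrightarrow> generic_stalk F \<subseteq> generic_stalk E \<and> (\<forall>P\<in>points X. stalk F P \<subseteq> stalk E P)"

text \<open>Coherent subsheaves of a vector bundle on a smooth curve are vector bundles.\<close>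

definition semistable :: "'l::field curve \<Rightarrow> ('l, 'm::finite) vbundle \<Rightarrow> bool" where
  "semistable X E \<longleftrightarrow> vector_bundle X E \<and>
     (\<forall>F. vector_bundle X F \<and> subsheaf X F E \<and> bundle_rank X F > 0 \<longrightarrow> bundle_slope X F \<le> bundle_slope X E)"

text \<open>
  Pullback under the absolute Frobenius of characteristic \<open>p\<close>. Since Frobenius is flat, the pullback of
  a subsheaf of \<open>K\<^sup>m\<close> is the subsheaf of the pullback \<open>K\<^sup>m\<close> generated by the images of its sections, and
  these are obtained by raising all coordinates to the power \<open>p\<close>.
\<close>

definition frobenius_pullback ::
    "nat \<Rightarrow> 'l::field curve \<Rightarrow> ('l, 'm::finite) vbundle \<Rightarrow> ('l, 'm) vbundle" where
  "frobenius_pullback p X E =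
     \<lparr>generic_stalk = lin_span (fun_field X) ((\<lambda>v. \<chi> i. (v $ i) ^ p) ` generic_stalk E),
      stalk = (\<lambda>P. lin_span P ((\<lambda>v. \<chi> i. (v $ i) ^ p) ` stalk E P))\<rparr>"

definition strongly_semistable :: "nat \<Rightarrow> 'l::field curve \<Rightarrow> ('l, 'm::finite) vbundle \<Rightarrow> bool" where
  "strongly_semistable p X E \<longleftrightarrow> (\<forall>s. semistable X ((frobenius_pullback p X ^^ s) E))"

definition zero_bundle :: "('l::field, 'm::finite) vbundle" where
  "zero_bundle = \<lparr>generic_stalk = {0}, stalk = (\<lambda>_. {0})\<rparr>"

text \<open>\<open>0 \<rightarrow> F \<rightarrow> E \<rightarrow> Q \<rightarrow> 0\<close> is exact for the inclusion \<open>F \<subseteq> E\<close> and some morphism \<open>\<phi> : E \<rightarrow> Q\<close>.\<close>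

definition quotient_bundle ::
    "'l::field curve \<Rightarrow> ('l, 'm::finite) vbundle \<Rightarrow> ('l, 'm) vbundle \<Rightarrow> ('l, 'm) vbundle \<Rightarrow> bool" where
  "quotient_bundle X E F Q \<longleftrightarrow>
     vector_bundle X F \<and> vector_bundle X E \<and> vector_bundle X Q \<and> subsheaf X F E \<and>
     (\<exists>\<phi>. (\<forall>v\<in>generic_stalk E. \<forall>w\<in>generic_stalk E. \<phi> (v + w) = \<phi> v + \<phi> w) \<and>
          (\<forall>c\<in>fun_field X. \<forall>v\<in>generic_stalk E. \<phi> (c *s v) = c *s \<phi> v) \<and>
          \<phi> ` generic_stalk E = generic_stalk Q \<and>
          {v \<in> generic_stalk E. \<phi> v = 0} = generic_stalk F \<and>
          (\<forall>P\<in>points X. \<phi> ` stalk E P = stalk Q P \<and> {v \<in> stalk E P. \<phi> v = 0} = stalk F P))"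

text \<open>\<open>Es\<close> is the list of all members of the filtration, from \<open>0\<close> to \<open>E\<close>.\<close>

definition HN_filtration ::
    "'l::field curve \<Rightarrow> ('l, 'm::finite) vbundle \<Rightarrow> ('l, 'm) vbundle list \<Rightarrow> bool" where
  "HN_filtration X E Es \<longleftrightarrow> Es \<noteq> [] \<and> hd Es = zero_bundle \<and> last Es = E \<and>
     (\<exists>Q. (\<forall>i. Suc i < length Es \<longrightarrow>
             quotient_bundle X (Es ! Suc i) (Es ! i) (Q i) \<and> bundle_rank X (Q i) > 0 \<and> semistable X (Q i)) \<and>
          (\<forall>i. Suc (Suc i) < length Es \<longrightarrow> bundle_slope X (Q i) > bundle_slope X (Q (Suc i))))"


section \<open>Syzygy bundles\<close>

text \<open>
  The stalk at \<open>c\<close> of the kernel \<open>W\<^sub>n\<close> of \<open>(s\<^sub>1, s\<^sub>2, s\<^sub>3) \<mapsto> s\<^sub>1 x\<^sup>n + s\<^sub>2 y\<^sup>n + s\<^sub>3 z\<^sup>n\<close> on \<open>\<O>\<^sub>C\<^sup>3\<close>; the values of this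
  map lie in the stalk of \<open>\<O>\<^sub>C(n)\<close>, which is contained in \<open>Frac R\<close>.
\<close>

definition W_stalk :: "('k::field poly3 \<Rightarrow> 'l::field) \<Rightarrow> nat \<Rightarrow> 'k ^ 3 \<Rightarrow> ('l ^ 3) set" where
  "W_stalk \<iota> n c = {s. (\<forall>i. s $ i \<in> curve_local_ring \<iota> c) \<and> (\<Sum>i\<in>UNIV. s $ i * \<iota> (Var3 i) ^ n) = 0}"

text \<open>
  The pullback \<open>V\<^sub>n = \<pi>\<^sup>* W\<^sub>n\<close>: as \<open>W\<^sub>n\<close> is locally free, the tensor product of its stalk at \<open>\<pi> P\<close> with the
  local ring at \<open>P\<close> is the module generated by this stalk in \<open>K\<^sup>3\<close>.

  As the kernel of a surjection from \<open>\<O>\<^sub>X\<^sup>3\<close> to \<open>\<O>\<^sub>X(n)\<close>, \<open>V\<^sub>n\<close> has degree \<open>-nd\<close> and slope \<open>-nd/2\<close>. Its twist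
  by \<open>\<O>\<^sub>X(-n)\<close>, the kernel of the same map from \<open>\<O>\<^sub>X(-n)\<^sup>3\<close> to \<open>\<O>\<^sub>X\<close>, has slope \<open>-3nd/2\<close>; degrees of subbundles in
  these two normalizations differ by \<open>nd\<close> times the rank.
\<close>

definition V_bundle :: "('k::field poly3 \<Rightarrow> 'l::field) \<Rightarrow> 'k poly3 \<Rightarrow> nat \<Rightarrow> ('l, 3) vbundle" where
  "V_bundle \<iota> h n =
     \<lparr>generic_stalk = {s. (\<forall>i. s $ i \<in> function_field \<iota>) \<and> (\<Sum>i\<in>UNIV. s $ i * \<iota> (Var3 i) ^ n) = 0},
      stalk = (\<lambda>P. lin_span P (\<Union>c\<in>{c. lies_over \<iota> h P c}. W_stalk \<iota> n c))\<rparr>"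

end

theory Submission
 imports Defs "Jordan_Normal_Form.Char_Poly"
begin

text \<open>The curve is an abelian cover of the line \<open>M\<^sub>x + M\<^sub>y + M\<^sub>z = 0\<close> given by the three monomials of \<open>h\<close>, with coordinate
 \<open>w = M\<^sub>x / M\<^sub>z\<close>. A destabilizing line subbundle of \<open>V n\<close> is unique, hence stable under the Galois group, so it is spanned by
 a section that comes from three coprime polynomials in \<open>w\<close> with sum zero. Its degree is determined by the orders of
 these polynomials at the three branch points; if their Wronskian does not vanish, the Mason-Stothers bound shows that
 it is at most \<open>- 3 n d / 2 + \<lambda> / 2 (1 - t)\<close>, where \<open>t\<close> is the distance from \<open>(\<alpha> n, \<beta> n, \<nu> n) / \<lambda>\<close> to an odd lattice point, and if it vanishes, the
 polynomials are \<open>p\<close>-th powers and the section is a Frobenius pullback. Frobenius moves the point by a symmetry of the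
 odd lattice because \<open>p\<close> is congruent to \<open>\<plusminus> 1\<close> modulo twice the reduced \<open>\<lambda>\<close>. Points of the normalization are discrete valuation
 rings, and degrees are computed with the product formula.\<close>


text \<open>Points are localizations of integral closures and degrees are definite descriptions, so
  every degree has to be traced back to orders of functions. The key identity is that the
  ramification indices in each fibre over the line add up to \<lambda>. The upper bound comes from
  independence of valuations over k(w), the lower bound from counting Taylor coefficients against
  the \<lambda> characters of the Galois group.

  The parity in \<open>L_odd\<close> is that of Mason-Stothers: the orders k of a triple of degree
  \<delta> at the branch points satisfy \<Sigma>k \<le> 2\<delta> + 1, and a destabilizing triple
  must attain this bound. Conversely, there are just enough coefficients to realize every odd k near
  the point.

  From p \<ge> d^2 follows \<lambda> < p, so averages over the Galois group may be divided by
  \<lambda>. The bound p \<ge> n starts the induction over Frobenius: the point divided by p has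
  coordinate sum at most 2, where a direct estimate excludes destabilizing triples. Degrees refer to
  V n inside the trivial bundle of rank 3, where its slope is -nd/2; twice the degree of the
  destabilizing line is then \<lambda>(1 - t) - nd.\<close>

no_notation vec_index (infixl "$" 100)

lemmas fvec_eq_iff = Finite_Cartesian_Product.vec_eq_iff

section \<open>Subrings, subfields and linear systems over a subfield\<close>

definition is_subring :: "'a::comm_ring_1 set => bool" where
 "is_subring A \<longleftrightarrow> 0 : A & 1 : A & (ALL x:A. - x : A) & (ALL x:A. ALL y:A. x + y : A & x * y : A)"

definition is_subfield :: "'a::field set => bool" where
 "is_subfield F \<longleftrightarrow> is_subring F & (ALL x:F. inverse x : F)"

lemma subringD:
 assumes "is_subring A"
 shows "0 : A" "1 : A" "x : A ==> - x : A" "x : A ==> y : A ==> x + y : A"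
  "x : A ==> y : A ==> x * y : A"
 using assms unfolding is_subring_def by blast+

lemma subring_diff: "is_subring A ==> x : A ==> y : A ==> x - y : A"
 using subringD(3,4)[of A] by(metis add_uminus_conv_diff)

lemma subring_power: "is_subring A ==> x : A ==> x ^ n : A"
 by(induction n) (auto simp: subringD)

lemma subring_sum: "is_subring A ==> (!!i. i : I ==> f i : A) ==> sum f I : A"
 by(induction I rule: infinite_finite_induct) (auto simp: subringD)

lemma subring_prod: "is_subring A ==> (!!i. i : I ==> f i : A) ==> prod f I : A"
 by(induction I rule: infinite_finite_induct) (auto simp: subringD)

lemma subfield_subring: "is_subfield F ==> is_subring F" by(simp add: is_subfield_def)

lemma subfield_inverse: "is_subfield F ==> x : F ==> inverse x : F"
 by(simp add: is_subfield_def)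

lemma subfield_divide: "is_subfield F ==> x : F ==> y : F ==> x / y : F"
 by(simp add: is_subfield_def divide_inverse subringD)

lemma subfield_powi: "is_subfield F ==> x : F ==> x powi n : F"
 by(auto simp: power_int_def is_subfield_def subring_power)

text \<open>Elimination of one equation at a time: either equation j0 is void on I, or one of its
  unknowns is expressed by the others and the smaller system again has fewer equations than
  unknowns. The solution has to stay in F because the fields in question, such as k(w), are only
  sets inside the ambient type.\<close>

lemma nontrivial_solution:
 fixes M :: "'j => 'i => 'a::field"
 assumes F: "is_subfield F" and "finite J" and "finite I" and "card J < card I"
  and "!!j i. j : J ==> i : I ==> M j i : F"
 shows "EX x. (ALL i. x i : F) & (EX i:I. x i ~= 0) & (ALL j:J. (SUM i:I. M j i * x i) = 0)"
 using assms(2-)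
proof (induction J arbitrary: I M rule: finite_induct)
 case empty
 then obtain i0 where "i0 : I" by fastforce
 thus ?case by(intro exI[of _ "%i. if i = i0 then 1 else 0"])
   (auto simp: subringD[OF subfield_subring[OF F]])
next
 case (insert j0 J)
 note R = subringD[OF subfield_subring[OF F]] subring_diff[OF subfield_subring[OF F]]
  subfield_divide[OF F]
 show ?case
 proof (cases "ALL i:I. M j0 i = 0")
  case True
  have "card J < card I" using insert.prems(2) insert.hyps by simp
  from insert.IH[OF insert.prems(1) this] insert.prems(3) obtain x where
   "ALL i. x i : F" "EX i:I. x i ~= 0" "ALL j:J. (SUM i:I. M j i * x i) = 0" by blast
  with True show ?thesis by(intro exI[of _ x]) auto
 next
  case False
  then obtain i0 where i0: "i0 : I" "M j0 i0 ~= 0" by blast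
  \<comment> \<open>The system after the unknown i0 has been eliminated by means of equation j0; the
    value of i0 is recovered below as \<open>- s\<close>.\<close>
  define M' where "M' j i = M j i - M j i0 * (M j0 i / M j0 i0)" for j i
  have c: "card J < card (I - {i0})" using insert.prems(1,2) insert.hyps i0 by(simp add: card_Diff_singleton)
  have fin: "finite (I - {i0})" using insert.prems(1) by simp
  have M'F: "M' j i : F" if "j : J" "i : I - {i0}" for j i
   using insert.prems(3) that i0 unfolding M'_def by(intro R) auto
  from insert.IH[OF fin c, of M', OF M'F] obtain x where
   x: "ALL i. x i : F" "EX i:I - {i0}. x i ~= 0" "ALL j:J. (SUM i:I - {i0}. M' j i * x i) = 0"
   by blast
  define s where "s = (SUM i:I - {i0}. (M j0 i / M j0 i0) * x i)"
  define y where "y i = (if i = i0 then - s else x i)" for i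
  have s: "s : F" unfolding s_def using insert.prems(3) x(1) i0
   by(intro subring_sum[OF subfield_subring[OF F]] R) auto
  have split: "(SUM i:I. M j i * y i) = - (M j i0 * s) + (SUM i:I - {i0}. M j i * x i)" for j
   using insert.prems(1) i0 by(subst sum.remove[of I i0]) (auto simp: y_def intro!: sum.cong)
  have "(SUM i:I. M j i * y i) = 0" if "j : J" for j
  proof -
   have "0 = (SUM i:I - {i0}. M' j i * x i)" using x(3) that by simp
   also have "... = (SUM i:I - {i0}. M j i * x i) - M j i0 * s"
    unfolding s_def sum_distrib_left sum_subtractf[symmetric]
    by(rule sum.cong) (auto simp: M'_def algebra_simps)
   finally show ?thesis by(simp add: split)
  qed
  moreover have "(SUM i:I. M j0 i * y i) = 0"
  proof -
   have "M j0 i0 * s = (SUM i:I - {i0}. M j0 i * x i)"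
    unfolding s_def sum_distrib_left using i0 by(intro sum.cong) auto
   thus ?thesis by(simp add: split)
  qed
  moreover have "EX i:I. y i ~= 0" using x(2) by(auto simp: y_def)
  moreover have "ALL i. y i : F" using x(1) s by(auto simp: y_def R)
  ultimately show ?thesis by(intro exI[of _ y]) auto
 qed
qed

section \<open>Integral elements\<close>

definition integral_over :: "'a::field set => 'a => bool" where
 "integral_over A f \<longleftrightarrow> (EX q. lead_coeff q = 1 & (ALL i. coeff q i : A) & poly q f = 0)"

lemma integral_closure_in_altdef: "integral_closure_in K A = {f : K. integral_over A f}"
 by(simp add: integral_closure_in_def integral_over_def)

lemma integral_over_base: "is_subring A ==> a : A ==> integral_over A a"
 unfolding integral_over_def
 by(intro exI[of _ "[:- a, 1:]"]) (auto simp: coeff_pCons subringD split: nat.splits)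

text \<open>The A-module generated by S, built up one summand at a time so that stability statements
  follow by rule induction.\<close>

inductive_set aspan :: "'a::field set => 'a set => 'a set" for A S where
 zero: "0 : aspan A S"
| step: "a : A ==> s : S ==> x : aspan A S ==> a * s + x : aspan A S"

lemma aspan_add: "x : aspan A S ==> y : aspan A S ==> x + y : aspan A S"
 by(induction rule: aspan.induct) (auto simp: add.assoc intro: aspan.intros)

lemma aspan_scale:
 assumes A: "is_subring A" and x: "x : aspan A S" and a: "a : A" shows "a * x : aspan A S" using x
proof (induction rule: aspan.induct)
 case zero
 show ?case by(simp add: aspan.zero)
next
 case (step b s x)
 thus ?case using aspan.step[OF subringD(5)[OF A a step.hyps(1)] step.hyps(2) step.IH]
  by(simp add: distrib_left mult.assoc)
qed

lemma aspan_base: "is_subring A ==> s : S ==> s : aspan A S"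
 using aspan.step[of 1 A s S 0] by(simp add: subringD aspan.zero)

lemma aspan_sum: "(!!i. i : I ==> f i : aspan A S) ==> sum f I : aspan A S"
 by(induction I rule: infinite_finite_induct) (auto intro: aspan.zero aspan_add)

lemma aspan_mult:
 assumes "is_subring A" and "!!s. s : S ==> f * s : aspan A S'" and "x : aspan A S"
 shows "f * x : aspan A S'" using assms(3)
proof (induction rule: aspan.induct)
 case zero
 thus ?case by(simp add: aspan.zero)
next
 case (step a s x)
 have "f * (a * s + x) = a * (f * s) + f * x" by(simp add: algebra_simps)
 with step assms show ?case by(simp add: aspan_add aspan_scale)
qed

lemma aspan_finite:
 assumes "is_subring A" and "finite S" and "x : aspan A S"
 shows "EX c. (ALL s:S. c s : A) & x = (SUM s:S. c s * s)" using assms(3)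
proof (induction rule: aspan.induct)
 case zero
 show ?case by(rule exI[of _ "%_. 0"]) (simp add: subringD assms)
next
 case (step a s x)
 then obtain c where c: "ALL s:S. c s : A" "x = (SUM s:S. c s * s)" by blast
 have "(SUM t:S. (c t + (if t = s then a else 0)) * t) = x + (SUM t:S. if t = s then a * t else 0)"
  unfolding c(2) sum.distrib[symmetric] by(rule sum.cong) (auto simp: algebra_simps)
 also have "... = a * s + x" using step.hyps assms(2) by simp
 finally show ?case using c(1) step.hyps assms(1)
  by(intro exI[of _ "%t. c t + (if t = s then a else 0)"]) (auto simp: subringD)
qed

lemma subring_coeffs:
 assumes "is_subring A" shows "is_subring {q. ALL i. coeff q i : A}"
proof -
 note A = subringD[OF assms]
 have "coeff (p * q) i : A" if "ALL i. coeff p i : A" "ALL i. coeff q i : A" for p q :: "'a poly" and i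
  unfolding coeff_mult using that A by(intro subring_sum[OF assms]) auto
 thus ?thesis unfolding is_subring_def[of "Collect _"] using A by(auto simp: coeff_1)
qed

lemma det_in_subring:
 assumes "is_subring A" and "M : carrier_mat n n"
  and "!!i j. i < n ==> j < n ==> M $$ (i, j) : A" shows "det M : A"
proof -
 have "signof p : A" for p :: "nat => nat" using assms(1) by(auto simp: sign_def subringD)
 thus ?thesis unfolding det_def'[OF assms(2)]
  using assms by(intro subring_sum subringD(5)[OF assms(1)] subring_prod) (auto dest: permutes_in_image)
qed

text \<open>The determinant trick: multiplication by f acts on the generators S through a matrix
  over A, and the list of generators is itself an eigenvector for the eigenvalue f. So f is a root
  of the characteristic polynomial, which is monic over A.\<close>

lemma integral_over_stable:
 assumes A: "is_subring A" and "finite S" and "EX s:S. s ~= 0"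
  and st: "!!s. s : S ==> f * s : aspan A S" shows "integral_over A f"
proof -
 obtain ss where ss: "set ss = S" "distinct ss" using finite_distinct_list[OF assms(2)] by blast
 define n where "n = length ss"
 have bij: "bij_betw (%i. ss ! i) {..<n} S"
  unfolding n_def using bij_betw_nth[OF ss(2) refl] ss(1) by auto
 have "ALL s:S. EX c. (ALL t:S. c t : A) & f * s = (SUM t:S. c t * t)"
  using aspan_finite[OF A assms(2) st] by blast
 then obtain c where c: "!!s t. s : S ==> t : S ==> c s t : A"
  "!!s. s : S ==> f * s = (SUM t:S. c s t * t)" by metis
 define M where "M = mat n n (%(i, j). c (ss ! i) (ss ! j))"
 define v where "v = vec n (%i. ss ! i)"
 have M: "M : carrier_mat n n" unfolding M_def by simp
 have in_S: "ss ! i : S" if "i < n" for i using that ss n_def by auto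
 have "M *\<^sub>v v = f \<cdot>\<^sub>v v"
 proof (rule eq_vecI)
  fix i assume "i < dim_vec (f \<cdot>\<^sub>v v)"
  hence i: "i < n" by(simp add: v_def)
  have "vec_index (M *\<^sub>v v) i = (SUM j:{..<n}. c (ss ! i) (ss ! j) * (ss ! j))"
   using i by(simp add: M_def v_def scalar_prod_def atLeast0LessThan)
  also have "... = f * (ss ! i)"
   using c(2)[OF in_S[OF i]] sum.reindex_bij_betw[OF bij, of "%t. c (ss ! i) t * t"] by simp
  finally show "vec_index (M *\<^sub>v v) i = vec_index (f \<cdot>\<^sub>v v) i" using i by(simp add: v_def)
 qed (simp add: M_def v_def)
 moreover have "v ~= 0\<^sub>v n"
 proof
  assume "v = 0\<^sub>v n"
  hence "ALL i<n. ss ! i = 0" unfolding v_def by(metis index_vec index_zero_vec(1))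
  thus False using assms(3) bij by(auto simp: bij_betw_def)
 qed
 ultimately have "eigenvalue M f"
  unfolding eigenvalue_def eigenvector_def using M by(intro exI[of _ v]) (auto simp: v_def)
 hence root: "poly (char_poly M) f = 0" using eigenvalue_root_char_poly[OF M] by simp
 have "char_poly M : {q. ALL i. coeff q i : A}" unfolding char_poly_def char_poly_matrix_def
 proof (rule det_in_subring[OF subring_coeffs[OF A]])
  show "[:0, 1:] \<cdot>\<^sub>m 1\<^sub>m (dim_row M) + map_mat (%a. [:- a:]) M : carrier_mat n n"
   using M by auto
  fix i j assume ij: "i < n" "j < n"
  hence "c (ss ! i) (ss ! j) : A" using c in_S by auto
  thus "([:0, 1:] \<cdot>\<^sub>m 1\<^sub>m (dim_row M) + map_mat (%a. [:- a:]) M) $$ (i, j)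
    : {q. ALL i. coeff q i : A}"
   using ij M A by(auto simp: M_def coeff_pCons subringD split: nat.splits)
 qed
 thus ?thesis unfolding integral_over_def using root degree_monic_char_poly[OF M] by blast
qed

text \<open>The products of S with the powers of b below the degree of q generate a module stable
  under b, and whatever stabilizes the span of S also stabilizes this module. The coefficients of q
  only have to map S into its span; this lets \<open>integral_over_trans\<close> use coefficients
  outside A.\<close>

lemma stable_adjoin:
 assumes A: "is_subring A" and S: "finite S" "1 : S"
  and q: "lead_coeff q = 1" "poly q b = 0" "!!i s. s : S ==> coeff q i * s : aspan A S"
 shows "EX S'. finite S' & 1 : S' & (ALL s:S'. b * s : aspan A S') &
  (ALL t. (ALL s:S. t * s : aspan A S) --> (ALL s:S'. t * s : aspan A S'))"
proof -
 define n where "n = degree q"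
 have n: "n > 0"
 proof (rule ccontr)
  assume "~ n > 0"
  hence "q = 1" using q(1) unfolding n_def by(simp add: monic_degree_0)
  thus False using q(2) by simp
 qed
 define S' where "S' = {s * b ^ j | s j. s : S & j < n}"
 have S'_eq: "S' = (%(s, j). s * b ^ j) ` (S \<times> {..<n})" unfolding S'_def by auto
 have S': "s * b ^ j : S'" if "s : S" "j < n" for s j using that unfolding S'_def by blast
 have lift: "x * b ^ j : aspan A S'" if "x : aspan A S" "j < n" for x j
  using aspan_mult[OF A, of S "b ^ j" S' x] that aspan_base[OF A S'[OF _ that(2)]] by(simp add: mult.commute)
 have top: "s * b ^ n : aspan A S'" if "s : S" for s
 proof -
  have "0 = poly q b" using q by simp
  also have "... = (SUM i<n. coeff q i * b ^ i) + b ^ n"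
   unfolding poly_altdef n_def using q(1) by(simp add: lessThan_Suc_atMost[symmetric])
  finally have "b ^ n = - (SUM i<n. coeff q i * b ^ i)" by(metis add.commute eq_neg_iff_add_eq_0)
  hence "s * b ^ n = (SUM i<n. (- 1) * (coeff q i * s * b ^ i))"
   by(simp add: sum_distrib_left sum_negf mult.assoc mult.left_commute)
  also have "... : aspan A S'"
  proof (rule aspan_sum)
   fix i assume "i : {..<n}"
   hence "coeff q i * s * b ^ i : aspan A S'" using lift[OF q(3)[OF that]] by simp
   thus "(- 1) * (coeff q i * s * b ^ i) : aspan A S'"
    by(rule aspan_scale[OF A]) (simp add: subringD[OF A])
  qed
  finally show ?thesis .
 qed
 have "b * s : aspan A S'" if sS: "s : S'" for s
 proof -
  obtain t j where tj: "t : S" "j < n" "s = t * b ^ j" using sS S'_def by blast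
  have eq: "b * s = t * b ^ Suc j" using tj by simp
  show ?thesis
  proof (cases "Suc j < n")
   case True
   thus ?thesis unfolding eq using aspan_base[OF A S'[OF tj(1)]] by blast
  next
   case False
   hence "Suc j = n" using tj by simp
   thus ?thesis unfolding eq using top[OF tj(1)] by simp
  qed
 qed
 moreover have "t * s : aspan A S'" if tS: "ALL s:S. t * s : aspan A S" and sS: "s : S'" for t s
 proof -
  obtain r j where "r : S" "j < n" "s = r * b ^ j" using sS S'_def by blast
  thus ?thesis using lift[of "t * r" j] tS by(simp add: mult.assoc)
 qed
 moreover have "finite S'" unfolding S'_eq using S by simp
 moreover have "1 : S'" using S S'[of 1 0] n by simp
 ultimately show ?thesis by blast
qed

lemma common_stable:
 assumes A: "is_subring A" and "finite T" and "!!t. t : T ==> integral_over A t"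
 shows "EX S. finite S & 1 : S & (ALL t:T. ALL s:S. t * s : aspan A S)"
 using assms(2,3)
proof (induction rule: finite_induct)
 case empty
 show ?case by(rule exI[of _ "{1}"]) simp
next
 case (insert b T)
 then obtain S where S: "finite S" "1 : S" "ALL t:T. ALL s:S. t * s : aspan A S" by auto
 from insert.prems[of b] obtain q where q: "lead_coeff q = 1" "ALL i. coeff q i : A" "poly q b = 0"
  unfolding integral_over_def by blast
 have "coeff q i * s : aspan A S" if "s : S" for i s
  using q(2) aspan_scale[OF A aspan_base[OF A that]] by blast
 from stable_adjoin[OF A S(1,2) q(1,3) this] obtain S' where
  S': "finite S'" "1 : S'" "ALL s:S'. b * s : aspan A S'"
  "ALL t. (ALL s:S. t * s : aspan A S) --> (ALL s:S'. t * s : aspan A S')" by blast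
 with S(3) show ?case by(intro exI[of _ S']) auto
qed

lemma integral_over_add_mult:
 assumes A: "is_subring A" and "integral_over A f" "integral_over A g"
 shows "integral_over A (f + g)" "integral_over A (f * g)"
proof -
 have "EX S. finite S & 1 : S & (ALL t:{f, g}. ALL s:S. t * s : aspan A S)"
  using assms by(intro common_stable) auto
 then obtain S where
  S: "finite S" "1 : S" "!!s. s : S ==> f * s : aspan A S" "!!s. s : S ==> g * s : aspan A S"
  by auto
 have nz: "EX s:S. s ~= 0" using S(2) by(intro bexI[of _ 1]) auto
 show "integral_over A (f + g)"
  using S by(intro integral_over_stable[OF A S(1) nz]) (simp add: distrib_right aspan_add)
 show "integral_over A (f * g)" using aspan_mult[OF A S(3) S(4)]
  by(intro integral_over_stable[OF A S(1) nz]) (simp add: mult.assoc)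
qed

text \<open>The coefficients take finitely many values, which stabilize one common finite module;
  adjoining f keeps it finite.\<close>

lemma integral_over_trans:
 assumes A: "is_subring A" and q: "lead_coeff q = 1" "poly q f = 0"
  and c: "!!i. integral_over A (coeff q i)" shows "integral_over A f"
proof -
 have fin: "finite (range (coeff q))"
 proof (rule finite_subset)
  show "range (coeff q) <= insert 0 (coeff q ` {..degree q})"
   by(metis (no_types, lifting) atMost_iff coeff_eq_0 image_eqI image_subsetI insertCI not_le)
 qed simp
 have "EX S. finite S & 1 : S & (ALL t:range (coeff q). ALL s:S. t * s : aspan A S)"
  using c by(intro common_stable[OF A fin]) auto
 then obtain S where
  S: "finite S" "1 : S" "!!i s. s : S ==> coeff q i * s : aspan A S" by auto
 from stable_adjoin[OF A S(1,2) q S(3)] obtain S' where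
  "finite S'" "1 : S'" "ALL s:S'. f * s : aspan A S'" by blast
 thus ?thesis using integral_over_stable[OF A] by(metis one_neq_zero)
qed

lemma subring_integral_closure:
 assumes "is_subfield K" and "is_subring A" shows "is_subring (integral_closure_in K A)"
proof -
 note K = subringD[OF subfield_subring[OF assms(1)]]
 have m: "- 1 : A" using assms(2) by(simp add: subringD)
 have neg: "integral_over A (- f)" if "integral_over A f" for f
  using integral_over_add_mult(2)[OF assms(2) integral_over_base[OF assms(2) m] that] by simp
 show ?thesis unfolding integral_closure_in_altdef is_subring_def[of "Collect _"] mem_Collect_eq
  by(intro conjI ballI) (simp_all add: K subringD(1,2)[OF assms(2)] integral_over_base[OF assms(2)] neg
    integral_over_add_mult[OF assms(2)])
qed

section \<open>Discrete valuation rings\<close>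

text \<open>The nonunits. They form an ideal only when P is local, so closure under addition is
  proved separately for valuation rings and for localizations.\<close>

definition maxid :: "'a::field set => 'a set" where
 "maxid P = {f : P. ~ unit_of P f}"

lemma unit_of_mult: "is_subring P ==> unit_of P f ==> unit_of P g ==> unit_of P (f * g)"
 unfolding unit_of_def by(auto simp: subringD)

lemma unit_of_inverse: "unit_of P f ==> unit_of P (inverse f)" unfolding unit_of_def by auto

lemma unit_of_1: "is_subring P ==> unit_of P 1" unfolding unit_of_def by(auto simp: subringD)

lemma unit_of_power: "is_subring P ==> unit_of P f ==> unit_of P (f ^ n)"
 by(induction n) (auto simp: unit_of_1 unit_of_mult)

lemma unit_of_powi: "is_subring P ==> unit_of P f ==> unit_of P (f powi n)"
 by(auto simp: power_int_def unit_of_power unit_of_inverse)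

lemma unit_of_multD:
 assumes "is_subring P" "f : P" "g : P" "unit_of P (f * g)" shows "unit_of P f"
proof -
 have "f ~= 0" "g ~= 0" using assms(4) by(auto simp: unit_of_def)
 hence "inverse f = g * inverse (f * g)" by(simp add: field_simps)
 hence "inverse f : P"
  using subringD(5)[OF assms(1,3), of "inverse (f * g)"] assms(4) by(simp only: unit_of_def)
 thus ?thesis using assms \<open>f \<noteq> 0\<close> by(auto simp: unit_of_def)
qed

lemma maxid_mult: "is_subring P ==> f : maxid P ==> g : P ==> f * g : maxid P"
 unfolding maxid_def using unit_of_multD[of P f g] by(auto simp: subringD)

lemma zero_maxid: "is_subring P ==> 0 : maxid P"
 by(auto simp: maxid_def subringD unit_of_def)

lemma integral_overI:
 assumes "is_subring A" and "!!i. i < n ==> c i : A" and "f ^ n + (SUM i<n. c i * f ^ i) = 0"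
 shows "integral_over A f"
proof -
 define q where "q = monom 1 n + (SUM i<n. monom (c i) i)"
 have co: "coeff q j = (if j = n then 1 else if j < n then c j else 0)" for j
  unfolding q_def by(auto simp: coeff_sum)
 have "degree q = n" using co[of n] by(intro antisym degree_le le_degree) (auto simp: co)
 hence "lead_coeff q = 1" using co by simp
 moreover have "poly q f = 0" unfolding q_def using assms(3) by(simp add: poly_sum poly_monom)
 moreover have "ALL i. coeff q i : A" using assms(1,2) by(auto simp: co subringD)
 ultimately show ?thesis unfolding integral_over_def by blast
qed

text \<open>Multiplying the relation by the n-th power of the leading coefficient a turns it into a
  monic equation for a f.\<close>

lemma integral_over_lead:
 assumes A: "is_subring A" and c: "!!i. i <= Suc n ==> c i : A" and s: "(SUM i<=Suc n. c i * f ^ i) = 0"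
 shows "integral_over A (c (Suc n) * f)"
proof (rule integral_overI[OF A])
 let ?a = "c (Suc n)"
 show "?a ^ (n - i) * c i : A" if "i < Suc n" for i
  using c[of i] c[of "Suc n"] that A by(intro subringD(5)[OF A] subring_power) auto
 have "(?a * f) ^ Suc n + (SUM i<Suc n. ?a ^ (n - i) * c i * (?a * f) ^ i)
  = ?a ^ n * (SUM i<=Suc n. c i * f ^ i)"
 proof -
  have "?a ^ (n - i) * c i * (?a * f) ^ i = ?a ^ n * (c i * f ^ i)" if "i < Suc n" for i
  proof -
   have "?a ^ n = ?a ^ (n - i) * ?a ^ i" using that by(simp add: power_add[symmetric])
   thus ?thesis by(simp add: power_mult_distrib)
  qed
  hence "(SUM i<Suc n. ?a ^ (n - i) * c i * (?a * f) ^ i) = ?a ^ n * (SUM i<Suc n. c i * f ^ i)"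
   unfolding sum_distrib_left by(intro sum.cong) auto
  moreover have "(SUM i<=Suc n. c i * f ^ i) = (SUM i<Suc n. c i * f ^ i) + ?a * f ^ Suc n"
   by(simp add: lessThan_Suc_atMost)
  ultimately show ?thesis by(simp add: power_mult_distrib algebra_simps)
 qed
 thus "(?a * f) ^ Suc n + (SUM i<Suc n. ?a ^ (n - i) * c i * (?a * f) ^ i) = 0" using s by simp
qed

text \<open>Induction on the degree of the relation. A unit as leading coefficient a makes f
  integral. Otherwise a f still lies in P by \<open>integral_over_lead\<close> and can be absorbed
  into the next coefficient. If this destroys the last unit, then a f is itself a unit, and 1/f = a
  / (a f) lies in P.\<close>

lemma unit_coeff_imp_valuation:
 assumes P: "is_subring P" "P <= K" and K: "is_subfield K"
  and closed: "!!f. f : K ==> integral_over P f ==> f : P"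
  and loc: "!!f g. f : maxid P ==> g : maxid P ==> f + g : maxid P"
  and f: "f : K" "f ~= 0"
  and "!!i. i <= n ==> c i : P" "EX i<=n. unit_of P (c i)" "(SUM i<=n. c i * f ^ i) = 0"
 shows "f : P | inverse f : P" using assms(8-)
proof (induction n arbitrary: c)
 case 0
 thus ?case by(auto simp: unit_of_def)
next
 case (Suc n)
 let ?a = "c (Suc n)"
 note KR = subringD[OF subfield_subring[OF K]]
 show ?case
 proof (cases "unit_of P ?a")
  case True
  have "(SUM i<Suc n. inverse ?a * c i * f ^ i) = inverse ?a * (SUM i<Suc n. c i * f ^ i)"
   by(simp add: sum_distrib_left mult.assoc del: sum.lessThan_Suc)
  also have "(SUM i<Suc n. c i * f ^ i) = - ?a * f ^ Suc n" using Suc.prems(3) unfolding lessThan_Suc_atMost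
   by(simp add: lessThan_Suc_atMost eq_neg_iff_add_eq_0)
  finally have eq0: "f ^ Suc n + (SUM i<Suc n. inverse ?a * c i * f ^ i) = 0"
   using True by(simp add: unit_of_def del: sum.lessThan_Suc)
  have "inverse ?a * c i : P" if "i < Suc n" for i
   using Suc.prems(1)[of i] that True P by(auto simp: unit_of_def subringD)
  hence "integral_over P f" by(rule integral_overI[OF P(1) _ eq0])
  thus ?thesis using closed f by blast
 next
  case False
  have a: "?a : maxid P" using False Suc.prems(1)[of "Suc n"] by(simp add: maxid_def)
  have aK: "?a * f : K" using Suc.prems(1)[of "Suc n"] P(2) f KR by auto
  have afP: "?a * f : P" by(rule closed[OF aK integral_over_lead[OF P(1) Suc.prems(1,3)]])
  define c' where "c' = c(n := ?a * f + c n)"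
  have c'P: "c' i : P" if "i <= n" for i
   using that afP Suc.prems(1) P(1) by(auto simp: c'_def subringD)
  have "(SUM i<=n. c' i * f ^ i) = (SUM i<n. c i * f ^ i) + (?a * f + c n) * f ^ n"
   by(simp add: c'_def lessThan_Suc_atMost[symmetric])
  also have "... = (SUM i<=Suc n. c i * f ^ i)"
   by(simp add: lessThan_Suc_atMost[symmetric] algebra_simps)
  finally have c's: "(SUM i<=n. c' i * f ^ i) = 0" using Suc.prems(3) by simp
  show ?thesis
  proof (cases "EX i<=n. unit_of P (c' i)")
   case True
   thus ?thesis using Suc.IH[OF c'P _ c's] by blast
  next
   case no: False
   obtain i where i: "i <= Suc n" "unit_of P (c i)" using Suc.prems(2) by blast
   have "i = n"
   proof (rule ccontr)
    assume "i ~= n"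
    moreover have "i ~= Suc n" using i False by auto
    ultimately have "i <= n" "c' i = c i" using i by(auto simp: c'_def)
    thus False using no i by auto
   qed
   hence un: "unit_of P (c n)" using i by simp
   have b: "c' n : maxid P" using no c'P[of n] by(auto simp: maxid_def)
   have "unit_of P (?a * f)"
   proof (rule ccontr)
    assume "~ unit_of P (?a * f)"
    hence "?a * f : maxid P" using afP by(simp add: maxid_def)
    hence "- (?a * f) : maxid P" using maxid_mult[OF P(1), of "?a * f" "- 1"] P(1) by(simp add: subringD)
    hence "c' n + - (?a * f) : maxid P" using loc b by blast
    thus False using un by(simp add: c'_def maxid_def)
   qed
   hence af: "?a * f ~= 0" "inverse (?a * f) : P" unfolding unit_of_def by blast+
   hence "?a ~= 0" by auto
   hence "inverse f = ?a * inverse (?a * f)" by simp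
   hence "inverse f : P" using subringD(5)[OF P(1) Suc.prems(1)[of "Suc n"] af(2)] by(simp only: le_refl)
   thus ?thesis by blast
  qed
 qed
qed

definition valuation_ring_of :: "'a::field set => 'a set => bool" where
 "valuation_ring_of K P \<longleftrightarrow> is_subfield K & is_subring P & P <= K &
   (ALL f:K. f ~= 0 --> f : P | inverse f : P)"

definition dvr :: "'a::field set => 'a set => bool" where
 "dvr K P \<longleftrightarrow> is_subfield K & is_subring P & P <= K &
   (EX t. uniformizer P t & (ALL f:K. f ~= 0 --> (EX m u. unit_of P u & f = t powi m * u)))"

lemma maxid_add:
 assumes V: "valuation_ring_of K P" and f: "f : maxid P" and g: "g : maxid P"
 shows "f + g : maxid P"
proof (cases "f = 0 | g = 0")
 case True
 thus ?thesis using assms by auto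
next
 case False
 have R: "is_subring P" and K: "is_subfield K" and sub: "P <= K"
  and v: "!!f. f : K ==> f ~= 0 ==> f : P | inverse f : P"
  using V unfolding valuation_ring_of_def by auto
 have "f / g : K" using f g sub subfield_divide[OF K] by(auto simp: maxid_def)
 then consider "f / g : P" | "g / f : P" using v[of "f / g"] False by(auto simp: field_simps)
 thus ?thesis
 proof cases
  case 1
  have "f + g = g * (f / g + 1)" using False by(simp add: field_simps)
  thus ?thesis using maxid_mult[OF R g] 1 R by(simp add: subringD)
 next
  case 2
  have "f + g = f * (g / f + 1)" using False by(simp add: field_simps)
  thus ?thesis using maxid_mult[OF R f] 2 R by(simp add: subringD)
 qed
qed

lemma valuation_ratio:
 assumes V: "valuation_ring_of K P" and "f : K" "g : K" "f ~= 0" "g ~= 0" "f / g ~: P"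
 shows "g / f : maxid P"
proof -
 have "f / g : K" using assms by(auto simp: valuation_ring_of_def subfield_divide)
 hence "inverse (f / g) : P" using assms unfolding valuation_ring_of_def by(metis divide_eq_0_iff)
 thus ?thesis using assms by(auto simp: maxid_def unit_of_def)
qed

lemma sum_maxid:
 assumes V: "valuation_ring_of K P" and "!!i. i : I ==> f i : maxid P"
 shows "sum f I : maxid P"
proof -
 have R: "is_subring P" using V by(simp add: valuation_ring_of_def)
 show ?thesis using assms(2)
  by(induction I rule: infinite_finite_induct) (simp_all add: zero_maxid[OF R] maxid_add[OF V])
qed

text \<open>Different values are expressed by quotients that are not units. Divided by the term of
  least value, the sum becomes 1 plus nonunits.\<close>

lemma sum_distinct_values_nonzero:
 assumes V: "valuation_ring_of K P" and "finite I" "I ~= {}"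
  and z: "!!i. i : I ==> z i : K & z i ~= 0"
  and d: "!!i j. i : I ==> j : I ==> i ~= j ==> ~ unit_of P (z i / z j)"
 shows "(SUM i:I. z i) ~= 0"
proof -
 have R: "is_subring P" using V by(simp add: valuation_ring_of_def)
 have ex: "EX j:J. ALL i:J. z i / z j : P" if "finite J" "J ~= {}" "J <= I" for J
  using that
 proof (induction J rule: finite_ne_induct)
  case (singleton x)
  thus ?case using z[of x] R by(auto simp: subringD)
 next
  case (insert x J)
  then obtain j where j: "j : J" "ALL i:J. z i / z j : P" by auto
  show ?case
  proof (cases "z x / z j : P")
   case True
   thus ?thesis using j by auto
  next
   case False
   hence jx: "z j / z x : P"
    using valuation_ratio[OF V, of "z x" "z j"] z insert.prems j by(auto simp: maxid_def)
   have "z i / z x : P" if "i : J" for i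
   proof -
    have "z j ~= 0" using z[of j] insert.prems j by auto
    hence "z i / z x = (z i / z j) * (z j / z x)" by simp
    thus ?thesis using subringD(5)[OF R] j that jx by metis
   qed
   moreover have "z x / z x : P" using z insert.prems R by(simp add: subringD)
   ultimately show ?thesis by blast
  qed
 qed
 obtain j where j: "j : I" "ALL i:I. z i / z j : P"
  using ex[OF assms(2,3) subset_refl] by blast
 have "z i / z j : maxid P" if "i : I - {j}" for i using that j d[of i j] by(auto simp: maxid_def)
 hence m: "(SUM i:I - {j}. z i / z j) : maxid P" by(rule sum_maxid[OF V])
 have nz: "z j ~= 0" using z j by auto
 have eq: "(SUM i:I. z i) / z j = 1 + (SUM i:I - {j}. z i / z j)"
  unfolding sum_divide_distrib using assms(2) j nz by(subst sum.remove[of I j]) auto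
 show ?thesis
 proof
  assume "(SUM i:I. z i) = 0"
  hence "(SUM i:I - {j}. z i / z j) = - 1" using eq by(simp add: eq_neg_iff_add_eq_0 add.commute)
  hence "- 1 * (- 1) : maxid P" using m maxid_mult[OF R, of "- 1" "- 1"] R by(simp add: subringD)
  thus False using unit_of_1[OF R] by(simp add: maxid_def)
 qed
qed

text \<open>Every strictly increasing chain of values within one period of \<open>v(\<pi>)\<close> has at most \<open>N\<close> members,
 and the multiples of \<open>v(\<pi>)\<close> are cofinal; so the value group is infinite cyclic.\<close>

lemma dvr_of_bounded_chains:
 assumes V: "valuation_ring_of K P" and pi: "\<pi> : maxid P" "\<pi> ~= 0"
  and chain: "!!y. (ALL i<=N. y i : K & y i ~= 0) ==> (ALL i<N. y (Suc i) / y i : maxid P) ==>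
    \<pi> * y 0 / y N : maxid P ==> False"
  and arch: "!!f. f : maxid P ==> f ~= 0 ==> EX j. \<pi> ^ j / f : P"
 shows "dvr K P"
proof -
 have R: "is_subring P" and K: "is_subfield K" and sub: "P <= K"
  and v: "!!f. f : K ==> f ~= 0 ==> f : P | inverse f : P"
  using V unfolding valuation_ring_of_def by auto
 have mP: "maxid P <= P" by(auto simp: maxid_def)
 note KR = subringD[OF subfield_subring[OF K]]
 have "EX t:maxid P. t ~= 0 & (ALL f:maxid P. f / t : P)"
 proof (rule ccontr)
  assume "~ ?thesis"
  hence no: "!!t. t : maxid P & t ~= 0 ==> EX f:maxid P. f / t ~: P" by blast
  have "EX f. (f : maxid P & f ~= 0) & t / f : maxid P" if tm: "t : maxid P & t ~= 0" for t
  proof -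
   obtain f where f: "f : maxid P" "f / t ~: P" using no[OF tm] by blast
   hence "f ~= 0" using R by(auto simp: subringD)
   hence "t / f : maxid P" using valuation_ratio[OF V _ _ _ _ f(2)] f tm sub mP \<open>f \<noteq> 0\<close> by blast
   thus ?thesis using f \<open>f \<noteq> 0\<close> by blast
  qed
  then obtain g where g: "!!i. g i : maxid P & g i ~= 0" "g 0 = \<pi>" "!!i. g i / g (Suc i) : maxid P"
   using dependent_nat_choice[of "%i x. x : maxid P & x ~= 0 & (i = 0 --> x = \<pi>)"
     "%_ x y. x / y : maxid P"] pi by(metis Zero_neq_Suc)
  \<comment> \<open>If there were no uniformizer, the sequence g would start at \<pi> and descend in
    value forever; its first N + 1 members, read backwards, contradict \<open>chain\<close>.\<close>
  define y where "y i = g (N - i)" for i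
  have "y (Suc i) / y i : maxid P" if "i < N" for i
   using g(3)[of "N - Suc i"] that by(simp add: y_def Suc_diff_Suc)
  moreover have "\<pi> * y 0 / y N : maxid P" using g(1)[of N] g(2) pi by(simp add: y_def)
  moreover have "y i : K & y i ~= 0" for i using g(1) sub mP by(auto simp: y_def)
  ultimately show False using chain by blast
 qed
 then obtain t where t: "t : maxid P" "t ~= 0" "!!f. f : maxid P ==> f / t : P" by blast
 have tP: "t : P" "t : K" using t mP sub by auto
 have "maxid P = {t * g |g. g : P}"
 proof (intro equalityI subsetI)
  fix f assume "f : maxid P"
  thus "f : {t * g |g. g : P}" using t by(intro CollectI exI[of _ "f / t"]) auto
 next
  fix f assume "f : {t * g |g. g : P}"
  thus "f : maxid P" using maxid_mult[OF R t(1)] by auto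
 qed
 hence unif: "uniformizer P t" using t(2) unfolding uniformizer_def maxid_def by blast
 \<comment> \<open>No f is divisible by all powers of t: by \<open>chain\<close>, the N-th power of
   t has at least the value of \<pi>, and some power of \<pi> is divisible by f.\<close>
 have bd: "EX M. f / t ^ M ~: P" if f: "f : P" "f ~= 0" for f
 proof -
  have "EX j. \<pi> ^ j / f : P"
  proof (cases "f : maxid P")
   case True
   thus ?thesis using arch f by blast
  next
   case False
   hence "unit_of P f" using f by(simp add: maxid_def)
   thus ?thesis by(intro exI[of _ 0]) (simp add: unit_of_def divide_inverse)
  qed
  then obtain j where j: "\<pi> ^ j / f : P" by blast
  have "\<pi> / t ^ N ~: maxid P"
   using chain[of "%i. t ^ i"] t tP subring_power[OF subfield_subring[OF K] tP(2)] by auto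
  hence "t ^ N / \<pi> : P"
  proof (rule contrapos_np)
   assume "t ^ N / \<pi> ~: P"
   thus "\<pi> / t ^ N : maxid P" using t pi tP mP sub by(intro valuation_ratio[OF V])
     (auto intro: subring_power[OF subfield_subring[OF K]])
  qed
  hence "(t ^ N / \<pi>) ^ j * (\<pi> ^ j / f) : P" by(intro subringD(5)[OF R] subring_power[OF R] j)
  also have "(t ^ N / \<pi>) ^ j * (\<pi> ^ j / f) = t ^ (N * j) / f"
   using pi by(simp add: power_divide power_mult)
  finally have a: "t ^ (N * j) / f : P" .
  have "t * (t ^ (N * j) / f) : maxid P" using maxid_mult[OF R t(1) a] .
  hence b: "t ^ Suc (N * j) / f : maxid P" by simp
  have "f / t ^ Suc (N * j) ~: P"
  proof
   assume "f / t ^ Suc (N * j) : P"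
   hence "unit_of P (t ^ Suc (N * j) / f)" using b mP t f by(auto simp: unit_of_def)
   thus False using b by(simp add: maxid_def)
  qed
  thus ?thesis by blast
 qed
 have repP: "EX m u. unit_of P u & f = t powi m * u" if f: "f : P" "f ~= 0" for f
 proof -
  define M where "M = (LEAST M. f / t ^ M ~: P)"
  have M: "f / t ^ M ~: P" unfolding M_def using bd[OF f] by(rule LeastI_ex)
  hence "M ~= 0" using f by(metis div_by_1 power_0)
  then obtain m where m: "M = Suc m" by(cases M) auto
  have in_P: "f / t ^ m : P" using not_less_Least[of m "%M. f / t ^ M ~: P"] m M_def by auto
  have "unit_of P (f / t ^ m)"
  proof (rule ccontr)
   assume "~ unit_of P (f / t ^ m)"
   hence "f / t ^ m : maxid P" using in_P by(simp add: maxid_def)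
   hence "f / t ^ m / t : P" using t by blast
   thus False using M m by(simp add: mult.commute)
  qed
  thus ?thesis using t by(intro exI[of _ "int m"] exI[of _ "f / t ^ m"]) auto
 qed
 have "EX m u. unit_of P u & f = t powi m * u" if f: "f : K" "f ~= 0" for f
 proof (cases "f : P")
  case True
  thus ?thesis using repP f by blast
 next
  case False
  hence "inverse f : P" using v f by blast
  moreover have "inverse f ~= 0" using f by simp
  ultimately obtain m u where u: "unit_of P u" "inverse f = t powi m * u" using repP[of "inverse f"] by blast
  have "f = inverse (t powi m * u)" using u(2) by(metis inverse_inverse_eq)
  hence "f = t powi (- m) * inverse u" by(simp add: power_int_minus)
  thus ?thesis using unit_of_inverse[OF u(1)] by blast
 qed
 thus ?thesis unfolding dvr_def using unif R K sub by blast
qed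

lemma dvrD:
 assumes "dvr K P" shows "is_subfield K" "is_subring P" "P <= K"
 using assms unfolding dvr_def by auto

lemma uniformizer_maxid: "is_subring P ==> uniformizer P t ==> t : maxid P & t ~= 0"
 unfolding uniformizer_def maxid_def[symmetric] using subringD(2)[of P] by fastforce

lemma uniformizer_power_not_unit:
 assumes "is_subring P" "uniformizer P t" "n > 0" shows "~ unit_of P (t ^ n)"
proof
 assume a: "unit_of P (t ^ n)"
 have t: "t : maxid P" "t : P" using uniformizer_maxid[OF assms(1,2)] by(auto simp: maxid_def)
 have "t ^ n = t * t ^ (n - 1)" using assms(3) by(cases n) auto
 hence "unit_of P t" using unit_of_multD[OF assms(1) t(2)] a subring_power[OF assms(1) t(2)] by metis
 thus False using t by(simp add: maxid_def)
qed

lemma uniformizer_powi_not_unit: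
 assumes "is_subring P" "uniformizer P t" "unit_of P (t powi n)" shows "n = 0"
proof (rule ccontr)
 assume "n ~= 0"
 then consider "n > 0" | "- n > 0" by linarith
 thus False
 proof cases
  case 1
  thus ?thesis using uniformizer_power_not_unit[OF assms(1,2), of "nat n"] assms(3)
   by(simp add: power_int_def)
 next
  case 2
  hence "t powi n = inverse (t ^ nat (- n))" by(simp add: power_int_def power_inverse)
  hence "unit_of P (t ^ nat (- n))" using unit_of_inverse[OF assms(3)] by simp
  thus ?thesis using uniformizer_power_not_unit[OF assms(1,2), of "nat (- n)"] 2 by simp
 qed
qed

lemma uniformizer_unique:
 assumes R: "is_subring P" and t: "uniformizer P t" "uniformizer P t'" shows "unit_of P (t' / t)"
proof -
 have m: "t : maxid P" "t ~= 0" "t' : maxid P" "t' ~= 0" using uniformizer_maxid[OF R] t by auto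
 obtain g where g: "g : P" "t' = t * g" using m(3) t(1) unfolding uniformizer_def maxid_def by auto
 obtain g' where g': "g' : P" "t = t' * g'" using m(1) t(2) unfolding uniformizer_def maxid_def by auto
 have "t = t * (g * g')" using g(2) g'(2) by(metis mult.assoc)
 hence "g * g' = 1" using m by simp
 hence "inverse g = g'" by(rule inverse_unique)
 moreover have "t' / t = g" using g m by simp
 moreover have "g ~= 0" using g m by auto
 ultimately show ?thesis unfolding unit_of_def using g(1) g'(1) by simp
qed

text \<open>Two uniformizers differ by a unit, so the exponent is the same for every choice; this
  turns the definite description in \<open>ord_at\<close> into a value.\<close>

lemma ord_at_eq:
 assumes R: "is_subring P" and t: "uniformizer P t" and u: "unit_of P u" and f: "f = t powi m * u"
 shows "ord_at P f = m" unfolding ord_at_def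
proof (rule the_equality)
 show "EX t u. uniformizer P t & unit_of P u & f = t powi m * u" using assms by blast
 fix m' assume "EX t u. uniformizer P t & unit_of P u & f = t powi m' * u"
 then obtain t' u' where t': "uniformizer P t'" "unit_of P u'" "f = t' powi m' * u'" by blast
 have nz: "t ~= 0" "t' ~= 0" "u ~= 0" "u' ~= 0"
  using uniformizer_maxid[OF R] t t' u by(auto simp: unit_of_def)
 have "t powi (m - m') = (t' / t) powi m' * u' * inverse u"
  using nz f t'(3) by(simp add: power_int_diff power_int_divide_distrib field_simps)
 also have "unit_of P ..."
  using uniformizer_unique[OF R t t'(1)] t'(2) u R by(intro unit_of_mult unit_of_powi unit_of_inverse)
 finally show "m' = m" using uniformizer_powi_not_unit[OF R t] by fastforce
qed

context
 fixes K P :: "'a::field set"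
 assumes D: "dvr K P"
begin

private lemma R: "is_subring P" and K: "is_subfield K" and sub: "P <= K" using dvrD[OF D] by auto

lemma dvr_rep: "EX t. uniformizer P t & (ALL f:K. f ~= 0 --> (EX u. unit_of P u & f = t powi (ord_at P f) * u))"
proof -
 obtain t where t: "uniformizer P t" "!!f. f : K ==> f ~= 0 ==> EX m u. unit_of P u & f = t powi m * u"
  using D unfolding dvr_def by blast
 have "EX u. unit_of P u & f = t powi (ord_at P f) * u" if f: "f : K" "f ~= 0" for f
 proof -
  obtain m u where u: "unit_of P u" "f = t powi m * u" using t(2)[OF f] by blast
  from ord_at_eq[OF R t(1) u] have "ord_at P f = m" .
  with u show ?thesis by metis
 qed
 thus ?thesis using t by blast
qed

lemma ord_mult:
 assumes "f : K" "f ~= 0" "g : K" "g ~= 0"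
 shows "ord_at P (f * g) = ord_at P f + ord_at P g"
proof -
 obtain t where t: "uniformizer P t" "!!f. f : K ==> f ~= 0 ==> EX u. unit_of P u & f = t powi (ord_at P f) * u"
  using dvr_rep by blast
 obtain u v where u: "unit_of P u" "f = t powi (ord_at P f) * u"
  and v: "unit_of P v" "g = t powi (ord_at P g) * v" using t(2) assms by meson
 have "t ~= 0" using uniformizer_maxid[OF R t(1)] by simp
 have "f * g = (t powi (ord_at P f) * u) * (t powi (ord_at P g) * v)" using u v by simp
 also have "... = t powi (ord_at P f + ord_at P g) * (u * v)"
  using \<open>t \<noteq> 0\<close> by(simp add: power_int_add)
 finally show ?thesis using ord_at_eq[OF R t(1) unit_of_mult[OF R u(1) v(1)]] by simp
qed

lemma unit_ord: "unit_of P f ==> ord_at P f = 0"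
proof -
 assume u: "unit_of P f"
 obtain t where "uniformizer P t" using dvr_rep by blast
 from ord_at_eq[OF R this u, of f 0] show ?thesis by simp
qed

lemma ord_1: "ord_at P 1 = 0" by(rule unit_ord[OF unit_of_1[OF R]])

lemma ord_inverse: "f : K ==> f ~= 0 ==> ord_at P (inverse f) = - ord_at P f"
 using ord_mult[of f "inverse f"] ord_1 K by(simp add: subfield_inverse)

lemma ord_divide:
 "f : K ==> f ~= 0 ==> g : K ==> g ~= 0 ==> ord_at P (f / g) = ord_at P f - ord_at P g"
 using ord_mult[of f "inverse g"] ord_inverse[of g] K by(simp add: subfield_inverse divide_inverse)

lemma ord_power: "f : K ==> f ~= 0 ==> ord_at P (f ^ n) = int n * ord_at P f"
 by(induction n) (auto simp: ord_1 ord_mult subring_power[OF subfield_subring[OF K]] algebra_simps)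

lemma ord_powi: "f : K ==> f ~= 0 ==> ord_at P (f powi n) = n * ord_at P f"
 by(auto simp: power_int_def ord_power ord_inverse subfield_inverse[OF K])

lemma ord_prod:
 "(!!i. i : I ==> f i : K & f i ~= 0) ==> ord_at P (PROD i:I. f i) = (SUM i:I. ord_at P (f i))"
 by(induction I rule: infinite_finite_induct)
  (auto simp: ord_1 ord_mult subring_prod[OF subfield_subring[OF K]])

lemma mem_iff_ord: "f : K ==> f ~= 0 ==> f : P \<longleftrightarrow> 0 <= ord_at P f"
proof -
 assume f: "f : K" "f ~= 0"
 obtain t u where t: "uniformizer P t" "unit_of P u" "f = t powi (ord_at P f) * u" using dvr_rep f by meson
 have tm: "t : P" "t ~= 0" using uniformizer_maxid[OF R t(1)] by(auto simp: maxid_def)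
 show ?thesis
 proof
  assume "0 <= ord_at P f"
  hence "t powi (ord_at P f) : P" using tm R by(simp add: power_int_def subring_power)
  thus "f : P" using t R by(metis subringD(5) unit_of_def)
 next
  assume fP: "f : P"
  show "0 <= ord_at P f"
  proof (rule ccontr)
   assume neg: "~ 0 <= ord_at P f"
   define n where "n = nat (- ord_at P f)"
   have n: "n > 0" "ord_at P f = - int n" using neg by(auto simp: n_def)
   have "inverse (t ^ n) = f * inverse u"
    using t n tm by(metis inverse_unique mult.assoc mult.commute mult.right_neutral power_int_minus
      power_int_of_nat right_inverse unit_of_def)
   hence "inverse (t ^ n) : P" using fP t(2) R by(simp add: unit_of_def subringD)
   hence "unit_of P (t ^ n)" using tm R by(simp add: unit_of_def subring_power)
   thus False using uniformizer_power_not_unit[OF R t(1) n(1)] by blast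
  qed
 qed
qed

lemma unit_iff_ord: "f : K ==> f ~= 0 ==> unit_of P f \<longleftrightarrow> ord_at P f = 0"
 using mem_iff_ord[of f] mem_iff_ord[of "inverse f"] ord_inverse[of f] K
 by(auto simp: unit_of_def subfield_inverse)

lemma maxid_iff_ord: "f : K ==> f ~= 0 ==> f : maxid P \<longleftrightarrow> 0 < ord_at P f"
 using mem_iff_ord[of f] unit_iff_ord[of f] by(auto simp: maxid_def)

lemma uniformizer_ord: "uniformizer P t ==> ord_at P t = 1"
 using ord_at_eq[OF R, of t 1 t 1] unit_of_1[OF R] by simp

lemma exists_uniformizer: "EX t. uniformizer P t & t : K & t ~= 0 & ord_at P t = 1"
proof -
 obtain t where t: "uniformizer P t" using dvr_rep by blast
 have "t : K" "t ~= 0" using uniformizer_maxid[OF R t] sub by(auto simp: maxid_def)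
 with t uniformizer_ord[OF t] show ?thesis by blast
qed

end

text \<open>The convention that 0 has infinite order; \<open>ord_at P 0\<close> itself carries no
  information.\<close>

abbreviation ord_ge :: "'a::field set => 'a => int => bool" where
 "ord_ge P f m \<equiv> f = 0 | m <= ord_at P f"

lemma ord_ge_iff:
 assumes D: "dvr K P" and t: "t : K" "t ~= 0" "ord_at P t = 1" and f: "f : K"
 shows "ord_ge P f m \<longleftrightarrow> f / t powi m : P"
proof (cases "f = 0")
 case True
 thus ?thesis using dvrD[OF D] by(simp add: subringD)
next
 case False
 have tm: "t powi m : K" "t powi m ~= 0" using t dvrD[OF D] by(auto simp: subfield_powi)
 have "f / t powi m : K" using f tm dvrD[OF D] by(simp add: subfield_divide)
 thus ?thesis
  using False mem_iff_ord[OF D, of "f / t powi m"] ord_divide[OF D f False tm] ord_powi[OF D t(1,2)] t tm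
  by auto
qed

lemma ord_ge_add:
 assumes D: "dvr K P" and "f : K" "g : K" "ord_ge P f m" "ord_ge P g m" shows "ord_ge P (f + g) m"
proof -
 obtain t where t: "t : K" "t ~= 0" "ord_at P t = 1" using exists_uniformizer[OF D] by blast
 show ?thesis
  using assms ord_ge_iff[OF D t, of f m] ord_ge_iff[OF D t, of g m] ord_ge_iff[OF D t, of "f + g" m]
   dvrD[OF D] subfield_subring[OF dvrD(1)[OF D]] by(simp add: add_divide_distrib subringD)
qed

lemma ord_ge_sum:
 assumes D: "dvr K P" and "!!i. i : I ==> f i : K & ord_ge P (f i) m"
 shows "ord_ge P (sum f I) m" using assms(2)
proof (induction I rule: infinite_finite_induct)
 case (insert x F)
 have "ord_ge P (f x + sum f F) m"
  using insert by(intro ord_ge_add[OF D]) (auto intro!: subring_sum subfield_subring dvrD(1)[OF D])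
 thus ?case using insert.hyps by simp
qed auto

lemma ord_uminus: assumes "dvr K P" "f : K" shows "ord_at P (- f) = ord_at P f"
proof (cases "f = 0")
 case False
 have "unit_of P (- 1)" using dvrD(2)[OF assms(1)] by(auto simp: unit_of_def subringD)
 hence "ord_at P (- 1) = 0" using unit_ord[OF assms(1)] by blast
 moreover have "- 1 : K" using dvrD(1)[OF assms(1)] by(simp add: subfield_subring subringD)
 ultimately show ?thesis using ord_mult[OF assms(1), of "- 1" f] False assms by simp
qed simp

lemma ord_add_less:
 assumes D: "dvr K P" and fg: "f : K" "g : K" "f ~= 0" "ord_ge P g (ord_at P f + 1)"
 shows "f + g ~= 0 & ord_at P (f + g) = ord_at P f"
proof (cases "g = 0")
 case False
 note KR = subringD[OF subfield_subring[OF dvrD(1)[OF D]]]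
 have nz: "f + g ~= 0"
 proof
  assume "f + g = 0"
  hence "g = - f" by(simp add: eq_neg_iff_add_eq_0 add.commute)
  thus False using fg False ord_uminus[OF D fg(1)] by simp
 qed
 moreover have "ord_ge P (f + g) (ord_at P f)" using fg by(intro ord_ge_add[OF D]) auto
 moreover have "~ ord_at P f + 1 <= ord_at P (f + g)"
 proof
  assume a: "ord_at P f + 1 <= ord_at P (f + g)"
  have "ord_ge P (- g) (ord_at P f + 1)" using fg(4) ord_uminus[OF D fg(2)] by auto
  from ord_ge_add[OF D KR(4)[OF fg(1,2)] KR(3)[OF fg(2)] disjI2[OF a] this]
  show False using fg by simp
 qed
 ultimately show ?thesis by auto
qed (use fg in auto)

text \<open>An element of Q outside P has negative order, and every element of K becomes integral
  after division by a high power of it.\<close>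

lemma dvr_maximal:
 assumes D: "dvr K P" and Q: "is_subring Q" "P <= Q" "Q <= K" "Q ~= K" shows "Q = P"
proof (rule ccontr)
 assume "Q ~= P"
 then obtain f where f: "f : Q" "f ~: P" using Q by auto
 hence fK: "f : K" "f ~= 0" using Q dvrD[OF D] by(auto simp: subringD)
 have neg: "ord_at P f < 0" using mem_iff_ord[OF D fK] f by auto
 have "g : Q" if g: "g : K" for g
 proof (cases "g = 0")
  case False
  define n where "n = nat \<bar>ord_at P g\<bar>"
  have fn: "f ^ n : K" "f ^ n ~= 0" using fK subring_power[OF subfield_subring[OF dvrD(1)[OF D]]] by auto
  have "0 <= ord_at P (g / f ^ n)"
  proof -
   have "int n * ord_at P f <= int n * (- 1)" using neg by(intro mult_left_mono) auto
   thus ?thesis using ord_divide[OF D g False fn] ord_power[OF D fK] by(simp add: n_def)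
  qed
  hence "g / f ^ n : P"
   using mem_iff_ord[OF D, of "g / f ^ n"] g False fn dvrD(1)[OF D] by(simp add: subfield_divide)
  hence "(g / f ^ n) * f ^ n : Q" using Q(2) f by(intro subringD(5)[OF Q(1)] subring_power[OF Q(1)]) auto
  thus ?thesis using fK(2) by simp
 qed (use Q in \<open>auto simp: subringD\<close>)
 thus False using Q by auto
qed

section \<open>Polynomials in three variables\<close>

text \<open>Additive extension of a map from terms to polynomials. Evaluation, rescaling of the
  variables and homogeneous components are all of this form, so their basic rules are instances of
  the ones below.\<close>

definition pm_ext :: "('e => 'a => 'b::comm_monoid_add) => ('e \<Rightarrow>\<^sub>0 'a::zero) => 'b" where
 "pm_ext G f = (SUM e:Poly_Mapping.keys f. G e (Poly_Mapping.lookup f e))"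

lemma pm_ext_superset:
 assumes "finite S" "Poly_Mapping.keys f <= S" "!!e. G e 0 = 0"
 shows "pm_ext G f = (SUM e:S. G e (Poly_Mapping.lookup f e))"
 unfolding pm_ext_def using assms by(intro sum.mono_neutral_left) (auto simp: in_keys_iff)

lemma pm_ext_add:
 assumes "!!e. G e 0 = 0" "!!e a b. G e (a + b) = G e a + G e b"
 shows "pm_ext G (f + g) = pm_ext G f + pm_ext G g"
proof -
 let ?S = "Poly_Mapping.keys f \<union> Poly_Mapping.keys g"
 have "pm_ext G (f + g) = (SUM e:?S. G e (Poly_Mapping.lookup (f + g) e))"
  using Poly_Mapping.keys_add[of f g] by(intro pm_ext_superset assms) auto
 also have "... = (SUM e:?S. G e (Poly_Mapping.lookup f e)) + (SUM e:?S. G e (Poly_Mapping.lookup g e))"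
  by(simp add: lookup_add assms sum.distrib)
 also have "... = pm_ext G f + pm_ext G g"
  using pm_ext_superset[of ?S f G] pm_ext_superset[of ?S g G] assms by simp
 finally show ?thesis .
qed

lemma pm_ext_single: "(!!e. G e 0 = 0) ==> pm_ext G (Poly_Mapping.single e a) = G e a"
 by(simp add: pm_ext_def)

lemma pm_ext_0: "pm_ext G 0 = 0" by(simp add: pm_ext_def)

lemma pm_ext_sum:
 assumes "!!e. G e 0 = 0" "!!e a b. G e (a + b) = G e a + G e b"
 shows "pm_ext G (SUM i:I. f i) = (SUM i:I. pm_ext G (f i))"
 by(induction I rule: infinite_finite_induct) (simp_all add: pm_ext_add[of G, OF assms] pm_ext_0)

lemma poly_mapping_sum_singles:
 "f = (SUM e:Poly_Mapping.keys f. Poly_Mapping.single e (Poly_Mapping.lookup f e))"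
proof (rule poly_mapping_eqI)
 fix k
 have "Poly_Mapping.lookup (SUM e:Poly_Mapping.keys f. Poly_Mapping.single e (Poly_Mapping.lookup f e)) k
   = (SUM e:Poly_Mapping.keys f. if e = k then Poly_Mapping.lookup f e else 0)"
  unfolding lookup_sum by(intro sum.cong) (auto simp: lookup_single when_def)
 also have "... = Poly_Mapping.lookup f k" by(simp add: in_keys_iff)
 finally show "Poly_Mapping.lookup f k = Poly_Mapping.lookup (SUM e:Poly_Mapping.keys f.
   Poly_Mapping.single e (Poly_Mapping.lookup f e)) k" by simp
qed

lemma pm_ext_mult:
 fixes f g :: "'e::comm_monoid_add \<Rightarrow>\<^sub>0 'a::comm_semiring_1" and G :: "'e => 'a => 'b::comm_semiring_0"
 assumes G: "!!e. G e 0 = 0" "!!e a b. G e (a + b) = G e a + G e b"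
  and m: "!!e e' a b. G (e + e') (a * b) = G e a * G e' b"
 shows "pm_ext G (f * g) = pm_ext G f * pm_ext G g"
proof -
 let ?s = "%f e. Poly_Mapping.single e (Poly_Mapping.lookup f e)"
 have "f * g = (SUM e:Poly_Mapping.keys f. ?s f e) * (SUM e:Poly_Mapping.keys g. ?s g e)"
  using poly_mapping_sum_singles[of f] poly_mapping_sum_singles[of g] by simp
 also have "... = (SUM e:Poly_Mapping.keys f. SUM e':Poly_Mapping.keys g.
   Poly_Mapping.single (e + e') (Poly_Mapping.lookup f e * Poly_Mapping.lookup g e'))"
  by(simp add: sum_product mult_single)
 finally have "pm_ext G (f * g) = (SUM e:Poly_Mapping.keys f. SUM e':Poly_Mapping.keys g.
   G e (Poly_Mapping.lookup f e) * G e' (Poly_Mapping.lookup g e'))"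
  by(simp add: pm_ext_sum[of G, OF G] pm_ext_single[of G, OF G(1)] m)
 thus ?thesis by(simp add: pm_ext_def sum_product)
qed

lemma UNIV3_eq: "distinct [x, y, z] ==> (UNIV :: 3 set) = {x, y, z}"
proof -
 assume "distinct [x, y, z]"
 hence "card {x, y, z} = 3" by simp
 thus "(UNIV :: 3 set) = {x, y, z}" by(intro sym[OF card_subset_eq]) auto
qed

section \<open>Evaluation, rescaling of the variables and homogeneous components\<close>

definition mon3 :: "('b::comm_monoid_mult) ^ 3 => nat ^ 3 => 'b" where
 "mon3 c e = (PROD i:UNIV. (c $ i) ^ (e $ i))"

lemma mon3_add: "mon3 c (e + e') = mon3 c e * mon3 c e'" by(simp add: mon3_def power_add prod.distrib)

lemma mon3_0: "mon3 c 0 = 1" by(simp add: mon3_def)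

lemma mon3_axis: "mon3 c (axis i n) = (c $ i) ^ n"
proof -
 have "mon3 c (axis i n) = (PROD j:UNIV. if j = i then (c $ j) ^ n else 1)"
  unfolding mon3_def axis_def by(intro prod.cong) auto
 thus ?thesis by simp
qed

lemma eval3_ext: "eval3 f c = pm_ext (%e a. a * mon3 c e) f"
 by(simp add: eval3_def pm_ext_def mon3_def)

lemma eval3_add: "eval3 (f + g) c = eval3 f c + eval3 g c"
 unfolding eval3_ext by(rule pm_ext_add) (auto simp: distrib_right)

lemma eval3_mult: "eval3 (f * g) c = eval3 f c * eval3 g c"
 unfolding eval3_ext by(rule pm_ext_mult) (auto simp: distrib_right mon3_add mult_ac)

lemma eval3_single: "eval3 (Poly_Mapping.single e a) c = a * mon3 c e"
 unfolding eval3_ext by(rule pm_ext_single) simp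

lemma eval3_monom3: "eval3 (monom3 e) c = mon3 c e" by(simp add: monom3_def eval3_single)

lemma eval3_Const3: "eval3 (Const3 a) c = a" by(simp add: Const3_def eval3_single mon3_0)

text \<open>The substitution that multiplies the i-th variable by \<open>c $ i\<close>.\<close>

definition scale3 :: "'k::comm_ring_1 ^ 3 => 'k poly3 => 'k poly3" where
 "scale3 c f = pm_ext (%e a. Poly_Mapping.single e (a * mon3 c e)) f"

lemma scale3_add: "scale3 c (f + g) = scale3 c f + scale3 c g"
 unfolding scale3_def by(rule pm_ext_add) (auto simp: distrib_right single_add)

lemma scale3_mult: "scale3 c (f * g) = scale3 c f * scale3 c g"
 unfolding scale3_def by(rule pm_ext_mult) (auto simp: distrib_right mon3_add mult_ac mult_single single_add)

lemma scale3_single: "scale3 c (Poly_Mapping.single e a) = Poly_Mapping.single e (a * mon3 c e)"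
 unfolding scale3_def by(rule pm_ext_single) simp

lemma lookup_scale3: "Poly_Mapping.lookup (scale3 c f) e = Poly_Mapping.lookup f e * mon3 c e"
proof -
 have "Poly_Mapping.lookup (scale3 c f) e
   = (SUM e':Poly_Mapping.keys f. if e' = e then Poly_Mapping.lookup f e' * mon3 c e' else 0)"
  unfolding scale3_def pm_ext_def lookup_sum by(intro sum.cong) (auto simp: lookup_single when_def)
 also have "... = Poly_Mapping.lookup f e * mon3 c e" by(simp add: in_keys_iff)
 finally show ?thesis .
qed

lemma homogeneous_scale3: "homogeneous m f ==> homogeneous m (scale3 c f)"
 unfolding homogeneous_def by(auto simp: in_keys_iff lookup_scale3)

lemma deg3_add: "deg3 (e + e') = deg3 e + deg3 e'" by(simp add: deg3_def sum.distrib)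

lemma deg3_0_iff: "deg3 e = 0 \<longleftrightarrow> e = 0" by(auto simp: deg3_def fvec_eq_iff)

lemma homogeneous_add: "homogeneous m f ==> homogeneous m g ==> homogeneous m (f + g)"
 unfolding homogeneous_def using Poly_Mapping.keys_add[of f g] by auto

lemma homogeneous_mult: "homogeneous m f ==> homogeneous n g ==> homogeneous (m + n) (f * g)"
 unfolding homogeneous_def using Poly_Mapping.keys_mult[of f g] by(auto simp: deg3_add)

lemma homogeneous_single: "deg3 e = m ==> homogeneous m (Poly_Mapping.single e a)"
 unfolding homogeneous_def by auto

lemma homogeneous_monom3: "deg3 e = m ==> homogeneous m (monom3 e)"
 unfolding monom3_def by(rule homogeneous_single)

lemma homogeneous_Const3: "homogeneous 0 (Const3 a)"
 unfolding Const3_def by(rule homogeneous_single) (simp add: deg3_def)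

lemma Const3_hom: "Const3 (a + b) = Const3 a + Const3 b" "Const3 (a * b) = Const3 a * Const3 b"
 "Const3 1 = 1" "Const3 0 = 0" by(simp_all add: Const3_def single_add mult_single)

lemma deg3_axis: "deg3 (axis i n) = n" by(simp add: deg3_def axis_def)

lemma monom3_add: "monom3 (e + e') = monom3 e * monom3 e'" by(simp add: monom3_def mult_single)

lemma single_conv: "Poly_Mapping.single e a = Const3 a * monom3 e"
 by(simp add: Const3_def monom3_def mult_single)

lemma Var3_power: "Var3 i ^ n = monom3 (axis i n)"
proof (induction n)
 case 0
 have "axis i (0::nat) = 0" by(simp add: axis_def fvec_eq_iff)
 thus ?case unfolding monom3_def by(simp only: power_0 single_one)
next
 case (Suc n)
 have "axis i (Suc n) = axis i 1 + axis i n" by(simp add: axis_def fvec_eq_iff)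
 thus ?case using Suc by(simp add: monom3_add Var3_def)
qed

definition hcomp :: "nat => 'k::comm_ring_1 poly3 => 'k poly3" where
 "hcomp m f = pm_ext (%e a. if deg3 e = m then Poly_Mapping.single e a else 0) f"

lemma hcomp_sum: "hcomp m (SUM i:I. f i) = (SUM i:I. hcomp m (f i))"
 unfolding hcomp_def by(rule pm_ext_sum) (auto simp: single_add)

lemma hcomp_single: "hcomp m (Poly_Mapping.single e a) = (if deg3 e = m then Poly_Mapping.single e a else 0)"
 unfolding hcomp_def by(rule pm_ext_single) simp

lemma lookup_hcomp: "Poly_Mapping.lookup (hcomp m f) e = (if deg3 e = m then Poly_Mapping.lookup f e else 0)"
proof -
 have "Poly_Mapping.lookup (hcomp m f) e
   = (SUM e':Poly_Mapping.keys f. if e' = e then (if deg3 e = m then Poly_Mapping.lookup f e else 0) else 0)"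
  unfolding hcomp_def pm_ext_def lookup_sum by(intro sum.cong) (auto simp: lookup_single when_def)
 thus ?thesis by(simp add: in_keys_iff)
qed

lemma hcomp_homogeneous: "homogeneous m (hcomp m f)"
 unfolding homogeneous_def by(auto simp: in_keys_iff lookup_hcomp split: if_splits)

lemma hcomp_self: "homogeneous m f ==> hcomp m f = f"
 by(intro poly_mapping_eqI) (auto simp: lookup_hcomp homogeneous_def in_keys_iff)

lemma hcomp_mult:
 assumes "homogeneous d h" shows "hcomp m (h * g) = (if d <= m then h * hcomp (m - d) g else 0)"
proof -
 let ?s = "%f e. Poly_Mapping.single e (Poly_Mapping.lookup f e)"
 have eq: "h * Poly_Mapping.single e a = (SUM e':Poly_Mapping.keys h. Poly_Mapping.single (e' + e) (Poly_Mapping.lookup h e' * a))"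
  for e a by(subst poly_mapping_sum_singles[of h]) (simp add: sum_distrib_right mult_single)
 have s: "hcomp m (h * Poly_Mapping.single e a) = (if d + deg3 e = m then h * Poly_Mapping.single e a else 0)"
  for e a unfolding eq hcomp_sum hcomp_single using assms
  by(auto simp: homogeneous_def deg3_add intro!: sum.cong sum.neutral)
 have "hcomp m (h * g) = hcomp m (SUM e:Poly_Mapping.keys g. h * ?s g e)"
  using poly_mapping_sum_singles[of g] by(simp add: sum_distrib_left[symmetric])
 also have "... = (SUM e:Poly_Mapping.keys g. if d + deg3 e = m then h * ?s g e else 0)"
  by(simp add: hcomp_sum s)
 also have "... = (if d <= m then h * hcomp (m - d) g else 0)"
 proof (cases "d <= m")
  case True
  thus ?thesis unfolding hcomp_def pm_ext_def sum_distrib_left by(auto intro!: sum.cong)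
 qed (auto intro!: sum.neutral)
 finally show ?thesis .
qed

lemma dvd_homogeneous_less:
 assumes "homogeneous d h" "homogeneous m F" "m < d" "h dvd F" shows "F = 0"
proof -
 obtain g where "F = h * g" using assms(4) by(auto simp: dvd_def)
 thus ?thesis using hcomp_mult[OF assms(1), of m g] hcomp_self[OF assms(2)] assms(3) by simp
qed

lemma dvd_homogeneous_eq:
 assumes "homogeneous d h" "homogeneous d F" "h dvd F" shows "EX c. F = Const3 c * h"
proof -
 obtain g where g: "F = h * g" using assms(3) by(auto simp: dvd_def)
 hence F: "F = h * hcomp 0 g" using hcomp_mult[OF assms(1), of d g] hcomp_self[OF assms(2)] by simp
 define c where "c = Poly_Mapping.lookup (hcomp 0 g) 0"
 have "Poly_Mapping.lookup (hcomp 0 g) e = 0" if "e ~= 0" for e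
  using hcomp_homogeneous[of 0 g] that unfolding homogeneous_def by(metis deg3_0_iff in_keys_iff)
 hence "hcomp 0 g = Const3 c"
  unfolding Const3_def c_def by(intro poly_mapping_eqI) (auto simp: lookup_single when_def)
 thus ?thesis using F by(metis mult.commute)
qed

section \<open>Automorphisms of a field and their action on local rings\<close>

definition field_autom :: "'a::field set => ('a => 'a) => bool" where
 "field_autom K \<tau> \<longleftrightarrow> bij_betw \<tau> K K &
   (ALL f:K. ALL g:K. \<tau> (f + g) = \<tau> f + \<tau> g & \<tau> (f * g) = \<tau> f * \<tau> g)"

context
 fixes K :: "'a::field set" and \<tau> :: "'a => 'a"
 assumes K: "is_subfield K" and T: "field_autom K \<tau>"
begin

private lemma KR: "0 : K" "1 : K" "x : K ==> - x : K" "x : K ==> y : K ==> x + y : K"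
  "x : K ==> y : K ==> x * y : K" "x : K ==> inverse x : K"
 using subringD[OF subfield_subring[OF K]] subfield_inverse[OF K] by auto

lemma autom_add: "f : K ==> g : K ==> \<tau> (f + g) = \<tau> f + \<tau> g"
 and autom_mult: "f : K ==> g : K ==> \<tau> (f * g) = \<tau> f * \<tau> g"
 and autom_mem: "f : K ==> \<tau> f : K"
 and autom_inj: "f : K ==> g : K ==> \<tau> f = \<tau> g \<longleftrightarrow> f = g"
 and autom_image: "\<tau> ` K = K" using T unfolding field_autom_def bij_betw_def inj_on_def by auto

lemma autom_0: "\<tau> 0 = 0"
proof -
 have "\<tau> (0 + 0) = \<tau> 0 + \<tau> 0" using KR by(intro autom_add)
 hence "\<tau> 0 = \<tau> 0 + \<tau> 0" by(simp only: add_0_left)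
 thus ?thesis by(metis add_cancel_right_right)
qed

lemma autom_eq_0_iff: "f : K ==> \<tau> f = 0 \<longleftrightarrow> f = 0"
 using autom_inj[of f 0] KR autom_0 by simp

lemma autom_1: "\<tau> 1 = 1"
proof -
 have "\<tau> (1 * 1) = \<tau> 1 * \<tau> 1" using KR by(intro autom_mult)
 moreover have "\<tau> 1 ~= 0" using autom_eq_0_iff[of 1] KR by simp
 ultimately show ?thesis by simp
qed

lemma autom_inverse: "f : K ==> \<tau> (inverse f) = inverse (\<tau> f)"
proof (cases "f = 0")
 case False
 assume f: "f : K"
 have "\<tau> (f * inverse f) = \<tau> f * \<tau> (inverse f)" using f KR by(intro autom_mult)
 hence "\<tau> f * \<tau> (inverse f) = 1" using False autom_1 by simp
 thus ?thesis by(rule inverse_unique[symmetric])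
qed (simp add: autom_0)

lemma autom_divide: "f : K ==> g : K ==> \<tau> (f / g) = \<tau> f / \<tau> g"
 by(simp add: divide_inverse autom_mult autom_inverse KR)

lemma autom_power: "f : K ==> \<tau> (f ^ n) = \<tau> f ^ n"
 by(induction n) (auto simp: autom_1 autom_mult subring_power[OF subfield_subring[OF K]])

lemma autom_powi: "f : K ==> \<tau> (f powi n) = \<tau> f powi n"
 by(auto simp: power_int_def autom_power autom_inverse KR)

lemma autom_sum: "(!!i. i : I ==> f i : K) ==> \<tau> (SUM i:I. f i) = (SUM i:I. \<tau> (f i))"
 by(induction I rule: infinite_finite_induct)
  (auto simp: autom_0 autom_add subring_sum[OF subfield_subring[OF K]])

lemma autom_prod: "(!!i. i : I ==> f i : K) ==> \<tau> (PROD i:I. f i) = (PROD i:I. \<tau> (f i))"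
 by(induction I rule: infinite_finite_induct)
  (auto simp: autom_1 autom_mult subring_prod[OF subfield_subring[OF K]])

lemma autom_uminus: "f : K ==> \<tau> (- f) = - \<tau> f"
 using autom_add[of f "- f"] KR(3)[of f] autom_0 by(simp add: eq_neg_iff_add_eq_0 add.commute)

lemma autom_integral_over:
 assumes "A <= K" "f : K" "integral_over A f" shows "integral_over (\<tau> ` A) (\<tau> f)"
proof -
 obtain q where q: "lead_coeff q = 1" "!!i. coeff q i : A" "poly q f = 0"
  using assms(3) unfolding integral_over_def by blast
 define q' where "q' = map_poly \<tau> q"
 have co: "coeff q' i = \<tau> (coeff q i)" for i unfolding q'_def by(simp add: coeff_map_poly autom_0)
 have dq: "degree q' = degree q"
  using q(1,2) assms(1) by(intro antisym degree_le le_degree) (auto simp: co autom_0 autom_1 coeff_eq_0)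
 have fK: "f ^ i : K" for i by(rule subring_power[OF subfield_subring[OF K] assms(2)])
 have cK: "coeff q i : K" for i using q(2) assms(1) by auto
 have "\<tau> (poly q f) = (SUM i<=degree q. \<tau> (coeff q i * f ^ i))"
  unfolding poly_altdef by(intro autom_sum KR fK cK)
 also have "... = poly q' (\<tau> f)" unfolding poly_altdef dq co
  by(intro sum.cong refl) (simp add: autom_mult[OF cK fK] autom_power[OF assms(2)])
 finally have "poly q' (\<tau> f) = \<tau> (poly q f)" by simp
 moreover have "lead_coeff q' = 1" using dq q(1) by(simp add: co autom_1)
 ultimately show ?thesis using q(2,3) autom_0 unfolding integral_over_def
  by(intro exI[of _ q']) (auto simp: co)
qed

lemma autom_unit_of: "P <= K ==> unit_of P f ==> unit_of (\<tau> ` P) (\<tau> f)"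
 unfolding unit_of_def using autom_inverse[of f] autom_eq_0_iff[of f] by(metis imageI subsetD)

end

lemma autom_subring:
 assumes K: "is_subfield K" and T: "field_autom K \<tau>" and P: "is_subring P" "P <= K"
 shows "is_subring (\<tau> ` P)"
proof -
 have "\<tau> f + \<tau> g : \<tau> ` P" "\<tau> f * \<tau> g : \<tau> ` P" if "f : P" "g : P" for f g
  using that P autom_add[OF K T, of f g] autom_mult[OF K T, of f g] subringD[OF P(1)]
  by(metis imageI subsetD)+
 moreover have "- \<tau> f : \<tau> ` P" if "f : P" for f
  using that P autom_uminus[OF K T, of f] subringD[OF P(1)] by(metis imageI subsetD)
 moreover have "0 : \<tau> ` P" "1 : \<tau> ` P"
  using subringD[OF P(1)] autom_0[OF K T] autom_1[OF K T] by(metis imageI)+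
 ultimately show ?thesis unfolding is_subring_def by auto
qed

lemma autom_unit_iff:
 assumes K: "is_subfield K" and T: "field_autom K \<tau>" and P: "P <= K" and f: "f : K"
 shows "unit_of (\<tau> ` P) (\<tau> f) \<longleftrightarrow> unit_of P f"
proof -
 have inj: "inj_on \<tau> K" using T unfolding field_autom_def bij_betw_def by blast
 show ?thesis unfolding unit_of_def autom_inverse[OF K T f, symmetric] autom_eq_0_iff[OF K T f]
  using inj_on_image_mem_iff[OF inj _ P] f subfield_inverse[OF K f] by blast
qed

lemma autom_uniformizer:
 assumes K: "is_subfield K" and T: "field_autom K \<tau>" and P: "P <= K" "is_subring P" and t: "uniformizer P t"
 shows "uniformizer (\<tau> ` P) (\<tau> t)"
proof -
 have tK: "t : K" "t ~= 0" using uniformizer_maxid[OF P(2) t] P by(auto simp: maxid_def)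
 have "{f : \<tau> ` P. ~ unit_of (\<tau> ` P) f} = \<tau> ` {f : P. ~ unit_of P f}"
  using autom_unit_iff[OF K T P(1)] P(1) by auto
 also have "{f : P. ~ unit_of P f} = {t * g |g. g : P}" using t unfolding uniformizer_def by blast
 also have "\<tau> ` {t * g |g. g : P} = {\<tau> t * g |g. g : \<tau> ` P}"
 proof -
  have "\<tau> (t * g) = \<tau> t * \<tau> g" if "g : P" for g using autom_mult[OF K T tK(1)] that P by auto
  thus ?thesis by(auto simp: image_iff) metis+
 qed
 finally show ?thesis using autom_eq_0_iff[OF K T tK(1)] tK unfolding uniformizer_def by blast
qed

lemma autom_ord:
 assumes T: "field_autom K \<tau>" and D: "dvr K P" and f: "f : K" "f ~= 0"
 shows "ord_at (\<tau> ` P) (\<tau> f) = ord_at P f"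
proof -
 note K = dvrD(1)[OF D]
 obtain t u where t: "uniformizer P t" "unit_of P u" "f = t powi (ord_at P f) * u"
  using dvr_rep[OF D] f by meson
 have m: "t : K" "u : K" using uniformizer_maxid[OF dvrD(2)[OF D] t(1)] t(2) dvrD(3)[OF D]
  by(auto simp: maxid_def unit_of_def)
 have "\<tau> f = \<tau> (t powi (ord_at P f) * u)" using t(3) by simp
 also have "... = \<tau> t powi (ord_at P f) * \<tau> u"
  using m by(simp add: autom_mult[OF K T] autom_powi[OF K T] subfield_powi[OF K])
 finally show ?thesis
  using ord_at_eq[OF autom_subring[OF K T dvrD(2,3)[OF D]] autom_uniformizer[OF K T dvrD(3,2)[OF D] t(1)]
    autom_unit_of[OF K T dvrD(3)[OF D] t(2)]] by blast
qed

section \<open>The function field of a trinomial curve\<close>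

lemma prod_powi_sum: "(c::'a::field) ~= 0 ==> (PROD i:I. c powi a i) = c powi (SUM i:I. a i)"
 by(induction I rule: infinite_finite_induct) (simp_all add: power_int_add)

lemma prod_powi: "(PROD i:I. (f i::'a::field) powi n) = (PROD i:I. f i) powi n"
 by(induction I rule: infinite_finite_induct) (simp_all add: power_int_mult_distrib)

text \<open>The monomials \<open>M\<^sub>l\<close> of \<open>h\<close> are indexed by the variables. The place at which \<open>M\<^sub>l\<close> vanishes on the
 line \<open>\<Sum>M\<^sub>l = 0\<close> gives the variables the weights \<open>r l\<close>; \<open>r l l\<close> is the largest one, \<open>mid l\<close> the
 second largest, and the smallest one is 0. The differences \<open>gap\<close> are \<open>\<nu>\<close>, \<open>\<beta>\<close>, \<open>\<alpha>\<close>.\<close>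

locale trinomial_curve =
 fixes h :: "'k::alg_closed_field poly3" and \<iota> :: "'k poly3 => 'l::field"
  and d lam :: nat and E r :: "3 => 3 => nat" and s s' mid gap :: "3 => nat" and x y z :: 3
 assumes char_prime: "prime CHAR('k)" and iota: "coordinate_ring_map h \<iota>" and dist: "distinct [x, y, z]"
  and h_eq: "h = (SUM l:UNIV. monom3 (\<chi> i. E l i))"
  and deg_E: "!!l. (SUM i:UNIV. E l i) = d" and d2: "2 <= d"
  and ER: "!!j l. (SUM i:UNIV. E j i * r l i) = s l + (if j = l then lam else 0)"
  and RE: "!!k i. (SUM l:UNIV. r l k * E l i) = s' i + (if k = i then lam else 0)"
  and r_sum: "!!i. (SUM l:UNIV. r l i) = d"
  and r_top: "!!l. r l l = mid l + gap l" and gap_pos: "!!l. 0 < gap l"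
  and r_mid: "!!l i. i ~= l ==> r l i <= mid l"
  and r_mid_ex: "!!l. EX i. i ~= l & r l i = mid l" and r_zero: "!!l. EX i. i ~= l & r l i = 0"
  and lam_pos: "0 < lam" and lam_char: "lam < CHAR('k)"
  and det_E: "\<bar>(int (E x y) - int (E z y)) * (int (E y z) - int (E z z))
   - (int (E x z) - int (E z z)) * (int (E y y) - int (E z y))\<bar> = int lam"
  and integrality: "!!Z. Z ~= UNIV ==> EX i j l m n. distinct [i, j, l] & 0 < m + n &
   (ALL v:Z. (m + n) * E j v <= m * E i v + n * E l v)"
begin

lemma UNIV_xyz: "(UNIV :: 3 set) = {x, y, z}" by(rule UNIV3_eq[OF dist])

lemma xyz: "x ~= y" "x ~= z" "y ~= z" "y ~= x" "z ~= x" "z ~= y"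
 using dist by auto

lemma sum_xyz: "(SUM i:UNIV. f i) = f x + f y + (f z :: 'b::comm_monoid_add)"
 unfolding UNIV_xyz using xyz by(simp add: add.assoc)

lemma prod_xyz: "(PROD i:UNIV. f i) = f x * f y * (f z :: 'b::comm_monoid_mult)"
 unfolding UNIV_xyz using xyz by(simp add: mult.assoc)

lemma iota_add: "\<iota> (f + g) = \<iota> f + \<iota> g" and iota_mult: "\<iota> (f * g) = \<iota> f * \<iota> g" and iota_1: "\<iota> 1 = 1"
 and iota_eq_0_iff: "\<iota> f = 0 \<longleftrightarrow> h dvd f"
 using iota unfolding coordinate_ring_map_def by auto

lemma iota_0: "\<iota> 0 = 0" by(simp add: iota_eq_0_iff)

lemma iota_sum: "\<iota> (SUM i:I. f i) = (SUM i:I. \<iota> (f i))"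
 by(induction I rule: infinite_finite_induct) (simp_all add: iota_0 iota_add)

lemma iota_power: "\<iota> (f ^ n) = \<iota> f ^ n" by(induction n) (simp_all add: iota_1 iota_mult)

lemma iota_uminus: "\<iota> (- f) = - \<iota> f"
 using iota_add[of f "- f"] by(simp add: iota_0 eq_neg_iff_add_eq_0 add.commute)

abbreviation Ev :: "3 => nat ^ 3" where
 "Ev l \<equiv> (\<chi> i. E l i)"

lemma deg3_Ev: "deg3 (Ev l) = d" using deg_E[of l] by(simp add: deg3_def)

lemma homogeneous_h: "homogeneous d h"
 unfolding h_eq sum_xyz by(intro homogeneous_add homogeneous_monom3 deg3_Ev)

lemma iota_nonzero: "homogeneous m F ==> m < d ==> F ~= 0 ==> \<iota> F ~= 0"
 using dvd_homogeneous_less[OF homogeneous_h] iota_eq_0_iff by blast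

definition kap :: "'k => 'l" where
 "kap c = \<iota> (Const3 c)"

lemma kap_add: "kap (a + b) = kap a + kap b" and kap_mult: "kap (a * b) = kap a * kap b"
 and kap_1: "kap 1 = 1" and kap_0: "kap 0 = 0"
 by(simp_all add: kap_def Const3_hom iota_add iota_mult iota_1 iota_0)

lemma kap_eq_0_iff: "kap c = 0 \<longleftrightarrow> c = 0"
proof
 assume "kap c = 0"
 hence "Const3 c = 0" using iota_nonzero[OF homogeneous_Const3, of c] d2 unfolding kap_def by auto
 hence "Poly_Mapping.lookup (Const3 c) 0 = 0" by simp
 thus "c = 0" by(simp add: Const3_def)
qed (simp add: kap_0)

lemma kap_uminus: "kap (- a) = - kap a"
 using kap_add[of a "- a"] by(simp add: kap_0 eq_neg_iff_add_eq_0 add.commute)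

lemma kap_diff: "kap (a - b) = kap a - kap b" using kap_add[of a "- b"] by(simp add: kap_uminus)

lemma kap_inverse: "kap (inverse a) = inverse (kap a)"
proof (cases "a = 0")
 case False
 hence "kap a * kap (inverse a) = 1" by(simp add: kap_mult[symmetric] kap_1)
 thus ?thesis by(rule inverse_unique[symmetric])
qed (simp add: kap_0)

lemma kap_divide: "kap (a / b) = kap a / kap b" by(simp add: divide_inverse kap_mult kap_inverse)

lemma kap_power: "kap (a ^ n) = kap a ^ n" by(induction n) (simp_all add: kap_1 kap_mult)

lemma kap_powi: "kap (a powi n) = kap a powi n" by(simp add: power_int_def kap_power kap_inverse)

lemma kap_sum: "kap (SUM i:I. f i) = (SUM i:I. kap (f i))"
 by(induction I rule: infinite_finite_induct) (simp_all add: kap_0 kap_add)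

lemma kap_prod: "kap (PROD i:I. f i) = (PROD i:I. kap (f i))"
 by(induction I rule: infinite_finite_induct) (simp_all add: kap_1 kap_mult)

lemma kap_of_nat: "kap (of_nat n) = of_nat n" by(induction n) (simp_all add: kap_0 kap_add kap_1)

lemma CHAR_l: "CHAR('l) = CHAR('k)"
proof (rule CHAR_eqI)
 show "of_nat CHAR('k) = (0 :: 'l)" using kap_of_nat[of "CHAR('k)"] kap_0 by simp
 fix n assume "of_nat n = (0 :: 'l)"
 hence "of_nat n = (0 :: 'k)" using kap_of_nat[of n] kap_eq_0_iff by metis
 thus "CHAR('k) dvd n" by(simp add: of_nat_eq_0_iff_char_dvd)
qed

lemma lam_nonzero: "of_nat lam ~= (0 :: 'k)"
 using lam_pos lam_char by(simp add: of_nat_eq_0_iff_char_dvd nat_dvd_not_less)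

definition X :: "'l ^ 3" where
 "X = (\<chi> i. \<iota> (Var3 i))"

lemma iota_monom3: "\<iota> (monom3 e) = mon3 X e"
proof -
 have "e = axis x (e $ x) + axis y (e $ y) + axis z (e $ z)" unfolding fvec_eq_iff
 proof
  fix i
  have "i = x | i = y | i = z" using UNIV_xyz by blast
  thus "e $ i = (axis x (e $ x) + axis y (e $ y) + axis z (e $ z)) $ i" using xyz by(auto simp: axis_def)
 qed
 hence "monom3 e = monom3 (axis x (e $ x) + axis y (e $ y) + axis z (e $ z))" by simp
 also have "... = Var3 x ^ (e $ x) * Var3 y ^ (e $ y) * (Var3 z ^ (e $ z) :: 'k poly3)"
  unfolding monom3_add Var3_power ..
 finally show ?thesis by(simp add: mon3_def prod_xyz iota_mult iota_power X_def)
qed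

lemma iota_single: "\<iota> (Poly_Mapping.single e a) = kap a * mon3 X e"
 by(simp add: single_conv iota_mult iota_monom3 kap_def)

lemma iota_repr: "\<iota> F = (SUM e:Poly_Mapping.keys F. kap (Poly_Mapping.lookup F e) * mon3 X e)"
 by(subst poly_mapping_sum_singles) (simp add: iota_sum iota_single)

lemma monom3_neq_0: "monom3 e ~= (0 :: 'k poly3)"
 unfolding monom3_def by(metis lookup_single_eq lookup_zero one_neq_zero)

lemma X_nonzero: "X $ i ~= 0"
proof -
 have "\<iota> (Var3 i) ~= 0"
  using iota_nonzero[of 1 "Var3 i"] d2 monom3_neq_0 homogeneous_monom3[of "axis i 1" 1] deg3_axis
  unfolding Var3_def by auto
 thus ?thesis by(simp add: X_def)
qed

lemma mon_X_nonzero: "mon3 X e ~= 0" by(simp add: mon3_def X_nonzero)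

definition M :: "3 => 'l" where
 "M l = mon3 X (Ev l)"

lemma M_eq: "M l = (PROD i:UNIV. X $ i ^ E l i)" by(simp add: M_def mon3_def)

lemma M_nonzero: "M l ~= 0" by(simp add: M_def mon_X_nonzero)

lemma M_sum: "(SUM l:UNIV. M l) = 0"
proof -
 have "\<iota> h = 0" by(simp add: iota_eq_0_iff)
 thus ?thesis unfolding h_eq by(simp add: iota_sum iota_monom3 M_def)
qed

abbreviation K :: "'l set" where
 "K \<equiv> function_field \<iota>"

lemma KI: "homogeneous m F ==> homogeneous m G ==> \<iota> G ~= 0 ==> \<iota> F / \<iota> G : K"
 unfolding function_field_def by blast

lemma KE:
 assumes "f : K"
 obtains F G m where "homogeneous m F" "homogeneous m G" "\<iota> G ~= 0" "f = \<iota> F / \<iota> G"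
 using assms unfolding function_field_def by blast

lemma kap_K: "kap c : K"
 using KI[OF homogeneous_Const3[of c] homogeneous_Const3[of 1]] by(simp add: kap_def Const3_hom iota_1)

lemma frac_add_mult:
 assumes F: "homogeneous m F" "homogeneous m G" "\<iota> G ~= 0" "homogeneous m' F'" "homogeneous m' G'" "\<iota> G' ~= 0"
 shows "\<iota> F / \<iota> G + \<iota> F' / \<iota> G' = \<iota> (F * G' + F' * G) / \<iota> (G * G')"
  "(\<iota> F / \<iota> G) * (\<iota> F' / \<iota> G') = \<iota> (F * F') / \<iota> (G * G')" "\<iota> (G * G') ~= 0"
  "homogeneous (m + m') (F * G' + F' * G)" "homogeneous (m + m') (F * F')" "homogeneous (m + m') (G * G')"
 using F homogeneous_mult[of m' F' m G]
 by(auto simp: iota_add iota_mult add_frac_eq add.commute[of m'] intro!: homogeneous_add homogeneous_mult)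

lemma K_subfield: "is_subfield K"
proof -
 have c: "f + g : K & f * g : K" if fK: "f : K" and gK: "g : K" for f g
 proof -
  obtain F G m where F: "homogeneous m F" "homogeneous m G" "\<iota> G ~= 0" "f = \<iota> F / \<iota> G"
   using KE[OF fK] by blast
  obtain F' G' m' where F': "homogeneous m' F'" "homogeneous m' G'" "\<iota> G' ~= 0" "g = \<iota> F' / \<iota> G'"
   using KE[OF gK] by blast
  note fr = frac_add_mult[OF F(1-3) F'(1-3)]
  show ?thesis unfolding F(4) F'(4) fr(1,2) using KI[OF fr(4,6,3)] KI[OF fr(5,6,3)] by blast
 qed
 have n: "- f : K & inverse f : K" if fK: "f : K" for f
 proof -
  obtain F G m where F: "homogeneous m F" "homogeneous m G" "\<iota> G ~= 0" "f = \<iota> F / \<iota> G"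
   using KE[OF fK] by blast
  have "inverse f : K"
  proof (cases "\<iota> F = 0")
   case True
   thus ?thesis using F fK by simp
  next
   case False
   thus ?thesis using KI[of m G F] F by simp
  qed
  moreover have "- f : K" using c[OF kap_K[of "- 1"] fK] by(simp add: kap_uminus kap_1)
  ultimately show ?thesis by blast
 qed
 show ?thesis unfolding is_subfield_def is_subring_def using c n kap_K[of 0] kap_K[of 1] kap_0 kap_1 by auto
qed

lemmas K_subring = subfield_subring[OF K_subfield]
lemmas KR = subringD[OF K_subring] subfield_inverse[OF K_subfield] subfield_divide[OF K_subfield]
 subring_power[OF K_subring] subfield_powi[OF K_subfield] subring_diff[OF K_subring]

lemma mon_ratio_K:
 assumes "deg3 e = deg3 e'" shows "mon3 X e / mon3 X e' : K"
 using KI[OF homogeneous_monom3[OF assms] homogeneous_monom3[OF refl]]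
 unfolding iota_monom3 by(simp add: mon_X_nonzero)

lemma X_ratio_K: "X $ i / X $ j : K"
 using mon_ratio_K[of "axis i 1" "axis j 1"] by(simp add: mon3_axis deg3_axis)

lemma M_ratio_K: "M l / M j : K" using mon_ratio_K[of "Ev l" "Ev j"] by(simp add: M_def deg3_Ev)

text \<open>Dividing by \<open>X $ x\<close> keeps the Laurent monomial in K for every exponent
  vector; for exponents with sum 0 the divisor cancels, see \<open>lmon_eq\<close>.\<close>

definition lmon :: "(3 => int) => 'l" where
 "lmon a = (PROD i:UNIV. (X $ i / X $ x) powi a i)"

lemma lmon_K: "lmon a : K" unfolding lmon_def by(intro subring_prod[OF K_subring] KR X_ratio_K)

lemma lmon_nonzero: "lmon a ~= 0" by(simp add: lmon_def X_nonzero)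

lemma lmon_add: "lmon (%i. a i + b i) = lmon a * lmon b"
 by(simp add: lmon_def power_int_add X_nonzero prod.distrib)

lemma lmon_eq:
 assumes "(SUM i:UNIV. a i) = 0" shows "lmon a = (PROD i:UNIV. X $ i powi a i)"
proof -
 have "lmon a = (PROD i:UNIV. X $ i powi a i) / (PROD i:UNIV. X $ x powi a i)"
  by(simp add: lmon_def power_int_divide_distrib prod_dividef)
 thus ?thesis using assms by(simp add: prod_powi_sum X_nonzero)
qed

lemma lmon_scale: "lmon (%i. n * a i) = lmon a powi n"
 by(simp add: lmon_def prod_powi[symmetric] power_int_mult mult.commute[of n])

lemma M_ratio_lmon: "M l / M j = lmon (%i. int (E l i) - int (E j i))"
proof -
 have "(SUM i:UNIV. int (E l i) - int (E j i)) = int (SUM i:UNIV. E l i) - int (SUM i:UNIV. E j i)"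
  by(simp add: sum_subtractf)
 hence "(SUM i:UNIV. int (E l i) - int (E j i)) = 0" using deg_E by simp
 from lmon_eq[OF this] show ?thesis by(simp add: M_eq power_int_diff X_nonzero prod_dividef)
qed

section \<open>The diagonal torus acting on the function field\<close>

definition admissible :: "'k ^ 3 => bool" where
 "admissible c \<longleftrightarrow> (ALL i. c $ i ~= 0) & (ALL l. mon3 c (Ev l) = mon3 c (Ev x))"

lemma mon3_inverse: "mon3 (\<chi> i. inverse (c $ i)) e = inverse (mon3 (c :: 'k ^ 3) e)"
 by(simp add: mon3_def prod_xyz power_inverse)

lemma admissible_inverse: "admissible c ==> admissible (\<chi> i. inverse (c $ i))"
 unfolding admissible_def mon3_inverse by simp

lemma mon3_nonzero: "(!!i. c $ i ~= 0) ==> mon3 (c :: 'k ^ 3) e ~= 0"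
 by(simp add: mon3_def)

lemma scale3_inverse:
 fixes c :: "'k ^ 3"
 assumes "!!i. c $ i ~= 0" shows "scale3 (\<chi> i. inverse (c $ i)) (scale3 c f) = f"
 by(rule poly_mapping_eqI) (simp add: lookup_scale3 mon3_inverse mon3_nonzero[OF assms])

text \<open>Admissible scalings multiply the three monomials of h by one common factor; hence they
  preserve the ideal of h and act on K.\<close>

lemma scale3_h:
 assumes "admissible c" shows "scale3 c h = Const3 (mon3 c (Ev x)) * h"
proof -
 have "scale3 c (monom3 (Ev l)) = Const3 (mon3 c (Ev x)) * monom3 (Ev l)" for l
 proof -
  have "mon3 c (Ev l) = mon3 c (Ev x)" using assms unfolding admissible_def by blast
  thus ?thesis unfolding monom3_def scale3_single by(simp add: Const3_def mult_single)
 qed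
 thus ?thesis unfolding h_eq sum_xyz by(simp add: scale3_add distrib_left)
qed

lemma iota_scale3_eq:
 assumes c: "admissible c" and "\<iota> F = \<iota> G" shows "\<iota> (scale3 c F) = \<iota> (scale3 c G)"
proof -
 have "\<iota> (F + - G) = 0" using assms by(simp only: iota_add iota_uminus) simp
 then obtain q where "F + - G = h * q" unfolding iota_eq_0_iff by(auto simp: dvd_def)
 hence "F = G + h * q" by(simp add: algebra_simps)
 hence "scale3 c F = scale3 c G + Const3 (mon3 c (Ev x)) * h * scale3 c q"
  by(simp add: scale3_add scale3_mult scale3_h[OF c])
 hence "\<iota> (scale3 c F) = \<iota> (scale3 c G) + \<iota> (Const3 (mon3 c (Ev x))) * \<iota> h * \<iota> (scale3 c q)"
  by(simp add: iota_add iota_mult)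
 moreover have "\<iota> h = 0" by(simp add: iota_eq_0_iff)
 ultimately show ?thesis by simp
qed

lemma scale3_0: "scale3 c 0 = 0" by(simp add: scale3_def pm_ext_0)

lemma iota_scale3_0: "admissible c ==> \<iota> (scale3 c F) = 0 \<longleftrightarrow> \<iota> F = 0"
 using iota_scale3_eq[of c F 0] iota_scale3_eq[OF admissible_inverse, of c "scale3 c F" 0]
  scale3_inverse[of c F] by(auto simp: scale3_0 iota_0 admissible_def)

text \<open>The action of an admissible scaling on K through an arbitrary representation as a
  fraction of forms; \<open>sig_eq\<close> shows independence of the choice.\<close>

definition sig :: "'k ^ 3 => 'l => 'l" where
 "sig c f = (SOME g. EX F G m. homogeneous m F & homogeneous m G & \<iota> G ~= 0 & f = \<iota> F / \<iota> G &
   g = \<iota> (scale3 c F) / \<iota> (scale3 c G))"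

lemma sig_eq:
 assumes c: "admissible c" and F: "homogeneous m F" "homogeneous m G" "\<iota> G ~= 0"
 shows "sig c (\<iota> F / \<iota> G) = \<iota> (scale3 c F) / \<iota> (scale3 c G)" unfolding sig_def
proof (rule some_equality)
 show "EX F' G' m. homogeneous m F' & homogeneous m G' & \<iota> G' ~= 0 & \<iota> F / \<iota> G = \<iota> F' / \<iota> G' &
   \<iota> (scale3 c F) / \<iota> (scale3 c G) = \<iota> (scale3 c F') / \<iota> (scale3 c G')" using F by blast
 fix g assume "EX F' G' m. homogeneous m F' & homogeneous m G' & \<iota> G' ~= 0 & \<iota> F / \<iota> G = \<iota> F' / \<iota> G' &
   g = \<iota> (scale3 c F') / \<iota> (scale3 c G')"
 then obtain F' G' where G: "\<iota> G' ~= 0" "\<iota> F / \<iota> G = \<iota> F' / \<iota> G'"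
  "g = \<iota> (scale3 c F') / \<iota> (scale3 c G')" by blast
 have "\<iota> (F * G') = \<iota> (F' * G)" using G F by(simp add: iota_mult field_simps)
 from iota_scale3_eq[OF c this]
 have "\<iota> (scale3 c F) * \<iota> (scale3 c G') = \<iota> (scale3 c F') * \<iota> (scale3 c G)"
  by(simp add: scale3_mult iota_mult)
 moreover have "\<iota> (scale3 c G) ~= 0" "\<iota> (scale3 c G') ~= 0" using iota_scale3_0[OF c] F G by auto
 ultimately show "g = \<iota> (scale3 c F) / \<iota> (scale3 c G)" unfolding G(3) by(simp add: field_simps)
qed

lemma sig_K:
 assumes c: "admissible c" and f: "f : K" shows "sig c f : K"
proof -
 obtain F G m where F: "homogeneous m F" "homogeneous m G" "\<iota> G ~= 0" "f = \<iota> F / \<iota> G"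
  using KE[OF f] by blast
 have "\<iota> (scale3 c G) ~= 0" using iota_scale3_0[OF c] F by simp
 from KI[OF homogeneous_scale3[OF F(1)] homogeneous_scale3[OF F(2)] this]
 show ?thesis unfolding F(4) sig_eq[OF c F(1-3)] .
qed

lemma sig_add_mult:
 assumes c: "admissible c" and "f : K" "g : K"
 shows "sig c (f + g) = sig c f + sig c g" "sig c (f * g) = sig c f * sig c g"
proof -
 obtain F G m where F: "homogeneous m F" "homogeneous m G" "\<iota> G ~= 0" "f = \<iota> F / \<iota> G"
  using KE[OF assms(2)] by blast
 obtain F' G' m' where F': "homogeneous m' F'" "homogeneous m' G'" "\<iota> G' ~= 0" "g = \<iota> F' / \<iota> G'"
  using KE[OF assms(3)] by blast
 note fr = frac_add_mult[OF F(1-3) F'(1-3)]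
 have nz2: "\<iota> (scale3 c G) ~= 0" "\<iota> (scale3 c G') ~= 0" using iota_scale3_0[OF c] F F' by auto
 note fr2 = frac_add_mult[OF homogeneous_scale3[OF F(1)] homogeneous_scale3[OF F(2)] nz2(1)
   homogeneous_scale3[OF F'(1)] homogeneous_scale3[OF F'(2)] nz2(2)]
 show "sig c (f + g) = sig c f + sig c g"
  unfolding F(4) F'(4) sig_eq[OF c F(1-3)] sig_eq[OF c F'(1-3)] fr(1) sig_eq[OF c fr(4,6,3)] fr2(1)
  by(simp add: scale3_add scale3_mult)
 show "sig c (f * g) = sig c f * sig c g"
  unfolding F(4) F'(4) sig_eq[OF c F(1-3)] sig_eq[OF c F'(1-3)] fr(2) sig_eq[OF c fr(5,6,3)] fr2(2)
  by(simp add: scale3_mult)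
qed

lemma sig_inverse:
 assumes c: "admissible c" and f: "f : K" shows "sig (\<chi> i. inverse (c $ i)) (sig c f) = f"
proof -
 obtain F G m where F: "homogeneous m F" "homogeneous m G" "\<iota> G ~= 0" "f = \<iota> F / \<iota> G"
  using KE[OF f] by blast
 have "\<iota> (scale3 c G) ~= 0" using iota_scale3_0[OF c] F by auto
 thus ?thesis unfolding F(4) sig_eq[OF c F(1-3)] using F c
  by(subst sig_eq[OF admissible_inverse[OF c], of m]) (auto simp: homogeneous_scale3 scale3_inverse admissible_def)
qed

lemma sig_inverse':
 assumes c: "admissible c" and f: "f : K" shows "sig c (sig (\<chi> i. inverse (c $ i)) f) = f"
proof -
 have "(\<chi> i. inverse ((\<chi> i. inverse (c $ i)) $ i)) = c" by(simp add: fvec_eq_iff)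
 with sig_inverse[OF admissible_inverse[OF c] f] show ?thesis by simp
qed

lemma sig_autom:
 assumes c: "admissible c" shows "field_autom K (sig c)"
proof -
 have c': "admissible (\<chi> i. inverse (c $ i))" by(rule admissible_inverse[OF c])
 have "bij_betw (sig c) K K" using sig_inverse[OF c] sig_inverse'[OF c] sig_K[OF c] sig_K[OF c']
  by(intro bij_betw_byWitness[of _ "sig (\<chi> i. inverse (c $ i))"]) auto
 thus ?thesis unfolding field_autom_def using sig_add_mult[OF c] by blast
qed

lemma sig_kap: "admissible c ==> sig c (kap a) = kap a"
 using sig_eq[OF _ homogeneous_Const3[of a] homogeneous_Const3[of 1], of c]
 unfolding Const3_def scale3_single by(simp add: kap_def mon3_0 Const3_def iota_1)

lemma sig_mon_ratio:
 assumes c: "admissible c" and "deg3 e = deg3 e'"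
 shows "sig c (mon3 X e / mon3 X e') = kap (mon3 c e / mon3 c e') * (mon3 X e / mon3 X e')"
proof -
 have i: "\<iota> (scale3 c (monom3 e)) = kap (mon3 c e) * mon3 X e" for e
  unfolding monom3_def scale3_single iota_single by simp
 have "sig c (\<iota> (monom3 e) / \<iota> (monom3 e')) = \<iota> (scale3 c (monom3 e)) / \<iota> (scale3 c (monom3 e'))"
  using mon_X_nonzero by(intro sig_eq[OF c homogeneous_monom3[OF assms(2)] homogeneous_monom3[OF refl]])
   (simp add: iota_monom3)
 thus ?thesis unfolding i iota_monom3 kap_divide by simp
qed

lemma sig_M_ratio:
 assumes c: "admissible c" shows "sig c (M l / M j) = M l / M j"
proof -
 have "mon3 c (Ev l) = mon3 c (Ev x)" "mon3 c (Ev j) = mon3 c (Ev x)" "mon3 c (Ev x) ~= 0"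
  using c mon3_nonzero unfolding admissible_def by blast+
 thus ?thesis unfolding M_def by(subst sig_mon_ratio[OF c]) (simp_all add: deg3_Ev kap_1)
qed

lemma sig_X_ratio: "admissible c ==> sig c (X $ i / X $ j) = kap (c $ i / c $ j) * (X $ i / X $ j)"
 using sig_mon_ratio[of c "axis i 1" "axis j 1"] by(simp add: mon3_axis deg3_axis)

text \<open>The character through which the torus acts on the Laurent monomial with exponents a, see
  \<open>sig_lmon\<close>.\<close>

definition chr :: "'k ^ 3 => (3 => int) => 'k" where
 "chr c a = (PROD i:UNIV. (c $ i / c $ x) powi a i)"

lemma sig_lmon:
 assumes c: "admissible c" shows "sig c (lmon a) = kap (chr c a) * lmon a"
proof -
 note T = sig_autom[OF c]
 have "sig c (lmon a) = (PROD i:UNIV. sig c ((X $ i / X $ x) powi a i))"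
  unfolding lmon_def by(intro autom_prod[OF K_subfield T] KR X_ratio_K)
 also have "... = (PROD i:UNIV. (kap (c $ i / c $ x) * (X $ i / X $ x)) powi a i)"
  by(simp only: autom_powi[OF K_subfield T X_ratio_K] sig_X_ratio[OF c])
 also have "... = kap (chr c a) * lmon a"
  by(simp only: chr_def lmon_def kap_prod kap_powi power_int_mult_distrib prod.distrib)
 finally show ?thesis .
qed

lemma eval3_nonzero: "on_curve h b ==> eval3 g b ~= 0 ==> \<iota> g ~= 0"
 unfolding iota_eq_0_iff on_curve_def by(auto simp: dvd_def eval3_mult)

lemma local_ring_K: "on_curve h b ==> curve_local_ring \<iota> b <= K"
 unfolding curve_local_ring_def using eval3_nonzero KI by blast

definition pts :: "'l set set" where
 "pts = {P. EX b. lies_over \<iota> h P b}"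

end

section \<open>Characters, and the function field over the field of invariants\<close>

lemma alg_closed_poly_induct [consumes 1, case_names const factor]:
 fixes q :: "'a::alg_closed_field poly"
 assumes "q ~= 0" "!!c. c ~= 0 ==> P [:c:]" "!!a f. f ~= 0 ==> P f ==> P ([:- a, 1:] * f)"
 shows "P q" using assms(1)
proof (induction "degree q" arbitrary: q)
 case 0
 thus ?case using assms(2) by(metis degree_eq_zeroE pCons_0_0)
next
 case (Suc n)
 then obtain a where "poly q a = 0" using alg_closed_imp_poly_has_root[of q] by auto
 then obtain f where q: "q = [:- a, 1:] * f" by(auto simp: poly_eq_0_iff_dvd)
 hence f: "f ~= 0" using Suc.prems by auto
 hence "degree q = Suc (degree f)" unfolding q by(subst degree_mult_eq) auto
 hence "P f" using Suc.hyps f by simp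
 thus ?case unfolding q by(rule assms(3)[OF f])
qed

lemma card_roots_separable:
 fixes q :: "'a::alg_closed_field poly"
 assumes "q ~= 0" and "!!a. poly q a = 0 ==> poly (pderiv q) a ~= 0"
 shows "card {a. poly q a = 0} = degree q" using assms
proof (induction q rule: alg_closed_poly_induct)
 case (factor a f)
 have pd: "pderiv ([:- a, 1:] * f) = [:- a, 1:] * pderiv f + f" unfolding pderiv_mult by(simp add: pderiv_pCons)
 have "poly (pderiv f) b ~= 0" if "poly f b = 0" for b using factor.prems[of b] that unfolding pd by simp
 hence "card {b. poly f b = 0} = degree f" using factor.IH by simp
 moreover have "poly f a ~= 0" using factor.prems[of a] unfolding pd by simp
 moreover have "{b. poly ([:- a, 1:] * f) b = 0} = insert a {b. poly f b = 0}" by auto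
 moreover have "degree ([:- a, 1:] * f) = Suc (degree f)" using factor.hyps by(subst degree_mult_eq) auto
 ultimately show ?case using poly_roots_finite[OF factor.hyps] by simp
qed simp

lemma card_roots_of_unity:
 assumes "of_nat n ~= (0 :: 'a::alg_closed_field)"
 shows "card {u :: 'a. u ^ n = 1} = n" "finite {u :: 'a. u ^ n = 1}"
proof -
 have n: "n > 0" using assms by(cases n) auto
 define q :: "'a poly" where "q = monom 1 n - 1"
 have deg: "degree q = n"
 proof (rule antisym)
  show "degree q <= n" unfolding q_def by(intro degree_diff_le) (auto simp: degree_monom_le)
  show "n <= degree q" using n by(intro le_degree) (simp add: q_def)
 qed
 hence q0: "q ~= 0" using n by auto
 have roots: "{u. u ^ n = 1} = {u. poly q u = 0}" by(auto simp: q_def poly_monom)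
 have "poly (pderiv q) a ~= 0" if "poly q a = 0" for a
 proof -
  have "a ^ n = 1" using that by(simp add: q_def poly_monom)
  hence "a ~= 0" using n by(metis power_eq_0_iff zero_neq_one zero_power)
  thus ?thesis using assms by(simp add: q_def pderiv_diff pderiv_monom poly_monom)
 qed
 thus "card {u :: 'a. u ^ n = 1} = n" using card_roots_separable[OF q0] deg roots by simp
 show "finite {u :: 'a. u ^ n = 1}" unfolding roots by(rule poly_roots_finite[OF q0])
qed

text \<open>If n does not divide m, some n-th root of unity v has v^m \<noteq> 1, since a polynomial
  of degree m mod n has too few roots; substituting v u for u multiplies the sum by v^m.\<close>

lemma sum_roots_of_unity:
 assumes n: "of_nat n ~= (0 :: 'a::alg_closed_field)"
 shows "(SUM u:{u :: 'a. u ^ n = 1}. u powi m) = (if int n dvd m then of_nat n else 0)"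
proof (cases "int n dvd m")
 case True
 then obtain k where k: "m = int n * k" by(auto simp: dvd_def)
 have "u powi m = 1" if "u ^ n = 1" for u :: 'a using that by(simp add: k power_int_mult)
 thus ?thesis using True card_roots_of_unity[OF n] by simp
next
 case False
 let ?U = "{u :: 'a. u ^ n = 1}"
 have n0: "n > 0" using n by(cases n) auto
 define m' where "m' = nat (m mod int n)"
 have m': "0 < m'" "m' < n" "m = int n * (m div int n) + int m'"
 proof -
  have "0 <= m mod int n" "m mod int n < int n" using n0 by simp_all
  moreover have "m mod int n ~= 0" using False by(simp add: dvd_eq_mod_eq_0)
  ultimately have "0 < m mod int n" "m mod int n < int n" by linarith+
  thus "0 < m'" "m' < n" "m = int n * (m div int n) + int m'" by(auto simp: m'_def)
 qed
 have nz: "u ~= 0" if "u ^ n = 1" for u :: 'a using that n0 by(metis power_eq_0_iff zero_neq_one zero_power)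
 have pm: "u powi m = u ^ m'" if "u ^ n = 1" for u :: 'a
  using that nz[OF that] by(subst m'(3)) (simp add: power_int_add power_int_mult)
 have "EX v:?U. v ^ m' ~= 1"
 proof (rule ccontr)
  assume no: "~ (EX v:?U. v ^ m' ~= 1)"
  define q :: "'a poly" where "q = monom 1 m' - 1"
  have "coeff q m' = 1" using m' by(simp add: q_def)
  hence q0: "q ~= 0" by auto
  have "?U <= {u. poly q u = 0}" using no by(auto simp: q_def poly_monom)
  hence "n <= card {u. poly q u = 0}"
   using card_mono[OF poly_roots_finite[OF q0]] card_roots_of_unity[OF n] by metis
  also have "... <= degree q" using card_poly_roots_bound[OF q0] .
  also have "... <= m'" unfolding q_def by(intro degree_diff_le) (auto simp: degree_monom_le)
  finally show False using m' by simp
 qed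
 then obtain v :: 'a where v: "v ^ n = 1" "v ^ m' ~= 1" by blast
 have "bij_betw (%u. v * u) ?U ?U"
  using v nz[OF v(1)] by(intro bij_betw_byWitness[of _ "%u. u / v"])
   (auto simp: power_mult_distrib power_divide)
 hence "(SUM u:?U. u ^ m') = (SUM u:?U. (v * u) ^ m')"
  using sum.reindex_bij_betw[of "%u. v * u" ?U ?U "%u. u ^ m'"] by simp
 also have "... = v ^ m' * (SUM u:?U. u ^ m')" by(simp add: power_mult_distrib sum_distrib_left)
 finally have "(1 - v ^ m') * (SUM u:?U. u ^ m') = 0" by(simp add: algebra_simps)
 hence "(SUM u:?U. u ^ m') = 0" using v(2) by simp
 thus ?thesis using False pm by simp
qed

text \<open>By Bezout, the lattice spanned by (A, B) and (C, D) also has a basis (g, f), (0, e) with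
  g = gcd A C and g |e| = N. The representatives are the points of a rectangle with sides g and
  |e|.\<close>

lemma lattice_representatives:
 fixes A B C D :: int
 assumes det: "\<bar>A * D - B * C\<bar> = int N" and N: "N > 0"
 shows "EX S. finite S & card S = N &
  (ALL u v. EX (i, j):S. EX m n. u - i = m * A + n * C & v - j = m * B + n * D) &
  (ALL i j i' j' m n. (i, j) : S --> (i', j') : S --> i - i' = m * A + n * C --> j - j' = m * B + n * D -->
    i = i' & j = j')"
proof -
 define g where "g = gcd A C"
 have "A ~= 0 | C ~= 0" using det N by auto
 hence g: "g > 0" by(auto simp: g_def)
 obtain s t where st: "s * A + t * C = g" using bezout_int[of A C] unfolding g_def by blast
 obtain A' C' where A': "A = g * A'" and C': "C = g * C'" unfolding g_def by(meson gcd_dvd1 gcd_dvd2 dvdE)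
 define e where "e = A' * D - B * C'"
 define f where "f = s * B + t * D"
 have st': "s * A' + t * C' = 1"
 proof -
  have "g * (s * A' + t * C') = g * 1" using st A' C' by(simp add: algebra_simps)
  thus ?thesis using g by(metis mult_cancel_left less_irrefl)
 qed
 have ge: "g * \<bar>e\<bar> = int N"
 proof -
  have "g * e = A * D - B * C" unfolding e_def A' C' by(simp add: algebra_simps)
  thus ?thesis using det g by(metis abs_mult abs_of_pos)
 qed
 hence e: "\<bar>e\<bar> > 0" using N g by(smt (verit) mult_eq_0_iff of_nat_0_less_iff abs_ge_zero)
 have B: "B = A' * f - t * e"
 proof -
  have "A' * f - t * e = (s * A' + t * C') * B" unfolding f_def e_def by(simp add: algebra_simps)
  thus ?thesis using st' by simp
 qed
 have D: "D = C' * f + s * e"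
 proof -
  have "C' * f + s * e = (s * A' + t * C') * D" unfolding f_def e_def by(simp add: algebra_simps)
  thus ?thesis using st' by simp
 qed
 define S where "S = {0..<g} \<times> {0..<\<bar>e\<bar>}"
 have card: "card S = N"
 proof -
  have "card S = nat g * nat \<bar>e\<bar>" by(simp add: S_def card_cartesian_product)
  also have "... = nat (g * \<bar>e\<bar>)" using g by(simp add: nat_mult_distrib)
  finally show ?thesis using ge by simp
 qed
 have ex: "EX (i, j):S. EX m n. u - i = m * A + n * C & v - j = m * B + n * D" for u v
 proof -
  define k where "k = u div g"
  define v' where "v' = v - k * f"
  define q where "q = v' div \<bar>e\<bar> * sgn e"
  have u: "u - u mod g = k * g" unfolding k_def by(simp add: minus_mod_eq_div_mult)
  have v: "v' - v' mod \<bar>e\<bar> = q * e"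
   unfolding q_def by(simp add: minus_mod_eq_div_mult mult.assoc sgn_mult_abs) (simp add: abs_sgn mult.commute)
  \<comment> \<open>(g, f) has the Bezout coefficients s, t, and (0, e) is A' times (C, D) minus C'
    times (A, B); here k and q are the coefficients over this second basis.\<close>
  define m n where "m = k * s - q * C'" and "n = k * t + q * A'"
  have "u - u mod g = m * A + n * C"
  proof -
   have "m * A + n * C = k * (s * A + t * C)" unfolding m_def n_def A' C' by(simp add: algebra_simps)
   thus ?thesis using st u by simp
  qed
  moreover have "v - v' mod \<bar>e\<bar> = m * B + n * D"
  proof -
   have "m * B + n * D = k * f + q * e" unfolding m_def n_def f_def e_def by(simp add: algebra_simps)
   thus ?thesis using v unfolding v'_def by simp
  qed
  moreover have "(u mod g, v' mod \<bar>e\<bar>) : S" using g e by(simp add: S_def)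
  ultimately show ?thesis by blast
 qed
 have un: "i = i' & j = j'" if S: "(i, j) : S" "(i', j') : S"
  and eq: "i - i' = m * A + n * C" "j - j' = m * B + n * D" for i j i' j' m n
 proof -
  have i: "i - i' = g * (m * A' + n * C')" unfolding eq A' C' by(simp add: algebra_simps)
  have "i = i'"
  proof -
   have "\<bar>i - i'\<bar> < g" using S by(auto simp: S_def)
   moreover have "g dvd i - i'" unfolding i by simp
   ultimately show ?thesis using zdvd_imp_le[of g "\<bar>i - i'\<bar>"] by fastforce
  qed
  hence mn: "m * A' + n * C' = 0" using i g by simp
  have "j - j' = (m * A' + n * C') * f + e * (n * s - m * t)" unfolding eq by(subst B, subst D) (simp add: algebra_simps)
  hence je: "j - j' = e * (n * s - m * t)" using mn by simp
  have "\<bar>j - j'\<bar> < \<bar>e\<bar>" using S by(auto simp: S_def)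
  moreover have "\<bar>e\<bar> dvd \<bar>j - j'\<bar>" unfolding je by simp
  ultimately have "j = j'" using zdvd_imp_le[of "\<bar>e\<bar>" "\<bar>j - j'\<bar>"] by fastforce
  thus ?thesis using \<open>i = i'\<close> by simp
 qed
 have "finite S" by(simp add: S_def)
 thus ?thesis using card ex un by(intro exI[of _ S]) blast
qed

section \<open>Torsion points of the torus and averages over them\<close>

context trinomial_curve
begin

definition Gam :: "(3 => 'k) set" where
 "Gam = PiE UNIV (%_. {u. u ^ lam = 1})"

text \<open>Each factor of \<open>Gam\<close> acts through the one-parameter group with weights
  \<open>r l\<close>. By \<open>ER\<close> it scales all monomials of h by the same power
  \<open>s l\<close>, up to lam-th powers, which are 1; so \<open>cc g\<close> is admissible.
  \<open>Gam\<close> has lam^3 elements and acts with repetitions, which averages and norms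
  tolerate.\<close>

definition cc :: "(3 => 'k) => 'k ^ 3" where
 "cc g = (\<chi> k. PROD l:UNIV. g l ^ r l k)"

text \<open>The characters of the three factors of \<open>Gam\<close> on the Laurent monomial a. For
  exponents with sum 0, \<open>wt a l\<close> divided by lam is also its order at the place where M
  l vanishes, measured on the line; see \<open>ord_lmon\<close>.\<close>

definition wt :: "(3 => int) => 3 => int" where
 "wt a l = (SUM k:UNIV. int (r l k) * a k)"

lemma Gam_iff: "g : Gam \<longleftrightarrow> (ALL l. g l ^ lam = 1)" by(auto simp: Gam_def)

lemma finite_Gam: "finite Gam"
 unfolding Gam_def using card_roots_of_unity(2)[OF lam_nonzero] by(intro finite_PiE) auto

lemma Gam_nonzero: "g : Gam ==> g l ~= 0"
 using lam_pos unfolding Gam_iff by(metis power_eq_0_iff zero_neq_one)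

lemma cc_admissible:
 assumes g: "g : Gam" shows "admissible (cc g)"
proof -
 have nz: "cc g $ k ~= 0" for k using Gam_nonzero[OF g] by(simp add: cc_def)
 have "mon3 (cc g) (Ev j) = (PROD l:UNIV. g l ^ s l)" for j
 proof -
  have "mon3 (cc g) (Ev j) = (PROD k:UNIV. PROD l:UNIV. g l ^ (E j k * r l k))"
   by(simp add: mon3_def cc_def prod_power_distrib power_mult[symmetric] mult.commute)
  also have "... = (PROD l:UNIV. g l ^ (SUM k:UNIV. E j k * r l k))"
   by(subst prod.swap) (simp add: power_sum)
  also have "... = (PROD l:UNIV. g l ^ s l)"
   using g unfolding ER Gam_iff by(intro prod.cong) (auto simp: power_add)
  finally show ?thesis .
 qed
 thus ?thesis unfolding admissible_def using nz by simp
qed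

lemma chr_cc:
 assumes g: "g : Gam" and a: "(SUM k:UNIV. a k) = 0"
 shows "chr (cc g) a = (PROD l:UNIV. g l powi wt a l)"
proof -
 have nz: "cc g $ k ~= 0" for k using Gam_nonzero[OF g] by(simp add: cc_def)
 have "chr (cc g) a = (PROD k:UNIV. cc g $ k powi a k) / (PROD k:UNIV. cc g $ x powi a k)"
  by(simp add: chr_def power_int_divide_distrib prod_dividef)
 also have "... = (PROD k:UNIV. cc g $ k powi a k)" using a nz by(simp add: prod_powi_sum)
 also have "... = (PROD k:UNIV. PROD l:UNIV. g l powi (int (r l k) * a k))"
  by(simp add: cc_def prod_powi[symmetric] power_int_mult)
 also have "... = (PROD l:UNIV. g l powi wt a l)"
  unfolding wt_def by(subst prod.swap) (simp add: prod_powi_sum Gam_nonzero[OF g])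
 finally show ?thesis .
qed

lemma sum_Gam: "(SUM g:Gam. PROD l:UNIV. g l powi n l) =
  (if ALL l. int lam dvd n l then of_nat lam ^ 3 else 0)"
proof -
 have "(SUM g:Gam. PROD l:UNIV. g l powi n l) = (PROD l:UNIV. SUM u:{u. u ^ lam = 1}. u powi n l)"
  unfolding Gam_def using card_roots_of_unity(2)[OF lam_nonzero] by(intro prod_sum_PiE[symmetric]) auto
 also have "... = (PROD l:UNIV. if int lam dvd n l then of_nat lam else 0)"
  by(simp add: sum_roots_of_unity[OF lam_nonzero])
 also have "... = (if ALL l. int lam dvd n l then of_nat lam ^ 3 else 0)"
 proof (cases "ALL l. int lam dvd n l")
  case False
  then obtain l where "~ int lam dvd n l" by blast
  thus ?thesis using False by(auto intro!: prod_zero bexI[of _ l])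
 qed (simp add: prod_xyz power3_eq_cube)
 finally show ?thesis .
qed

text \<open>The projection onto the isotypical component of the character of \<open>lmon a\<close>.
  The division by lam^3 is possible since lam is smaller than the characteristic.\<close>

definition proj :: "(3 => int) => 'l => 'l" where
 "proj a f = kap (inverse (of_nat lam ^ 3)) * (SUM g:Gam. kap (inverse (chr (cc g) a)) * sig (cc g) f)"

lemma proj_lmon:
 assumes a: "(SUM k:UNIV. a k) = 0" and b: "(SUM k:UNIV. b k) = 0"
 shows "proj a (lmon b) = (if ALL l. int lam dvd wt b l - wt a l then lmon b else 0)"
proof -
 have eq: "kap (inverse (chr (cc g) a)) * sig (cc g) (lmon b)
  = kap (PROD l:UNIV. g l powi (wt b l - wt a l)) * lmon b" if g: "g : Gam" for g
 proof -
  have "(PROD l:UNIV. g l powi (wt b l - wt a l)) = (PROD l:UNIV. g l powi wt b l / g l powi wt a l)"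
   by(intro prod.cong refl power_int_diff) (simp add: Gam_nonzero[OF g])
  also have "... = inverse (chr (cc g) a) * chr (cc g) b"
   unfolding chr_cc[OF g a] chr_cc[OF g b] prod_dividef by(simp add: divide_inverse mult.commute)
  finally show ?thesis unfolding sig_lmon[OF cc_admissible[OF g]] by(simp only: kap_mult mult.assoc)
 qed
 have "proj a (lmon b) = kap (inverse (of_nat lam ^ 3)) *
   (SUM g:Gam. kap (PROD l:UNIV. g l powi (wt b l - wt a l)) * lmon b)"
  unfolding proj_def by(intro arg_cong[of _ _ "%v. _ * v"] sum.cong refl eq)
 also have "... = kap (inverse (of_nat lam ^ 3) * (SUM g:Gam. PROD l:UNIV. g l powi (wt b l - wt a l))) * lmon b"
  by(simp only: kap_sum sum_distrib_right kap_mult mult.assoc)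
 also have "... = (if ALL l. int lam dvd wt b l - wt a l then lmon b else 0)"
  unfolding sum_Gam using lam_nonzero by(simp add: kap_0 kap_1)
 finally show ?thesis .
qed

lemma proj_add: "f : K ==> g : K ==> proj a (f + g) = proj a f + proj a g"
proof -
 assume fg: "f : K" "g : K"
 have "(SUM c:Gam. kap (inverse (chr (cc c) a)) * sig (cc c) (f + g)) =
   (SUM c:Gam. kap (inverse (chr (cc c) a)) * sig (cc c) f + kap (inverse (chr (cc c) a)) * sig (cc c) g)"
  by(intro sum.cong refl) (simp add: sig_add_mult(1)[OF cc_admissible fg] distrib_left)
 thus ?thesis unfolding proj_def by(simp add: sum.distrib distrib_left)
qed

lemma proj_0: "proj a 0 = 0"
 unfolding proj_def using autom_0[OF K_subfield sig_autom[OF cc_admissible]] by simp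

lemma proj_sum: "(!!i. i : I ==> f i : K) ==> proj a (SUM i:I. f i) = (SUM i:I. proj a (f i))"
 by(induction I rule: infinite_finite_induct) (simp_all add: proj_0 proj_add subring_sum[OF K_subring])

lemma proj_scale:
 assumes "c : K" "!!g. g : Gam ==> sig (cc g) c = c" "f : K"
 shows "proj a (c * f) = c * proj a f"
proof -
 have "(SUM g:Gam. kap (inverse (chr (cc g) a)) * sig (cc g) (c * f))
  = (SUM g:Gam. c * (kap (inverse (chr (cc g) a)) * sig (cc g) f))"
 proof (intro sum.cong refl)
  fix g assume g: "g : Gam"
  show "kap (inverse (chr (cc g) a)) * sig (cc g) (c * f) = c * (kap (inverse (chr (cc g) a)) * sig (cc g) f)"
   unfolding sig_add_mult(2)[OF cc_admissible[OF g] assms(1,3)] assms(2)[OF g] by(rule mult.left_commute)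
 qed
 thus ?thesis unfolding proj_def sum_distrib_left[symmetric] by(simp only: mult.left_commute)
qed

section \<open>The rational subfield k(w)\<close>

definition w :: 'l where
 "w = M x / M z"

lemma w_K: "w : K" and w_nonzero: "w ~= 0" by(simp_all add: w_def M_ratio_K M_nonzero)

lemma My_w: "M y / M z = - 1 - w"
proof -
 have "M x + M y + M z = 0" using M_sum by(simp add: sum_xyz)
 moreover have "M y = (M x + M y + M z) - M z - M x" by simp
 ultimately have "M y = - M z - M x" by simp
 thus ?thesis by(simp add: w_def M_nonzero diff_divide_distrib)
qed

definition evp :: "'l => 'k poly => 'l" where
 "evp v q = poly (map_poly kap q) v"

lemma evp_pCons: "evp v (pCons a q) = kap a + v * evp v q"
 by(simp add: evp_def Polynomial.map_poly_pCons[of kap, OF kap_0])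

lemma evp_0: "evp v 0 = 0" by(simp add: evp_def)

lemma evp_const: "evp v [:c:] = kap c" by(simp add: evp_pCons evp_0)

lemma evp_1: "evp v 1 = 1" using evp_const[of v 1] by(simp add: one_pCons kap_1)

lemma evp_add: "evp v (p + q) = evp v p + evp v q"
 by(induction p q rule: poly_induct2) (simp_all add: evp_0 evp_pCons kap_add distrib_left add_ac)

lemma evp_smult: "evp v (Polynomial.smult c q) = kap c * evp v q"
 by(induction q) (simp_all add: evp_0 evp_pCons kap_mult distrib_left mult.left_commute)

lemma evp_mult: "evp v (p * q) = evp v p * evp v q"
 by(induction p) (simp_all add: evp_0 evp_pCons evp_add evp_smult kap_0 distrib_right mult.assoc)

lemma evp_power: "evp v (q ^ n) = evp v q ^ n" by(induction n) (simp_all add: evp_1 evp_mult)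

lemma evp_linear: "evp v [:- a, 1:] = v - kap a" by(simp add: evp_pCons evp_0 kap_uminus kap_1)

lemma evp_X: "evp v [:0, 1:] = v" using evp_linear[of v 0] by(simp add: kap_0)

lemma E_inj: "Ev j = Ev l ==> j = l"
proof (rule ccontr)
 assume "Ev j = Ev l" "j ~= l"
 hence "E j i = E l i" for i by(simp add: fvec_eq_iff)
 hence "(SUM i:UNIV. E j i * r l i) = (SUM i:UNIV. E l i * r l i)" by simp
 thus False using ER[of j l] ER[of l l] \<open>j \<noteq> l\<close> lam_pos by simp
qed

text \<open>A relation M x = a M z would come from a form of degree d divisible by h, so from a
  constant multiple of h; but this form does not contain the monomial M y.\<close>

lemma w_not_const: "w ~= kap a"
proof
 assume "w = kap a"
 hence "M x = kap a * M z" by(simp add: w_def M_nonzero field_simps)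
 hence "\<iota> (monom3 (Ev x) + Poly_Mapping.single (Ev z) (- a)) = 0"
  by(simp add: iota_add iota_single iota_monom3 M_def kap_uminus)
 moreover have "homogeneous d (monom3 (Ev x) + Poly_Mapping.single (Ev z) (- a))"
  by(intro homogeneous_add homogeneous_monom3 homogeneous_single deg3_Ev)
 ultimately obtain c where c: "monom3 (Ev x) + Poly_Mapping.single (Ev z) (- a) = Const3 c * h"
  unfolding iota_eq_0_iff using dvd_homogeneous_eq[OF homogeneous_h] by blast
 have "Const3 c * h = Poly_Mapping.single (Ev x) c + Poly_Mapping.single (Ev y) c + Poly_Mapping.single (Ev z) c"
  unfolding h_eq sum_xyz by(simp add: Const3_def monom3_def mult_single distrib_left)
 note eq = c[unfolded this monom3_def]
 have ne: "Ev x ~= Ev y" "Ev x ~= Ev z" "Ev z ~= Ev y" "Ev y ~= Ev x" "Ev z ~= Ev x" "Ev y ~= Ev z"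
  using E_inj xyz by blast+
 have "c = 0" using arg_cong[OF eq, of "%q. Poly_Mapping.lookup q (Ev y)"] ne
  by(simp add: lookup_add lookup_single when_def)
 moreover have "1 = c" using arg_cong[OF eq, of "%q. Poly_Mapping.lookup q (Ev x)"] ne
  by(simp add: lookup_add lookup_single when_def)
 ultimately show False by simp
qed

text \<open>Over the algebraically closed k every element outside k is transcendental, as
  \<open>evp_eq_0_iff\<close> shows by splitting polynomials into linear factors. Stated for general
  v because the inverse of w serves as coordinate at infinity.\<close>

definition transc :: "'l => bool" where
 "transc v \<longleftrightarrow> (ALL a. v ~= kap a)"

lemma transc_w: "transc w" using w_not_const by(simp add: transc_def)

lemma transc_inverse_w: "transc (inverse w)"
 unfolding transc_def using w_not_const by(metis inverse_inverse_eq kap_inverse)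

lemma evp_eq_0_iff:
 assumes "transc v" shows "evp v q = 0 \<longleftrightarrow> q = 0"
proof
 have "evp v q ~= 0" if "q ~= 0" using that
 proof (induction q rule: alg_closed_poly_induct)
  case (factor a f)
  thus ?case using assms unfolding evp_mult evp_linear transc_def by auto
 qed (simp add: evp_const kap_eq_0_iff)
 thus "evp v q = 0 ==> q = 0" by blast
qed (simp add: evp_0)

definition ratfun :: "'l => 'l set" where
 "ratfun v = {evp v p / evp v q | p q. q ~= 0}"

abbreviation K0 :: "'l set" where
 "K0 \<equiv> ratfun w"

lemma evp_ratfun: "evp v q : ratfun v"
 unfolding ratfun_def using evp_1 by(intro CollectI exI[of _ q] exI[of _ 1]) auto

lemma kap_ratfun: "kap c : ratfun v" using evp_ratfun[of v "[:c:]"] by(simp add: evp_const)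

lemma self_ratfun: "v : ratfun v" using evp_ratfun[of v "[:0, 1:]"] by(simp add: evp_X)

lemma ratfun_subfield:
 assumes v: "transc v" shows "is_subfield (ratfun v)"
proof -
 have c: "f + g : ratfun v & f * g : ratfun v" if f: "f : ratfun v" and g: "g : ratfun v" for f g
 proof -
  obtain p q where f: "f = evp v p / evp v q" "q ~= 0" using f unfolding ratfun_def by blast
  obtain p' q' where g: "g = evp v p' / evp v q'" "q' ~= 0" using g unfolding ratfun_def by blast
  have "f + g = evp v (p * q' + p' * q) / evp v (q * q')" "f * g = evp v (p * p') / evp v (q * q')"
   using f g by(simp_all add: evp_eq_0_iff[OF v] evp_mult evp_add add_frac_eq)
  moreover have "q * q' ~= 0" using f g by simp
  ultimately show ?thesis unfolding ratfun_def by blast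
 qed
 have i: "inverse f : ratfun v" if f: "f : ratfun v" for f
 proof -
  obtain p q where f: "f = evp v p / evp v q" "q ~= 0" using f unfolding ratfun_def by blast
  show ?thesis
  proof (cases "p = 0")
   case True
   thus ?thesis using f evp_ratfun[of v 0] by(simp add: evp_0)
  next
   case False
   have "inverse f = evp v q / evp v p" using f by simp
   thus ?thesis unfolding ratfun_def using False by blast
  qed
 qed
 have m: "- f : ratfun v" if "f : ratfun v" for f
  using c[OF kap_ratfun[of "- 1"] that] by(simp add: kap_uminus kap_1)
 show ?thesis unfolding is_subfield_def is_subring_def
  using c i m kap_ratfun[of 0] kap_ratfun[of 1] by(auto simp: kap_0 kap_1)
qed

lemma evp_in_subfield:
 assumes "is_subfield F" "!!c. kap c : F" "v : F" shows "evp v q : F"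
 using assms by(induction q) (auto simp: evp_0 evp_pCons subringD[OF subfield_subring])

lemma ratfun_least:
 assumes "is_subfield F" "!!c. kap c : F" "v : F" shows "ratfun v <= F"
 unfolding ratfun_def using evp_in_subfield[OF assms] subfield_divide[OF assms(1)] by auto

lemma ratfun_inverse_w: "ratfun (inverse w) = K0"
proof
 show "ratfun (inverse w) <= K0"
  by(intro ratfun_least ratfun_subfield transc_w kap_ratfun subfield_inverse self_ratfun)
 have "inverse (inverse w) : ratfun (inverse w)"
  by(intro subfield_inverse ratfun_subfield transc_inverse_w self_ratfun)
 thus "K0 <= ratfun (inverse w)"
  by(intro ratfun_least ratfun_subfield transc_inverse_w kap_ratfun) simp
qed

lemmas K0_subfield = ratfun_subfield[OF transc_w]
lemmas kap_K0 = kap_ratfun[of _ w]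
lemmas w_K0 = self_ratfun[of w]
lemmas K0R = subringD[OF subfield_subring[OF K0_subfield]] subfield_inverse[OF K0_subfield]
 subfield_divide[OF K0_subfield] subring_power[OF subfield_subring[OF K0_subfield]]
 subfield_powi[OF K0_subfield]

lemma K0_K: "K0 <= K" by(intro ratfun_least K_subfield kap_K w_K)

lemma sig_w: "admissible c ==> sig c w = w" unfolding w_def by(rule sig_M_ratio)

lemma sig_evp: "admissible c ==> v : K ==> sig c v = v ==> sig c (evp v q) = evp v q"
 by(induction q) (simp_all add: evp_0 evp_pCons autom_0[OF K_subfield sig_autom] sig_add_mult KR kap_K
   evp_in_subfield[OF K_subfield kap_K] sig_kap)

lemma sig_K0: "admissible c ==> f : K0 ==> sig c f = f" unfolding ratfun_def
 by(auto simp: autom_divide[OF K_subfield sig_autom] evp_in_subfield[OF K_subfield kap_K] w_K sig_evp sig_w)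

lemma wt_diff: "wt (%i. a i - b i) l = wt a l - wt b l"
 by(simp_all add: wt_def distrib_left right_diff_distrib sum.distrib sum_subtractf)

lemma wt_E: "wt (%i. int (E j i)) l = int (s l) + (if j = l then int lam else 0)"
proof -
 have "wt (%i. int (E j i)) l = int (SUM i:UNIV. E j i * r l i)" by(simp add: wt_def mult.commute)
 thus ?thesis unfolding ER by simp
qed

text \<open>By \<open>RE\<close> the matrix r inverts the exponent matrix E up to the factor lam and
  a term that vanishes on exponents with sum 0. So a Laurent monomial of degree 0 whose weights are
  divisible by lam is a product of powers of ratios of the M l.\<close>

lemma lattice_of_wt:
 assumes a: "(SUM i:UNIV. a i) = 0" and n: "!!l. wt a l = int lam * n l"
 shows "a i = (SUM l:UNIV. n l * int (E l i))" "(SUM l:UNIV. n l) = 0"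
proof -
 have "(SUM k:UNIV. a k * int (SUM l:UNIV. r l k * E l i)) = (SUM l:UNIV. wt a l * int (E l i))"
  by(simp add: wt_def sum_xyz algebra_simps)
 moreover have "(SUM k:UNIV. a k * int (SUM l:UNIV. r l k * E l i)) = int (s' i) * (SUM k:UNIV. a k) + int lam * a i"
 proof -
  have "(SUM k:UNIV. a k * int (SUM l:UNIV. r l k * E l i))
    = (SUM k:UNIV. int (s' i) * a k + (if k = i then int lam * a k else 0))"
   unfolding RE by(intro sum.cong) (auto simp: algebra_simps)
  thus ?thesis by(simp add: sum.distrib sum_distrib_left)
 qed
 ultimately have "int lam * a i = int lam * (SUM l:UNIV. n l * int (E l i))"
  using a n by(simp add: sum_distrib_left mult.assoc)
 thus "a i = (SUM l:UNIV. n l * int (E l i))" using lam_pos by simp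
 have "int lam * (SUM l:UNIV. n l) = (SUM l:UNIV. wt a l)" using n by(simp add: sum_distrib_left)
 also have "... = (SUM k:UNIV. int (SUM l:UNIV. r l k) * a k)" by(simp add: wt_def sum_xyz algebra_simps)
 also have "... = int d * (SUM k:UNIV. a k)" unfolding r_sum by(simp add: sum_distrib_left)
 finally show "(SUM l:UNIV. n l) = 0" using a lam_pos by simp
qed

lemma lmon_sum_E:
 assumes "(SUM l:UNIV. n l) = 0"
 shows "lmon (%i. SUM l:UNIV. n l * int (E l i)) = w powi n x * (- 1 - w) powi n y"
proof -
 have nz: "n z = - n x - n y" using assms by(simp add: sum_xyz)
 have "(%i. SUM l:UNIV. n l * int (E l i)) =
   (%i. n x * (int (E x i) - int (E z i)) + n y * (int (E y i) - int (E z i)))"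
  by(simp add: sum_xyz nz algebra_simps)
 thus ?thesis by(simp add: lmon_add lmon_scale M_ratio_lmon[symmetric] w_def[symmetric] My_w)
qed

lemma lmon_K0:
 assumes "(SUM i:UNIV. a i) = 0" "!!l. int lam dvd wt a l" shows "lmon a : K0"
proof -
 from assms(2) have "ALL l. EX n. wt a l = int lam * n" by(auto simp: dvd_def)
 then obtain n where n: "!!l. wt a l = int lam * n l" by metis
 note L = lattice_of_wt[OF assms(1) n]
 have "lmon a = w powi n x * (- 1 - w) powi n y" using lmon_sum_E[OF L(2)] L(1)[symmetric] by simp
 moreover have "- 1 - w : K0" using K0R(2,3,4) w_K0 by(metis diff_conv_add_uminus)
 ultimately show ?thesis using w_K0 by(auto intro!: K0R)
qed

text \<open>Two Laurent monomials of degree 0 have congruent weights if and only if their quotient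
  is a product of powers of ratios of the M l. The exponents of such products form a lattice, which
  has index lam by \<open>det_E\<close> once the coordinate x is eliminated.\<close>

lemma representatives: "EX R. finite R & card R = lam & (ALL a:R. (SUM i:UNIV. a i) = 0) &
  (ALL b. (SUM i:UNIV. b i) = 0 --> (EX a:R. ALL l. int lam dvd wt b l - wt a l)) &
  (ALL a:R. ALL b:R. (ALL l. int lam dvd wt a l - wt b l) --> a = b)"
proof -
 define F where "F = (%(u, v) i. if i = y then u else if i = z then v else - u - v :: int)"
 have F: "F (u, v) x = - u - v" "F (u, v) y = u" "F (u, v) z = v" for u v using xyz by(auto simp: F_def)
 have F_eq: "b = F (b y, b z)" if "(SUM i:UNIV. b i) = 0" for b
 proof
  fix i have "i = x | i = y | i = z" using UNIV_xyz by blast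
  thus "b i = F (b y, b z) i" using that by(auto simp: F sum_xyz)
 qed
 obtain S where S: "finite S" "card S = lam"
  "!!u v. EX (i, j):S. EX m n. u - i = m * (int (E x y) - int (E z y)) + n * (int (E y y) - int (E z y)) &
    v - j = m * (int (E x z) - int (E z z)) + n * (int (E y z) - int (E z z))"
  "!!i j i' j' m n. (i, j) : S ==> (i', j') : S ==>
    i - i' = m * (int (E x y) - int (E z y)) + n * (int (E y y) - int (E z y)) ==>
    j - j' = m * (int (E x z) - int (E z z)) + n * (int (E y z) - int (E z z)) ==> i = i' & j = j'"
  using lattice_representatives[OF det_E lam_pos] by blast
 have sumF: "(SUM i:UNIV. F uv i) = 0" for uv by(cases uv) (simp add: sum_xyz F)
 have 1: "EX a:F ` S. ALL l. int lam dvd wt b l - wt a l" if b: "(SUM i:UNIV. b i) = 0" for b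
 proof -
  obtain i j m n where ij: "(i, j) : S"
   "b y - i = m * (int (E x y) - int (E z y)) + n * (int (E y y) - int (E z y))"
   "b z - j = m * (int (E x z) - int (E z z)) + n * (int (E y z) - int (E z z))"
   using S(3)[of "b y" "b z"] by blast
  have dE: "int (E l x) = int d - int (E l y) - int (E l z)" for l
   using arg_cong[OF deg_E[of l], of int] by(simp add: sum_xyz)
  have "b k - F (i, j) k = m * (int (E x k) - int (E z k)) + n * (int (E y k) - int (E z k))" for k
  proof -
   have "k = x | k = y | k = z" using UNIV_xyz by blast
   thus ?thesis
   proof (elim disjE)
    assume k: "k = x"
    have "b x = - b y - b z" using b by(simp add: sum_xyz)
    hence "b x - F (i, j) x = - (b y - i) - (b z - j)" by(simp add: F)
    thus ?thesis unfolding k ij(2,3) dE by(simp add: algebra_simps)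
   qed (use ij F in simp_all)
  qed
  hence "wt b l - wt (F (i, j)) l = wt (%k. m * (int (E x k) - int (E z k)) + n * (int (E y k) - int (E z k))) l" for l
   unfolding wt_diff[symmetric] by presburger
  also have "... l = m * (wt (%k. int (E x k)) l - wt (%k. int (E z k)) l)
    + n * (wt (%k. int (E y k)) l - wt (%k. int (E z k)) l)" for l
   by(simp add: wt_def sum_xyz algebra_simps)
  finally have "int lam dvd wt b l - wt (F (i, j)) l" for l unfolding wt_E by auto
  thus ?thesis using ij(1) by blast
 qed
 have 2: "uv = uv'" if uv: "uv : S" "uv' : S" and dv: "ALL l. int lam dvd wt (F uv) l - wt (F uv') l" for uv uv'
 proof -
  obtain i j i' j' where e: "uv = (i, j)" "uv' = (i', j')" by(metis surj_pair)
  define a where "a k = F uv k - F uv' k" for k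
  have "ALL l. EX n. wt a l = int lam * n" using dv unfolding a_def wt_diff by(auto simp: dvd_def)
  then obtain n where n: "!!l. wt a l = int lam * n l" by metis
  have a0: "(SUM k:UNIV. a k) = 0" unfolding a_def sum_subtractf sumF by simp
  note L = lattice_of_wt[OF a0 n]
  have nz: "n z = - n x - n y" using L(2) by(simp add: sum_xyz)
  have "a k = n x * (int (E x k) - int (E z k)) + n y * (int (E y k) - int (E z k))" for k
   unfolding L(1)[of k] by(simp add: sum_xyz nz algebra_simps)
  from this[of y] this[of z] show ?thesis using S(4)[of i j i' j' "n x" "n y"] uv unfolding e a_def F by simp
 qed
 have inj: "inj_on F S" using F by(intro inj_onI) (metis prod.collapse F)
 have "card (F ` S) = lam" using card_image[OF inj] S(2) by simp
 moreover have "ALL b. (SUM i:UNIV. b i) = 0 --> (EX a:F ` S. ALL l. int lam dvd wt b l - wt a l)"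
  using 1 by blast
 moreover have "ALL a:F ` S. ALL b:F ` S. (ALL l. int lam dvd wt a l - wt b l) --> a = b"
  using 2 by blast
 moreover have "ALL a:F ` S. (SUM i:UNIV. a i) = 0" using sumF by blast
 ultimately show ?thesis using S(1) by(intro exI[of _ "F ` S"]) blast
qed

definition R :: "(3 => int) set" where
 "R = (SOME R. finite R & card R = lam & (ALL a:R. (SUM i:UNIV. a i) = 0) &
  (ALL b. (SUM i:UNIV. b i) = 0 --> (EX a:R. ALL l. int lam dvd wt b l - wt a l)) &
  (ALL a:R. ALL b:R. (ALL l. int lam dvd wt a l - wt b l) --> a = b))"

lemma R: "finite R" "card R = lam" "!!a. a : R ==> (SUM i:UNIV. a i) = 0"
  "!!b. (SUM i:UNIV. b i) = 0 ==> EX a:R. ALL l. int lam dvd wt b l - wt a l"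
  "!!a b. a : R ==> b : R ==> (ALL l. int lam dvd wt a l - wt b l) \<longleftrightarrow> a = b"
 using someI_ex[OF representatives] unfolding R_def[symmetric] by auto

end

section \<open>K as a vector space over k(w)\<close>

context trinomial_curve
begin

definition spanR :: "'l set" where
 "spanR = {SUM a:R. c a * lmon a | c. ALL a. c a : K0}"

lemma spanR_I: "(!!a. c a : K0) ==> (SUM a:R. c a * lmon a) : spanR"
 unfolding spanR_def by blast

lemma spanR_D: "f : spanR ==> EX c. (ALL a. c a : K0) & f = (SUM a:R. c a * lmon a)"
 unfolding spanR_def by blast

lemma spanR_K: "spanR <= K"
 unfolding spanR_def using K0_K by(auto intro!: subring_sum[OF K_subring] KR lmon_K)

lemma spanR_add: "f : spanR ==> g : spanR ==> f + g : spanR"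
proof -
 assume f: "f : spanR" and g: "g : spanR"
 obtain c where c: "ALL a. c a : K0" "f = (SUM a:R. c a * lmon a)" using spanR_D[OF f] by blast
 obtain c' where c': "ALL a. c' a : K0" "g = (SUM a:R. c' a * lmon a)" using spanR_D[OF g] by blast
 have "f + g = (SUM a:R. (c a + c' a) * lmon a)" unfolding c(2) c'(2) by(simp add: sum.distrib distrib_right)
 thus ?thesis using spanR_I[of "%a. c a + c' a"] c(1) c'(1) K0R by simp
qed

lemma spanR_scale: "k : K0 ==> f : spanR ==> k * f : spanR"
proof -
 assume k: "k : K0" and f: "f : spanR"
 obtain c where c: "ALL a. c a : K0" "f = (SUM a:R. c a * lmon a)" using spanR_D[OF f] by blast
 have "k * f = (SUM a:R. (k * c a) * lmon a)" unfolding c(2) by(simp add: sum_distrib_left mult.assoc)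
 thus ?thesis using spanR_I[of "%a. k * c a"] c(1) k K0R by simp
qed

lemma spanR_0: "0 : spanR" using spanR_I[of "%_. 0"] K0R by simp

lemma spanR_sum: "(!!i. i : I ==> f i : spanR) ==> sum f I : spanR"
 by(induction I rule: infinite_finite_induct) (simp_all add: spanR_0 spanR_add)

lemma lmon_spanR:
 assumes b: "(SUM i:UNIV. b i) = 0" shows "lmon b : spanR"
proof -
 obtain a where a: "a : R" "ALL l. int lam dvd wt b l - wt a l" using R(4)[OF b] by blast
 have "lmon (%i. b i - a i) : K0"
  using a b R(3)[OF a(1)] by(intro lmon_K0) (simp_all add: sum_subtractf wt_diff)
 moreover have "lmon b = lmon (%i. b i - a i) * lmon a" by(simp add: lmon_add[symmetric])
 moreover have "lmon a : spanR"
 proof -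
  have "lmon a = (SUM a':R. (if a' = a then 1 else 0) * lmon a')"
   using a(1) R(1) by(simp add: if_distrib[of "%v. v * _"] cong: if_cong)
  thus ?thesis using spanR_I[of "%a'. if a' = a then 1 else 0"] K0R by simp
 qed
 ultimately show ?thesis using spanR_scale by simp
qed

text \<open>A product of two of the chosen monomials is again a Laurent monomial, hence a multiple
  of a chosen one by an element of k(w).\<close>

lemma spanR_mult:
 assumes "f : spanR" "g : spanR" shows "f * g : spanR"
proof -
 obtain c where c: "ALL a. c a : K0" "f = (SUM a:R. c a * lmon a)" using spanR_D[OF assms(1)] by blast
 obtain c' where c': "ALL a. c' a : K0" "g = (SUM a:R. c' a * lmon a)" using spanR_D[OF assms(2)] by blast
 have "f * g = (SUM a:R. SUM b:R. (c a * c' b) * lmon (%i. a i + b i))"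
  unfolding c(2) c'(2) sum_product by(intro sum.cong refl) (simp add: lmon_add)
 also have "... : spanR"
  using c(1) c'(1) R(3) by(intro spanR_sum spanR_scale lmon_spanR K0R) (auto simp: sum.distrib)
 finally show ?thesis .
qed

lemma K0_spanR: "K0 <= spanR"
proof
 fix f assume "f : K0"
 hence "f * lmon (%_. 0) : spanR" by(intro spanR_scale lmon_spanR) simp_all
 thus "f : spanR" by(simp add: lmon_def)
qed

lemma spanR_prod: "(!!i. i : I ==> f i : spanR) ==> prod f I : spanR"
 using K0_spanR K0R(2) by(induction I rule: infinite_finite_induct) (auto simp: spanR_mult)

lemma iota_spanR:
 assumes "homogeneous m F" shows "\<iota> F / X $ x ^ m : spanR"
proof -
 have "kap (Poly_Mapping.lookup F e) * mon3 X e / X $ x ^ m : spanR" if e: "e : Poly_Mapping.keys F" for e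
 proof -
  have de: "deg3 e = m" using assms e by(simp add: homogeneous_def)
  define a where "a i = int (e $ i) - (if i = x then int m else 0)" for i
  have a: "(SUM i:UNIV. a i) = 0" using de by(simp add: a_def sum_subtractf deg3_def flip: of_nat_sum)
  have "lmon a = (PROD i:UNIV. X $ i powi a i)" by(rule lmon_eq[OF a])
  also have "... = mon3 X e / X $ x ^ m"
   using xyz by(simp add: a_def prod_xyz mon3_def power_int_diff X_nonzero)
  finally have "kap (Poly_Mapping.lookup F e) * mon3 X e / X $ x ^ m = kap (Poly_Mapping.lookup F e) * lmon a" by simp
  thus ?thesis using spanR_scale[OF kap_K0 lmon_spanR[OF a]] by simp
 qed
 thus ?thesis unfolding iota_repr[of F] sum_divide_distrib by(intro spanR_sum)
qed

definition gmul :: "(3 => 'k) => (3 => 'k) => 3 => 'k" where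
 "gmul g g' l = g l * g' l"

lemma gmul_Gam: "g : Gam ==> g' : Gam ==> gmul g g' : Gam"
 by(simp add: Gam_iff gmul_def power_mult_distrib)

lemma gmul_bij: "g : Gam ==> bij_betw (gmul g) Gam Gam"
proof -
 assume g: "g : Gam"
 have i: "(%l. inverse (g l)) : Gam" using g by(simp add: Gam_iff power_inverse)
 show ?thesis using Gam_nonzero[OF g] gmul_Gam[OF g] gmul_Gam[OF i]
  by(intro bij_betw_byWitness[of _ "gmul (%l. inverse (g l))"]) (auto simp: gmul_def fun_eq_iff)
qed

lemma sig_lmon_sum:
 assumes g: "g : Gam" and c: "!!a. c a : K0"
 shows "sig (cc g) (SUM a:R. c a * lmon a) = (SUM a:R. (c a * kap (chr (cc g) a)) * lmon a)"
proof -
 note A = cc_admissible[OF g]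
 have cK: "c a : K" for a using c K0_K by blast
 have "sig (cc g) (SUM a:R. c a * lmon a) = (SUM a:R. sig (cc g) (c a * lmon a))"
  by(intro autom_sum[OF K_subfield sig_autom[OF A]] KR cK lmon_K)
 thus ?thesis by(simp add: sig_add_mult(2)[OF A cK lmon_K] sig_lmon[OF A] sig_K0[OF A c] mult.assoc)
qed

lemma sig_spanR:
 assumes "g : Gam" "f : spanR" shows "sig (cc g) f : spanR"
proof -
 obtain c where c: "ALL a. c a : K0" "f = (SUM a:R. c a * lmon a)" using spanR_D[OF assms(2)] by blast
 show ?thesis unfolding c(2) using c(1) by(subst sig_lmon_sum[OF assms(1)]) (auto intro!: spanR_I K0R kap_K0)
qed

lemma sig_gmul: "g : Gam ==> g' : Gam ==> f : spanR ==> sig (cc g) (sig (cc g') f) = sig (cc (gmul g g')) f"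
proof -
 assume g: "g : Gam" "g' : Gam" and "f : spanR"
 then obtain c where c: "!!a. c a : K0" "f = (SUM a:R. c a * lmon a)" using spanR_D by blast
 have "chr (cc (gmul g g')) a = chr (cc g') a * chr (cc g) a" if "a : R" for a
  unfolding chr_cc[OF g(1) R(3)[OF that]] chr_cc[OF g(2) R(3)[OF that]] chr_cc[OF gmul_Gam[OF g] R(3)[OF that]]
  by(simp add: gmul_def power_int_mult_distrib prod.distrib mult.commute)
 thus ?thesis unfolding c(2) sig_lmon_sum[OF g(2) c(1)] sig_lmon_sum[OF gmul_Gam[OF g] c(1)]
  by(subst sig_lmon_sum[OF g(1)]) (simp_all add: K0R c kap_K0 kap_mult mult.assoc)
qed

text \<open>A power of the norm from K to k(w), since \<open>Gam\<close> acts with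
  repetitions.\<close>

definition Nm :: "'l => 'l" where
 "Nm f = (PROD g:Gam. sig (cc g) f)"

lemma sig_Nm:
 assumes g: "g : Gam" and f: "f : spanR" shows "sig (cc g) (Nm f) = Nm f"
proof -
 have "sig (cc g) (Nm f) = (PROD g':Gam. sig (cc (gmul g g')) f)" unfolding Nm_def using f spanR_K
  by(subst autom_prod[OF K_subfield sig_autom[OF cc_admissible[OF g]]])
   (auto intro!: prod.cong sig_K cc_admissible sig_gmul g)
 also have "... = Nm f" unfolding Nm_def using prod.reindex_bij_betw[OF gmul_bij[OF g]] .
 finally show ?thesis .
qed

lemma one_Gam: "(%_. 1) : Gam" by(simp add: Gam_iff)

lemma sig_one: "f : spanR ==> sig (cc (%_. 1)) f = f"
proof -
 assume "f : spanR"
 then obtain c where c: "!!a. c a : K0" "f = (SUM a:R. c a * lmon a)" using spanR_D by blast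
 have "chr (cc (%_. 1)) a = 1" for a by(simp add: chr_def cc_def)
 thus ?thesis unfolding c(2) sig_lmon_sum[OF one_Gam c(1)] by(simp add: kap_1)
qed

lemma card_Gam: "of_nat (card Gam) = (of_nat lam ^ 3 :: 'k)" using sum_Gam[of "%_. 0"] by simp

lemma wt_0: "wt (%_. 0) l = 0" by(simp add: wt_def)

lemma proj_invariant:
 assumes "f : K" "!!g. g : Gam ==> sig (cc g) f = f"
 shows "proj (%_. 0) f = f"
proof -
 have "(SUM g:Gam. kap (inverse (chr (cc g) (%_. 0))) * sig (cc g) f) = (SUM g:Gam. f)"
  using assms(2) by(intro sum.cong refl) (simp add: chr_def kap_1)
 also have "... = kap (of_nat lam ^ 3) * f" by(simp add: card_Gam[symmetric] kap_of_nat)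
 finally show ?thesis unfolding proj_def
  using lam_nonzero by(simp add: mult.assoc[symmetric] kap_mult[symmetric] kap_1)
qed

lemma proj_spanR:
 assumes c: "!!a. c a : K0" and b: "(SUM k:UNIV. b k) = 0"
 shows "proj b (SUM a:R. c a * lmon a) = (SUM a:R. c a * (if ALL l. int lam dvd wt a l - wt b l then lmon a else 0))"
proof -
 have cK: "c a : K" for a using c K0_K by blast
 have "proj b (SUM a:R. c a * lmon a) = (SUM a:R. proj b (c a * lmon a))"
  by(intro proj_sum KR cK lmon_K)
 also have "... = (SUM a:R. c a * proj b (lmon a))"
  by(intro sum.cong refl proj_scale cK lmon_K sig_K0 cc_admissible c)
 also have "... = (SUM a:R. c a * (if ALL l. int lam dvd wt a l - wt b l then lmon a else 0))"
  using R(3) by(intro sum.cong refl arg_cong[of _ _ "%v. _ * v"] proj_lmon b) auto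
 finally show ?thesis .
qed

lemma proj_coeff:
 assumes c: "!!a. c a : K0" and b: "b : R"
 shows "proj b (SUM a:R. c a * lmon a) = c b * lmon b"
proof -
 have "proj b (SUM a:R. c a * lmon a) = (SUM a:R. if a = b then c a * lmon a else 0)"
  unfolding proj_spanR[OF c R(3)[OF b]] using R(5)[OF _ b] by(intro sum.cong) auto
 also have "... = c b * lmon b" using R(1) b by simp
 finally show ?thesis .
qed

text \<open>An invariant equals its projection to the trivial character, and only monomials with
  weights divisible by lam survive this projection.\<close>

lemma invariant_spanR_K0:
 assumes f: "f : spanR" and inv: "!!g. g : Gam ==> sig (cc g) f = f"
 shows "f : K0"
proof -
 obtain c where "ALL a. c a : K0" and cf: "f = (SUM a:R. c a * lmon a)"
  using spanR_D[OF f] by blast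
 hence c: "c a : K0" for a by blast
 have "f = proj (%_. 0) f" using proj_invariant[OF _ inv] f spanR_K by auto
 also have "... = (SUM a:R. c a * (if ALL l. int lam dvd wt a l - wt (%_. 0) l then lmon a else 0))"
  unfolding cf by(rule proj_spanR[OF c]) simp
 also have "... : K0"
 proof (intro subring_sum[OF subfield_subring[OF K0_subfield]] K0R(5) c)
  fix a assume "a : R"
  thus "(if ALL l. int lam dvd wt a l - wt (%_. 0) l then lmon a else 0) : K0"
   using lmon_K0[OF R(3)[of a]] K0R(1) by(simp add: wt_0)
 qed
 finally show ?thesis .
qed

lemma Nm_K0_spanR: "f : spanR ==> Nm f : K0"
 using spanR_K by(intro invariant_spanR_K0 sig_Nm) (auto simp: Nm_def intro!: spanR_prod sig_spanR)

lemma Nm_nonzero: "f : K ==> f ~= 0 ==> Nm f ~= 0"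
 unfolding Nm_def using finite_Gam autom_eq_0_iff[OF K_subfield sig_autom[OF cc_admissible]] by(simp add: prod_zero_iff)

text \<open>The inverse is the product of the other conjugates divided by the norm. So the ring
  \<open>spanR\<close> is a field, which is how it comes to be all of K in
  \<open>K_spanR\<close>.\<close>

lemma spanR_inverse:
 assumes f: "f : spanR" shows "inverse f : spanR"
proof (cases "f = 0")
 case False
 have fK: "f : K" using f spanR_K by blast
 have "Nm f = f * (PROD g:Gam - {%_. 1}. sig (cc g) f)"
  unfolding Nm_def using finite_Gam one_Gam sig_one[OF f] by(subst prod.remove[of _ "%_. 1"]) auto
 hence "inverse f = inverse (Nm f) * (PROD g:Gam - {%_. 1}. sig (cc g) f)"
  using Nm_nonzero[OF fK False] False by(simp add: field_simps)
 also have "... : spanR"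
  using Nm_K0_spanR[OF f] f by(intro spanR_scale spanR_prod sig_spanR K0R) auto
 finally show ?thesis .
qed (simp add: spanR_0)

lemma K_spanR: "K = spanR"
proof
 show "K <= spanR"
 proof
  fix f assume "f : K"
  then obtain F G m where F: "homogeneous m F" "homogeneous m G" "\<iota> G ~= 0" "f = \<iota> F / \<iota> G"
   by(rule KE)
  have "f = (\<iota> F / X $ x ^ m) * inverse (\<iota> G / X $ x ^ m)" using F by(simp add: X_nonzero)
  thus "f : spanR" using spanR_mult[OF iota_spanR[OF F(1)] spanR_inverse[OF iota_spanR[OF F(2)]]] by simp
 qed
qed (rule spanR_K)

lemma Nm_K0: "f : K ==> Nm f : K0" using Nm_K0_spanR K_spanR by simp

lemma invariant_K0: "f : K ==> (!!g. g : Gam ==> sig (cc g) f = f) ==> f : K0"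
 using invariant_spanR_K0 K_spanR by simp

text \<open>K is spanned by the lam monomials in \<open>R\<close>. This bound drives the finiteness
  statements about the valuations of K.\<close>

lemma dependent_K0:
 assumes I: "finite I" "lam < card I" and Y: "!!i. i : I ==> Y i : K"
 shows "EX c. (ALL i. c i : K0) & (EX i:I. c i ~= 0) & (SUM i:I. c i * Y i) = 0"
proof -
 have "ALL i:I. EX m. (ALL a. m a : K0) & Y i = (SUM a:R. m a * lmon a)"
 proof
  fix i assume "i : I"
  hence "Y i : spanR" using Y K_spanR by simp
  from spanR_D[OF this] show "EX m. (ALL a. m a : K0) & Y i = (SUM a:R. m a * lmon a)" .
 qed
 then obtain m where m: "!!i a. i : I ==> m i a : K0" "!!i. i : I ==> Y i = (SUM a:R. m i a * lmon a)" by metis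
 have "card R < card I" using I(2) R(2) by simp
 from nontrivial_solution[OF K0_subfield R(1) I(1) this, of "%a i. m i a"] m(1)
 obtain c where c: "ALL i. c i : K0" "EX i:I. c i ~= 0" "ALL a:R. (SUM i:I. m i a * c i) = 0" by blast
 have "(SUM i:I. c i * Y i) = (SUM i:I. SUM a:R. m i a * c i * lmon a)"
  using m(2) by(intro sum.cong refl) (simp add: sum_distrib_left mult_ac)
 also have "... = (SUM a:R. (SUM i:I. m i a * c i) * lmon a)"
  by(subst sum.swap) (simp add: sum_distrib_right)
 also have "... = 0" using c(3) by simp
 finally show ?thesis using c by blast
qed

end

section \<open>The points of the normalization\<close>

context trinomial_curve
begin

lemma evp_sum: "evp v (SUM i:A. f i) = (SUM i:A. evp v (f i))"
 by(induction A rule: infinite_finite_induct) (simp_all add: evp_0 evp_add)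

lemma evp_monom: "evp v (monom c n) = kap c * v ^ n"
 by(induction n) (simp_all add: monom_0 evp_const monom_Suc evp_pCons kap_0 evp_0)

abbreviation lr :: "'k ^ 3 => 'l set" where
 "lr b \<equiv> curve_local_ring \<iota> b"

definition val_at :: "'k ^ 3 => 'l => 'k => bool" where
 "val_at b f c \<longleftrightarrow> (EX F G m. homogeneous m F & homogeneous m G & eval3 G b ~= 0 & eval3 F b = c * eval3 G b & f = \<iota> F / \<iota> G)"

lemma valI: "homogeneous m F ==> homogeneous m G ==> eval3 G b ~= 0 ==> eval3 F b = c * eval3 G b ==> val_at b (\<iota> F / \<iota> G) c"
 unfolding val_at_def by blast

definition lm :: "'k ^ 3 => 'l set" where
 "lm b = {f. val_at b f 0}"

lemma lrI: "homogeneous m F ==> homogeneous m G ==> eval3 G b ~= 0 ==> \<iota> F / \<iota> G : lr b"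
 unfolding curve_local_ring_def by blast

lemma lrE:
 assumes "f : lr b"
 shows "EX F G m. homogeneous m F & homogeneous m G & eval3 G b ~= 0 & f = \<iota> F / \<iota> G"
 using assms unfolding curve_local_ring_def by blast

lemma lr_iff_val: "f : lr b \<longleftrightarrow> (EX c. val_at b f c)"
proof
 assume "f : lr b"
 then obtain F G m where "homogeneous m F" "homogeneous m G" "eval3 G b ~= 0" "f = \<iota> F / \<iota> G" using lrE by blast
 hence "val_at b f (eval3 F b / eval3 G b)" using valI[of m F G b "eval3 F b / eval3 G b"] by simp
 thus "EX c. val_at b f c" by blast
qed (use lrI in \<open>auto simp: val_at_def\<close>)

lemma val_kap: "val_at b (kap c) c" using valI[OF homogeneous_Const3[of c] homogeneous_Const3[of 1], of b c]
 by(simp add: eval3_Const3 kap_def[symmetric] kap_1)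

lemma kap_lr: "kap c : lr b" using val_kap lr_iff_val by blast

lemma val_add_mult:
 assumes b: "on_curve h b" and "val_at b f c" "val_at b g e"
 shows "val_at b (f + g) (c + e)" "val_at b (f * g) (c * e)"
proof -
 obtain F G m where F: "homogeneous m F" "homogeneous m G" "eval3 G b ~= 0" "eval3 F b = c * eval3 G b" "f = \<iota> F / \<iota> G"
  using assms(2) unfolding val_at_def by blast
 obtain F' G' m' where F': "homogeneous m' F'" "homogeneous m' G'" "eval3 G' b ~= 0" "eval3 F' b = e * eval3 G' b" "g = \<iota> F' / \<iota> G'"
  using assms(3) unfolding val_at_def by blast
 note fr = frac_add_mult[OF F(1,2) eval3_nonzero[OF b F(3)] F'(1,2) eval3_nonzero[OF b F'(3)]]
 note e = F(3,4) F'(3,4) eval3_mult eval3_add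
 show "val_at b (f + g) (c + e)" unfolding F(5) F'(5) fr(1)
  by(rule valI[OF fr(4,6)]) (simp_all add: e algebra_simps)
 show "val_at b (f * g) (c * e)" unfolding F(5) F'(5) fr(2) by(rule valI[OF fr(5,6)]) (simp_all add: e)
qed

lemma val_unit:
 assumes b: "on_curve h b" and f: "val_at b f c" "c ~= 0" shows "f ~= 0" "inverse f : lr b"
proof -
 obtain F G m where F: "homogeneous m F" "homogeneous m G" "eval3 G b ~= 0" "eval3 F b = c * eval3 G b" "f = \<iota> F / \<iota> G"
  using f(1) unfolding val_at_def by blast
 have e: "eval3 F b ~= 0" using F(3,4) f(2) by simp
 show "f ~= 0" unfolding F(5) using eval3_nonzero[OF b F(3)] eval3_nonzero[OF b e] by simp
 show "inverse f : lr b" using lrI[OF F(2,1) e] unfolding F(5) by simp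
qed

lemma M_power: "M j ^ n = (PROD v:UNIV. X $ v ^ (n * E j v))"
 by(simp add: M_eq prod_power_distrib power_mult[symmetric] mult.commute)

text \<open>What the construction of points uses of a local ring A with maximal ideal m and residue
  field k; invertibility of 1 + m expresses that A is local. It applies to the local rings of the
  plane curve and, in \<open>local_ring_av\<close>, to those of the affine line.\<close>

definition local_ring_with :: "'l set => 'l set => bool" where
 "local_ring_with A m \<longleftrightarrow> is_subring A & A <= K & (ALL c. kap c : A) & m <= A & 0 : m &
   (ALL f:m. ALL g:m. f + g : m) & (ALL f:A. ALL g:m. f * g : m) & (ALL f:A. EX c. f - kap c : m) &
   (ALL f:m. 1 + f ~= 0 & inverse (1 + f) : A)"

lemma local_ring_withI:
 assumes kap: "!!c. val (kap c) c" and K: "!!f c. val f c ==> f : K"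
  and add: "!!f g c e. val f c ==> val g e ==> val (f + g) (c + e)"
  and mult: "!!f g c e. val f c ==> val g e ==> val (f * g) (c * e)"
  and unit: "!!f c. val f c ==> c ~= 0 ==> f ~= 0 & (EX e. val (inverse f) e)"
 shows "local_ring_with {f. EX c. val f c} {f. val f (0 :: 'k)}"
proof -
 have "EX c. val (- f) c" if "val f c" for f c using mult[OF kap[of "- 1"] that] by(auto simp: kap_uminus kap_1)
 hence "is_subring {f. EX c. val f c}"
  unfolding is_subring_def using kap[of 0] kap[of 1] add mult by(auto simp: kap_0 kap_1) blast+
 moreover have "EX e. val (f - kap e) 0" if "val f c" for f c
  using add[OF that kap[of "- c"]] by(intro exI[of _ c]) (simp add: kap_uminus)
 moreover have "1 + f ~= 0 & (EX e. val (inverse (1 + f)) e)" if "val f 0" for f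
  using unit[OF add[OF kap[of 1] that]] by(simp add: kap_1)
 moreover have "val (f * g) 0" if "val f c" "val g 0" for f g c using mult[OF that] by simp
 moreover have "val (f + g) 0" if "val f 0" "val g 0" for f g using add[OF that] by simp
 moreover have "EX e. val (kap c) e" for c using kap by blast
 ultimately show ?thesis unfolding local_ring_with_def using kap[of 0] K by(auto simp: kap_0)
qed

lemma local_ring_lr: "on_curve h b ==> local_ring_with (lr b) (lm b)"
proof -
 assume b: "on_curve h b"
 have lr: "lr b = {f. EX c. val_at b f c}" using lr_iff_val by blast
 show ?thesis unfolding lm_def lr by(rule local_ring_withI[OF val_kap _ val_add_mult[OF b]])
   (use val_unit[OF b] lr local_ring_K[OF b] in blast)+
qed

lemma lr_subring: "on_curve h b ==> is_subring (lr b)"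
 using local_ring_lr unfolding local_ring_with_def by blast

section \<open>Localization of an integral closure at a maximal ideal\<close>

context
 fixes A m B I :: "'l set"
 assumes Am: "local_ring_with A m" and B: "B = integral_closure_in K A" and I: "maximal_ideal_of B I"
begin

private lemma Ap: "is_subring A" "A <= K" "kap c : A" "m <= A" "0 : m"
  "f : m ==> g : m ==> f + g : m" "f : A ==> g : m ==> f * g : m"
  "f : A ==> EX c. f - kap c : m" "f : m ==> 1 + f ~= 0" "f : m ==> inverse (1 + f) : A"
 using Am unfolding local_ring_with_def by blast+

private lemma m_sum: "(!!i. i : J ==> f i : m) ==> sum f J : m"
 by(induction J rule: infinite_finite_induct) (simp_all add: Ap)

private lemma Bsub: "is_subring B" unfolding B by(rule subring_integral_closure[OF K_subfield Ap(1)])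

private lemmas BR = subringD[OF Bsub]

private lemma BK: "B <= K" unfolding B integral_closure_in_def by blast

private lemma lrB: "A <= B" unfolding B integral_closure_in_altdef
 using Ap(2) integral_over_base[OF Ap(1)] by blast

private lemma Iprops: "I <= B" "0 : I" "f : I ==> g : I ==> f + g : I" "c : B ==> f : I ==> c * f : I"
  "1 ~: I"
proof -
 have id: "ideal_of B I" and ne: "I ~= B" using I unfolding maximal_ideal_of_def by auto
 show 1: "I <= B" "0 : I" "f : I ==> g : I ==> f + g : I" "c : B ==> f : I ==> c * f : I" for f g c
  using id unfolding ideal_of_def by blast+
 show "1 ~: I"
 proof
  assume "1 : I"
  hence "c : I" if "c : B" for c using 1(4)[OF that] by fastforce
  thus False using 1(1) ne by blast
 qed
qed

private lemma Iuminus: "f : I ==> - f : I" using Iprops(4)[of "- 1" f] BR by simp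

private lemma Isum: "(!!i. i : J ==> f i : I) ==> sum f J : I"
 by(induction J rule: infinite_finite_induct) (simp_all add: Iprops)

private lemma Iadjoin:
 assumes f: "f : B" "f ~: I" shows "EX i:I. EX c:B. 1 = i + c * f"
proof -
 define J where "J = {i + c * f | i c. i : I & c : B}"
 have "ideal_of B J" unfolding ideal_of_def
 proof (intro conjI ballI)
  show "J <= B" unfolding J_def using Iprops(1) BR(4,5) f by auto
  show "0 : J" unfolding J_def using Iprops(2) BR(1) by(intro CollectI exI[of _ 0]) auto
 next
  fix u v assume "u : J" "v : J"
  then obtain i c i' c' where u: "u = i + c * f" "i : I" "c : B" and v: "v = i' + c' * f" "i' : I" "c' : B"
   unfolding J_def by blast
  have "u + v = (i + i') + (c + c') * f" unfolding u v by(simp add: algebra_simps)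
  thus "u + v : J" unfolding J_def using Iprops(3)[OF u(2) v(2)] BR(4)[OF u(3) v(3)] by blast
 next
  fix e u assume e: "e : B" and "u : J"
  then obtain i c where u: "u = i + c * f" "i : I" "c : B" unfolding J_def by blast
  have "e * u = e * i + (e * c) * f" unfolding u by(simp add: algebra_simps)
  thus "e * u : J" unfolding J_def using Iprops(4)[OF e u(2)] BR(5)[OF e u(3)] by blast
 qed
 moreover have "I <= J"
 proof
  fix i assume "i : I"
  thus "i : J" unfolding J_def using BR(1) by(intro CollectI exI[of _ i] exI[of _ 0]) auto
 qed
 moreover have "J ~= I"
 proof -
  have "f : J" unfolding J_def using Iprops(2) BR(2) by(intro CollectI exI[of _ 0] exI[of _ 1]) auto
  thus ?thesis using f by blast
 qed
 ultimately have "J = B" using I unfolding maximal_ideal_of_def by blast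
 hence "1 : J" using BR(2) by simp
 thus ?thesis unfolding J_def by blast
qed

private lemma Iprime:
 assumes "f : B" "g : B" "f * g : I" shows "f : I | g : I"
proof (rule disjCI)
 assume "g ~: I"
 then obtain i c where ic: "i : I" "c : B" "1 = i + c * g" using Iadjoin[OF assms(2)] by blast
 have "f = f * (i + c * g)" using ic(3) by simp
 also have "... = f * i + c * (f * g)" by(simp add: algebra_simps)
 finally show "f : I" using Iprops(3)[OF Iprops(4)[OF assms(1) ic(1)] Iprops(4)[OF ic(2) assms(3)]] by simp
qed

text \<open>Lying over. If v in m were outside I, some c in B would satisfy c v = 1 modulo I. The
  integral equation of c, multiplied by v^n, would then read 1 + t = 0 modulo I with t in m,
  although 1 + t is a unit.\<close>

private lemma m_I: "m <= I"
proof
 fix v assume v: "v : m"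
 have vB: "v : B" "v : A" using v Ap(4) lrB by blast+
 show "v : I"
 proof (rule ccontr)
  assume "v ~: I"
  then obtain i c where ic: "i : I" "c : B" "1 = i + c * v" using Iadjoin[OF vB(1)] by blast
  obtain q where q: "lead_coeff q = 1" "!!i. coeff q i : A" "poly q c = 0"
   using ic(2) unfolding B integral_closure_in_altdef integral_over_def by blast
  define n where "n = degree q"
  have cv: "c * v = 1 - i" "c * v : B" using ic vB BR(5) by(auto simp: eq_diff_eq add.commute)
  have pw: "(c * v) ^ j - 1 : I" for j
  proof (induction j)
   case (Suc j)
   have "(c * v) ^ Suc j - 1 = (c * v) * ((c * v) ^ j - 1) + - i" using cv(1) by(simp add: algebra_simps)
   thus ?case using Iprops(3)[OF Iprops(4)[OF cv(2) Suc] Iuminus[OF ic(1)]] by simp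
  qed (simp add: Iprops)
  define t where "t = (SUM j<n. coeff q j * v ^ (n - j))"
  have t: "t : m" unfolding t_def
  proof (rule m_sum)
   fix j assume "j : {..<n}"
   hence "n - j = Suc (n - j - 1)" by auto
   hence "coeff q j * v ^ (n - j) = (coeff q j * v ^ (n - j - 1)) * v" by(metis mult.assoc power_Suc2)
   moreover have "coeff q j * v ^ (n - j - 1) : A"
    using q(2) vB(2) by(intro subringD(5)[OF Ap(1)] subring_power[OF Ap(1)])
   ultimately show "coeff q j * v ^ (n - j) : m" using Ap(7)[OF _ v] by metis
  qed
  have "0 = v ^ n * poly q c" using q(3) by simp
  also have "... = (SUM j<=n. coeff q j * v ^ (n - j) * (c * v) ^ j)"
   unfolding poly_altdef n_def[symmetric] sum_distrib_left
  proof (intro sum.cong refl)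
   fix j assume "j : {..n}"
   hence "v ^ n = v ^ (n - j) * v ^ j" by(simp add: power_add[symmetric])
   thus "v ^ n * (coeff q j * c ^ j) = coeff q j * v ^ (n - j) * (c * v) ^ j"
    by(simp add: power_mult_distrib mult_ac)
  qed
  also have "... = (SUM j<=n. coeff q j * v ^ (n - j) * ((c * v) ^ j - 1)) + (SUM j<=n. coeff q j * v ^ (n - j))"
   by(simp add: sum.distrib[symmetric] algebra_simps)
  also have "(SUM j<=n. coeff q j * v ^ (n - j)) = t + 1"
   unfolding t_def using q(1) by(simp add: lessThan_Suc_atMost[symmetric] n_def)
  finally have "1 + t = - (SUM j<=n. coeff q j * v ^ (n - j) * ((c * v) ^ j - 1))"
   by(simp add: eq_neg_iff_add_eq_0 add_ac)
  also have "... : I"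
  proof (intro Iuminus Isum)
   fix j
   have "coeff q j * v ^ (n - j) : B" using q(2) lrB subring_power[OF Bsub vB(1)] BR(5) by blast
   thus "coeff q j * v ^ (n - j) * ((c * v) ^ j - 1) : I" using Iprops(4) pw by blast
  qed
  finally have "1 + t : I" .
  moreover have "inverse (1 + t) : B" using Ap(10)[OF t] lrB by blast
  ultimately have "inverse (1 + t) * (1 + t) : I" using Iprops(4) by blast
  thus False using Ap(9)[OF t] Iprops(5) by simp
 qed
qed

private lemma kapB: "kap c : B" using Ap(3) lrB by blast

private lemma kap_I: "kap c : I ==> c = 0"
proof (rule ccontr)
 assume c: "kap c : I" "c ~= 0"
 hence "kap (inverse c) * kap c : I" using Iprops(4) kapB by blast
 thus False using Iprops(5) c(2) by(simp add: kap_mult[symmetric] kap_1)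
qed

private lemma root_I:
 assumes f: "f : B"
 shows "q ~= 0 ==> evp f q : I ==> EX a. f - kap a : I"
proof (induction q rule: alg_closed_poly_induct)
 case (const c)
 thus ?case using kap_I[of c] by(simp add: evp_const)
next
 case (factor a g)
 have "f - kap a : B" using f kapB subring_diff[OF Bsub] by blast
 moreover have "evp f g : B" by(induction g) (auto simp: evp_0 evp_pCons f kapB BR)
 ultimately show ?case using Iprime factor unfolding evp_mult evp_linear by blast
qed

text \<open>Modulo I the integral equation of f has coefficients in k, where it splits into linear
  factors; as I is prime, one of them lies in I.\<close>

private lemma residue_I:
 assumes f: "f : B" shows "EX a. f - kap a : I"
proof -
 obtain q where q: "lead_coeff q = 1" "!!i. coeff q i : A" "poly q f = 0"
  using f unfolding B integral_closure_in_altdef integral_over_def by blast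
 define n where "n = degree q"
 have "ALL i. EX c. coeff q i - kap c : I" using Ap(8)[OF q(2)] m_I by blast
 then obtain c where c: "!!i. coeff q i - kap (c i) : I" by metis
 define q0 where "q0 = monom 1 n + (SUM i<n. monom (c i) i)"
 have "coeff q0 n = 1" unfolding q0_def by(simp add: coeff_sum)
 hence q0: "q0 ~= 0" by auto
 have "evp f q0 = f ^ n + (SUM i<n. kap (c i) * f ^ i)"
  unfolding q0_def by(simp add: evp_add evp_sum evp_monom kap_1)
 moreover have "poly q f = f ^ n + (SUM i<n. coeff q i * f ^ i)"
  unfolding poly_altdef using q(1) by(simp add: lessThan_Suc_atMost[symmetric] n_def)
 ultimately have "evp f q0 = - (SUM i<n. f ^ i * (coeff q i - kap (c i)))"
  using q(3) by(simp add: sum_subtractf algebra_simps eq_neg_iff_add_eq_0)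
 moreover have "... : I" using c subring_power[OF Bsub f] Iprops(4) by(intro Iuminus Isum) auto
 ultimately show ?thesis using root_I[OF f q0] by simp
qed

private abbreviation (input) P :: "'l set" where
 "P \<equiv> localization_at B I"

private lemma P_I: "u : B ==> v : B ==> v ~: I ==> u / v : P"
 unfolding localization_at_def by blast

private lemma P_E: "f : P ==> EX u v. u : B & v : B & v ~: I & f = u / v"
 unfolding localization_at_def by blast

private lemma nz: "v ~: I ==> v ~= 0" using Iprops(2) by auto

private lemma B_P: "B <= P" using P_I[OF _ BR(2) Iprops(5)] by(metis div_by_1 subsetI)

private lemma P_K: "P <= K" unfolding localization_at_def using BK by(auto intro!: KR(7))

private lemma P_subring: "is_subring P"
proof -
 have "f + g : P & f * g : P" if f: "f : P" and g: "g : P" for f g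
 proof -
  obtain u v where u: "u : B" "v : B" "v ~: I" "f = u / v" using P_E[OF f] by blast
  obtain u' v' where u': "u' : B" "v' : B" "v' ~: I" "g = u' / v'" using P_E[OF g] by blast
  have "v * v' ~: I" using Iprime u u' by blast
  moreover have "f + g = (u * v' + u' * v) / (v * v')" "f * g = (u * u') / (v * v')"
   using nz u u' by(simp_all add: add_frac_eq)
  moreover have "u * v' + u' * v : B" "u * u' : B" "v * v' : B" using u u' BR(4,5) by auto
  ultimately show ?thesis using P_I by metis
 qed
 moreover have "- f : P" if f: "f : P" for f
 proof -
  obtain u v where u: "u : B" "v : B" "v ~: I" "f = u / v" using P_E[OF f] by blast
  thus ?thesis using P_I[OF BR(3)[OF u(1)] u(2,3)] by simp
 qed
 moreover have "0 : P" "1 : P" using B_P BR(1,2) by blast+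
 ultimately show ?thesis unfolding is_subring_def by blast
qed

private lemma P_unit_iff: "u : B ==> v : B ==> v ~: I ==> unit_of P (u / v) \<longleftrightarrow> u ~: I"
proof
 assume u: "u : B" "v : B" "v ~: I"
 show "unit_of P (u / v)" if "u ~: I"
  using P_I[OF u] P_I[OF u(2,1) that] nz[OF u(3)] nz[OF that] unfolding unit_of_def by simp
 assume un: "unit_of P (u / v)"
 hence "v / u : P" "u ~= 0" unfolding unit_of_def by auto
 then obtain a c where a: "a : B" "c : B" "c ~: I" "v / u = a / c" using P_E by blast
 have "v * c = a * u" using a(4) nz[OF a(3)] \<open>u \<noteq> 0\<close> by(simp add: field_simps)
 thus "u ~: I" using Iprops(4)[OF a(1), of u] Iprime[OF u(2) a(2)] u(3) a(3) by auto
qed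

private lemma maxid_P: "f : maxid P \<longleftrightarrow> (EX u v. u : I & v : B & v ~: I & f = u / v)"
proof
 assume f: "f : maxid P"
 then obtain u v where u: "u : B" "v : B" "v ~: I" "f = u / v" using P_E unfolding maxid_def by blast
 thus "EX u v. u : I & v : B & v ~: I & f = u / v" using f P_unit_iff[OF u(1-3)] unfolding maxid_def by blast
next
 assume "EX u v. u : I & v : B & v ~: I & f = u / v"
 then obtain u v where u: "u : I" "v : B" "v ~: I" "f = u / v" by blast
 thus "f : maxid P" using P_I[of u v] P_unit_iff[of u v] Iprops(1) unfolding maxid_def by blast
qed

private lemma maxid_P_add: "f : maxid P ==> g : maxid P ==> f + g : maxid P"
proof -
 assume "f : maxid P" "g : maxid P"
 then obtain u v u' v' where u: "u : I" "v : B" "v ~: I" "f = u / v" and u': "u' : I" "v' : B" "v' ~: I" "g = u' / v'"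
  unfolding maxid_P by blast
 have "f + g = (v' * u + v * u') / (v * v')" using u u' nz by(simp add: add_frac_eq mult.commute)
 moreover have "v' * u + v * u' : I" by(intro Iprops(3,4) u u')
 moreover have "v * v' : B" "v * v' ~: I" using Iprime u u' BR(5) by blast+
 ultimately show ?thesis unfolding maxid_P by blast
qed

private lemma P_residue:
 assumes f: "f : P" shows "EX c. f - kap c : maxid P"
proof -
 obtain u v where u: "u : B" "v : B" "v ~: I" "f = u / v" using P_E[OF f] by blast
 obtain c e where c: "u - kap c : I" and e: "v - kap e : I" using residue_I u by blast
 have e0: "e ~= 0" using e u(3) by(auto simp: kap_0)
 have "f - kap (c / e) = ((u - kap c) + - (kap (c / e) * (v - kap e))) / v"
 proof -
  have "kap (c / e) * kap e = kap c" using e0 by(simp add: kap_mult[symmetric])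
  hence eq: "(u - kap c) + - (kap (c / e) * (v - kap e)) = u - kap (c / e) * v" by(simp add: algebra_simps)
  show ?thesis unfolding eq u(4) using nz[OF u(3)] by(simp add: diff_divide_distrib)
 qed
 moreover have "(u - kap c) + - (kap (c / e) * (v - kap e)) : I" by(intro Iprops(3,4) Iuminus c e kapB)
 ultimately show ?thesis unfolding maxid_P using u by blast
qed

text \<open>One denominator v serves for all coefficients, so v f is integral over B by
  \<open>integral_over_lead\<close>, hence over A by transitivity, hence in B.\<close>

private lemma P_integrally_closed:
 assumes f: "f : K" "integral_over P f" shows "f : P"
proof -
 obtain q where q: "lead_coeff q = 1" "!!i. coeff q i : P" "poly q f = 0"
  using f(2) unfolding integral_over_def by blast
 define n where "n = degree q"
 have "EX v:B. v ~: I & (ALL i<N. v * coeff q i : B)" for N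
 proof (induction N)
  case 0
  thus ?case using BR(2) Iprops(5) by auto
 next
  case (Suc N)
  then obtain v where v: "v : B" "v ~: I" "ALL i<N. v * coeff q i : B" by blast
  obtain u' v' where u': "u' : B" "v' : B" "v' ~: I" "coeff q N = u' / v'" using P_E[OF q(2)] by blast
  have "(v' * v) * coeff q i : B" if "i < Suc N" for i
  proof (cases "i = N")
   case True
   hence "(v' * v) * coeff q i = v * u'" using u'(4) nz[OF u'(3)] by simp
   moreover have "v * u' : B" using BR(5) v u' by blast
   ultimately show ?thesis by(simp only:)
  next
   case False
   hence "v' * (v * coeff q i) : B" using that v u' BR(5) by simp
   thus ?thesis by(simp add: mult.assoc)
  qed
  moreover have "v' * v : B" "v' * v ~: I" using Iprime u' v BR(5) by blast+
  ultimately show ?case by blast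
 qed
 then obtain v where v: "v : B" "v ~: I" "ALL i<Suc n. v * coeff q i : B" by blast
 have "n ~= 0" using q(1,3) unfolding n_def by(metis degree_eq_zeroE poly_const_conv lead_coeff_pCons(2) pCons_0_0 zero_neq_one)
 then obtain k where k: "n = Suc k" by(cases n) auto
 have "(SUM i<=Suc k. v * coeff q i * f ^ i) = v * poly q f"
  unfolding poly_altdef n_def[symmetric] k by(simp add: sum_distrib_left mult.assoc del: sum.atMost_Suc)
 hence "(SUM i<=Suc k. v * coeff q i * f ^ i) = 0" using q(3) by simp
 from integral_over_lead[OF Bsub _ this] have "integral_over B (v * f)"
  using v(3) q(1) k unfolding n_def by(simp add: less_Suc_eq_le)
 then obtain q' where q': "lead_coeff q' = 1" "!!i. coeff q' i : B" "poly q' (v * f) = 0"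
  unfolding integral_over_def by blast
 have "integral_over (A) (coeff q' i)" for i using q'(2)[of i] unfolding B integral_closure_in_altdef by simp
 from integral_over_trans[OF Ap(1) q'(1,3) this] have "integral_over (A) (v * f)" .
 moreover have "v * f : K" using v(1) BK f(1) KR(5) by blast
 ultimately have "v * f : B" unfolding B integral_closure_in_altdef by simp
 from P_I[OF this v(1,2)] show ?thesis using nz[OF v(2)] by simp
qed

lemma localization_props: "is_subring (localization_at B I)" "localization_at B I <= K"
 "!!f. f : K ==> integral_over (localization_at B I) f ==> f : localization_at B I"
 "!!f g. f : maxid (localization_at B I) ==> g : maxid (localization_at B I) ==>
  f + g : maxid (localization_at B I)"
 "!!f. f : localization_at B I ==> EX c. f - kap c : maxid (localization_at B I)"
 "!!c. kap c : localization_at B I" "A <= localization_at B I" "B <= localization_at B I"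
 "m <= maxid (localization_at B I)"
proof -
 show "m <= maxid (localization_at B I)"
 proof
  fix f assume "f : m"
  hence "f : I" using m_I by blast
  thus "f : maxid P" unfolding maxid_P using BR(2) Iprops(5) by(intro exI[of _ f] exI[of _ 1]) simp
 qed
qed (use P_subring P_K P_integrally_closed maxid_P_add P_residue kapB B_P lrB in blast)+

end

text \<open>The weights m, n come from \<open>integrality\<close>: on the variables that vanish at
  b, the exponents of M j are at most the weighted mean of those of M i and M l. So the product of
  (M i / M j)^m and (M l / M j)^n is regular at b, and as M l / M j = - 1 - \<rho>, this is an
  integral equation for \<rho> = M i / M j.\<close>

lemma ratio_integral:
 assumes b: "on_curve h b" and "distinct [i, j, l]" "0 < m + n"
  and le: "!!v. b $ v = 0 ==> (m + n) * E j v <= m * E i v + n * E l v"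
 shows "M i / M j : integral_closure_in K (lr b)"
proof -
 define \<rho> where "\<rho> = M i / M j"
 have un: "(UNIV :: 3 set) = {i, j, l}" by(rule UNIV3_eq[OF assms(2)])
 have "M i + M j + M l = 0" using M_sum assms(2) unfolding un by(simp add: add.assoc)
 moreover have "M l = (M i + M j + M l) - M j - M i" by simp
 ultimately have "M l = - M j - M i" by simp
 hence Ml: "M l / M j = - 1 - \<rho>" by(simp add: \<rho>_def M_nonzero diff_divide_distrib)
 \<comment> \<open>Exponents of numerator and denominator: on the variables that vanish at b
   everything goes to the numerator, so that the denominator does not vanish there.\<close>
 define e1 where "e1 v = (if b $ v = 0 then m * E i v + n * E l v - (m + n) * E j v else m * E i v + n * E l v)" for v
 define e2 where "e2 v = (if b $ v = 0 then 0 else (m + n) * E j v)" for v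
 have e12: "e1 v + (m + n) * E j v = e2 v + (m * E i v + n * E l v)" for v
  using le[of v] by(simp add: e1_def e2_def)
 have sums: "(SUM v:UNIV. e1 v) = (SUM v:UNIV. e2 v)"
 proof -
  have "(SUM v:UNIV. e1 v) + (m + n) * d = (SUM v:UNIV. e2 v) + (m * d + n * d)"
  proof -
   have "(SUM v:UNIV. e1 v + (m + n) * E j v) = (SUM v:UNIV. e2 v + (m * E i v + n * E l v))"
    by(intro sum.cong refl e12)
   thus ?thesis by(simp add: sum.distrib sum_distrib_left[symmetric] deg_E)
  qed
  thus ?thesis by(simp add: algebra_simps)
 qed
 have "\<iota> (monom3 (\<chi> v. e1 v)) / \<iota> (monom3 (\<chi> v. e2 v)) : lr b"
 proof (rule lrI[OF homogeneous_monom3[OF refl]])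
  show "homogeneous (deg3 (\<chi> v. e1 v)) (monom3 (\<chi> v. e2 v))"
   by(rule homogeneous_monom3) (simp add: deg3_def sums)
  show "eval3 (monom3 (\<chi> v. e2 v)) b ~= 0" by(simp add: eval3_monom3 mon3_def e2_def)
 qed
 moreover have "\<iota> (monom3 (\<chi> v. e1 v)) / \<iota> (monom3 (\<chi> v. e2 v)) = \<rho> ^ m * (- 1 - \<rho>) ^ n"
 proof -
  have "mon3 X (\<chi> v. e1 v) * M j ^ (m + n) = (PROD v:UNIV. X $ v ^ (e1 v + (m + n) * E j v))"
   by(simp only: mon3_def M_power prod.distrib[symmetric] power_add vec_lambda_beta add_mult_distrib)
  also have "... = mon3 X (\<chi> v. e2 v) * (M i ^ m * M l ^ n)"
   by(simp only: e12 mon3_def M_power prod.distrib[symmetric] power_add vec_lambda_beta)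
  finally have "mon3 X (\<chi> v. e1 v) / mon3 X (\<chi> v. e2 v) = (M i ^ m * M l ^ n) / M j ^ (m + n)"
   using M_nonzero mon_X_nonzero by(simp add: field_simps)
  also have "... = \<rho> ^ m * (M l / M j) ^ n" by(simp add: \<rho>_def power_divide power_add)
  finally show ?thesis unfolding Ml iota_monom3 .
 qed
 ultimately have c: "\<rho> ^ m * (- 1 - \<rho>) ^ n : lr b" by simp
 \<comment> \<open>The sign turns (- 1 - \<rho>)^n into (1 + \<rho>)^n, which makes the equation
   monic.\<close>
 define c' where "c' = (- 1) ^ n * (\<rho> ^ m * (- 1 - \<rho>) ^ n)"
 have c': "c' : lr b" unfolding c'_def using subringD(2,3)[OF lr_subring[OF b]]
  by(intro subringD(5)[OF lr_subring[OF b] _ c] subring_power[OF lr_subring[OF b]]) blast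
 have c'_eq: "c' = \<rho> ^ m * (1 + \<rho>) ^ n"
 proof -
  have "(- 1) ^ n * (- 1 - \<rho>) ^ n = ((- 1) * (- 1 - \<rho>)) ^ n" by(simp only: power_mult_distrib)
  also have "(- 1) * (- 1 - \<rho>) = 1 + \<rho>" by simp
  finally show ?thesis unfolding c'_def by(simp add: mult.left_commute)
 qed
 define q0 :: "'l poly" where "q0 = [:0, 1:] ^ m * [:1, 1:] ^ n"
 have "lead_coeff q0 = 1" unfolding q0_def lead_coeff_mult lead_coeff_power by simp
 moreover have "degree q0 = m + n" unfolding q0_def by(simp add: degree_mult_eq degree_power_eq)
 ultimately have q0: "degree q0 = m + n" "lead_coeff q0 = 1" by blast+
 define q where "q = q0 - [:c':]"
 have dq: "degree q = m + n" unfolding q_def using q0(1) assms(3)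
  by(metis degree_add_eq_left degree_minus degree_pCons_0 diff_conv_add_uminus)
 have "coeff [:c':] (m + n) = 0" using assms(3) by(intro coeff_eq_0) simp
 hence "coeff q (m + n) = 1" using q0 unfolding q_def coeff_diff by simp
 hence "lead_coeff q = 1" unfolding dq .
 moreover have "poly q \<rho> = 0" by(simp add: q_def q0_def c'_eq add.commute)
 moreover have "coeff q i : lr b" for i
 proof -
  have A: "is_subring {q. ALL i. coeff q i : lr b}" by(rule subring_coeffs[OF lr_subring[OF b]])
  have "[:0, 1:] : {q. ALL i. coeff q i : lr b}" "[:1, 1:] : {q. ALL i. coeff q i : lr b}"
   "[:c':] : {q. ALL i. coeff q i : lr b}"
   using c' subringD(1,2)[OF lr_subring[OF b]] by(auto simp: coeff_pCons split: nat.splits)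
  hence "q : {q. ALL i. coeff q i : lr b}"
   unfolding q_def q0_def by(intro subring_diff[OF A] subringD(5)[OF A] subring_power[OF A])
  thus ?thesis by simp
 qed
 ultimately have "integral_over (lr b) \<rho>" unfolding integral_over_def by blast
 thus ?thesis unfolding integral_closure_in_altdef \<rho>_def[symmetric] using M_ratio_K \<rho>_def by simp
qed

text \<open>All ratios M v / M j with the j supplied by \<open>integrality\<close> lie in P. For j =
  x or j = z one of them is the inverse of w or w itself. For j = y, the ratios M x / M y and M z /
  M y have sum - 1, so one of them is a unit.\<close>

lemma w_cases:
 assumes b: "on_curve h b" and B: "B = integral_closure_in K (lr b)" and I: "maximal_ideal_of B I"
  and P: "P = localization_at B I" shows "w : P | inverse w : P"
proof -
 note L = localization_props[OF local_ring_lr[OF b] B I, folded P]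
 note P_subring = L(1) and maxid_P_add = L(4) and B_P = L(8)
 have "b ~= 0" using b by(simp add: on_curve_def)
 hence "{v. b $ v = 0} ~= UNIV" by(auto simp: fvec_eq_iff)
 from integrality[OF this] obtain i j l m n where ij: "distinct [i, j, l]" "0 < m + n"
  and le: "ALL v:{v. b $ v = 0}. (m + n) * E j v <= m * E i v + n * E l v" by(elim exE conjE)
 have "(m + n) * E j v <= m * E i v + n * E l v" if "b $ v = 0" for v using le that by simp
 note ijl = ij this
 have ij: "M i / M j : B" unfolding B by(rule ratio_integral[OF b ijl])
 have lj: "M l / M j : B"
  unfolding B using ijl by(intro ratio_integral[OF b, of l j i n m]) (auto simp: add.commute)
 have un: "(UNIV :: 3 set) = {i, j, l}" by(rule UNIV3_eq[OF ijl(1)])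
 have all: "M v / M j : B" for v
 proof -
  have "v = i | v = j | v = l" using un by blast
  thus ?thesis using ij lj subringD(2)[OF subring_integral_closure[OF K_subfield lr_subring[OF b]]] M_nonzero
   unfolding B by auto
 qed
 have "M i + M j + M l = 0" using M_sum ijl(1) unfolding un by(simp add: add.assoc)
 have j: "j = x | j = y | j = z" using UNIV_xyz by blast
 have "x = j | x ~= j" by blast
 have iw: "inverse w = M z / M x" by(simp add: w_def)
 from j show ?thesis
 proof (elim disjE)
  assume "j = x" thus ?thesis using all[of z] B_P iw by auto
 next
  assume "j = z" thus ?thesis using all[of x] B_P w_def by auto
 next
  assume jy: "j = y"
  have u: "M x / M y : P" "M z / M y : P" using all B_P jy by blast+
  have "M x + M y + M z = 0" using M_sum by(simp add: sum_xyz)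
  hence "M x / M y + M z / M y = - 1"
   using M_nonzero[of y] by(simp add: field_simps eq_neg_iff_add_eq_0 add_ac)
  moreover have "- 1 ~: maxid P" using subringD(2,3)[OF P_subring] by(auto simp: maxid_def unit_of_def)
  ultimately have "M x / M y ~: maxid P | M z / M y ~: maxid P" using maxid_P_add by metis
  hence "inverse (M x / M y) : P | inverse (M z / M y) : P" using u by(auto simp: maxid_def unit_of_def)
  hence "(M z / M y) * inverse (M x / M y) : P | (M x / M y) * inverse (M z / M y) : P"
   using u subringD(5)[OF P_subring] by blast
  moreover have "(M z / M y) * inverse (M x / M y) = inverse w" "(M x / M y) * inverse (M z / M y) = w"
   using M_nonzero by(simp_all add: w_def)
  ultimately show ?thesis by auto
 qed
qed

end

section \<open>Places and their valuations\<close>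

context trinomial_curve
begin

text \<open>An intrinsic description of the points of X, without reference to a point of the plane
  curve, so that it can be transported along the Galois action and checked for rings constructed
  over the line. By \<open>place_lies_over\<close> and \<open>place_complete\<close> it describes
  exactly the points.\<close>

definition place :: "'l set => bool" where
 "place P \<longleftrightarrow> is_subring P & P <= K & (ALL f:K. integral_over P f --> f : P) &
   (ALL f:maxid P. ALL g:maxid P. f + g : maxid P) & (ALL f:P. EX c. f - kap c : maxid P) &
   (ALL c. kap c : P) & (w : P | inverse w : P)"

lemma place_lies_over: "lies_over \<iota> h P b ==> place P"
proof -
 assume "lies_over \<iota> h P b"
 then obtain I where b: "on_curve h b" and I: "maximal_ideal_of (integral_closure_in K (lr b)) I"
  and P: "P = localization_at (integral_closure_in K (lr b)) I" unfolding lies_over_def Let_def by blast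
 note L = localization_props[OF local_ring_lr[OF b] refl I, folded P]
 show ?thesis unfolding place_def using L(1-6) w_cases[OF b refl I P] by blast
qed

lemma kap_unit: "is_subring P ==> (!!c. kap c : P) ==> c ~= 0 ==> unit_of P (kap c)"
 unfolding unit_of_def using kap_eq_0_iff by(simp add: kap_inverse[symmetric])

context
 fixes P :: "'l set" and v :: 'l and a :: 'k
 assumes pl: "place P" and v: "transc v" "ratfun v = K0" "v : P" "v - kap a : maxid P"
begin

private lemma P: "is_subring P" "P <= K" "f : K ==> integral_over P f ==> f : P"
  "f : maxid P ==> g : maxid P ==> f + g : maxid P" "f : P ==> EX c. f - kap c : maxid P" "kap c : P"
 using pl unfolding place_def by blast+

private lemmas PR = subringD[OF P(1)]

private definition "\<pi> = v - kap a"

private lemma pi: "\<pi> : maxid P" "\<pi> ~= 0" "\<pi> : P" "\<pi> : K"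
 using v P(2) unfolding \<pi>_def transc_def maxid_def by auto

private lemma evp_unit:
 assumes "poly q a ~= 0" shows "unit_of P (evp v q)"
proof -
 have "[:- a, 1:] dvd q - [:poly q a:]" by(simp add: poly_eq_0_iff_dvd[symmetric])
 then obtain q' where q': "q - [:poly q a:] = [:- a, 1:] * q'" by(auto simp: dvd_def)
 have "q = [:poly q a:] + [:- a, 1:] * q'" using q' by(simp add: algebra_simps)
 hence eq: "evp v q = kap (poly q a) + \<pi> * evp v q'"
  by(metis evp_add evp_const evp_linear evp_mult \<pi>_def)
 have "evp v q' : P" by(induction q') (auto simp: evp_0 evp_pCons v P PR)
 hence m: "\<pi> * evp v q' : maxid P" by(rule maxid_mult[OF P(1) pi(1)])
 show ?thesis
 proof (rule ccontr)
  assume "~ unit_of P (evp v q)"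
  moreover have "evp v q : P" by(induction q) (auto simp: evp_0 evp_pCons v P PR)
  ultimately have e: "evp v q : maxid P" by(simp add: maxid_def)
  have "- 1 * (\<pi> * evp v q') : maxid P" using maxid_mult[OF P(1) m, of "- 1"] PR by(simp add: mult.commute)
  hence "evp v q + - 1 * (\<pi> * evp v q') : maxid P" using P(4) e by blast
  hence "kap (poly q a) : maxid P" using eq by simp
  thus False using kap_unit[OF P(1) P(6) assms] by(simp add: maxid_def)
 qed
qed

private lemma evp_factor: "q ~= 0 ==> EX u. unit_of P u & evp v q = \<pi> ^ order a q * u"
proof -
 assume "q ~= 0"
 from order_decomp[OF this, of a] obtain q' where q': "q = [:- a, 1:] ^ order a q * q'" "~ [:- a, 1:] dvd q'"
  by blast
 have "evp v q = evp v ([:- a, 1:] ^ order a q * q')" using q'(1) by simp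
 also have "... = \<pi> ^ order a q * evp v q'" by(simp add: evp_mult evp_power evp_linear \<pi>_def)
 finally show ?thesis using evp_unit[of q'] q'(2) by(auto simp: poly_eq_0_iff_dvd)
qed

text \<open>On k(w) the valuation is that of the point v = a of the line, so every value is a
  multiple of the value of \<pi>.\<close>

private lemma K0_factor:
 assumes "c : K0" "c ~= 0" shows "EX i u. unit_of P u & c = \<pi> powi i * u"
proof -
 obtain p q where pq: "c = evp v p / evp v q" "q ~= 0" using assms(1) v(2) unfolding ratfun_def by blast
 have "p ~= 0" using assms(2) pq by(auto simp: evp_0)
 then obtain u where u: "unit_of P u" "evp v p = \<pi> ^ order a p * u" using evp_factor by blast
 obtain u' where u': "unit_of P u'" "evp v q = \<pi> ^ order a q * u'" using evp_factor pq by blast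
 have "c = \<pi> powi (int (order a p) - int (order a q)) * (u * inverse u')"
  unfolding pq(1) u(2) u'(2) using pi(2) by(simp add: power_int_diff divide_inverse)
 moreover have "unit_of P (u * inverse u')" using u u' unit_of_mult[OF P(1)] unit_of_inverse by blast
 ultimately show ?thesis by blast
qed

text \<open>After division by the smallest power of \<open>\<pi>\<close> that occurs, an algebraic relation over \<open>k(w)\<close> has
 coefficients in \<open>P\<close> and one of them is a unit.\<close>

private lemma unit_relation:
 assumes f: "f : K"
 shows "EX c. (ALL i<=lam. c i : P & (c i ~= 0 --> (EX j u. unit_of P u & c i = \<pi> ^ j * u))) &
  (EX i<=lam. unit_of P (c i)) & (SUM i<=lam. c i * f ^ i) = 0"
proof -
 obtain c where c: "ALL i. c i : K0" "EX i:{..lam}. c i ~= 0" "(SUM i<=lam. c i * f ^ i) = 0"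
  using dependent_K0[of "{..lam}" "%i. f ^ i"] f KR by auto
 define J where "J = {i. i <= lam & c i ~= 0}"
 have J: "finite J" "J ~= {}" using c(2) by(auto simp: J_def)
 have "ALL i:J. EX n u. unit_of P u & c i = \<pi> powi n * u" using K0_factor c(1) by(simp add: J_def)
 then obtain n u where nu: "!!i. i : J ==> unit_of P (u i) & c i = \<pi> powi n i * u i" by metis
 define n0 where "n0 = Min (n ` J)"
 have n0: "!!i. i : J ==> n0 <= n i" using J by(simp add: n0_def)
 obtain i0 where i0: "i0 : J" "n i0 = n0" using Min_in[of "n ` J"] J unfolding n0_def by fastforce
 define c' where "c' i = \<pi> powi (- n0) * c i" for i
 have c'J: "c' i = \<pi> ^ nat (n i - n0) * u i" if "i : J" for i
 proof -
  have "c' i = \<pi> powi (n i - n0) * u i"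
   using nu[OF that] pi(2) unfolding c'_def by(simp add: mult.assoc[symmetric] power_int_add[symmetric])
  thus ?thesis using n0[OF that] by(simp add: power_int_def)
 qed
 have c'0: "c' i = 0" if "i <= lam" "i ~: J" for i using that by(simp add: c'_def J_def)
 have 1: "c' i : P & (c' i ~= 0 --> (EX j u. unit_of P u & c' i = \<pi> ^ j * u))" if "i <= lam" for i
 proof (cases "i : J")
  case True
  have "u i : P" using nu[OF True] by(simp add: unit_of_def)
  hence "c' i : P" unfolding c'J[OF True] by(intro PR(5) subring_power[OF P(1)] pi(3))
  thus ?thesis using c'J[OF True] nu[OF True] by blast
 next
  case False
  thus ?thesis using c'0[OF that] PR by simp
 qed
 have 2: "unit_of P (c' i0)" using c'J[OF i0(1)] i0(2) nu[OF i0(1)] by simp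
 have "(SUM i<=lam. c' i * f ^ i) = \<pi> powi (- n0) * (SUM i<=lam. c i * f ^ i)"
  unfolding sum_distrib_left c'_def by(simp add: mult.assoc)
 hence "(SUM i<=lam. c' i * f ^ i) = 0" using c(3) by simp
 moreover have "i0 <= lam" using i0(1) by(simp add: J_def)
 ultimately show ?thesis using 1 2 by(intro exI[of _ c']) blast
qed

private lemma valuation: "valuation_ring_of K P" unfolding valuation_ring_of_def
proof (intro conjI ballI impI K_subfield P(1,2))
 fix f assume f: "f : K" "f ~= 0"
 obtain c where c: "ALL i<=lam. c i : P" "EX i<=lam. unit_of P (c i)" "(SUM i<=lam. c i * f ^ i) = 0"
  using unit_relation[OF f(1)] by blast
 show "f : P | inverse f : P"
  by(rule unit_coeff_imp_valuation[OF P(1,2) K_subfield P(3,4) f, of lam c]) (use c in auto)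
qed

text \<open>After division by powers of f, the relation has a nonzero constant coefficient. This is
  a unit times a power of \<pi>, and by the relation it is a multiple of f in P.\<close>

private lemma cofinal:
 assumes f: "f : maxid P" "f ~= 0" shows "EX j. \<pi> ^ j / f : P"
proof -
 have fP: "f : P" "f : K" using f P(2) by(auto simp: maxid_def)
 obtain c where c: "ALL i<=lam. c i : P & (c i ~= 0 --> (EX j u. unit_of P u & c i = \<pi> ^ j * u))"
  "EX i<=lam. unit_of P (c i)" "(SUM i<=lam. c i * f ^ i) = 0"
  using unit_relation[OF fP(2)] by blast
 have "EX j. \<pi> ^ j / f : P" if "q ~= 0" "poly q f = 0" and
  "ALL i. coeff q i : P & (coeff q i ~= 0 --> (EX j u. unit_of P u & coeff q i = \<pi> ^ j * u))" for q
  using that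
 proof (induction q)
  case (pCons e q)
  have q: "ALL i. coeff q i : P & (coeff q i ~= 0 --> (EX j u. unit_of P u & coeff q i = \<pi> ^ j * u))"
   using pCons.prems(3) by(metis coeff_pCons_Suc)
  show ?case
  proof (cases "e = 0")
   case True
   thus ?thesis using pCons f(2) q by auto
  next
   case False
   then obtain j u where u: "unit_of P u" "e = \<pi> ^ j * u" using pCons.prems(3) by(metis coeff_pCons_0)
   have "poly q f : P" unfolding poly_altdef
    using q by(intro subring_sum[OF P(1)] PR(5) subring_power[OF P(1)] fP(1)) blast
   hence "- poly q f * inverse u : P" using u(1) PR(3,5) by(simp add: unit_of_def)
   moreover have "e = - poly q f * f" using pCons.prems(2) by(simp add: eq_neg_iff_add_eq_0 mult.commute)
   hence "\<pi> ^ j / f = - poly q f * inverse u" using u f(2) by(auto simp: unit_of_def field_simps)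
   ultimately show ?thesis by metis
  qed
 qed simp
 note ex = this
 have co: "coeff (SUM i<=lam. monom (c i) i) i = (if i <= lam then c i else 0)" for i
  by(simp add: coeff_sum)
 show ?thesis
 proof (rule ex)
  show "(SUM i<=lam. monom (c i) i) ~= 0" using c(2) co by(metis coeff_0 unit_of_def)
  show "poly (SUM i<=lam. monom (c i) i) f = 0" using c(3) by(simp add: poly_sum poly_monom)
 qed (use c(1) PR(1) in \<open>simp add: co\<close>)
qed

text \<open>The values of such a chain are distinct modulo multiples of the value of \<pi>, and
  nonzero factors from k(w) change values only by such multiples. So the lam + 1 members would be
  independent over k(w).\<close>

private lemma chains:
 assumes y: "ALL i<=lam. Y i : K & Y i ~= 0" and up: "ALL i<lam. Y (Suc i) / Y i : maxid P"
  and last: "\<pi> * Y 0 / Y lam : maxid P" shows False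
proof -
 obtain c where c: "ALL i. c i : K0" "EX i:{..lam}. c i ~= 0" "(SUM i<=lam. c i * Y i) = 0"
  using dependent_K0[of "{..lam}" Y] y by auto
 define J where "J = {i. i <= lam & c i ~= 0}"
 have mP: "f : P" if "f : maxid P" for f using that by(simp add: maxid_def)
 have step: "Y j / Y i : maxid P" if "i < j" "j <= lam" for i j using that
 proof (induction j)
  case (Suc j)
  have 1: "Y (Suc j) / Y j : maxid P" using up Suc.prems by simp
  show ?case
  proof (cases "i = j")
   case False
   hence "Y j / Y i : P" using Suc mP by simp
   hence "(Y (Suc j) / Y j) * (Y j / Y i) : maxid P" by(rule maxid_mult[OF P(1) 1])
   moreover have "Y j ~= 0" using y Suc.prems by simp
   ultimately show ?thesis by simp
  qed (use 1 in simp)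
 qed simp
 have stepP: "Y j / Y i : P" if "i <= j" "j <= lam" for i j
 proof (cases "i = j")
  case True
  thus ?thesis using y that PR(2) by simp
 qed (use step[of i j] that mP in simp)
 have down: "\<pi> * Y i / Y j : maxid P" if "i < j" "j <= lam" for i j
 proof -
  have nz: "Y 0 ~= 0" "Y lam ~= 0" "Y i ~= 0" "Y j ~= 0" using y that by simp_all
  have "(\<pi> * Y 0 / Y lam) * ((Y i / Y 0) * (Y lam / Y j)) : maxid P"
   using that by(intro maxid_mult[OF P(1) last] PR(5) stepP) simp_all
  thus ?thesis using nz by simp
 qed
 have non: "~ unit_of P ((c j * Y j) / (c i * Y i)) & ~ unit_of P ((c i * Y i) / (c j * Y j))"
  if ij: "i < j" "i : J" "j : J" for i j
 proof -
  have nz: "Y i ~= 0" "Y j ~= 0" "c i ~= 0" "c j ~= 0" using y ij by(auto simp: J_def)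
  have "c j / c i : K0" using c(1) K0R(7) by blast
  moreover have "c j / c i ~= 0" using nz by simp
  ultimately obtain n u where u: "unit_of P u" "c j / c i = \<pi> powi n * u" using K0_factor by blast
  have uP: "u : P" "u ~= 0" "inverse u : P" using u(1) by(auto simp: unit_of_def)
  have jl: "j <= lam" using ij by(simp add: J_def)
  have "(c j * Y j) / (c i * Y i) : maxid P | (c i * Y i) / (c j * Y j) : maxid P"
  proof (cases "n >= 0")
   case True
   have "(c j * Y j) / (c i * Y i) = (c j / c i) * (Y j / Y i)" by simp
   also have "... = (Y j / Y i) * (\<pi> ^ nat n * u)" unfolding u(2) using True by(simp add: power_int_def)
   also have "... : maxid P"
    by(intro maxid_mult[OF P(1) step[OF ij(1) jl]] PR(5) subring_power[OF P(1)] pi uP)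
   finally show ?thesis by blast
  next
   case False
   define k where "k = nat (- n - 1)"
   have k: "n = - int (Suc k)" using False by(simp add: k_def)
   have "(c i * Y i) / (c j * Y j) = inverse (c j / c i) * (Y i / Y j)" using nz by simp
   also have "... = (\<pi> ^ Suc k * inverse u) * (Y i / Y j)"
    unfolding u(2) k by(simp add: power_int_minus power_int_of_nat del: of_nat_Suc power_Suc)
   also have "... = (\<pi> * Y i / Y j) * (\<pi> ^ k * inverse u)" by simp
   also have "... : maxid P"
    by(intro maxid_mult[OF P(1) down[OF ij(1) jl]] PR(5) subring_power[OF P(1)] pi uP)
   finally show ?thesis by blast
  qed
  thus ?thesis
   using unit_of_inverse[of P "(c i * Y i) / (c j * Y j)"] unit_of_inverse[of P "(c j * Y j) / (c i * Y i)"]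
   by(auto simp: maxid_def)
 qed
 have "(SUM i:J. c i * Y i) ~= 0"
 proof (rule sum_distinct_values_nonzero[OF valuation])
  show "finite J" "J ~= {}" using c(2) by(auto simp: J_def)
  have cK: "c i : K" for i using c(1) K0_K by blast
  show "c i * Y i : K & c i * Y i ~= 0" if "i : J" for i
   using that y KR(5)[OF cK] by(simp add: J_def)
  show "~ unit_of P (c i * Y i / (c j * Y j))" if "i : J" "j : J" "i ~= j" for i j
   using non[of i j] non[of j i] that by(cases i j rule: linorder_cases) auto
 qed
 moreover have "(SUM i:J. c i * Y i) = (SUM i<=lam. c i * Y i)"
  by(intro sum.mono_neutral_left) (auto simp: J_def)
 ultimately show False using c(3) by simp
qed

private lemma dvr_P: "dvr K P"
 using dvr_of_bounded_chains[OF valuation pi(1,2), of lam] chains cofinal by blast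

lemmas place_facts = dvr_P evp_factor[unfolded \<pi>_def] K0_factor[unfolded \<pi>_def] pi(2)[unfolded \<pi>_def]

end

lemma place_coordinate:
 assumes "place P"
 shows "EX v a. transc v & ratfun v = K0 & v : P & v - kap a : maxid P & (v = w | v = inverse w)"
proof -
 have "w : P | inverse w : P" and r: "!!f. f : P ==> EX c. f - kap c : maxid P"
  using assms unfolding place_def by blast+
 thus ?thesis using transc_w transc_inverse_w ratfun_inverse_w by blast
qed

lemma place_dvr:
 assumes "place P" shows "dvr K P"
proof -
 obtain v a where "transc v" "ratfun v = K0" "v : P" "v - kap a : maxid P"
  using place_coordinate[OF assms] by blast
 from place_facts(1)[OF assms this] show ?thesis .
qed

lemma pts_place: "P : pts ==> place P" unfolding pts_def using place_lies_over by blast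

lemmas pts_dvr = place_dvr[OF pts_place]

end

section \<open>Existence of places, and places as points\<close>

lemma exists_maximal_ideal:
 assumes B: "is_subring (B :: 'a::field set)" shows "EX I. maximal_ideal_of B I"
proof -
 define \<A> where "\<A> = {J. ideal_of B J & 1 ~: J}"
 have "{0} : \<A>" using subringD(1)[OF B] by(auto simp: \<A>_def ideal_of_def)
 hence ne: "\<A> ~= {}" by blast
 have ch: "\<Union>C : \<A>" if C: "C ~= {}" "subset.chain \<A> C" for C
 proof -
  have C\<A>: "C <= \<A>" and total: "!!J J'. J : C ==> J' : C ==> J <= J' | J' <= J"
   using C(2) unfolding subset.chain_def by auto
  have J: "J <= B" "0 : J" "f : J ==> g : J ==> f + g : J" "b : B ==> f : J ==> b * f : J" "1 ~: J"
   if "J : C" for J f g b using C\<A> that unfolding \<A>_def ideal_of_def by blast+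
  have add: "f + g : \<Union>C" if fg: "f : \<Union>C" "g : \<Union>C" for f g
  proof -
   obtain J J' where "J : C" "f : J" "J' : C" "g : J'" using fg by blast
   thus ?thesis using total[of J J'] J(3) by blast
  qed
  have mul: "b * f : \<Union>C" if b: "b : B" and f: "f : \<Union>C" for b f
  proof -
   obtain J where "J : C" "f : J" using f by blast
   thus ?thesis using J(4)[OF _ b] by blast
  qed
  have sub: "\<Union>C <= B" using J(1) by blast
  have zero: "0 : \<Union>C" using J(2) C(1) by blast
  have "1 ~: \<Union>C" using J(5) by blast
  thus ?thesis using add mul sub zero unfolding \<A>_def ideal_of_def by simp
 qed
 obtain I where I: "I : \<A>" "ALL J:\<A>. I <= J --> J = I" using subset_Zorn_nonempty[OF ne ch] by blast
 have "J = I | J = B" if J: "ideal_of B J" "I <= J" for J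
 proof (cases "1 : J")
  case True
  have "b : J" if "b : B" for b
  proof -
   have "b * 1 : J" using J(1) True that unfolding ideal_of_def by blast
   thus ?thesis by simp
  qed
  thus ?thesis using J(1) unfolding ideal_of_def by blast
 next
  case False
  thus ?thesis using I(2) J unfolding \<A>_def by blast
 qed
 moreover have "ideal_of B I" "I ~= B" using I(1) subringD(2)[OF B] unfolding \<A>_def by auto
 ultimately show ?thesis unfolding maximal_ideal_of_def by blast
qed

lemma dvr_neq: "dvr K P ==> P ~= K"
proof
 assume D: "dvr K P" and "P = K"
 obtain t where t: "t : K" "t ~= 0" "uniformizer P t" using exists_uniformizer[OF D] by blast
 hence "inverse t : P" "t : P" using \<open>P = K\<close> dvrD(1)[OF D] by(auto simp: subfield_inverse)
 hence "unit_of P t" using t by(simp add: unit_of_def)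
 thus False using uniformizer_maxid[OF dvrD(2)[OF D] t(3)] by(simp add: maxid_def)
qed

context trinomial_curve
begin

text \<open>The local ring of the affine line with coordinate v at the point a, together with the
  values of its elements.\<close>

definition av :: "'l => 'k => 'l => 'k => bool" where
 "av v a f c \<longleftrightarrow> (EX p q. poly q a ~= 0 & poly p a = c * poly q a & f = evp v p / evp v q)"

lemma avI: "poly q a ~= 0 ==> poly p a = c * poly q a ==> av v a (evp v p / evp v q) c"
 unfolding av_def by blast

lemma local_ring_av:
 assumes v: "transc v" "v : K" shows "local_ring_with {f. EX c. av v a f c} {f. av v a f 0}"
proof (rule local_ring_withI)
 have nz: "evp v q ~= 0" if "poly q a ~= 0" for q
  using evp_eq_0_iff[OF v(1)] that by(metis poly_0)
 show "av v a (kap c) c" for c using avI[of 1 a "[:c:]" c] by(simp add: evp_const evp_1)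
 show "f : K" if "av v a f c" for f c
  using that evp_in_subfield[OF K_subfield kap_K v(2)] KR(7) unfolding av_def by blast
 show "f ~= 0 & (EX e. av v a (inverse f) e)" if f: "av v a f c" "c ~= 0" for f c
 proof -
  obtain p q where e: "poly q a ~= 0" "poly p a = c * poly q a" "f = evp v p / evp v q"
   using f(1) unfolding av_def by blast
  have p: "poly p a ~= 0" using e f(2) by simp
  thus ?thesis using nz[OF e(1)] nz[OF p] avI[OF p, of q "inverse c"] e f(2) by auto
 qed
 fix f g c e assume "av v a f c" "av v a g e"
 then obtain p q p' q' where e: "poly q a ~= 0" "poly p a = c * poly q a" "f = evp v p / evp v q"
  "poly q' a ~= 0" "poly p' a = e * poly q' a" "g = evp v p' / evp v q'" unfolding av_def by blast
 have "f + g = evp v (p * q' + p' * q) / evp v (q * q')" "f * g = evp v (p * p') / evp v (q * q')"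
  using nz[OF e(1)] nz[OF e(4)] unfolding e(3,6) by(simp_all add: evp_add evp_mult add_frac_eq)
 thus "av v a (f + g) (c + e)" "av v a (f * g) (c * e)" using e
  by(simp_all only:) (rule avI; simp add: algebra_simps)+
qed

text \<open>The integral closure in K of the local ring of the line at a is localized at any of its
  maximal ideals; this contains v - a by lying over.\<close>

lemma exists_place:
 assumes v: "v = w | v = inverse w" shows "EX P. place P & v - kap a : maxid P"
proof -
 have vK: "transc v" "v : K" using v transc_w transc_inverse_w w_K KR(6) by auto
 note L0 = local_ring_av[OF vK, of a]
 let ?A = "{f. EX c. av v a f c}"
 have sub: "is_subring (integral_closure_in K ?A)"
  using subring_integral_closure[OF K_subfield] L0 unfolding local_ring_with_def by blast
 obtain I where I: "maximal_ideal_of (integral_closure_in K ?A) I" using exists_maximal_ideal[OF sub] by blast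
 define P where "P = localization_at (integral_closure_in K ?A) I"
 note L = localization_props[OF L0 refl I, folded P_def]
 have "av v a (evp v [:0, 1:] / evp v 1) a" "av v a (evp v [:- a, 1:] / evp v 1) 0" by(rule avI; simp)+
 hence "v : ?A" and m: "v - kap a : {f. av v a f 0}" by(auto simp: evp_X evp_1 evp_linear)
 hence "w : P | inverse w : P" using L(7) v by auto
 hence "place P" unfolding place_def using L(1-6) by blast
 thus ?thesis using L(9) m by blast
qed

context
 fixes P :: "'l set"
 assumes pl: "place P"
begin

private lemma Pl: "is_subring P" "P <= K" "f : K ==> integral_over P f ==> f : P"
  "f : maxid P ==> g : maxid P ==> f + g : maxid P" "f : P ==> EX c. f - kap c : maxid P" "kap c : P"
 using pl unfolding place_def by blast+

private lemmas PlR = subringD[OF Pl(1)]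

lemma maxid_P_in: "f : maxid P ==> f : P" by(simp add: maxid_def)

lemma kap_maxid_iff: "kap c : maxid P \<longleftrightarrow> c = 0"
 using kap_unit[OF Pl(1) Pl(6), of c] zero_maxid[OF Pl(1)] by(auto simp: maxid_def kap_0)

lemma maxid_uminus: "f : maxid P ==> - f : maxid P"
 using maxid_mult[OF Pl(1), of f "- 1"] PlR(2,3) by simp

lemma maxid_cong_mult:
 assumes "f - kap c : maxid P" "g - kap e : maxid P" shows "f * g - kap (c * e) : maxid P"
proof -
 have f: "f : P" using PlR(4)[OF maxid_P_in[OF assms(1)] Pl(6)[of c]] by simp
 have "f * g - kap (c * e) = (g - kap e) * f + (f - kap c) * kap e" by(simp add: kap_mult algebra_simps)
 thus ?thesis using maxid_mult[OF Pl(1) assms(2) f] maxid_mult[OF Pl(1) assms(1) Pl(6)] Pl(4) by metis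
qed

lemma maxid_cong_add:
 assumes "f - kap c : maxid P" "g - kap e : maxid P" shows "f + g - kap (c + e) : maxid P"
proof -
 have "f + g - kap (c + e) = (f - kap c) + (g - kap e)" by(simp add: kap_add)
 thus ?thesis using Pl(4) assms by metis
qed

lemma maxid_cong_kap: "kap c - kap c : maxid P" using zero_maxid[OF Pl(1)] by simp

lemma maxid_cong_power: "f - kap c : maxid P ==> f ^ n - kap (c ^ n) : maxid P"
proof (induction n)
 case 0
 show ?case using maxid_cong_kap[of 1] by(simp add: kap_1)
next
 case (Suc n)
 thus ?case using maxid_cong_mult[OF Suc.prems Suc.IH] by simp
qed

lemma maxid_cong_sum: "(!!i. i : A ==> f i - kap (c i) : maxid P) ==> sum f A - kap (sum c A) : maxid P"
proof (induction A rule: infinite_finite_induct)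
 case (insert x F)
 thus ?case using maxid_cong_add[of "f x" "c x" "sum f F" "sum c F"] by simp
qed (use maxid_cong_kap[of 0] in \<open>simp_all add: kap_0\<close>)

lemma maxid_cong_prod: "(!!i. i : A ==> f i - kap (c i) : maxid P) ==> prod f A - kap (prod c A) : maxid P"
proof (induction A rule: infinite_finite_induct)
 case (insert x F)
 thus ?case using maxid_cong_mult[of "f x" "c x" "prod f F" "prod c F"] by simp
qed (use maxid_cong_kap[of 1] in \<open>simp_all add: kap_1\<close>)

lemma maxid_cong_unit: "f - kap c : maxid P ==> c ~= 0 ==> unit_of P f"
proof (rule ccontr)
 assume f: "f - kap c : maxid P" "c ~= 0" and n: "~ unit_of P f"
 have "f : P" using PlR(4)[OF maxid_P_in[OF f(1)] Pl(6)[of c]] by simp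
 hence "f : maxid P" using n by(simp add: maxid_def)
 hence "f + - (f - kap c) : maxid P" using Pl(4) maxid_uminus f by blast
 thus False using f(2) kap_maxid_iff[of c] by simp
qed

text \<open>The valuative criterion. Dividing by a variable of least order makes all coordinates
  regular; their residues form a point b of the curve whose local ring lies in P. The localization
  of its integral closure at the trace of the maximal ideal of P is a discrete valuation ring inside
  P, so it equals P by \<open>dvr_maximal\<close>.\<close>

lemma place_complete: "P : pts"
proof -
 have D: "dvr K P" by(rule place_dvr[OF pl])
 define i0 where "i0 = arg_min_on (%i. ord_at P (X $ i / X $ x)) UNIV"
 have min: "ord_at P (X $ i0 / X $ x) <= ord_at P (X $ i / X $ x)" for i
  unfolding i0_def by(rule arg_min_least) auto
 have XP: "X $ i / X $ i0 : P" for i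
 proof -
  have "X $ i / X $ i0 = (X $ i / X $ x) / (X $ i0 / X $ x)" by(simp add: X_nonzero)
  hence "0 <= ord_at P (X $ i / X $ i0)"
   using ord_divide[OF D, of "X $ i / X $ x" "X $ i0 / X $ x"] X_ratio_K X_nonzero min[of i] by simp
  thus ?thesis using mem_iff_ord[OF D, of "X $ i / X $ i0"] X_ratio_K X_nonzero by simp
 qed
 hence "ALL i. EX c. X $ i / X $ i0 - kap c : maxid P" using Pl(5) by blast
 then obtain c where c: "!!i. X $ i / X $ i0 - kap (c i) : maxid P" by metis
 define b :: "'k ^ 3" where "b = (\<chi> i. c i)"
 have "c i0 ~= 0"
 proof
  assume "c i0 = 0"
  hence "1 : maxid P" using c[of i0] X_nonzero by(simp add: kap_0)
  thus False using unit_of_1[OF Pl(1)] by(simp add: maxid_def)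
 qed
 hence b0: "b ~= 0" by(auto simp: b_def fvec_eq_iff)
 have F: "\<iota> F / X $ i0 ^ m - kap (eval3 F b) : maxid P" if "homogeneous m F" for F m
 proof -
  have "\<iota> F / X $ i0 ^ m = (SUM e:Poly_Mapping.keys F. kap (Poly_Mapping.lookup F e) * (PROD i:UNIV. (X $ i / X $ i0) ^ (e $ i)))"
   unfolding iota_repr[of F] sum_divide_distrib
  proof (intro sum.cong refl)
   fix e assume "e : Poly_Mapping.keys F"
   hence "m = (SUM i:UNIV. e $ i)" using that by(auto simp: homogeneous_def deg3_def)
   hence "X $ i0 ^ m = (PROD i:UNIV. X $ i0 ^ (e $ i))" by(simp add: power_sum)
   thus "kap (Poly_Mapping.lookup F e) * mon3 X e / X $ i0 ^ m =
     kap (Poly_Mapping.lookup F e) * (PROD i:UNIV. (X $ i / X $ i0) ^ (e $ i))"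
    by(simp add: mon3_def power_divide prod_dividef)
  qed
  moreover have "eval3 F b = (SUM e:Poly_Mapping.keys F. Poly_Mapping.lookup F e * (PROD i:UNIV. c i ^ (e $ i)))"
   by(simp add: eval3_def b_def)
  ultimately show ?thesis
   by(simp only:) (intro maxid_cong_sum maxid_cong_mult maxid_cong_kap maxid_cong_prod maxid_cong_power c)
 qed
 have b: "on_curve h b"
 proof -
  have "\<iota> h = 0" by(simp add: iota_eq_0_iff)
  hence "kap (- eval3 h b) : maxid P" using F[OF homogeneous_h] by(simp add: kap_uminus)
  thus ?thesis using b0 kap_maxid_iff by(simp add: on_curve_def)
 qed
 have lrP: "lr b <= P"
 proof
  fix f assume "f : lr b"
  then obtain G H m where G: "homogeneous m G" "homogeneous m H" "eval3 H b ~= 0" "f = \<iota> G / \<iota> H"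
   using lrE by blast
  have "unit_of P (\<iota> H / X $ i0 ^ m)" using maxid_cong_unit[OF F[OF G(2)] G(3)] .
  hence "inverse (\<iota> H / X $ i0 ^ m) : P" by(simp add: unit_of_def)
  moreover have "\<iota> G / X $ i0 ^ m : P"
   using PlR(4)[OF maxid_P_in[OF F[OF G(1)]] Pl(6)[of "eval3 G b"]] by simp
  ultimately have "(\<iota> G / X $ i0 ^ m) * inverse (\<iota> H / X $ i0 ^ m) : P" using PlR(5) by blast
  thus "f : P" using G(4) X_nonzero by simp
 qed
 define B where "B = integral_closure_in K (lr b)"
 have BP: "B <= P"
 proof
  fix f assume "f : B"
  hence "f : K" "integral_over (lr b) f" by(auto simp: B_def integral_closure_in_altdef)
  moreover from this have "integral_over P f" unfolding integral_over_def using lrP by blast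
  ultimately show "f : P" using Pl(3) by blast
 qed
 have Bsub: "is_subring B" unfolding B_def by(rule subring_integral_closure[OF K_subfield lr_subring[OF b]])
 have kB: "kap e : B" for e unfolding B_def integral_closure_in_altdef
  using kap_K integral_over_base[OF lr_subring[OF b] kap_lr] by blast
 define I where "I = B \<inter> maxid P"
 have one: "1 ~: maxid P" using unit_of_1[OF Pl(1)] by(simp add: maxid_def)
 have I: "maximal_ideal_of B I" unfolding maximal_ideal_of_def
 proof (intro conjI allI impI)
  have mul: "u * f : maxid P" if "u : B" "f : maxid P" for u f
   using maxid_mult[OF Pl(1) that(2), of u] that(1) BP by(auto simp: mult.commute)
  show "ideal_of B I" unfolding ideal_of_def I_def
  proof (intro conjI ballI)
   show "0 : B \<inter> maxid P" using subringD(1)[OF Bsub] zero_maxid[OF Pl(1)] by blast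
   show "f + g : B \<inter> maxid P" if "f : B \<inter> maxid P" "g : B \<inter> maxid P" for f g
    using that subringD(4)[OF Bsub] Pl(4) by simp
   show "u * f : B \<inter> maxid P" if "u : B" "f : B \<inter> maxid P" for u f
    using that subringD(5)[OF Bsub] mul by simp
  qed simp
  show "I ~= B" using one subringD(2)[OF Bsub] by(auto simp: I_def)
  fix J assume J: "ideal_of B J & I <= J"
  show "J = I | J = B"
  proof (cases "J <= I")
   case False
   then obtain f where f: "f : J" "f ~: I" by blast
   have fB: "f : B" using J f by(auto simp: ideal_of_def)
   \<comment> \<open>An element of J outside I has a nonzero residue e, and subtracting e leaves an
     element of I; so J contains a nonzero constant.\<close>
   obtain e where e: "f - kap e : maxid P" using Pl(5) fB BP by blast
   have "e ~= 0" using e f(2) fB by(auto simp: I_def kap_0)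
   have "f - kap e : J" using e fB kB[of e] subring_diff[OF Bsub] J by(auto simp: I_def)
   moreover have Jadd: "u + t : J" if "u : J" "t : J" for u t
    using J that by(auto simp: ideal_of_def)
   moreover have Jmul: "g * u : J" if "g : B" "u : J" for g u
    using J that by(auto simp: ideal_of_def)
   ultimately have "kap (- 1) * (f - kap e) : J" using kB by simp
   hence "f + kap (- 1) * (f - kap e) : J" using Jadd f(1) by simp
   hence "kap e : J" by(simp add: kap_uminus kap_1)
   hence "kap (inverse e) * kap e : J" using Jmul kB by simp
   hence one_J: "1 : J" using \<open>e \<noteq> 0\<close> by(simp add: kap_mult[symmetric] kap_1)
   have "u : J" if "u : B" for u using Jmul[OF that one_J] by simp
   thus ?thesis using J by(auto simp: ideal_of_def)
  qed (use J in blast)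
 qed
 have "lies_over \<iota> h (localization_at B I) b" unfolding lies_over_def Let_def using b I B_def by blast
 hence Q: "localization_at B I : pts" unfolding pts_def by blast
 have "localization_at B I <= P"
 proof
  fix f assume "f : localization_at B I"
  then obtain u t where u: "u : B" "t : B" "t ~: I" "f = u / t" unfolding localization_at_def by blast
  hence "unit_of P t" using BP by(auto simp: I_def maxid_def)
  hence "inverse t : P" by(simp add: unit_of_def)
  thus "f : P" using u BP PlR(5) by(auto simp: divide_inverse)
 qed
 hence "P = localization_at B I" using dvr_maximal[OF pts_dvr[OF Q] Pl(1) _ Pl(2) dvr_neq[OF D]] by blast
 thus ?thesis using Q by simp
qed

end

lemma place_sig:
 assumes c: "admissible c" and P: "place P" shows "place (sig c ` P)"
proof -
 note T = sig_autom[OF c]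
 let ?c = "\<chi> i. inverse (c $ i)" and ?Q = "sig c ` P"
 have R: "is_subring P" and PK: "P <= K" and int: "!!f. f : K ==> integral_over P f ==> f : P"
  and add: "!!f g. f : maxid P ==> g : maxid P ==> f + g : maxid P"
  and res: "!!f. f : P ==> EX e. f - kap e : maxid P" and kP: "!!e. kap e : P" and wP: "w : P | inverse w : P"
  using P unfolding place_def by blast+
 have QK: "?Q <= K" using sig_K[OF c] PK by blast
 have m: "maxid ?Q = sig c ` maxid P"
  unfolding maxid_def using autom_unit_iff[OF K_subfield T PK] PK by(auto simp: subset_iff)
 have mK: "f : K" if "f : maxid P" for f using that PK by(auto simp: maxid_def)
 have 1: "f : ?Q" if f: "f : K" "integral_over ?Q f" for f
 proof -
  have "sig ?c (sig c g) = g" if "g : P" for g using sig_inverse[OF c] PK that by blast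
  hence "sig ?c ` ?Q = P" unfolding image_image by simp
  hence "sig ?c f : P" using int[OF sig_K[OF admissible_inverse[OF c] f(1)]]
    autom_integral_over[OF K_subfield sig_autom[OF admissible_inverse[OF c]] QK f] by simp
  thus ?thesis using sig_inverse'[OF c f(1)] by(metis imageI)
 qed
 have 2: "f + g : maxid ?Q" if "f : maxid ?Q" "g : maxid ?Q" for f g
 proof -
  obtain u v where uv: "u : maxid P" "v : maxid P" "f = sig c u" "g = sig c v" using \<open>f \<in> _\<close> \<open>g \<in> _\<close> unfolding m by blast
  thus ?thesis using imageI[OF add[OF uv(1,2)], of "sig c"] autom_add[OF K_subfield T mK mK, OF uv(1,2)] unfolding m by simp
 qed
 have 3: "EX e. f - kap e : maxid ?Q" if fQ: "f : ?Q" for f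
 proof -
  obtain u where u: "u : P" "f = sig c u" using fQ by blast
  obtain e where e: "u - kap e : maxid P" using res[OF u(1)] by blast
  have "sig c (u + kap (- e)) = f + kap (- e)"
   using autom_add[OF K_subfield T _ kap_K] u PK sig_kap[OF c] by auto
  thus ?thesis using imageI[OF e, of "sig c"] unfolding m by(auto simp: kap_uminus)
 qed
 have 4: "kap e : ?Q" for e using imageI[OF kP, of "sig c"] sig_kap[OF c] by metis
 have 5: "w : ?Q | inverse w : ?Q"
  using wP sig_w[OF c] autom_inverse[OF K_subfield T w_K] by(metis imageI)
 show ?thesis unfolding place_def by(intro conjI ballI impI allI)
   (rule autom_subring[OF K_subfield T R PK] QK 4 5 | erule (1) 2 | erule 3 | erule (1) 1)+
qed

lemma sig_pts: "admissible c ==> P : pts ==> sig c ` P : pts"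
 using place_complete[OF place_sig[OF _ pts_place]] .

end

section \<open>Fibres over the projective line\<close>

lemma dvr_incomparable:
 assumes "dvr K P" "dvr K Q" "P ~= Q" shows "EX f:P. f ~: Q"
 using dvr_maximal[OF assms(1) dvrD(2)[OF assms(2)] _ dvrD(3)[OF assms(2)] dvr_neq[OF assms(2)]] assms(3)
 by blast

text \<open>Induction on T. To a function z that serves for T one adds a high power of some u with a
  zero at P and a pole at the new point Q.\<close>

lemma exists_separating:
 assumes "finite T" "dvr K P" "P ~: T" "!!Q. Q : T ==> dvr K Q"
 shows "EX z:K. z ~= 0 & 0 < ord_at P z & (ALL Q:T. ord_at Q z < 0)"
 using assms
proof (induction T rule: finite_induct)
 case empty
 obtain t where "t : K" "t ~= 0" "ord_at P t = 1" using exists_uniformizer[OF assms(2)] by blast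
 thus ?case by(intro bexI[of _ t]) auto
next
 case (insert Q T)
 then obtain z where z: "z : K" "z ~= 0" "0 < ord_at P z" "!!Q. Q : T ==> ord_at Q z < 0" by auto
 note DP = insert.prems(1)
 have DQ: "dvr K Q" and ne: "P ~= Q" using insert.prems by auto
 note F = dvrD(1)[OF DP]
 obtain f g where f: "f : P" "f ~: Q" and g: "g : Q" "g ~: P"
  using dvr_incomparable[OF DP DQ ne] dvr_incomparable[OF DQ DP] ne by metis
 have fg: "f : K" "f ~= 0" "g : K" "g ~= 0"
  using f g dvrD[OF DP] dvrD[OF DQ] by(auto simp: subringD)
 define u where "u = f / g"
 have u: "u : K" "u ~= 0" using fg F by(auto simp: u_def subfield_divide)
 have uP: "0 < ord_at P u" and uQ: "ord_at Q u < 0"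
  using ord_divide[OF DP fg] ord_divide[OF DQ fg] mem_iff_ord[OF DP, of f] mem_iff_ord[OF DP, of g]
   mem_iff_ord[OF DQ, of f] mem_iff_ord[OF DQ, of g] f g fg by(auto simp: u_def)
 \<comment> \<open>N exceeds the orders of z in absolute value: where u has a pole, u^N dominates z,
   and at the other points of \<open>insert Q T\<close> the pole of z dominates.\<close>
 define N where "N = Suc (nat (SUM R:insert Q T. \<bar>ord_at R z\<bar>))"
 have NT: "\<bar>ord_at R z\<bar> < int N" if "R : insert Q T" for R
  using member_le_sum[OF that, of "%R. \<bar>ord_at R z\<bar>"] insert.hyps(1) unfolding N_def by simp
 have uN: "u ^ N : K" "u ^ N ~= 0" using u subring_power[OF subfield_subring[OF F]] by auto
 define v where "v = z + u ^ N"
 have neg: "v ~= 0 & ord_at R v < 0" if R: "R : insert Q T" for R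
 proof -
  have DR: "dvr K R" using insert.prems R by blast
  have o: "ord_at R (u ^ N) = int N * ord_at R u" by(rule ord_power[OF DR u])
  show ?thesis
  proof (cases "0 <= ord_at R u")
   case True
   hence zR: "ord_at R z < 0" using z(4)[of R] R uQ by auto
   have "0 <= int N * ord_at R u" using True by simp
   hence "z + u ^ N ~= 0 & ord_at R (z + u ^ N) = ord_at R z"
    using zR o by(intro ord_add_less[OF DR z(1) uN(1) z(2)]) linarith
   thus ?thesis using zR by(simp add: v_def)
  next
   case False
   hence "int N * ord_at R u <= int N * (- 1)" by(intro mult_left_mono) auto
   hence lt: "ord_at R (u ^ N) + 1 <= ord_at R z" "ord_at R (u ^ N) < 0" using NT[OF R] o by auto
   have "u ^ N + z ~= 0 & ord_at R (u ^ N + z) = ord_at R (u ^ N)"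
    by(rule ord_add_less[OF DR uN(1) z(1) uN(2)]) (use lt in simp)
   thus ?thesis using lt by(simp add: v_def add.commute)
  qed
 qed
 have vK: "v : K" using z uN subfield_subring[OF F] by(simp add: v_def subringD)
 have "0 < N" by(simp only: N_def zero_less_Suc)
 hence "0 < int N * ord_at P u" using uP by simp
 hence "ord_ge P (u ^ N) 1" using ord_power[OF DP u, of N] by simp
 moreover have "ord_ge P z 1" using z(3) by simp
 ultimately have "ord_ge P (z + u ^ N) 1" by(intro ord_ge_add[OF DP z(1) uN(1)])
 hence "0 < ord_at P v" using neg[of Q] by(simp add: v_def)
 thus ?case using neg vK by(intro bexI[of _ v]) auto
qed

text \<open>The function 1 / (1 + z) for z as above: it has order 0 at P, and the poles of z become
  zeros.\<close>

lemma exists_isolating: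
 assumes "finite T" "dvr K P" "P ~: T" "!!Q. Q : T ==> dvr K Q"
 shows "EX z:K. z ~= 0 & ord_at P z = 0 & (ALL Q:T. 0 < ord_at Q z)"
proof -
 note F = dvrD(1)[OF assms(2)]
 obtain z where z: "z : K" "z ~= 0" "0 < ord_at P z" "!!Q. Q : T ==> ord_at Q z < 0"
  using exists_separating[OF assms] by blast
 have one: "1 : K" using subfield_subring[OF F] by(simp add: subringD)
 have P: "1 + z ~= 0 & ord_at P (1 + z) = ord_at P 1"
  using z ord_1[OF assms(2)] by(intro ord_add_less[OF assms(2) one z(1)]) auto
 have zK: "1 + z : K" using z one subfield_subring[OF F] by(simp add: subringD)
 have "0 < ord_at Q (inverse (1 + z))" if Q: "Q : T" for Q
 proof -
  note DQ = assms(4)[OF Q]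
  have "z + 1 ~= 0 & ord_at Q (z + 1) = ord_at Q z"
   using z(4)[OF Q] ord_1[OF DQ] by(intro ord_add_less[OF DQ z(1) one z(2)]) auto
  thus ?thesis using ord_inverse[OF DQ zK] P z(4)[OF Q] by(simp add: add.commute)
 qed
 moreover have "ord_at P (inverse (1 + z)) = 0" using ord_inverse[OF assms(2) zK] P ord_1[OF assms(2)] by simp
 ultimately show ?thesis using P zK F by(intro bexI[of _ "inverse (1 + z)"]) (auto simp: subfield_inverse)
qed

lemma sum_nonzero_of_min_ord:
 assumes D: "dvr K P" and "finite I" "i0 : I" "f i0 ~= 0" "!!i. i : I ==> f i : K"
  and "!!i. i : I ==> i ~= i0 ==> ord_ge P (f i) (ord_at P (f i0) + 1)"
 shows "(SUM i:I. f i) ~= 0"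
proof -
 have g: "ord_ge P (SUM i:I - {i0}. f i) (ord_at P (f i0) + 1)"
  using assms(5,6) by(intro ord_ge_sum[OF D]) auto
 have "(SUM i:I - {i0}. f i) : K"
  using assms(5) by(intro subring_sum subfield_subring dvrD(1)[OF D]) auto
 from ord_add_less[OF D assms(5)[OF assms(3)] this assms(4) g] show ?thesis
  using sum.remove[OF assms(2,3), of f] by simp
qed

section \<open>Ramification indices and the fundamental inequality\<close>

context trinomial_curve
begin

text \<open>A point of the projective line is an element of \<open>'k option\<close>, with
  \<open>None\<close> at infinity; this is the local parameter there.\<close>

definition par :: "'k option => 'l" where
 "par a = (case a of None => inverse w | Some c => w - kap c)"

definition fib :: "'k option => 'l set set" where
 "fib a = {P : pts. 0 < ord_at P (par a)}"

definition ram :: "'l set => 'k option => int" where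
 "ram P a = ord_at P (par a)"

lemma par_K: "par a : K" and par_nonzero: "par a ~= 0" and par_K0: "par a : K0"
 using w_not_const w_nonzero w_K0 kap_K0 K0R K0_K unfolding par_def
 by(auto split: option.splits simp: subring_diff[OF subfield_subring[OF K0_subfield]])

lemma fib_pts: "P : fib a ==> P : pts" and ram_pos: "P : fib a ==> 0 < ram P a"
 by(auto simp: fib_def ram_def)

lemma fib_dvr: "P : fib a ==> dvr K P" using fib_pts pts_dvr by blast

lemma kap_ord: "P : pts ==> c ~= 0 ==> ord_at P (kap c) = 0"
 using kap_unit[of P c] unit_ord[OF pts_dvr] pts_place unfolding place_def by blast

lemma ord_w_minus_None:
 assumes P: "P : fib None" shows "ord_at P (w - kap c) = - ram P None"
proof -
 note D = fib_dvr[OF P]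
 have ow: "ord_at P w = - ram P None" using ord_inverse[OF D w_K w_nonzero] by(simp add: ram_def par_def)
 have "w + - kap c ~= 0 & ord_at P (w + - kap c) = ord_at P w"
 proof (rule ord_add_less[OF D w_K _ w_nonzero])
  show "- kap c : K" using kap_K KR(3) by blast
  show "ord_ge P (- kap c) (ord_at P w + 1)"
   using ow ram_pos[OF P] kap_ord[OF fib_pts[OF P], of "- c"] by(cases "c = 0") (auto simp: kap_0 kap_uminus)
 qed
 thus ?thesis using ow by simp
qed

lemma ord_w_minus_Some:
 assumes P: "P : fib (Some a)" and "c ~= a" shows "ord_at P (w - kap c) = 0"
proof -
 note D = fib_dvr[OF P]
 have "kap (a - c) + (w - kap a) ~= 0 & ord_at P (kap (a - c) + (w - kap a)) = ord_at P (kap (a - c))"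
 proof (rule ord_add_less[OF D kap_K])
  show "w - kap a : K" by(intro KR(10) w_K kap_K)
  show "kap (a - c) ~= 0" using assms(2) by(simp add: kap_eq_0_iff)
  show "ord_ge P (w - kap a) (ord_at P (kap (a - c)) + 1)"
   using ram_pos[OF P] kap_ord[OF fib_pts[OF P], of "a - c"] assms(2) by(simp add: ram_def par_def)
 qed
 moreover have "kap (a - c) + (w - kap a) = w - kap c" by(simp add: kap_diff)
 ultimately show ?thesis using kap_ord[OF fib_pts[OF P], of "a - c"] assms(2) by simp
qed

lemma fib_disjoint:
 assumes "P : fib a" "P : fib a'" shows "a = a'"
proof -
 have S: "b = Some c" if "P : fib (Some c)" "P : fib b" for b c
 proof (cases b)
  case None
  thus ?thesis using ram_pos[OF that(1)] ram_pos[OF that(2)] ord_w_minus_None[of P c] that(2)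
   by(simp add: ram_def par_def)
 next
  case (Some e)
  thus ?thesis using ram_pos[OF that(1)] ord_w_minus_Some[of P e c] that(2)
   by(cases "c = e") (simp_all add: ram_def par_def)
 qed
 show ?thesis
 proof (cases "a = None & a' = None")
  case False
  then obtain c where "a = Some c | a' = Some c" by auto
  thus ?thesis using S assms by metis
 qed simp
qed

lemma pts_fib:
 assumes P: "P : pts" shows "EX a. P : fib a"
proof -
 have "EX a. par a : maxid P"
 proof (cases "w : P")
  case True
  then obtain c where "w - kap c : maxid P" using pts_place[OF P] unfolding place_def by blast
  thus ?thesis by(intro exI[of _ "Some c"]) (simp add: par_def)
 next
  case False
  hence "inverse w : maxid P" using pts_place[OF P] unfolding place_def maxid_def unit_of_def by auto
  thus ?thesis by(intro exI[of _ None]) (simp add: par_def)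
 qed
 thus ?thesis using P maxid_iff_ord[OF pts_dvr[OF P] par_K par_nonzero] unfolding fib_def by blast
qed

lemma fib_nonempty: "EX P. P : fib a"
proof -
 have "EX P. place P & par a : maxid P"
 proof (cases a)
  case None
  thus ?thesis using exists_place[of "inverse w" 0] by(simp add: par_def kap_0)
 next
  case (Some c)
  thus ?thesis using exists_place[of w c] by(simp add: par_def)
 qed
 then obtain P where P: "place P" "par a : maxid P" by blast
 hence "P : pts" "0 < ord_at P (par a)"
  using place_complete maxid_iff_ord[OF place_dvr[OF P(1)] par_K par_nonzero] by auto
 thus ?thesis unfolding fib_def by blast
qed

text \<open>The order at a point of the projective line of a polynomial in w, hence minus the degree
  at infinity.\<close>

fun vord :: "'k option => 'k poly => int" where
 "vord (Some c) q = int (order c q)"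
| "vord None q = - int (degree q)"

lemma ord_evp:
 assumes P: "P : fib a" and "q ~= 0" shows "ord_at P (evp w q) = vord a q * ram P a" using assms(2)
proof (induction q rule: alg_closed_poly_induct)
 case (const c)
 moreover have "order b [:c:] = 0" for b using const by(intro order_0I) simp
 ultimately show ?case using kap_ord[OF fib_pts[OF P] const] by(cases a) (simp_all add: evp_const)
next
 case (factor c f)
 note D = fib_dvr[OF P] and f = factor.hyps and IH = factor.IH
 let ?q = "[:- c, 1:] * f"
 have deg: "degree ?q = Suc (degree f)" using f by(subst degree_mult_eq) auto
 have ef: "evp w f : K" "evp w f ~= 0"
  using evp_in_subfield[OF K_subfield kap_K w_K] evp_eq_0_iff[OF transc_w] f by auto
 have wc: "w - kap c : K" "w - kap c ~= 0" using w_K kap_K KR(10) w_not_const by auto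
 have o: "ord_at P (evp w ?q) = ord_at P (w - kap c) + ord_at P (evp w f)"
  unfolding evp_mult evp_linear by(rule ord_mult[OF D wc ef])
 have "vord a ?q * ram P a = ord_at P (w - kap c) + vord a f * ram P a"
 proof (cases a)
  case None
  thus ?thesis using ord_w_minus_None P deg by(simp add: algebra_simps)
 next
  case (Some b)
  have "order b ?q = order b [:- c, 1:] + order b f" using deg by(intro order_mult) auto
  moreover have "order b [:- c, 1:] = (if b = c then 1 else 0)"
  proof (cases "b = c")
   case True
   thus ?thesis using order_power_n_n[of c 1] by simp
  next
   case False
   thus ?thesis by(simp add: order_0I)
  qed
  moreover have "ord_at P (w - kap c) = (if b = c then ram P a else 0)"
   using ord_w_minus_Some[of P b c] P Some by(auto simp: ram_def par_def)
  ultimately show ?thesis using Some by(simp add: algebra_simps)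
 qed
 thus ?case using o IH by simp
qed

lemma K0_ord:
 assumes "c : K0" "c ~= 0" shows "EX i. ALL P:fib a. ord_at P c = i * ram P a"
proof -
 obtain p q where pq: "c = evp w p / evp w q" "q ~= 0" using assms(1) unfolding ratfun_def by blast
 have p: "p ~= 0" using assms(2) pq by(auto simp: evp_0)
 have e: "evp w q : K" for q using evp_in_subfield[OF K_subfield kap_K w_K] by auto
 have "ord_at P c = (vord a p - vord a q) * ram P a" if P: "P : fib a" for P
  using ord_divide[OF fib_dvr[OF P] e _ e, of p q] evp_eq_0_iff[OF transc_w] p pq(2) ord_evp[OF P]
  unfolding pq(1) by(simp add: algebra_simps)
 thus ?thesis by blast
qed

text \<open>The elements \<open>u P ^ N * t P ^ j\<close> with j below the ramification index of P
  are independent over k(w): at their own point they have order j, at the other points of S at least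
  the ramification index there. Hence there are at most lam of them.\<close>

lemma sum_ram_le:
 assumes S: "finite S" "S <= fib a" shows "(SUM P:S. ram P a) <= int lam"
proof (rule ccontr)
 assume big: "~ ?thesis"
 have D: "dvr K P" if "P : S" for P using that S(2) fib_dvr by blast
 have rp: "0 < ram P a" if "P : S" for P using that S(2) ram_pos by blast
 have "ALL P:S. EX u:K. u ~= 0 & ord_at P u = 0 & (ALL Q:S - {P}. 0 < ord_at Q u)"
  using exists_isolating[of "S - {_}" K] S(1) D by blast
 then obtain u where u: "!!P. P : S ==> u P : K & u P ~= 0 & ord_at P (u P) = 0"
  "!!P Q. P : S ==> Q : S ==> Q ~= P ==> 0 < ord_at Q (u P)" by(metis DiffI singletonD)
 have "ALL P:S. EX t. t : K & t ~= 0 & ord_at P t = 1" using exists_uniformizer D by blast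
 then obtain t where t: "!!P. P : S ==> t P : K & t P ~= 0 & ord_at P (t P) = 1" by metis
 \<comment> \<open>Large enough that the zeros of \<open>u P ^ N\<close> at the other points
   outweigh possible poles of the powers of \<open>t P\<close> and still leave the order
   \<open>ram Q a\<close>.\<close>
 define N where "N = nat (SUM P:S. SUM Q:S. ram Q a + ram P a * \<bar>ord_at Q (t P)\<bar>)"
 have N: "ram Q a + ram P a * \<bar>ord_at Q (t P)\<bar> <= int N" if "P : S" "Q : S" for P Q
 proof -
  have nn: "0 <= ram Q a + ram P a * \<bar>ord_at Q (t P)\<bar>" if "P : S" "Q : S" for P Q
   using rp that by(simp add: less_imp_le add_nonneg_nonneg)
  have "ram Q a + ram P a * \<bar>ord_at Q (t P)\<bar> <= (SUM Q:S. ram Q a + ram P a * \<bar>ord_at Q (t P)\<bar>)"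
   using that S(1) nn by(intro member_le_sum) auto
  also have "... <= (SUM P:S. SUM Q:S. ram Q a + ram P a * \<bar>ord_at Q (t P)\<bar>)"
   using that S(1) nn by(intro member_le_sum) (auto intro!: sum_nonneg)
  finally show ?thesis unfolding N_def by simp
 qed
 define Y where "Y = (%(P, j). u P ^ N * t P ^ (j::nat))"
 define J where "J = (SIGMA P:S. {..<nat (ram P a)})"
 have YK: "Y i : K & Y i ~= 0" if "i : J" for i
  using that u(1) t by(auto simp: J_def Y_def intro!: KR(5,8))
 have oY: "ord_at Q (Y (P, j)) = int N * ord_at Q (u P) + int j * ord_at Q (t P)" if "P : S" "Q : S" for P Q j
  using that u(1)[of P] t[of P] ord_mult[OF D[OF that(2)], of "u P ^ N" "t P ^ j"] KR(8)
   ord_power[OF D[OF that(2)]] by(simp add: Y_def)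
 have oYP: "ord_at P (Y (P, j)) = int j" if "P : S" for P j using oY[OF that that] u(1)[OF that] t[OF that] by simp
 have oYQ: "ram Q a <= ord_at Q (Y (P, j))" if "P : S" "Q : S" "Q ~= P" "j < nat (ram P a)" for P Q j
 proof -
  have "int N * 1 <= int N * ord_at Q (u P)" using u(2)[OF that(1-3)] by(intro mult_left_mono) auto
  moreover have "- (ram P a * \<bar>ord_at Q (t P)\<bar>) <= int j * ord_at Q (t P)"
  proof -
   have "int j * - ord_at Q (t P) <= int j * \<bar>ord_at Q (t P)\<bar>" by(intro mult_left_mono) auto
   also have "... <= ram P a * \<bar>ord_at Q (t P)\<bar>" using that(4) by(intro mult_right_mono) auto
   finally show ?thesis by simp
  qed
  ultimately show ?thesis using N[OF that(1,2)] oY[OF that(1,2)] by simp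
 qed
 have finJ: "finite J" using S(1) by(auto simp: J_def)
 have "int (card J) = (SUM P:S. ram P a)" using S(1) rp by(simp add: J_def less_imp_le)
 hence "lam < card J" using big by simp
 from dependent_K0[OF finJ this, of Y] YK obtain c where
  c: "ALL i. c i : K0" "EX i:J. c i ~= 0" "(SUM i:J. c i * Y i) = 0" by blast
 have "ALL i. EX n. c i ~= 0 --> (ALL P:fib a. ord_at P (c i) = n * ram P a)" using K0_ord c(1) by blast
 then obtain n where n: "!!i P. c i ~= 0 ==> P : fib a ==> ord_at P (c i) = n i * ram P a" by metis
 \<comment> \<open>Among the coefficients of least order on the line, a point P0 is fixed and for it
   the least exponent j0. At P0 this term has strictly smaller order than all others.\<close>
 define J' where "J' = {i : J. c i ~= 0}"
 have J': "finite J'" "J' ~= {}" using finJ c(2) by(auto simp: J'_def)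
 define n0 where "n0 = Min (n ` J')"
 have n0: "n0 <= n i" if "i : J'" for i using J' that by(simp add: n0_def)
 define J0 where "J0 = {i : J'. n i = n0}"
 have "J0 ~= {}" using Min_in[of "n ` J'"] J' unfolding J0_def n0_def by fastforce
 then obtain P0 j1 where P01: "(P0, j1) : J0" by auto
 define j0 where "j0 = (LEAST j. (P0, j) : J0)"
 have j0: "(P0, j0) : J0" unfolding j0_def using P01 by(rule LeastI)
 have j0_min: "j0 <= j" if "(P0, j) : J0" for j unfolding j0_def using that by(rule Least_le)
 have P0: "P0 : S" "j0 < nat (ram P0 a)" "c (P0, j0) ~= 0" "n (P0, j0) = n0"
  using j0 by(auto simp: J0_def J'_def J_def)
 have cK: "c i : K" for i using c(1) K0_K by blast
 have P0f: "P0 : fib a" using P0(1) S(2) by blast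
 have ocY: "ord_at P0 (c i * Y i) = n i * ram P0 a + ord_at P0 (Y i)" if "i : J'" for i
  using that ord_mult[OF D[OF P0(1)] cK, of i "Y i"] YK[of i] n[of i, OF _ P0f] by(auto simp: J'_def)
 have o0: "ord_at P0 (c (P0, j0) * Y (P0, j0)) = n0 * ram P0 a + int j0"
  using ocY[of "(P0, j0)"] j0 oYP[OF P0(1)] P0(4) by(simp add: J0_def)
 have "(SUM i:J. c i * Y i) ~= 0"
 proof (rule sum_nonzero_of_min_ord[OF D[OF P0(1)] finJ])
  show "(P0, j0) : J" using j0 by(simp add: J0_def J'_def)
  thus "c (P0, j0) * Y (P0, j0) ~= 0" using P0(3) YK by simp
  show "c i * Y i : K" if "i : J" for i using YK[OF that] cK KR(5) by blast
  fix i assume i: "i : J" "i ~= (P0, j0)"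
  show "ord_ge P0 (c i * Y i) (ord_at P0 (c (P0, j0) * Y (P0, j0)) + 1)"
  proof (cases "c i = 0")
   case False
   hence iJ': "i : J'" using i by(simp add: J'_def)
   obtain Q j where Qj: "i = (Q, j)" "Q : S" "j < nat (ram Q a)" using i(1) by(auto simp: J_def)
   have "n0 * ram P0 a + int j0 + 1 <= n i * ram P0 a + ord_at P0 (Y i)"
   proof (cases "Q = P0")
    case True
    show ?thesis
    proof (cases "n i = n0")
     case eq: True
     hence "i : J0" using iJ' by(simp add: J0_def)
     hence "j0 <= j" "j ~= j0" using j0_min i(2) Qj True by auto
     thus ?thesis using eq oYP[OF P0(1)] Qj True by simp
    next
     case False
     hence "n0 + 1 <= n i" using n0[OF iJ'] by simp
     hence "(n0 + 1) * ram P0 a <= n i * ram P0 a" using rp[OF P0(1)] by(intro mult_right_mono) auto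
     thus ?thesis using P0(2) oYP[OF P0(1)] Qj True by(simp add: algebra_simps)
    qed
   next
    case False
    have "n0 * ram P0 a <= n i * ram P0 a" using n0[OF iJ'] rp[OF P0(1)] by(intro mult_right_mono) auto
    thus ?thesis using oYQ[OF Qj(2) P0(1) _ Qj(3)] False Qj(1) P0(2) by simp
   qed
   thus ?thesis using ocY[OF iJ'] o0 by simp
  qed simp
 qed
 thus False using c(3) by simp
qed

lemma finite_fib: "finite (fib a)"
proof (rule ccontr)
 assume "infinite (fib a)"
 then obtain S where S: "S <= fib a" "finite S" "card S = Suc lam" using infinite_arbitrarily_large by blast
 have "int (card S) = (SUM P:S. 1)" by simp
 also have "... <= (SUM P:S. ram P a)"
 proof (intro sum_mono)
  fix P assume "P : S"
  thus "1 <= ram P a" using ram_pos[of P a] S(1) by auto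
 qed
 also have "... <= int lam" by(rule sum_ram_le[OF S(2,1)])
 finally show False using S(3) by simp
qed

end

section \<open>The product formula\<close>

text \<open>The shape of the sum in \<open>bundle_degree\<close>, restricted to the support;
  additivity holds under finiteness of the supports, which \<open>fsupp_on\<close> records.\<close>

definition sum_on :: "'p set => ('p => int) => int" where
 "sum_on \<Omega> \<phi> = (SUM P | P : \<Omega> & \<phi> P ~= 0. \<phi> P)"

definition fsupp_on :: "'p set => ('p => int) => bool" where
 "fsupp_on \<Omega> \<phi> \<longleftrightarrow> finite {P : \<Omega>. \<phi> P ~= 0}"

lemma psum_superset: "finite S ==> S <= \<Omega> ==> {P : \<Omega>. \<phi> P ~= 0} <= S ==> sum_on \<Omega> \<phi> = sum \<phi> S"
 unfolding sum_on_def by(intro sum.mono_neutral_left) auto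

lemma fsupp_add: "fsupp_on \<Omega> \<phi> ==> fsupp_on \<Omega> \<psi> ==> fsupp_on \<Omega> (%P. \<phi> P + \<psi> P)"
 unfolding fsupp_on_def by(rule finite_subset[of _ "{P : \<Omega>. \<phi> P ~= 0} \<union> {P : \<Omega>. \<psi> P ~= 0}"]) auto

lemma psum_add: "fsupp_on \<Omega> \<phi> ==> fsupp_on \<Omega> \<psi> ==> sum_on \<Omega> (%P. \<phi> P + \<psi> P) = sum_on \<Omega> \<phi> + sum_on \<Omega> \<psi>"
proof -
 assume f: "fsupp_on \<Omega> \<phi>" "fsupp_on \<Omega> \<psi>"
 let ?S = "{P : \<Omega>. \<phi> P ~= 0} \<union> {P : \<Omega>. \<psi> P ~= 0}"
 have S: "finite ?S" "?S <= \<Omega>" using f by(auto simp: fsupp_on_def)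
 have "sum_on \<Omega> (%P. \<phi> P + \<psi> P) = (SUM P:?S. \<phi> P + \<psi> P)" using S by(intro psum_superset) auto
 moreover have "sum_on \<Omega> \<phi> = sum \<phi> ?S" "sum_on \<Omega> \<psi> = sum \<psi> ?S" using S by(intro psum_superset; auto)+
 ultimately show ?thesis by(simp add: sum.distrib)
qed

lemma fsupp_uminus: "fsupp_on \<Omega> (%P. - \<phi> P) \<longleftrightarrow> fsupp_on \<Omega> \<phi>" and psum_uminus: "sum_on \<Omega> (%P. - \<phi> P) = - sum_on \<Omega> \<phi>"
 by(simp_all add: fsupp_on_def sum_on_def sum_negf)

lemma psum_cong: "(!!P. P : \<Omega> ==> \<phi> P = \<psi> P) ==> sum_on \<Omega> \<phi> = sum_on \<Omega> \<psi>"
 unfolding sum_on_def by(intro sum.cong) auto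

lemma fsupp_cong: "(!!P. P : \<Omega> ==> \<phi> P = \<psi> P) ==> fsupp_on \<Omega> \<phi> = fsupp_on \<Omega> \<psi>"
 unfolding fsupp_on_def by(metis (mono_tags, lifting) Collect_cong)

lemma fsupp_sum: "finite A ==> (!!i. i : A ==> fsupp_on \<Omega> (\<phi> i)) ==> fsupp_on \<Omega> (%P. SUM i:A. \<phi> i P)"
 by(induction A rule: finite_induct) (simp_all add: fsupp_add, simp add: fsupp_on_def)

lemma psum_sum: "finite A ==> (!!i. i : A ==> fsupp_on \<Omega> (\<phi> i)) ==> sum_on \<Omega> (%P. SUM i:A. \<phi> i P) = (SUM i:A. sum_on \<Omega> (\<phi> i))"
 by(induction A rule: finite_induct) (simp_all add: psum_add fsupp_sum, simp add: sum_on_def)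

lemma psum_mono:
 assumes "fsupp_on \<Omega> \<phi>" "fsupp_on \<Omega> \<psi>" "!!P. P : \<Omega> ==> \<phi> P <= \<psi> P"
 shows "sum_on \<Omega> \<phi> <= sum_on \<Omega> \<psi>"
proof -
 let ?S = "{P : \<Omega>. \<phi> P ~= 0} \<union> {P : \<Omega>. \<psi> P ~= 0}"
 have S: "finite ?S" "?S <= \<Omega>" using assms by(auto simp: fsupp_on_def)
 have "sum_on \<Omega> \<phi> = sum \<phi> ?S" "sum_on \<Omega> \<psi> = sum \<psi> ?S" using S by(intro psum_superset; auto)+
 moreover have "sum \<phi> ?S <= sum \<psi> ?S" using S(2) assms(3) by(intro sum_mono) blast
 ultimately show ?thesis by simp
qed

lemma psum_reindex:
 assumes "bij_betw \<tau> \<Omega> \<Omega>" "!!P. P : \<Omega> ==> \<psi> (\<tau> P) = \<phi> P"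
 shows "sum_on \<Omega> \<psi> = sum_on \<Omega> \<phi>" "fsupp_on \<Omega> \<psi> \<longleftrightarrow> fsupp_on \<Omega> \<phi>"
proof -
 have b: "bij_betw \<tau> {P : \<Omega>. \<phi> P ~= 0} {P : \<Omega>. \<psi> P ~= 0}"
 proof (rule bij_betw_imageI)
  show "inj_on \<tau> {P : \<Omega>. \<phi> P ~= 0}"
   using assms(1) unfolding bij_betw_def by(auto intro: inj_on_subset)
  show "\<tau> ` {P : \<Omega>. \<phi> P ~= 0} = {P : \<Omega>. \<psi> P ~= 0}"
  proof (intro equalityI subsetI)
   fix Q assume "Q : {P : \<Omega>. \<psi> P ~= 0}"
   moreover then obtain P where "P : \<Omega>" "Q = \<tau> P" using assms(1) unfolding bij_betw_def by blast
   ultimately show "Q : \<tau> ` {P : \<Omega>. \<phi> P ~= 0}" using assms(2) by auto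
  qed (use assms in \<open>auto simp: bij_betw_def\<close>)
 qed
 have "sum_on \<Omega> \<psi> = (SUM P:{P : \<Omega>. \<phi> P ~= 0}. \<psi> (\<tau> P))"
  unfolding sum_on_def by(rule sum.reindex_bij_betw[OF b, symmetric])
 also have "... = sum_on \<Omega> \<phi>" unfolding sum_on_def by(intro sum.cong refl) (simp add: assms(2))
 finally show "sum_on \<Omega> \<psi> = sum_on \<Omega> \<phi>" .
 show "fsupp_on \<Omega> \<psi> \<longleftrightarrow> fsupp_on \<Omega> \<phi>" unfolding fsupp_on_def using bij_betw_finite[OF b] by simp
qed

section \<open>Orders of monomials and the fundamental equality\<close>

context trinomial_curve
begin

lemma sig_maps:
 assumes g: "g : Gam" and P: "P : pts"
 shows "sig (cc g) ` P : pts" and "f : K ==> f ~= 0 ==> ord_at (sig (cc g) ` P) (sig (cc g) f) = ord_at P f"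
 using sig_pts[OF cc_admissible[OF g] P] autom_ord[OF sig_autom[OF cc_admissible[OF g]] pts_dvr[OF P]] by auto

lemma sig_image_inverse:
 assumes g: "g : Gam" and P: "P : pts" shows "EX Q:pts. P = sig (cc g) ` Q"
proof -
 note A = cc_admissible[OF g]
 define c' where "c' = (\<chi> i. inverse (cc g $ i))"
 have A': "admissible c'" unfolding c'_def by(rule admissible_inverse[OF A])
 have PK: "P <= K" using dvrD(3)[OF pts_dvr[OF P]] .
 have "sig (cc g) ` sig c' ` P = P"
  unfolding image_image c'_def using sig_inverse'[OF A] PK by(auto simp: subset_iff image_iff)
 thus ?thesis using sig_pts[OF A' P] by(intro bexI[of _ "sig c' ` P"]) auto
qed

lemma sig_bij_pts: "g : Gam ==> bij_betw (%P. sig (cc g) ` P) pts pts"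
proof -
 assume g: "g : Gam"
 have inj: "inj_on (sig (cc g)) K"
  using sig_autom[OF cc_admissible[OF g]] unfolding field_autom_def bij_betw_def by blast
 have "inj_on (%P. sig (cc g) ` P) pts"
 proof (rule inj_onI)
  fix P Q assume "P : pts" "Q : pts" "sig (cc g) ` P = sig (cc g) ` Q"
  thus "P = Q" using inj_on_image_eq_iff[OF inj] dvrD(3)[OF pts_dvr] by blast
 qed
 moreover have "(%P. sig (cc g) ` P) ` pts = pts"
  using sig_maps(1)[OF g] sig_image_inverse[OF g] by blast
 ultimately show ?thesis unfolding bij_betw_def by blast
qed

lemma sig_par: "g : Gam ==> sig (cc g) (par a) = par a"
 using sig_K0[OF cc_admissible par_K0] by blast

lemma sig_fib_iff: "g : Gam ==> P : pts ==> sig (cc g) ` P : fib a \<longleftrightarrow> P : fib a"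
 using sig_maps(1)[of g P] sig_maps(2)[of g P "par a"] par_K par_nonzero sig_par unfolding fib_def by simp

lemma sig_ram: "g : Gam ==> P : pts ==> ram (sig (cc g) ` P) a = ram P a"
 using sig_maps(2)[of g P "par a"] par_K par_nonzero sig_par unfolding ram_def by simp

definition cw :: "'k option => (3 => int) => int" where
 "cw a b = (case a of None => wt b z | Some c => if c = 0 then wt b x else if c = - 1 then wt b y else 0)"

text \<open>By \<open>lattice_of_wt\<close>, the lam-th power of the monomial is a product of powers
  of w and - 1 - w with the weights at x and y as exponents.\<close>

lemma ord_lmon:
 assumes P: "P : fib a" and b: "(SUM i:UNIV. b i) = 0"
 shows "int lam * ord_at P (lmon b) = cw a b * ram P a"
proof -
 note D = fib_dvr[OF P]
 have wl: "wt (%i. int lam * b i) l = int lam * wt b l" for l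
  by(simp add: wt_def sum_distrib_left mult.left_commute)
 have sl: "(SUM i:UNIV. int lam * b i) = 0" using b by(simp add: sum_distrib_left[symmetric])
 note L = lattice_of_wt(1)[OF sl wl] and s = lattice_of_wt(2)[OF sl wl]
 have "lmon b powi int lam = w powi wt b x * (- 1 - w) powi wt b y"
  unfolding lmon_scale[symmetric] L by(rule lmon_sum_E[OF s])
 hence lw: "lmon b powi int lam = w powi wt b x * (- 1 - w) powi wt b y" .
 have w1: "- 1 - w : K" "- 1 - w ~= 0" "w - kap (- 1) : K" "- 1 - w = - (w - kap (- 1))"
 proof -
  show "- 1 - w : K" using M_ratio_K[of y z] My_w by simp
  show "- 1 - w ~= 0"
  proof
   assume "- 1 - w = 0"
   thus False using My_w M_nonzero by simp
  qed
  show "w - kap (- 1) : K" by(rule KR(10)[OF w_K kap_K])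
  show "- 1 - w = - (w - kap (- 1))" by(simp add: kap_uminus kap_1)
 qed
 have nz: "w powi wt b x ~= 0" "(- 1 - w) powi wt b y ~= 0" using w_nonzero w1(2) by(auto simp: power_int_eq_0_iff)
 have "int lam * ord_at P (lmon b) = ord_at P (lmon b powi int lam)"
  by(rule ord_powi[OF D lmon_K lmon_nonzero, symmetric])
 also have "... = ord_at P (w powi wt b x) + ord_at P ((- 1 - w) powi wt b y)"
  unfolding lw by(rule ord_mult[OF D KR(9)[OF w_K] nz(1) KR(9)[OF w1(1)] nz(2)])
 also have "... = wt b x * ord_at P w + wt b y * ord_at P (- 1 - w)"
  by(simp only: ord_powi[OF D w_K w_nonzero] ord_powi[OF D w1(1,2)])
 also have "ord_at P (- 1 - w) = ord_at P (w - kap (- 1))" unfolding w1(4) by(rule ord_uminus[OF D w1(3)])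
 also have "ord_at P w = ord_at P (w - kap 0)" by(simp add: kap_0)
 also have "wt b x * ord_at P (w - kap 0) + wt b y * ord_at P (w - kap (- 1)) = cw a b * ram P a"
 proof (cases a)
  case None
  have wz: "wt b z = - wt b x - wt b y" using s by(simp add: sum_xyz)
  show ?thesis unfolding None ord_w_minus_None[OF P[unfolded None]] by(simp add: cw_def wz left_diff_distrib)
 next
  case (Some c)
  have "ord_at P (w - kap e) = (if e = c then ram P a else 0)" for e
   using ord_w_minus_Some[of P c e] P Some by(auto simp: ram_def par_def)
  thus ?thesis using Some by(auto simp: cw_def)
 qed
 finally show ?thesis .
qed

text \<open>Taylor expansion with constant coefficients: the residue field is k, so the next
  coefficient is the residue of the remainder divided by t^n.\<close>

lemma jet:
 assumes P: "P : pts" and t: "t : K" "t ~= 0" "ord_at P t = 1" and f: "f : K" "ord_ge P f 0"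
 shows "EX c. ord_ge P (f - (SUM j<n. kap (c j) * t ^ j)) (int n)"
proof (induction n)
 case 0
 thus ?case using f by simp
next
 case (Suc n)
 note D = pts_dvr[OF P]
 obtain c where c: "ord_ge P (f - (SUM j<n. kap (c j) * t ^ j)) (int n)" using Suc by blast
 define f' where "f' = (f - (SUM j<n. kap (c j) * t ^ j)) / t ^ n"
 have SK: "(SUM j<n. kap (c j) * t ^ j) : K" by(intro subring_sum[OF K_subring] KR kap_K t)
 have fK: "f - (SUM j<n. kap (c j) * t ^ j) : K" by(rule KR(10)[OF f(1) SK])
 have "f' : P" using ord_ge_iff[OF D t fK, of "int n"] c by(simp add: f'_def)
 then obtain e where e: "f' - kap e : maxid P" using pts_place[OF P] unfolding place_def by blast
 have eK: "f' - kap e : K" using e dvrD(3)[OF D] by(auto simp: maxid_def)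
 have ge: "ord_ge P (f' - kap e) 1" using maxid_iff_ord[OF D eK] e by(cases "f' - kap e = 0") auto
 have tn: "t ^ n : K" "t ^ n ~= 0" using t KR(8) by auto
 have "ord_ge P ((f' - kap e) * t ^ n) (int (Suc n))"
  using ge ord_mult[OF D eK _ tn] ord_power[OF D t(1,2), of n] t(3) by auto
 moreover have "f' * t ^ n = f - (SUM j<n. kap (c j) * t ^ j)" using t(2) by(simp add: f'_def)
 hence "(f' - kap e) * t ^ n = f - (SUM j<Suc n. kap ((c(n := e)) j) * t ^ j)"
  by(simp add: left_diff_distrib)
 ultimately show ?case by metis
qed

lemma kap_mult_ord_ge:
 assumes "P : pts" "f : K" "ord_ge P f m" shows "ord_ge P (kap c * f) m"
proof (cases "c = 0 | f = 0")
 case True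
 thus ?thesis by(auto simp: kap_0)
next
 case False
 thus ?thesis using ord_mult[OF pts_dvr[OF assms(1)] kap_K _ assms(2)] kap_ord[OF assms(1), of c] assms(3)
  by(auto simp: kap_eq_0_iff)
qed

text \<open>The Galois group permutes the points of a fibre, hence the isotypical components of a function
 are at least as integral along the fibre as the function itself.\<close>

lemma proj_ord_ge:
 assumes f: "f : K" "!!P. P : fib a ==> ord_ge P f (ram P a)" and P: "P : fib a"
 shows "ord_ge P (proj b f) (ram P a)"
proof -
 note D = fib_dvr[OF P] and Pp = fib_pts[OF P]
 have sK: "sig (cc g) f : K" if "g : Gam" for g using sig_K[OF cc_admissible[OF that] f(1)] .
 have s: "ord_ge P (sig (cc g) f) (ram P a)" if g: "g : Gam" for g
 proof (cases "f = 0")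
  case True
  thus ?thesis using autom_0[OF K_subfield sig_autom[OF cc_admissible[OF g]]] by simp
 next
  case False
  obtain Q where Q: "Q : pts" "P = sig (cc g) ` Q" using sig_image_inverse[OF g Pp] by blast
  have "Q : fib a" using sig_fib_iff[OF g Q(1)] Q(2) P by simp
  hence "ram Q a <= ord_at Q f" using f(2) False by blast
  thus ?thesis using sig_maps(2)[OF g Q(1) f(1) False] sig_ram[OF g Q(1)] Q(2) by simp
 qed
 have 1: "ord_ge P (SUM g:Gam. kap (inverse (chr (cc g) b)) * sig (cc g) f) (ram P a)"
 proof (rule ord_ge_sum[OF D])
  fix g assume g: "g : Gam"
  show "kap (inverse (chr (cc g) b)) * sig (cc g) f : K &
    ord_ge P (kap (inverse (chr (cc g) b)) * sig (cc g) f) (ram P a)"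
   using KR(5)[OF kap_K sK[OF g]] kap_mult_ord_ge[OF Pp sK[OF g] s[OF g]] by blast
 qed
 have "(SUM g:Gam. kap (inverse (chr (cc g) b)) * sig (cc g) f) : K"
  by(intro subring_sum[OF K_subring] KR(5) kap_K sK)
 from kap_mult_ord_ge[OF Pp this 1] show ?thesis unfolding proj_def .
qed

text \<open>If the indices added up to less than lam, a nonzero combination over k of the lam
  functions \<open>Y b\<close> could be made to vanish to the order \<open>ram P a\<close> at every
  P of the fibre. By \<open>proj_ord_ge\<close> the same would hold for each of its summands, but
  the \<open>Y b\<close> have orders below \<open>ram P a\<close>.\<close>

lemma sum_ram_ge: "int lam <= (SUM P:fib a. ram P a)"
proof (rule ccontr)
 assume small: "~ ?thesis"
 \<comment> \<open>The power of the parameter that moves the order of \<open>lmon b\<close> at every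
   P of the fibre into the range from 0 to \<open>ram P a - 1\<close>.\<close>
 define m where "m b = - (cw a b div int lam)" for b
 define Y where "Y b = par a powi m b * lmon b" for b
 have pm: "par a powi m b : K0" "par a powi m b ~= 0" for b using K0R(9) par_K0 par_nonzero by auto
 have pmK: "par a powi m b : K" for b using pm(1) K0_K by blast
 have YK: "Y b : K" "Y b ~= 0" for b using KR(5)[OF pmK lmon_K] pm(2) lmon_nonzero by(auto simp: Y_def)
 have oY: "0 <= ord_at P (Y b) & ord_at P (Y b) < ram P a" if b: "b : R" and P: "P : fib a" for b P
 proof -
  note D = fib_dvr[OF P]
  have "ord_at P (Y b) = m b * ram P a + ord_at P (lmon b)"
   using ord_mult[OF D pmK pm(2) lmon_K lmon_nonzero] ord_powi[OF D par_K par_nonzero]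
   unfolding Y_def ram_def by simp
  hence "int lam * ord_at P (Y b) = (int lam * m b + cw a b) * ram P a"
   using ord_lmon[OF P R(3)[OF b]] by(simp add: algebra_simps)
  also have "int lam * m b + cw a b = cw a b mod int lam"
   unfolding m_def by(simp add: minus_div_mult_eq_mod[symmetric] mult.commute)
  finally have e: "int lam * ord_at P (Y b) = (cw a b mod int lam) * ram P a" .
  have r: "0 <= cw a b mod int lam" "cw a b mod int lam < int lam" using lam_pos by simp_all
  have "0 <= int lam * ord_at P (Y b)" unfolding e using r ram_pos[OF P] by simp
  moreover have "int lam * ord_at P (Y b) < int lam * ram P a" unfolding e using r ram_pos[OF P] by simp
  ultimately show ?thesis using lam_pos by(simp add: zero_le_mult_iff)
 qed
 have "ALL P:fib a. EX t. t : K & t ~= 0 & ord_at P t = 1" using exists_uniformizer[OF fib_dvr] by blast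
 then obtain t where t: "!!P. P : fib a ==> t P : K & t P ~= 0 & ord_at P (t P) = 1" by metis
 let ?jet = "%P b c. ord_ge P (Y b - (SUM j<nat (ram P a). kap (c j) * t P ^ j)) (int (nat (ram P a)))"
 have ex: "EX c. ?jet P b c" if P: "P : fib a" and b: "b : R" for P b
  using jet[OF fib_pts[OF P], of "t P" "Y b" "nat (ram P a)"] t[OF P] YK(1)[of b] oY[OF b P] by blast
 define C where "C P b = (SOME c. ?jet P b c)" for P b
 have C: "?jet P b (C P b)" if P: "P : fib a" and b: "b : R" for P b
  unfolding C_def by(rule someI_ex[OF ex[OF P b]])
 define J where "J = (SIGMA P:fib a. {..<nat (ram P a)})"
 have "int (card J) = (SUM P:fib a. ram P a)" using finite_fib ram_pos by(simp add: J_def less_imp_le)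
 hence cJ: "card J < card R" using small R(2) by simp
 have finJ: "finite J" unfolding J_def using finite_fib by auto
 have UN: "is_subfield (UNIV :: 'k set)" by(simp add: is_subfield_def is_subring_def)
 \<comment> \<open>One equation for each Taylor coefficient, as many as the sum of the ramification
   indices, in the unknowns u b.\<close>
 from nontrivial_solution[OF UN finJ R(1) cJ, of "%(P, j) b. C P b j"]
 obtain u where u: "EX b:R. u b ~= 0" "!!P j. P : fib a ==> j < nat (ram P a) ==> (SUM b:R. C P b j * u b) = 0"
  by(force simp: J_def)
 define f where "f = (SUM b:R. kap (u b) * Y b)"
 have fK: "f : K" unfolding f_def by(intro subring_sum[OF K_subring] KR(5) kap_K YK(1))
 have ge: "ord_ge P f (ram P a)" if P: "P : fib a" for P
 proof -
  note D = fib_dvr[OF P]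
  let ?n = "nat (ram P a)"
  have rn: "int ?n = ram P a" using ram_pos[OF P] by simp
  have SK: "(SUM j<?n. kap (C P b j) * t P ^ j) : K" for b
   using t[OF P] by(intro subring_sum[OF K_subring] KR kap_K) auto
  have "(SUM b:R. kap (u b) * (SUM j<?n. kap (C P b j) * t P ^ j)) = (SUM j<?n. kap (SUM b:R. C P b j * u b) * t P ^ j)"
   unfolding sum_distrib_left by(subst sum.swap) (simp add: kap_sum kap_mult sum_distrib_left sum_distrib_right mult_ac)
  also have "... = 0" using u(2)[OF P] by(simp add: kap_0)
  finally have "f = (SUM b:R. kap (u b) * (Y b - (SUM j<?n. kap (C P b j) * t P ^ j)))"
   unfolding f_def by(simp add: right_diff_distrib sum_subtractf)
  moreover have "ord_ge P ... (ram P a)"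
  proof (rule ord_ge_sum[OF D])
   fix b assume b: "b : R"
   have k: "Y b - (SUM j<?n. kap (C P b j) * t P ^ j) : K" by(rule KR(10)[OF YK(1) SK])
   have "ord_ge P (Y b - (SUM j<?n. kap (C P b j) * t P ^ j)) (ram P a)" using C[OF P b] unfolding rn .
   thus "kap (u b) * (Y b - (SUM j<?n. kap (C P b j) * t P ^ j)) : K &
     ord_ge P (kap (u b) * (Y b - (SUM j<?n. kap (C P b j) * t P ^ j))) (ram P a)"
    using KR(5)[OF kap_K k] kap_mult_ord_ge[OF fib_pts[OF P] k] by blast
  qed
  ultimately show ?thesis by simp
 qed
 obtain b where b: "b : R" "u b ~= 0" using u(1) by blast
 obtain P where P: "P : fib a" using fib_nonempty by blast
 have "f = (SUM b:R. (kap (u b) * par a powi m b) * lmon b)"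
  unfolding f_def Y_def by(simp add: mult.assoc)
 moreover have "kap (u b) * par a powi m b : K0" for b using K0R(5)[OF kap_K0 pm(1)] .
 ultimately have "proj b f = kap (u b) * par a powi m b * lmon b" using proj_coeff[OF _ b(1)] by simp
 hence pf: "proj b f = kap (u b) * Y b" by(simp add: Y_def mult.assoc)
 have "ord_ge P (proj b f) (ram P a)" by(rule proj_ord_ge[OF fK ge P])
 moreover have "kap (u b) * Y b ~= 0" using b(2) YK(2) by(simp add: kap_eq_0_iff)
 moreover have "ord_at P (kap (u b) * Y b) = ord_at P (Y b)"
  using ord_mult[OF fib_dvr[OF P] kap_K _ YK] kap_ord[OF fib_pts[OF P] b(2)] b(2) by(simp add: kap_eq_0_iff)
 ultimately show False using oY[OF b(1) P] pf by simp
qed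

lemma sum_ram: "(SUM P:fib a. ram P a) = int lam"
 using sum_ram_le[OF finite_fib order_refl] sum_ram_ge by(rule antisym)

section \<open>Principal divisors have degree 0\<close>

abbreviation psum :: "('l set => int) => int" where
 "psum \<equiv> sum_on pts"

abbreviation fsupp :: "('l set => int) => bool" where
 "fsupp \<equiv> fsupp_on pts"

lemma psum_fibres:
 assumes A: "finite A" and supp: "!!P a. P : fib a ==> a ~: A ==> \<phi> P = 0"
 shows "fsupp \<phi>" "psum \<phi> = (SUM a:A. SUM P:fib a. \<phi> P)"
proof -
 let ?S = "UN a:A. fib a"
 have S1: "finite ?S" by(rule finite_UN_I[OF A finite_fib])
 have S2: "?S <= pts" by(intro UN_least subsetI) (rule fib_pts)
 have S3: "{P : pts. \<phi> P ~= 0} <= ?S"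
 proof
  fix P assume P: "P : {P : pts. \<phi> P ~= 0}"
  then obtain a where a: "P : fib a" using pts_fib[of P] by auto
  have "a : A" using supp[OF a] P by auto
  thus "P : ?S" using a by(rule UN_I)
 qed
 note S = S1 S2 S3
 show "fsupp \<phi>" unfolding fsupp_on_def by(rule finite_subset[OF S(3,1)])
 have "psum \<phi> = sum \<phi> ?S" by(rule psum_superset[OF S])
 also have "... = (SUM a:A. SUM P:fib a. \<phi> P)"
 proof (rule sum.UNION_disjoint[OF A])
  show "ALL a:A. finite (fib a)" using finite_fib by blast
  show "ALL a:A. ALL b:A. a ~= b --> fib a \<inter> fib b = {}"
  proof (intro ballI impI)
   fix a b :: "'k option" assume "a ~= b"
   thus "fib a \<inter> fib b = {}" using fib_disjoint[of _ a b] by auto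
  qed
 qed
 finally show "psum \<phi> = (SUM a:A. SUM P:fib a. \<phi> P)" .
qed

text \<open>A linear factor w - c has its zeros over c and its poles over infinity, lam of each by
  \<open>sum_ram\<close>.\<close>

lemma psum_evp: "q ~= 0 ==> fsupp (%P. ord_at P (evp w q)) & psum (%P. ord_at P (evp w q)) = 0"
proof (induction q rule: alg_closed_poly_induct)
 case (const c)
 have "ord_at P (evp w [:c:]) = 0" if "P : pts" for P using kap_ord[OF that const] by(simp add: evp_const)
 thus ?case by(simp add: fsupp_on_def sum_on_def cong: conj_cong)
next
 case (factor c f)
 note f = factor.hyps and IH = conjunct1[OF factor.IH] conjunct2[OF factor.IH]
 have ef: "evp w f : K" "evp w f ~= 0"
  using evp_in_subfield[OF K_subfield kap_K w_K] evp_eq_0_iff[OF transc_w] f by auto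
 have wc: "w - kap c : K" "w - kap c ~= 0" using w_K kap_K KR(10) w_not_const by auto
 have o: "ord_at P (evp w ([:- c, 1:] * f)) = ord_at P (w - kap c) + ord_at P (evp w f)" if "P : pts" for P
  unfolding evp_mult evp_linear by(rule ord_mult[OF pts_dvr[OF that] wc ef])
 have z: "ord_at P (w - kap c) = 0" if P: "P : fib a" and a: "a ~: {None, Some c}" for P a
  using a P ord_w_minus_Some[of P _ c] by(cases a) auto
 note pf = psum_fibres[of "{None, Some c}" "%P. ord_at P (w - kap c)", OF _ z]
 have "(SUM P:fib None. ord_at P (w - kap c)) = - int lam"
  using ord_w_minus_None sum_ram[of None] by(simp add: sum_negf)
 moreover have "(SUM P:fib (Some c). ord_at P (w - kap c)) = int lam"
  using sum_ram[of "Some c"] by(simp add: ram_def par_def)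
 ultimately have 1: "fsupp (%P. ord_at P (w - kap c))" "psum (%P. ord_at P (w - kap c)) = 0"
  using pf by auto
 show ?case
  using psum_cong[of pts, OF o] fsupp_cong[of pts, OF o] psum_add[OF 1(1) IH(1)] fsupp_add[OF 1(1) IH(1)] 1(2) IH(2) by simp
qed

lemma psum_K0:
 assumes "c : K0" "c ~= 0"
 shows "fsupp (%P. ord_at P c)" "psum (%P. ord_at P c) = 0"
proof -
 obtain p q where pq: "c = evp w p / evp w q" "q ~= 0" using assms(1) unfolding ratfun_def by blast
 have p: "p ~= 0" using assms(2) pq by(auto simp: evp_0)
 have e: "evp w q : K" for q using evp_in_subfield[OF K_subfield kap_K w_K] by auto
 have o: "ord_at P c = ord_at P (evp w p) + - ord_at P (evp w q)" if "P : pts" for P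
  using ord_divide[OF pts_dvr[OF that] e _ e, of p q] evp_eq_0_iff[OF transc_w] p pq(2) unfolding pq(1) by simp
 have p1: "fsupp (%P. ord_at P (evp w p))" "psum (%P. ord_at P (evp w p)) = 0" using psum_evp[OF p] by auto
 have q1: "fsupp (%P. - ord_at P (evp w q))" "psum (%P. - ord_at P (evp w q)) = 0"
  using psum_evp[OF pq(2)] by(auto simp: fsupp_uminus psum_uminus)
 show "fsupp (%P. ord_at P c)" using fsupp_add[OF p1(1) q1(1)] fsupp_cong[of pts, OF o] by simp
 show "psum (%P. ord_at P c) = 0" using psum_add[OF p1(1) q1(1)] psum_cong[of pts, OF o] p1(2) q1(2) by simp
qed

text \<open>In the expansion over the monomials in \<open>R\<close> the coefficients lie in k(w),
  where finiteness is known, and the monomials have zeros and poles only over the three branch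
  points.\<close>

lemma finite_poles:
 assumes f: "f : K" shows "finite {P : pts. f ~: P}"
proof -
 have "f : spanR" using f K_spanR by simp
 from spanR_D[OF this] obtain c where c: "ALL a. c a : K0" "f = (SUM a:R. c a * lmon a)" by blast
 have fin: "finite {P : pts. c b * lmon b ~: P}" if b: "b : R" for b
 proof (cases "c b = 0")
  case True
  hence "{P : pts. c b * lmon b ~: P} = {}" using subringD(1)[OF dvrD(2)[OF pts_dvr]] by auto
  thus ?thesis by(simp only: finite.emptyI)
 next
  case False
  have cK: "c b : K" using c(1) K0_K by blast
  let ?S = "fib None \<union> fib (Some 0) \<union> fib (Some (- 1))"
  have "{P : pts. c b * lmon b ~: P} <= {P : pts. ord_at P (c b) ~= 0} \<union> ?S"
  proof
   fix P assume P: "P : {P : pts. c b * lmon b ~: P}"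
   note D = pts_dvr[of P]
   obtain a where a: "P : fib a" using P pts_fib by blast
   show "P : {P : pts. ord_at P (c b) ~= 0} \<union> ?S"
   proof (rule ccontr)
    assume n: "P ~: {P : pts. ord_at P (c b) ~= 0} \<union> ?S"
    hence "cw a b = 0" using a by(cases a) (auto simp: cw_def)
    hence "ord_at P (lmon b) = 0" using ord_lmon[OF a R(3)[OF b]] lam_pos by simp
    hence "ord_at P (c b * lmon b) = 0" using ord_mult[OF D cK False lmon_K lmon_nonzero] P n by auto
    hence "c b * lmon b : P" using mem_iff_ord[OF D KR(5)[OF cK lmon_K]] P False lmon_nonzero by auto
    thus False using P by simp
   qed
  qed
  thus ?thesis
   using psum_K0(1)[of "c b"] c(1) False finite_fib unfolding fsupp_on_def by(metis (no_types, lifting) finite_Un finite_subset)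
 qed
 have "{P : pts. f ~: P} <= (UN b:R. {P : pts. c b * lmon b ~: P})"
 proof
  fix P assume P: "P : {P : pts. f ~: P}"
  show "P : (UN b:R. {P : pts. c b * lmon b ~: P})"
  proof (rule ccontr)
   assume "P ~: (UN b:R. {P : pts. c b * lmon b ~: P})"
   hence "f : P" unfolding c(2) using P by(intro subring_sum[OF dvrD(2)[OF pts_dvr]]) auto
   thus False using P by simp
  qed
 qed
 thus ?thesis using fin R(1) finite_subset by blast
qed

lemma fsupp_ord:
 assumes f: "f : K" "f ~= 0" shows "fsupp (%P. ord_at P f)"
proof -
 have "{P : pts. ord_at P f ~= 0} <= {P : pts. f ~: P} \<union> {P : pts. inverse f ~: P}"
  using mem_iff_ord[OF pts_dvr f] mem_iff_ord[OF pts_dvr KR(6)[OF f(1)]] ord_inverse[OF pts_dvr f] f(2) by auto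
 thus ?thesis unfolding fsupp_on_def
  using finite_poles[OF f(1)] finite_poles[OF KR(6)[OF f(1)]] finite_subset by blast
qed

text \<open>The conjugates of f have the same total order as f, because the Galois group permutes
  the points, and their product lies in k(w), where the total order is 0.\<close>

theorem product_formula:
 assumes f: "f : K" "f ~= 0" shows "psum (%P. ord_at P f) = 0"
proof -
 have s: "sig (cc g) f : K & sig (cc g) f ~= 0" if "g : Gam" for g
  using sig_K[OF cc_admissible[OF that] f(1)]
   autom_eq_0_iff[OF K_subfield sig_autom[OF cc_admissible[OF that]] f(1)] f(2) by simp
 have o: "ord_at P (Nm f) = (SUM g:Gam. ord_at P (sig (cc g) f))" if "P : pts" for P
  unfolding Nm_def using s by(intro ord_prod[OF pts_dvr[OF that]])
 have r: "psum (%P. ord_at P (sig (cc g) f)) = psum (%P. ord_at P f)" if "g : Gam" for g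
  by(rule psum_reindex(1)[OF sig_bij_pts[OF that]]) (rule sig_maps(2)[OF that _ f])
 have "0 = psum (%P. ord_at P (Nm f))" using psum_K0(2)[OF Nm_K0[OF f(1)] Nm_nonzero[OF f]] by simp
 also have "... = psum (%P. SUM g:Gam. ord_at P (sig (cc g) f))" by(rule psum_cong[of pts, OF o])
 also have "... = (SUM g:Gam. psum (%P. ord_at P (sig (cc g) f)))"
 proof (intro psum_sum finite_Gam)
  fix g assume "g : Gam"
  from s[OF this] show "fsupp (%P. ord_at P (sig (cc g) f))" by(intro fsupp_ord) auto
 qed
 also have "... = int (card Gam) * psum (%P. ord_at P f)" using r by simp
 finally have "int (card Gam) * psum (%P. ord_at P f) = 0" by simp
 moreover have "card Gam ~= 0" using finite_Gam one_Gam by auto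
 ultimately show ?thesis by simp
qed

end

section \<open>Degrees of vector bundles\<close>

lemma leibniz_det_mat: "leibniz_det r A = Determinant.det (mat r r (%(i, j). A i j))"
proof -
 have "(PROD i<r. A i (p i)) = (PROD i = 0..<r. mat r r (%(i, j). A i j) $$ (i, p i))" if "p permutes {0..<r}" for p
  using that by(intro prod.cong) (auto dest: permutes_in_image simp: atLeast0LessThan)
 thus ?thesis unfolding leibniz_det_def det_def'[OF mat_carrier] atLeast0LessThan[symmetric]
  by(intro sum.cong) (auto simp: sign_def atLeast0LessThan)
qed

lemma leibniz_det_cong: "(!!i j. i < r ==> j < r ==> A i j = B i j) ==> leibniz_det r A = leibniz_det r B"
 unfolding leibniz_det_mat by(intro arg_cong[where f = Determinant.det] eq_matI) auto

lemma leibniz_det_mult: "leibniz_det r (%i j. SUM k<r. A i k * B k j) = leibniz_det r A * leibniz_det r B"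
 unfolding leibniz_det_mat by(subst det_mult[symmetric, where n = r])
  (auto intro!: arg_cong[where f = Determinant.det] eq_matI sum.cong simp: scalar_prod_def atLeast0LessThan)

lemma leibniz_det_id: "leibniz_det r (%i j. if i = j then 1 else 0) = 1"
proof -
 have "mat r r (%(i, j). if i = j then 1 else 0) = (1\<^sub>m r :: 'a mat)" by(intro eq_matI) auto
 thus ?thesis unfolding leibniz_det_mat by simp
qed

lemma leibniz_det_in: "is_subring F ==> (!!i j. i < r ==> j < r ==> A i j : F) ==> leibniz_det r A : F"
 unfolding leibniz_det_mat by(rule det_in_subring[OF _ mat_carrier]) auto

lemma leibniz_det_1: "leibniz_det 1 A = A 0 0" unfolding leibniz_det_mat by(subst det_single) auto

lemma leibniz_det_2: "leibniz_det 2 A = A 0 0 * A 1 1 - A 0 1 * A 1 0"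
proof -
 have p: "{..<2::nat} = {0, 1}" "{\<sigma>. \<sigma> permutes {0, 1::nat}} = {id, transpose 0 1}"
  by(auto simp: permutes_doubleton_iff)
 have "id ~= transpose 0 (1::nat)" by(auto simp: fun_eq_iff transpose_def)
 thus ?thesis unfolding leibniz_det_def p by(simp add: sign_swap_id)
qed

lemma sum_scale_swap:
 fixes b :: "'j => 'a::field ^ 'm::finite"
 shows "(SUM i:I. c i *s (SUM j:J. A i j *s b j)) = (SUM j:J. (SUM i:I. c i * A i j) *s b j)"
 unfolding fvec_eq_iff by(auto simp: sum_distrib_left sum_distrib_right mult.assoc intro: sum.swap)

lemma sum_scale_add:
 fixes b :: "'j => 'a::field ^ 'm::finite"
 shows "(SUM i:I. c i *s b i) + (SUM i:I. c' i *s b i) = (SUM i:I. (c i + c' i) *s b i)"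
  and "a *s (SUM i:I. c i *s b i) = (SUM i:I. (a * c i) *s b i)" unfolding fvec_eq_iff
 by(auto simp: sum.distrib distrib_right sum_distrib_left mult.assoc)

lemma basis_indep:
 assumes "is_basis A r b M" "!!i. i < r ==> c i : A" "(SUM i<r. c i *s b i) = 0" "i < r"
 shows "c i = 0"
proof -
 have "ALL c. (ALL i<r. c i : A) & (SUM i<r. c i *s b i) = 0 --> (ALL i<r. c i = 0)"
  using assms(1) unfolding is_basis_def by(rule conjunct2)
 from this[rule_format, of c i] show ?thesis using assms(2-4) by simp
qed

lemma basis_expand: "is_basis A r b M ==> v : M ==> EX c. (ALL i<r. c i : A) & v = (SUM i<r. c i *s b i)"
 unfolding is_basis_def by blast

lemma basis_in: "is_basis A r b M ==> (!!i. i < r ==> c i : A) ==> (SUM i<r. c i *s b i) : M"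
 unfolding is_basis_def by blast

lemma basis_mem:
 assumes A: "is_subring A" and b: "is_basis A r b M" and "i < r" shows "b i : M"
proof -
 have "b i = (SUM j<r. (if j = i then 1 else 0) *s b j)"
  using assms(3) by(simp add: fvec_eq_iff if_distrib[of "%c. c * _"] cong: if_cong)
 also have "... : M" using subringD[OF A] by(intro basis_in[OF b]) auto
 finally show ?thesis .
qed

lemma basis_coeff_eq:
 assumes A: "is_subring A" and b: "is_basis A r b M"
  and c: "!!i. i < r ==> c i : A" "!!i. i < r ==> c' i : A"
  and eq: "(SUM i<r. c i *s b i) = (SUM i<r. c' i *s b i)" and "i < r" shows "c i = c' i"
proof -
 have "(SUM i<r. (c i - c' i) *s b i) = 0"
  using eq by(simp add: fvec_eq_iff left_diff_distrib sum_subtractf)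
 hence "c i - c' i = 0"
  using c subring_diff[OF A] \<open>i < r\<close> by(intro basis_indep[OF b, of "%i. c i - c' i"]) auto
 thus ?thesis by simp
qed

lemma basis_matrix:
 assumes b: "is_basis A r b M" and e: "ALL i<n. e i : M"
 shows "EX C. (ALL i<n. ALL j<r. C i j : A) & (ALL i<n. e i = (SUM j<r. C i j *s b j))"
proof -
 have ex: "EX c. (ALL j<r. c j : A) & e i = (SUM j<r. c j *s b j)" if "i < n" for i
  using basis_expand[OF b] e that by blast
 define C where "C i = (SOME c. (ALL j<r. c j : A) & e i = (SUM j<r. c j *s b j))" for i
 have "(ALL j<r. C i j : A) & e i = (SUM j<r. C i j *s b j)" if "i < n" for i
  unfolding C_def by(rule someI_ex[OF ex[OF that]])
 thus ?thesis by blast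
qed

lemma basis_length_le:
 assumes K: "is_subfield K" and b: "is_basis K r b M" and e: "!!i. i < n ==> e i : M"
  and ind: "!!c. (!!i. i < n ==> c i : K) ==> (SUM i<n. c i *s e i) = 0 ==> ALL i<n. c i = 0"
 shows "n <= r"
proof (rule ccontr)
 assume "~ n <= r"
 obtain C where C: "ALL i<n. ALL j<r. C i j : K" "ALL i<n. e i = (SUM j<r. C i j *s b j)"
 proof -
  have "EX C. (ALL i<n. ALL j<r. C i j : K) & (ALL i<n. e i = (SUM j<r. C i j *s b j))"
   by(rule basis_matrix[OF b]) (use e in blast)
  thus thesis by(elim exE conjE) (rule that)
 qed
 obtain c where c: "ALL i. c i : K" "EX i:{..<n}. c i ~= 0" "ALL j:{..<r}. (SUM i<n. C i j * c i) = 0"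
  using nontrivial_solution[OF K, of "{..<r}" "{..<n}" "%j i. C i j"] C(1) \<open>\<not> n \<le> r\<close> by auto
 have "(SUM i<n. c i *s e i) = (SUM i<n. c i *s (SUM j<r. C i j *s b j))"
  using C(2) by(intro sum.cong) auto
 also have "... = (SUM j<r. (SUM i<n. c i * C i j) *s b j)" by(rule sum_scale_swap)
 also have "... = (SUM j<r. 0 *s b j)" using c(3) by(intro sum.cong) (auto simp: mult.commute)
 also have "... = 0" by(simp add: fvec_eq_iff)
 finally show False using ind[of c] c by blast
qed

lemma basis_rank_le:
 assumes K: "is_subfield K" and b: "is_basis K r b M" and e: "is_basis K r' e M'" and sub: "M' <= M"
 shows "r' <= r"
proof (rule basis_length_le[OF K b])
 show "e i : M" if "i < r'" for i using basis_mem[OF subfield_subring[OF K] e that] sub by blast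
 show "ALL i<r'. c i = 0" if "!!i. i < r' ==> c i : K" "(SUM i<r'. c i *s e i) = 0" for c
  using basis_indep[OF e that] by blast
qed

lemma basis_full:
 assumes K: "is_subfield K" and b: "is_basis K r b M" and e: "is_basis K r e M'" and sub: "M' <= M"
 shows "M' = M"
proof (rule antisym[OF sub], rule subsetI, rule ccontr)
 note R = subringD[OF subfield_subring[OF K]]
 fix v assume v: "v : M" "v ~: M'"
 define e' where "e' i = (if i < r then e i else v)" for i
 have "Suc r <= r"
 proof (rule basis_length_le[OF K b])
  show "e' i : M" if "i < Suc r" for i
   using v(1) basis_mem[OF subfield_subring[OF K] e] sub by(auto simp: e'_def)
  fix c assume c: "!!i. i < Suc r ==> c i : K" "(SUM i<Suc r. c i *s e' i) = 0"
  have s: "(SUM i<r. c i *s e i) + c r *s v = 0" using c(2) by(simp add: e'_def)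
  have "c r = 0"
  proof (rule ccontr)
   assume r0: "c r ~= 0"
   have "v = inverse (c r) *s (c r *s v)" using r0 by(simp add: fvec_eq_iff)
   also have "c r *s v = (- 1) *s (SUM i<r. c i *s e i)"
    using s by(simp add: fvec_eq_iff eq_neg_iff_add_eq_0 add.commute)
   finally have "v = (SUM i<r. (inverse (c r) * (- 1 * c i)) *s e i)" by(simp only: sum_scale_add)
   also have "... : M'" using c(1) subfield_inverse[OF K] R by(intro basis_in[OF e] R(5)) auto
   finally show False using v(2) by simp
  qed
  moreover from this have "(SUM i<r. c i *s e i) = 0" using s by simp
  hence "c i = 0" if "i < r" for i by(rule basis_indep[OF e, rotated]) (use c(1) that in simp_all)
  ultimately show "ALL i<Suc r. c i = 0" by(auto simp: less_Suc_eq)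
 qed
 thus False by simp
qed

text \<open>If D expresses b by the basis e, then A D = 1. For a coefficient matrix B over b, the
  product B D depends only on the vectors that B produces, so cancelling det D determines det
  B.\<close>

lemma basis_det:
 assumes K: "is_subfield K" and e: "is_basis K r e M" and b: "!!i. i < r ==> b i : M"
  and A: "!!i j. i < r ==> j < r ==> A i j : K" "!!i. i < r ==> e i = (SUM j<r. A i j *s b j)"
 shows "leibniz_det r A ~= 0" "leibniz_det r A : K"
  and "!!B B'. (!!i j. i < r ==> j < r ==> B i j : K) ==> (!!i j. i < r ==> j < r ==> B' i j : K) ==>
   (!!i. i < r ==> (SUM j<r. B i j *s b j) = (SUM j<r. B' i j *s b j)) ==> leibniz_det r B = leibniz_det r B'"
proof -
 note S = subfield_subring[OF K]
 obtain D where D: "ALL i<r. ALL j<r. D i j : K" "ALL i<r. b i = (SUM j<r. D i j *s e j)"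
 proof -
  have "EX D. (ALL i<r. ALL j<r. D i j : K) & (ALL i<r. b i = (SUM j<r. D i j *s e j))"
   by(rule basis_matrix[OF e]) (use b in blast)
  thus thesis by(elim exE conjE) (rule that)
 qed
 have ex: "(SUM j<r. c j *s b j) = (SUM k<r. (SUM j<r. c j * D j k) *s e k)" for c
 proof -
  have "(SUM j<r. c j *s b j) = (SUM j<r. c j *s (SUM k<r. D j k *s e k))" using D(2) by(intro sum.cong) auto
  thus ?thesis by(simp only: sum_scale_swap)
 qed
 have DK: "(SUM j<r. c j * D j k) : K" if "!!j. j < r ==> c j : K" "k < r" for c k
  using that D(1) by(intro subring_sum[OF S] subringD(5)[OF S]) auto
 have "(SUM j<r. A i j * D j k) = (if i = k then 1 else 0)" if i: "i < r" "k < r" for i k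
 proof (rule basis_coeff_eq[OF S e, of "%k. SUM j<r. A i j * D j k" "%k. if i = k then 1 else 0"])
  show "(SUM k<r. (SUM j<r. A i j * D j k) *s e k) = (SUM k<r. (if i = k then 1 else 0) *s e k)"
   using A(2)[OF i(1)] i(1) unfolding ex[symmetric]
   by(simp add: fvec_eq_iff if_distrib[of "%c. c * _"] cong: if_cong)
 qed (use A(1) i DK subringD[OF S] in auto)
 hence "leibniz_det r (%i k. SUM j<r. A i j * D j k) = leibniz_det r (%i k. if i = k then 1 else 0)"
  by(rule leibniz_det_cong)
 hence "leibniz_det r (%i k. SUM j<r. A i j * D j k) = 1" by(simp only: leibniz_det_id)
 hence AD: "leibniz_det r A * leibniz_det r D = 1" by(simp add: leibniz_det_mult)
 thus "leibniz_det r A ~= 0" by auto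
 show "leibniz_det r A : K" by(rule leibniz_det_in[OF S A(1)])
 fix B B' assume B: "!!i j. i < r ==> j < r ==> B i j : K" "!!i j. i < r ==> j < r ==> B' i j : K"
  and eq: "!!i. i < r ==> (SUM j<r. B i j *s b j) = (SUM j<r. B' i j *s b j)"
 have "(SUM j<r. B i j * D j k) = (SUM j<r. B' i j * D j k)" if i: "i < r" "k < r" for i k
 proof (rule basis_coeff_eq[OF S e, of "%k. SUM j<r. B i j * D j k" "%k. SUM j<r. B' i j * D j k"])
  show "(SUM k<r. (SUM j<r. B i j * D j k) *s e k) = (SUM k<r. (SUM j<r. B' i j * D j k) *s e k)"
   unfolding ex[symmetric] by(rule eq[OF i(1)])
 qed (use B i DK in auto)
 hence "leibniz_det r (%i k. SUM j<r. B i j * D j k) = leibniz_det r (%i k. SUM j<r. B' i j * D j k)"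
  by(rule leibniz_det_cong)
 hence "leibniz_det r B * leibniz_det r D = leibniz_det r B' * leibniz_det r D"
  by(simp add: leibniz_det_mult)
 thus "leibniz_det r B = leibniz_det r B'" using AD by auto
qed

lemma lin_span_base: "is_subring A ==> v : S ==> v : lin_span A S"
 unfolding lin_span_def by(auto simp: subringD fvec_eq_iff intro!: exI[of _ "%_. 1"] exI[of _ "{v}"])

lemma lin_span_expand:
 fixes r :: nat
 assumes A: "is_subring A" and S: "!!v. v : S ==> EX c. (ALL i<r. c i : A) & v = (SUM i<r. c i *s b i)"
  and v: "v : lin_span A S"
 shows "EX c. (ALL i<r. c i : A) & v = (SUM i<r. c i *s b i)"
proof -
 obtain a T where T: "v = (SUM u:T. a u *s u)" "finite T" "T <= S" "ALL u:T. a u : A"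
  using v unfolding lin_span_def by blast
 define C where "C u = (SOME c. (ALL i<r. c i : A) & u = (SUM i<r. c i *s b i))" for u
 have C: "(ALL i<r. C u i : A) & u = (SUM i<r. C u i *s b i)" if "u : T" for u
  unfolding C_def using someI_ex[OF S[of u]] that T(3) by blast
 have "v = (SUM u:T. a u *s (SUM i<r. C u i *s b i))" unfolding T(1) using C by(intro sum.cong) auto
 hence "v = (SUM i<r. (SUM u:T. a u * C u i) *s b i)" by(simp only: sum_scale_swap)
 moreover have "ALL i<r. (SUM u:T. a u * C u i) : A"
  using C T(4) by(intro allI impI subring_sum[OF A] subringD(5)[OF A]) auto
 ultimately show ?thesis by(intro exI[of _ "%i. SUM u:T. a u * C u i"] conjI)
qed

lemma lin_span_expand_image:
 fixes r :: nat
 assumes A: "is_subring A" and v: "v : lin_span A (e ` {..<r})"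
 shows "EX c. (ALL i<r. c i : A) & v = (SUM i<r. c i *s e i)"
proof (rule lin_span_expand[OF A _ v])
 fix u assume "u : e ` {..<r}"
 then obtain k where k: "k < r" "u = e k" by auto
 have "u = (SUM j<r. (if j = k then 1 else 0) *s e j)"
  using k by(simp add: fvec_eq_iff if_distrib[of "%c. c * _"] cong: if_cong)
 thus "EX c. (ALL i<r. c i : A) & u = (SUM i<r. c i *s e i)"
  using subringD(1,2)[OF A] by(intro exI[of _ "%i. if i = k then 1 else 0"]) simp
qed

lemma lin_span_0: "0 : lin_span A S" unfolding lin_span_def by(auto intro!: exI[of _ "{}"])

lemma lin_span_scale: "is_subring A ==> a : A ==> v : lin_span A S ==> a *s v : lin_span A S"
proof -
 assume A: "is_subring A" "a : A" "v : lin_span A S"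
 then obtain c T where T: "v = (SUM u:T. c u *s u)" "finite T" "T <= S" "ALL u:T. c u : A"
  unfolding lin_span_def by blast
 have "a *s v = (SUM u:T. (a * c u) *s u)" unfolding T(1) by(rule sum_scale_add(2))
 thus ?thesis unfolding lin_span_def using T subringD(5)[OF A(1,2)]
  by(intro CollectI exI[of _ "%u. a * c u"] exI[of _ T]) auto
qed

lemma lin_span_add:
 assumes A: "is_subring A" and "v : lin_span A S" "w : lin_span A S" shows "v + w : lin_span A S"
proof -
 obtain c T where T: "v = (SUM u:T. c u *s u)" "finite T" "T <= S" "ALL u:T. c u : A"
  using assms(2) unfolding lin_span_def by blast
 obtain c' T' where T': "w = (SUM u:T'. c' u *s u)" "finite T'" "T' <= S" "ALL u:T'. c' u : A"
  using assms(3) unfolding lin_span_def by blast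
 define f where "f u = (if u : T then c u else 0)" for u
 define g where "g u = (if u : T' then c' u else 0)" for u
 have "v = (SUM u:T \<union> T'. f u *s u)" unfolding T(1) f_def
  using T(2) T'(2) by(intro sum.mono_neutral_cong_left) auto
 moreover have "w = (SUM u:T \<union> T'. g u *s u)" unfolding T'(1) g_def
  using T(2) T'(2) by(intro sum.mono_neutral_cong_left) auto
 ultimately have "v + w = (SUM u:T \<union> T'. (f u + g u) *s u)" by(simp only: sum_scale_add(1))
 moreover have "ALL u. f u + g u : A" using T(4) T'(4) subringD(1,4)[OF A] by(simp add: f_def g_def)
 ultimately show ?thesis unfolding lin_span_def using T(2,3) T'(2,3)
  by(intro CollectI exI[of _ "%u. f u + g u"] exI[of _ "T \<union> T'"]) auto
qed

lemma lin_span_sum: "is_subring A ==> (!!i. i : I ==> f i : lin_span A S) ==> sum f I : lin_span A S"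
 by(induction I rule: infinite_finite_induct) (auto simp: lin_span_0 lin_span_add)

lemma lin_span_least:
 assumes "S <= M" "0 : M" "!!u v. u : M ==> v : M ==> u + v : M" "!!a v. a : A ==> v : M ==> a *s v : M"
 shows "lin_span A S <= M"
proof
 fix v assume "v : lin_span A S"
 then obtain c T where T: "v = (SUM u:T. c u *s u)" "finite T" "T <= S" "ALL u:T. c u : A"
  unfolding lin_span_def by blast
 have "(SUM u:T. c u *s u) : M" using T(2-) by(induction T rule: finite_induct) (use assms in auto)
 thus "v : M" using T(1) by simp
qed

lemma lin_span_image:
 fixes r :: nat
 assumes A: "is_subring A"
 shows "lin_span A (f ` {..<r}) = {SUM i<r. c i *s f i |c. ALL i<r. c i : A}"
proof (intro equalityI subsetI)
 fix v assume "v : lin_span A (f ` {..<r})"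
 from lin_span_expand_image[OF A this] show "v : {SUM i<r. c i *s f i |c. ALL i<r. c i : A}" by blast
next
 fix v assume "v : {SUM i<r. c i *s f i |c. ALL i<r. c i : A}"
 then obtain c where c: "ALL i<r. c i : A" "v = (SUM i<r. c i *s f i)" by blast
 show "v : lin_span A (f ` {..<r})" unfolding c(2)
  using c(1) by(intro lin_span_sum[OF A] lin_span_scale[OF A] lin_span_base[OF A]) auto
qed

lemma lin_span_basis: "is_subring A ==> is_basis A r b M ==> lin_span A (b ` {..<r}) = M"
 unfolding lin_span_image is_basis_def by(rule sym, rule conjunct1)

lemma basis_span:
 assumes K: "is_subfield K" and P: "is_subring P" "P <= K" and f: "is_basis K r f M"
 shows "is_basis P r f (lin_span P (f ` {..<r}))"
 unfolding is_basis_def lin_span_image[OF P(1)] using basis_indep[OF f] P(2) by blast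

section \<open>Bundles on an abstract complete curve\<close>

no_notation fps_nth (infixl "$" 75)

text \<open>All that the theory of degrees takes from a smooth projective curve: points that are
  discrete valuation rings, and principal divisors that are finite and of degree 0.\<close>

locale complete_curve =
 fixes C :: "'l::field curve"
 assumes K_field: "is_subfield (fun_field C)"
  and dvrs: "!!P. P : points C ==> dvr (fun_field C) P"
  and fsupp_fun: "!!f. f : fun_field C ==> f ~= 0 ==> fsupp_on (points C) (%P. ord_at P f)"
  and sum_fun: "!!f. f : fun_field C ==> f ~= 0 ==> sum_on (points C) (%P. ord_at P f) = 0"
begin

abbreviation K :: "'l set" where
 "K \<equiv> fun_field C"

lemmas K_ring = subfield_subring[OF K_field]

lemma P_ring: "P : points C ==> is_subring P" and P_sub: "P : points C ==> P <= K"
 using dvrD(2,3)[OF dvrs] by auto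

text \<open>The witnesses in the definite description of \<open>bundle_degree\<close>: a generic
  basis e, local bases b and the transition matrices A.\<close>

definition deg_data where
 "deg_data E r e b A \<longleftrightarrow> is_basis K r e (generic_stalk E) &
   (ALL P:points C. is_basis P r (b P) (stalk E P) &
    (ALL i<r. (ALL j<r. A P i j : K) & e i = (SUM j<r. A P i j *s b P j)))"

lemma bundle_degree_altdef: "bundle_degree C E = (THE m. EX r e b A. deg_data E r e b A &
  m = sum_on (points C) (%P. ord_at P (leibniz_det r (A P))))"
 unfolding bundle_degree_def deg_data_def sum_on_def conj_assoc ..

lemma vbD:
 assumes "vector_bundle C E"
 obtains r e where "is_basis K r e (generic_stalk E)"
  and "!!P. P : points C ==> EX b. is_basis P r b (stalk E P)"
  and "!!P. P : points C ==> generic_stalk E = lin_span K (stalk E P)"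
  and "finite {P : points C. stalk E P ~= lin_span P (e ` {..<r})}"
 using assms unfolding vector_bundle_def by(elim conjE exE) (erule that; blast)

lemma generic_span: "vector_bundle C E ==> P : points C ==> generic_stalk E = lin_span K (stalk E P)"
 by(erule vbD)

lemma stalk_generic: "vector_bundle C E ==> P : points C ==> stalk E P <= generic_stalk E"
 using generic_span[of E P] lin_span_base[OF K_ring] by auto

lemma basis_unique: "is_basis K r e M ==> is_basis K r' e' M ==> r = r'"
 using basis_rank_le[OF K_field] by(metis order_refl antisym)

lemma bundle_rank_eq: "is_basis K r e (generic_stalk E) ==> bundle_rank C E = r"
 unfolding bundle_rank_def by(rule the_equality) (auto dest: basis_unique)

lemma deg_data_exists:
 assumes vb: "vector_bundle C E" shows "EX r e b A. deg_data E r e b A"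
proof -
 obtain r e where e: "is_basis K r e (generic_stalk E)"
  and b: "!!P. P : points C ==> EX b. is_basis P r b (stalk E P)"
  by(rule vbD[OF vb]) (rule that)
 define B where "B P = (SOME b. is_basis P r b (stalk E P))" for P
 have B: "is_basis P r (B P) (stalk E P)" if "P : points C" for P
  unfolding B_def by(rule someI_ex[OF b[OF that]])
 have "EX c. (ALL j<r. c j : K) & e i = (SUM j<r. c j *s B P j)" if P: "P : points C" and i: "i < r" for P i
 proof (rule lin_span_expand[OF K_ring])
  show "e i : lin_span K (stalk E P)" using basis_mem[OF K_ring e i] unfolding generic_span[OF vb P] .
  fix v assume "v : stalk E P"
  then obtain c where "ALL j<r. c j : P" "v = (SUM j<r. c j *s B P j)" using basis_expand[OF B[OF P]] by blast
  thus "EX c. (ALL j<r. c j : K) & v = (SUM j<r. c j *s B P j)"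
   using P_sub[OF P] by(intro exI[of _ c]) blast
 qed
 note ex = this
 define A where "A P i = (SOME c. (ALL j<r. c j : K) & e i = (SUM j<r. c j *s B P j))" for P i
 have "(ALL j<r. A P i j : K) & e i = (SUM j<r. A P i j *s B P j)" if "P : points C" "i < r" for P i
  unfolding A_def by(rule someI_ex[OF ex[OF that]])
 hence "deg_data E r e B A" unfolding deg_data_def using e B by blast
 thus ?thesis by blast
qed

lemma deg_dataD:
 assumes "deg_data E r e b A" shows "is_basis K r e (generic_stalk E)"
  and "!!P. P : points C ==> is_basis P r (b P) (stalk E P)"
  and "!!P i j. P : points C ==> i < r ==> j < r ==> A P i j : K"
  and "!!P i. P : points C ==> i < r ==> e i = (SUM j<r. A P i j *s b P j)"
 using assms unfolding deg_data_def by blast+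

lemma basis_transition:
 assumes e: "is_basis K r e M" and f: "is_basis K r f M"
  and H: "ALL i<r. ALL j<r. H i j : K" "ALL i<r. f i = (SUM j<r. H i j *s e j)"
 shows "leibniz_det r H : K" "leibniz_det r H ~= 0"
proof -
 show "leibniz_det r H : K" by(rule leibniz_det_in[OF K_ring]) (simp add: H(1))
 show "leibniz_det r H ~= 0"
 proof (rule basis_det(1)[OF K_field f])
  show "e i : M" if "i < r" for i by(rule basis_mem[OF K_ring e that])
  show "H i j : K" if "i < r" "j < r" for i j using H(1) that by blast
  show "f i = (SUM j<r. H i j *s e j)" if "i < r" for i by(rule H(2)[rule_format, OF that])
 qed
qed

text \<open>The smaller lattice has a basis b' = G b with G over P, so det G has nonnegative order;
  comparing the two ways from f to b gives det H det A = det A' det G.\<close>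

lemma lattice_compare:
 assumes P: "P : points C" and e: "is_basis K r e M" and f: "is_basis K r f M"
  and b: "is_basis P r b L" "L <= M" and b': "is_basis P r b' L'" "L' <= L"
  and A: "!!i j. i < r ==> j < r ==> A i j : K" "!!i. i < r ==> e i = (SUM j<r. A i j *s b j)"
  and A': "!!i j. i < r ==> j < r ==> A' i j : K" "!!i. i < r ==> f i = (SUM j<r. A' i j *s b' j)"
  and H: "ALL i<r. ALL j<r. H i j : K" "ALL i<r. f i = (SUM j<r. H i j *s e j)"
 shows "ord_at P (leibniz_det r A') <= ord_at P (leibniz_det r H) + ord_at P (leibniz_det r A)"
proof -
 note D = dvrs[OF P] and R = P_ring[OF P] and PK = P_sub[OF P]
 have bM: "b i : M" "b' i : L" if "i < r" for i
  using basis_mem[OF R b(1) that] b(2) basis_mem[OF R b'(1) that] b'(2) by auto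
 hence "b' i : M" if "i < r" for i using that b(2) by blast
 note a = basis_det(1,2)[OF K_field e bM(1) A] and a' = basis_det(1,2)[OF K_field f this A']
 have "ALL i<r. b' i : L" using bM(2) by blast
 from basis_matrix[OF b(1) this] obtain G where G: "ALL i<r. ALL j<r. G i j : P"
  "ALL i<r. b' i = (SUM j<r. G i j *s b j)" by(elim exE conjE)
 have "leibniz_det r (%i j. SUM k<r. H i k * A k j) = leibniz_det r (%i j. SUM k<r. A' i k * G k j)"
 proof (rule basis_det(3)[OF K_field e bM(1) A])
  fix i assume i: "i < r"
  show "(SUM k<r. H i k * A k j) : K" "(SUM k<r. A' i k * G k j) : K" if "j < r" for j
   using H(1) A'(1) G(1) i A(1) that PK by(auto intro!: subring_sum[OF K_ring] subringD(5)[OF K_ring])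
  have "(SUM j<r. (SUM k<r. H i k * A k j) *s b j) = (SUM k<r. H i k *s e k)"
   unfolding sum_scale_swap[symmetric] using A(2) by(intro sum.cong) auto
  also have "... = (SUM k<r. A' i k *s b' k)" using H(2) A'(2)[OF i] i by simp
  also have "... = (SUM k<r. A' i k *s (SUM j<r. G k j *s b j))" using G(2) by(intro sum.cong) auto
  finally show "(SUM j<r. (SUM k<r. H i k * A k j) *s b j) = (SUM j<r. (SUM k<r. A' i k * G k j) *s b j)"
   by(simp only: sum_scale_swap)
 qed
 hence det: "leibniz_det r H * leibniz_det r A = leibniz_det r A' * leibniz_det r G"
  by(simp only: leibniz_det_mult)
 have h: "leibniz_det r H : K" "leibniz_det r H ~= 0" by(rule basis_transition[OF e f H])+
 have GP: "leibniz_det r G : P" using G(1) by(intro leibniz_det_in[OF R]) blast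
 have G0: "leibniz_det r G ~= 0" using det h(2) a(1) by auto
 have GK: "leibniz_det r G : K" using GP PK by blast
 have "0 <= ord_at P (leibniz_det r G)" using mem_iff_ord[OF D GK G0] GP by simp
 moreover have "ord_at P (leibniz_det r H) + ord_at P (leibniz_det r A) =
   ord_at P (leibniz_det r A') + ord_at P (leibniz_det r G)"
  using ord_mult[OF D h a(2,1)] ord_mult[OF D a'(2,1) GK G0] unfolding det by simp
 ultimately show ?thesis by simp
qed

lemma deg_data_fsupp:
 assumes vb: "vector_bundle C E" and dd: "deg_data E r e b A"
 shows "fsupp_on (points C) (%P. ord_at P (leibniz_det r (A P)))"
proof -
 note D = deg_dataD[OF dd]
 obtain r0 f where f0: "is_basis K r0 f (generic_stalk E)"
  and fin0: "finite {P : points C. stalk E P ~= lin_span P (f ` {..<r0})}"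
  by(rule vbD[OF vb]) (rule that)
 have "r0 = r" by(rule basis_unique[OF f0 D(1)])
 note f = f0[unfolded this] and fin = fin0[unfolded this]
 have "ALL i<r. f i : generic_stalk E" "ALL i<r. e i : generic_stalk E" using basis_mem[OF K_ring f] basis_mem[OF K_ring D(1)] by auto
 from basis_matrix[OF D(1) this(1)] basis_matrix[OF f this(2)] obtain H H' where
  H: "ALL i<r. ALL j<r. H i j : K" "ALL i<r. f i = (SUM j<r. H i j *s e j)"
  and H': "ALL i<r. ALL j<r. H' i j : K" "ALL i<r. e i = (SUM j<r. H' i j *s f j)" by(elim exE conjE)
 let ?I = "%i j. if i = j then 1 else 0 :: 'l"
 have I: "?I i j : K" for i j :: nat using subringD(1,2)[OF K_ring] by simp
 have If: "f i = (SUM j<r. ?I i j *s f j)" if "i < r" for i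
  using that by(simp add: fvec_eq_iff if_distrib[of "%c. c * _"] cong: if_cong)
 have "ord_at P (leibniz_det r (A P)) = 0"
  if P: "P : points C" and s: "stalk E P = lin_span P (f ` {..<r})" and o: "ord_at P (leibniz_det r H) = 0"
   "ord_at P (leibniz_det r H') = 0" for P
 proof -
  note fP = basis_span[OF K_field P_ring[OF P] P_sub[OF P] f, folded s] and sg = stalk_generic[OF vb P]
  have "ord_at P (leibniz_det r ?I) <= ord_at P (leibniz_det r H) + ord_at P (leibniz_det r (A P))"
   by(rule lattice_compare[OF P D(1) f D(2)[OF P] sg fP order_refl D(3,4)[OF P] I If H])
  moreover have "ord_at P (leibniz_det r (A P)) <= ord_at P (leibniz_det r H') + ord_at P (leibniz_det r ?I)"
   by(rule lattice_compare[OF P f D(1) fP sg D(2)[OF P] order_refl I If D(3,4)[OF P] H'])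
  ultimately show ?thesis using o ord_1[OF dvrs[OF P]] by(simp add: leibniz_det_id)
 qed
 hence "{P : points C. ord_at P (leibniz_det r (A P)) ~= 0} <= {P : points C. stalk E P ~= lin_span P (f ` {..<r})} \<union>
   ({P : points C. ord_at P (leibniz_det r H) ~= 0} \<union> {P : points C. ord_at P (leibniz_det r H') ~= 0})"
  by blast
 moreover note fsupp_fun[OF basis_transition[OF D(1) f H]] fsupp_fun[OF basis_transition[OF f D(1) H']]
 ultimately show ?thesis using fin unfolding fsupp_on_def by(meson finite_UnI finite_subset)
qed

text \<open>\<open>lattice_compare\<close> is summed over all points; the transition determinant
  between the generic bases is a rational function and contributes 0. Applied with F = E in both
  directions, it shows that the degree is well defined.\<close>

lemma deg_data_le:
 assumes vb: "vector_bundle C E" and dd: "deg_data E r e b A"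
  and vb': "vector_bundle C F" and dd': "deg_data F r f b' A'" and sub: "subsheaf C F E"
 shows "sum_on (points C) (%P. ord_at P (leibniz_det r (A' P))) <=
  sum_on (points C) (%P. ord_at P (leibniz_det r (A P)))"
proof -
 note D = deg_dataD[OF dd] and D' = deg_dataD[OF dd']
 have "generic_stalk F = generic_stalk E"
  using basis_full[OF K_field D(1) D'(1)] sub unfolding subsheaf_def by blast
 note f = D'(1)[unfolded this]
 have "ALL i<r. f i : generic_stalk E" using basis_mem[OF K_ring f] by blast
 from basis_matrix[OF D(1) this] obtain H where H: "ALL i<r. ALL j<r. H i j : K"
  "ALL i<r. f i = (SUM j<r. H i j *s e j)" by(elim exE conjE)
 note h = basis_transition[OF D(1) f H]
 have le: "ord_at P (leibniz_det r (A' P)) <= ord_at P (leibniz_det r H) + ord_at P (leibniz_det r (A P))"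
  if P: "P : points C" for P
 proof (rule lattice_compare[OF P D(1) f D(2)[OF P] stalk_generic[OF vb P] D'(2)[OF P] _ D(3,4)[OF P] D'(3,4)[OF P] H])
  show "stalk F P <= stalk E P" using sub P unfolding subsheaf_def by blast
 qed
 have "sum_on (points C) (%P. ord_at P (leibniz_det r (A' P))) <=
   sum_on (points C) (%P. ord_at P (leibniz_det r H) + ord_at P (leibniz_det r (A P)))"
  by(intro psum_mono fsupp_add deg_data_fsupp[OF vb dd] deg_data_fsupp[OF vb' dd'] fsupp_fun h le)
 also have "... = sum_on (points C) (%P. ord_at P (leibniz_det r (A P)))"
  using psum_add[OF fsupp_fun[OF h] deg_data_fsupp[OF vb dd]] sum_fun[OF h] by simp
 finally show ?thesis .
qed

lemma subsheaf_refl: "subsheaf C E E" by(simp add: subsheaf_def)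

lemma bundle_degree_eq:
 assumes vb: "vector_bundle C E" and dd: "deg_data E r e b A"
 shows "bundle_degree C E = sum_on (points C) (%P. ord_at P (leibniz_det r (A P)))"
 unfolding bundle_degree_altdef
proof (rule the_equality)
 show "EX r' e b A'. deg_data E r' e b A' & sum_on (points C) (%P. ord_at P (leibniz_det r (A P))) =
   sum_on (points C) (%P. ord_at P (leibniz_det r' (A' P)))" using dd by blast
 fix m assume "EX r e b A. deg_data E r e b A & m = sum_on (points C) (%P. ord_at P (leibniz_det r (A P)))"
 then obtain r' e' b' A' where d: "deg_data E r' e' b' A'"
  and m: "m = sum_on (points C) (%P. ord_at P (leibniz_det r' (A' P)))" by blast
 have "r' = r" by(rule basis_unique[OF deg_dataD(1)[OF d] deg_dataD(1)[OF dd]])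
 note d' = d[unfolded this] and m' = m[unfolded this]
 show "m = sum_on (points C) (%P. ord_at P (leibniz_det r (A P)))"
  unfolding m' by(rule antisym[OF deg_data_le[OF vb dd vb d' subsheaf_refl] deg_data_le[OF vb d' vb dd subsheaf_refl]])
qed

lemma bundle_degree_mono:
 assumes vb: "vector_bundle C E" and vb': "vector_bundle C F" and sub: "subsheaf C F E"
  and rk: "bundle_rank C F = bundle_rank C E" shows "bundle_degree C F <= bundle_degree C E"
proof -
 obtain r e b A where dd: "deg_data E r e b A" using deg_data_exists[OF vb] by blast
 obtain r' e' b' A' where d: "deg_data F r' e' b' A'" using deg_data_exists[OF vb'] by blast
 have "r' = r" using rk bundle_rank_eq[OF deg_dataD(1)[OF d]] bundle_rank_eq[OF deg_dataD(1)[OF dd]] by simp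
 note d' = d[unfolded this]
 show ?thesis unfolding bundle_degree_eq[OF vb dd] bundle_degree_eq[OF vb' d'] by(rule deg_data_le[OF vb dd vb' d' sub])
qed

lemma bundle_rank_mono:
 assumes vb: "vector_bundle C E" and vb': "vector_bundle C F" and sub: "subsheaf C F E"
 shows "bundle_rank C F <= bundle_rank C E"
proof -
 obtain r e where e: "is_basis K r e (generic_stalk E)" by(rule vbD[OF vb]) (rule that)
 obtain r' e' where e': "is_basis K r' e' (generic_stalk F)" by(rule vbD[OF vb']) (rule that)
 show ?thesis unfolding bundle_rank_eq[OF e] bundle_rank_eq[OF e']
  using sub by(intro basis_rank_le[OF K_field e e']) (simp add: subsheaf_def)
qed

lemma rank_one_semistable:
 assumes vb: "vector_bundle C E" and rk: "bundle_rank C E = 1" shows "semistable C E" unfolding semistable_def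
proof (intro conjI vb allI impI)
 fix F assume F: "vector_bundle C F & subsheaf C F E & 0 < bundle_rank C F"
 hence "bundle_rank C F = 1" using bundle_rank_mono[OF vb, of F] rk by simp
 thus "bundle_slope C F <= bundle_slope C E"
  using bundle_degree_mono[OF vb, of F] F rk by(simp add: bundle_slope_def)
qed

lemma vector_bundleI:
 assumes e: "is_basis K r e (generic_stalk E)" and MK: "!!v i. v : generic_stalk E ==> v $ i : K"
  and b: "!!P. P : points C ==> is_basis P r (b P) (stalk E P)" "!!P. P : points C ==> is_basis K r (b P) (generic_stalk E)"
  and fin: "finite {P : points C. stalk E P ~= lin_span P (e ` {..<r})}" shows "vector_bundle C E"
proof -
 have "generic_stalk E = lin_span K (stalk E P)" if P: "P : points C" for P
 proof
  note L = lin_span_least[where A = K] lin_span_0 lin_span_add[OF K_ring] lin_span_scale[OF K_ring]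
  have "stalk E P <= lin_span K (b P ` {..<r})"
   unfolding lin_span_basis[OF P_ring[OF P] b(1)[OF P], symmetric] lin_span_image[OF P_ring[OF P]] lin_span_image[OF K_ring]
   using P_sub[OF P] by blast
  from L(1)[OF this L(2-4)] show "lin_span K (stalk E P) <= generic_stalk E"
   unfolding lin_span_basis[OF K_ring b(2)[OF P]] .
  have "b P ` {..<r} <= lin_span K (stalk E P)"
   using basis_mem[OF P_ring[OF P] b(1)[OF P]] by(auto intro: lin_span_base[OF K_ring])
  from L(1)[OF this L(2-4)] show "generic_stalk E <= lin_span K (stalk E P)"
   unfolding lin_span_basis[OF K_ring b(2)[OF P]] .
 qed
 moreover have "EX b. is_basis P r b (stalk E P)" if "P : points C" for P
  by(rule exI[of _ "b P"]) (rule b(1)[OF that])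
 moreover have "generic_stalk E <= {v. ALL i. v $ i : K}" using MK by blast
 moreover have "EX r e. is_basis K r e (generic_stalk E) & (ALL P:points C. EX b. is_basis P r b (stalk E P)) & finite {P : points C. stalk E P ~= lin_span P (e ` {..<r})}" if "ALL P:points C. EX b. is_basis P r b (stalk E P)"
  by(rule exI[of _ r], rule exI[of _ e], intro conjI e fin that)
 ultimately show ?thesis unfolding vector_bundle_def by simp
qed

end

section \<open>Line bundles and saturated line subbundles\<close>

lemma is_basis_scaled:
 fixes s :: "'a::field ^ 'm::finite"
 assumes "s ~= 0" "g ~= 0" shows "is_basis A 1 (%_. g *s s) {c *s s | c. c / g : A}"
proof -
 have "{c *s s | c. c / g : A} = {a *s (g *s s) | a. a : A}"
 proof (intro equalityI subsetI)
  fix v assume "v : {c *s s | c. c / g : A}"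
  then obtain c where "v = c *s s" "c / g : A" by blast
  thus "v : {a *s (g *s s) | a. a : A}"
   using assms(2) by(intro CollectI exI[of _ "c / g"]) (simp add: vector_smult_assoc)
 next
  fix v assume "v : {a *s (g *s s) | a. a : A}"
  then obtain a where "v = a *s (g *s s)" "a : A" by blast
  thus "v : {c *s s | c. c / g : A}"
   using assms(2) by(intro CollectI exI[of _ "a * g"]) (simp add: vector_smult_assoc)
 qed
 also have "... = {SUM i<1::nat. c i *s (g *s s) | c. ALL i<1::nat. c i : A}"
 proof (intro equalityI subsetI)
  fix v assume "v : {a *s (g *s s) | a. a : A}"
  then obtain a where "v = a *s (g *s s)" "a : A" by blast
  thus "v : {SUM i<1::nat. c i *s (g *s s) | c. ALL i<1::nat. c i : A}"
   by(intro CollectI exI[of _ "%_. a"]) simp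
 qed auto
 finally show ?thesis unfolding is_basis_def by(rule conjI) (use assms in simp)
qed

context complete_curve
begin

lemma ord_ge_0_iff: "P : points C ==> c : K ==> ord_ge P c 0 \<longleftrightarrow> c : P"
 using mem_iff_ord[OF dvrs, of P c] subringD(1)[OF P_ring, of P] by(cases "c = 0") auto

text \<open>The stalk at P is generated by s times the power of a uniformizer with exponent
  \<open>m P\<close>, so s is the generator times the power with exponent \<open>- m P\<close>; this
  is the sign in the degree.\<close>

lemma rank_one_bundle:
 fixes s :: "'l ^ 'm::finite"
 assumes s: "s ~= 0" "!!i. s $ i : K" and gen: "generic_stalk E = {c *s s | c. c : K}"
  and st: "!!P. P : points C ==> stalk E P = {c *s s | c. c : K & ord_ge P c (m P)}"
  and fs: "fsupp_on (points C) m"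
 shows "vector_bundle C E" "bundle_rank C E = 1" "bundle_degree C E = - sum_on (points C) m"
proof -
 note R = subringD[OF K_ring]
 define t where "t P = (SOME t. t : K & t ~= 0 & ord_at P t = 1)" for P
 have t: "t P : K & t P ~= 0 & ord_at P (t P) = 1" if "P : points C" for P
  unfolding t_def by(rule someI_ex) (use exists_uniformizer[OF dvrs[OF that]] in blast)
 define g where "g P = t P powi m P" for P
 have g: "g P : K" "g P ~= 0" "ord_at P (g P) = m P" if "P : points C" for P
  using t[OF that] subfield_powi[OF K_field] ord_powi[OF dvrs[OF that]] by(auto simp: g_def)
 have basis_K: "is_basis K 1 (%_. a *s s) (generic_stalk E)" if a: "a : K" "a ~= 0" for a
 proof -
  have "c / a : K \<longleftrightarrow> c : K" for c
   using R(5)[of "c / a" a] subfield_divide[OF K_field _ a(1)] a by auto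
  thus ?thesis unfolding gen using is_basis_scaled[OF s(1) a(2), of K] by simp
 qed
 have basis_s: "is_basis K 1 (%_. s) (generic_stalk E)" using basis_K[of 1] R(2) by simp
 have basis_P: "is_basis P 1 (%_. g P *s s) (stalk E P)" if P: "P : points C" for P
 proof -
  have "c : K & ord_ge P c (m P) \<longleftrightarrow> c / g P : P" for c
  proof (cases "c : K")
   case True
   thus ?thesis using ord_ge_iff[OF dvrs[OF P] _ _ _ True, of "t P" "m P"] t[OF P] by(simp add: g_def)
  next
   case False
   thus ?thesis using R(5)[OF _ g(1)[OF P], of "c / g P"] P_sub[OF P] g(2)[OF P] by auto
  qed
  thus ?thesis unfolding st[OF P] using is_basis_scaled[OF s(1) g(2)[OF P], of P] by simp
 qed
 have "{P : points C. stalk E P ~= lin_span P ((%_. s) ` {..<1::nat})} <= {P : points C. m P ~= 0}"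
 proof (intro subsetI CollectI conjI notI; elim CollectE conjE)
  fix P assume P: "P : points C" and ne: "stalk E P ~= lin_span P ((%_. s) ` {..<1::nat})" and m0: "m P = 0"
  have "c : K & ord_ge P c 0 \<longleftrightarrow> c : P" for c using ord_ge_0_iff[OF P, of c] P_sub[OF P] by blast
  thus False using st[OF P] m0 ne lin_span_basis[OF P_ring[OF P] is_basis_scaled[OF s(1), of 1 P]] by simp
 qed
 hence fin: "finite {P : points C. stalk E P ~= lin_span P ((%_. s) ` {..<1::nat})}"
  using fs unfolding fsupp_on_def by(rule finite_subset)
 show vb: "vector_bundle C E"
  by(rule vector_bundleI[OF basis_s _ basis_P basis_K[OF g(1,2)] fin]) (use s(2) R(5) in \<open>auto simp: gen\<close>)
 show "bundle_rank C E = 1" by(rule bundle_rank_eq[OF basis_s])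
 have "s = (SUM j<1::nat. inverse (g P) *s (g P *s s))" if "P : points C" for P
  using g(2)[OF that] by(simp add: vector_smult_assoc)
 hence dd: "deg_data E 1 (%_. s) (%P _. g P *s s) (%P _ _. inverse (g P))"
  unfolding deg_data_def using basis_s basis_P g(1) subfield_inverse[OF K_field] by simp
 show "bundle_degree C E = - sum_on (points C) m"
  unfolding bundle_degree_eq[OF vb dd] leibniz_det_1 psum_uminus[symmetric]
  using ord_inverse[OF dvrs g(1,2)] g(3) by(intro psum_cong) simp
qed

definition line_ord :: "'l ^ 'm::finite => 'l set => int" where
 "line_ord s P = Min ((%i. ord_at P (s $ i)) ` {i. s $ i ~= 0})"

text \<open>The saturation of the line through s in the trivial bundle: all multiples with integral
  coordinates. As the stalks of V n consist of all integral vectors of its generic stalk, it is also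
  the saturated line subbundle of V n through s.\<close>

definition line :: "'l ^ 'm::finite => ('l, 'm) vbundle" where
 "line s = \<lparr>generic_stalk = {c *s s | c. c : K},
  stalk = (%P. {v : {c *s s | c. c : K}. ALL i. v $ i : P})\<rparr>"

lemma line_ord_le_iff:
 fixes s :: "'l ^ 'm::finite"
 assumes "s ~= 0" shows "n <= line_ord s P \<longleftrightarrow> (ALL i. ord_ge P (s $ i) n)"
proof -
 have "{i. s $ i ~= 0} ~= {}" using assms by(auto simp: fvec_eq_iff)
 thus ?thesis unfolding line_ord_def by(subst Min_ge_iff) auto
qed

lemma line_ord_le: "(s :: 'l ^ 'm::finite) $ i ~= 0 ==> line_ord s P <= ord_at P (s $ i)"
 unfolding line_ord_def by(rule Min_le) auto

lemma line_ord_attained: "(s :: 'l ^ 'm::finite) ~= 0 ==> EX i. s $ i ~= 0 & line_ord s P = ord_at P (s $ i)"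
proof -
 assume "s ~= 0"
 hence "{i. s $ i ~= 0} ~= {}" by(auto simp: fvec_eq_iff)
 hence "line_ord s P : (%i. ord_at P (s $ i)) ` {i. s $ i ~= 0}"
  unfolding line_ord_def by(intro Min_in) auto
 thus ?thesis by auto
qed

lemma line_ord_fsupp:
 fixes s :: "'l ^ 'm::finite"
 assumes s: "s ~= 0" "!!i. s $ i : K" shows "fsupp_on (points C) (line_ord s)"
proof -
 have "{P : points C. line_ord s P ~= 0} <= (UN i:{i. s $ i ~= 0}. {P : points C. ord_at P (s $ i) ~= 0})"
 proof
  fix P assume P: "P : {P : points C. line_ord s P ~= 0}"
  obtain i where "s $ i ~= 0" "line_ord s P = ord_at P (s $ i)" using line_ord_attained[OF s(1)] by blast
  thus "P : (UN i:{i. s $ i ~= 0}. {P : points C. ord_at P (s $ i) ~= 0})" using P by auto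
 qed
 moreover have "finite (UN i:{i. s $ i ~= 0}. {P : points C. ord_at P (s $ i) ~= 0})"
  using fsupp_fun[OF s(2)] unfolding fsupp_on_def by auto
 ultimately show ?thesis unfolding fsupp_on_def by(rule finite_subset)
qed

lemma line_stalk:
 fixes s :: "'l ^ 'm::finite"
 assumes s: "s ~= 0" "!!i. s $ i : K" and P: "P : points C" and c: "c : K"
 shows "(ALL i. c * s $ i : P) \<longleftrightarrow> ord_ge P c (- line_ord s P)"
proof (cases "c = 0")
 case True
 thus ?thesis using subringD(1)[OF P_ring[OF P]] by simp
next
 case False
 have "c * s $ i : P \<longleftrightarrow> ord_ge P (s $ i) (- ord_at P c)" for i
 proof (cases "s $ i = 0")
  case True
  thus ?thesis using subringD(1)[OF P_ring[OF P]] by simp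
 next
  case i: False
  have "c * s $ i : P \<longleftrightarrow> 0 <= ord_at P (c * s $ i)"
   by(rule mem_iff_ord[OF dvrs[OF P] subringD(5)[OF K_ring c s(2)]]) (simp add: False i)
  thus ?thesis using ord_mult[OF dvrs[OF P] c False s(2) i] i by auto
 qed
 hence "(ALL i. c * s $ i : P) \<longleftrightarrow> - ord_at P c <= line_ord s P"
  by(simp only: line_ord_le_iff[OF s(1)])
 thus ?thesis using False by(simp add: minus_le_iff)
qed

lemma line_props:
 fixes s :: "'l ^ 'm::finite"
 assumes s: "s ~= 0" "!!i. s $ i : K"
 shows "vector_bundle C (line s)" "bundle_rank C (line s) = 1"
  "bundle_degree C (line s) = sum_on (points C) (line_ord s)"
proof -
 have gen: "generic_stalk (line s) = {c *s s | c. c : K}" by(simp add: line_def)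
 have st: "stalk (line s) P = {c *s s | c. c : K & ord_ge P c (- line_ord s P)}" if P: "P : points C" for P
 proof -
  have "(ALL i. (c *s s) $ i : P) \<longleftrightarrow> ord_ge P c (- line_ord s P)" if "c : K" for c
   using line_stalk[OF s P that] by(simp only: vector_smult_component)
  thus ?thesis by(simp only: line_def vbundle.simps) blast
 qed
 have fs: "fsupp_on (points C) (%P. - line_ord s P)" using line_ord_fsupp[OF s] by(simp only: fsupp_uminus)
 note B = rank_one_bundle[OF s gen st fs]
 show "vector_bundle C (line s)" "bundle_rank C (line s) = 1" using B(1,2) by auto
 show "bundle_degree C (line s) = sum_on (points C) (line_ord s)" using B(3) by(simp add: psum_uminus)
qed

lemma generic_coord: fixes v :: "'l ^ 'm::finite" shows "vector_bundle C E ==> v : generic_stalk E ==> v $ i : K"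
 unfolding vector_bundle_def by blast

lemma line_subsheaf:
 assumes vb: "vector_bundle C E" and s: "s : generic_stalk E"
  and st: "!!P. P : points C ==> stalk E P = {v : generic_stalk E. ALL i. v $ i : P}"
 shows "subsheaf C (line s) E"
proof -
 obtain r e where e: "is_basis K r e (generic_stalk E)" by(rule vbD[OF vb]) (rule that)
 have "c *s s : generic_stalk E" if "c : K" for c
  using lin_span_scale[OF K_ring that] s lin_span_basis[OF K_ring e] by blast
 thus ?thesis unfolding subsheaf_def using st by(auto simp: line_def)
qed

text \<open>A subsheaf of rank 1 lies in the saturated line through a generic basis vector, so only
  the degrees of such lines have to be bounded.\<close>

lemma rank_two_semistable:
 assumes vb: "vector_bundle C E" and rk: "bundle_rank C E = 2"
  and st: "!!P. P : points C ==> stalk E P = {v : generic_stalk E. ALL i. v $ i : P}"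
  and le: "!!s. s : generic_stalk E ==> s ~= 0 ==> 2 * sum_on (points C) (line_ord s) <= bundle_degree C E"
 shows "semistable C E" unfolding semistable_def
proof (intro conjI vb allI impI)
 fix F assume F: "vector_bundle C F & subsheaf C F E & 0 < bundle_rank C F"
 hence "bundle_rank C F <= 2" using bundle_rank_mono[OF vb, of F] rk by simp
 then consider "bundle_rank C F = 1" | "bundle_rank C F = 2" using F by linarith
 thus "bundle_slope C F <= bundle_slope C E"
 proof cases
  case 2
  thus ?thesis using bundle_degree_mono[OF vb, of F] F rk by(simp add: bundle_slope_def)
 next
  case 1
  have F1: "vector_bundle C F" "subsheaf C F E" using F by auto
  obtain r e where "is_basis K r e (generic_stalk F)" by(rule vbD[OF F1(1)]) (rule that)
  moreover from this have "r = 1" using 1 bundle_rank_eq by metis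
  ultimately have e: "is_basis K 1 e (generic_stalk F)" by simp
  define s where "s = e 0"
  have sF: "s : generic_stalk F" unfolding s_def by(rule basis_mem[OF K_ring e]) simp
  hence sE: "s : generic_stalk E" using F1(2) unfolding subsheaf_def by blast
  have s0: "s ~= 0"
  proof
   assume "s = 0"
   hence "(1::'l) = 0" by(intro basis_indep[OF e, of "%_. 1" 0])
    (auto simp: s_def subringD[OF K_ring] fvec_eq_iff)
   thus False by simp
  qed
  note s = s0 generic_coord[OF vb sE]
  have gen: "generic_stalk F = {c *s s | c. c : K}" using e unfolding is_basis_def s_def by auto
  have "subsheaf C F (line s)" unfolding subsheaf_def
  proof (intro conjI ballI)
   show "generic_stalk F <= generic_stalk (line s)" by(simp add: gen line_def)
   fix P assume P: "P : points C"
   show "stalk F P <= stalk (line s) P"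
   proof
    fix v assume v: "v : stalk F P"
    hence "v : generic_stalk F" using stalk_generic[OF F1(1) P] by blast
    moreover have "v : stalk E P" using v F1(2) P unfolding subsheaf_def by blast
    hence "ALL i. v $ i : P" unfolding st[OF P] by simp
    ultimately show "v : stalk (line s) P" unfolding gen by(simp add: line_def)
   qed
  qed
  hence "bundle_degree C F <= sum_on (points C) (line_ord s)"
   using bundle_degree_mono[OF line_props(1)[OF s] F1(1)] line_props(2,3)[OF s] 1 by simp
  hence "2 * bundle_degree C F <= bundle_degree C E" using le[OF sE s0] by linarith
  thus ?thesis using 1 rk by(simp add: bundle_slope_def)
 qed
qed

lemma zero_bundle_vector_bundle: "vector_bundle C (zero_bundle :: ('l, 'm::finite) vbundle)"
proof -
 have b: "EX e. is_basis A 0 e {0 :: 'l ^ 'm}" for A by(simp add: is_basis_def)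
 have "lin_span K {0 :: 'l ^ 'm} = {0}" by(intro equalityI lin_span_least) (auto simp: lin_span_0)
 moreover have "lin_span P {} = {0 :: 'l ^ 'm}" for P :: "'l set" by(auto simp: lin_span_def)
 ultimately show ?thesis unfolding vector_bundle_def zero_bundle_def
  using subringD(1)[OF K_ring] b by(auto intro!: exI[of _ 0])
qed

text \<open>Both graded pieces have rank 1 and are therefore semistable, and the line has the larger
  slope because its degree exceeds half the degree of E.\<close>

lemma HN_line:
 fixes E :: "('l, 'm::finite) vbundle"
 assumes vb: "vector_bundle C E" and rk: "bundle_rank C E = 2" and s: "s : generic_stalk E" "s ~= 0"
  and st: "!!P. P : points C ==> stalk E P = {v : generic_stalk E. ALL i. v $ i : P}"
  and Q: "quotient_bundle C E (line s) Q" "bundle_rank C Q = 1"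
   "bundle_degree C Q + bundle_degree C (line s) = bundle_degree C E"
  and gt: "2 * sum_on (points C) (line_ord s) > bundle_degree C E"
 shows "HN_filtration C E [zero_bundle, line s, E]" "~ semistable C E"
proof -
 have sK: "s $ i : K" for i by(rule generic_coord[OF vb s(1)])
 note L = line_props[OF s(2) sK]
 have L0: "quotient_bundle C (line s) zero_bundle (line s)" unfolding quotient_bundle_def
 proof (intro conjI L(1) zero_bundle_vector_bundle exI[of _ id] ballI)
  have "0 : P" if "P : points C" for P using subringD(1)[OF P_ring[OF that]] .
  moreover have "0 : K" using subringD(1)[OF K_ring] .
  ultimately have z: "0 : generic_stalk (line s)" "!!P. P : points C ==> 0 : stalk (line s) P"
   by(auto simp: line_def intro!: exI[of _ 0])
  show "subsheaf C zero_bundle (line s)" unfolding subsheaf_def zero_bundle_def using z by simp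
  show "{v : generic_stalk (line s). id v = 0} = generic_stalk zero_bundle"
   using z by(auto simp: zero_bundle_def)
  fix P assume "P : points C"
  thus "{v : stalk (line s) P. id v = 0} = stalk zero_bundle P" using z by(auto simp: zero_bundle_def)
 qed auto
 have sl: "bundle_slope C (line s) > bundle_slope C Q" using gt Q(2,3) L by(simp add: bundle_slope_def)
 have vQ: "vector_bundle C Q" using Q(1) by(simp add: quotient_bundle_def)
 have ss: "semistable C (line s)" "semistable C Q"
  using rank_one_semistable[OF L(1,2)] rank_one_semistable[OF vQ Q(2)] by auto
 show "HN_filtration C E [zero_bundle, line s, E]" unfolding HN_filtration_def
 proof (intro conjI exI[of _ "%i. if i = 0 then line s else Q"] allI impI)
  fix i assume "Suc i < length [zero_bundle, line s, E]"
  hence "i = 0 | i = 1" by auto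
  thus "quotient_bundle C ([zero_bundle, line s, E] ! Suc i) ([zero_bundle, line s, E] ! i)
     (if i = 0 then line s else Q)"
    "0 < bundle_rank C (if i = 0 then line s else Q)" "semistable C (if i = 0 then line s else Q)"
   using L0 Q L(2) ss by auto
 next
  fix i assume "Suc (Suc i) < length [zero_bundle, line s, E]"
  thus "bundle_slope C (if Suc i = 0 then line s else Q) < bundle_slope C (if i = 0 then line s else Q)"
   using sl by auto
 qed auto
 have "bundle_slope C (line s) > bundle_slope C E" using gt L rk by(simp add: bundle_slope_def)
 thus "~ semistable C E"
  unfolding semistable_def using L(1,2) line_subsheaf[OF vb s(1) st] by(auto simp: not_le)
qed

end

section \<open>The syzygy bundles\<close>

context trinomial_curve
begin

abbreviation Crv :: "'l curve" where
 "Crv \<equiv> normalized_curve \<iota> h"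

lemma Crv_simps: "fun_field Crv = K" "points Crv = pts" by(simp_all add: normalized_curve_def pts_def)

sublocale crv: complete_curve Crv
 by unfold_locales (auto simp: Crv_simps K_subfield pts_dvr fsupp_ord product_formula)

text \<open>lam times the order of the variable v over a, measured on the line and normalized so
  that the least order is 0. It can be nonzero only at w = 0, - 1 and infinity, where M x, M y and M
  z vanish.\<close>

definition rr :: "'k option => 3 => int" where
 "rr a v = (case a of None => int (r z v) | Some c =>
   if c = 0 then int (r x v) else if c = - 1 then int (r y v) else 0)"

lemma ord_X_ratio:
 assumes P: "P : fib a" shows "int lam * ord_at P (X $ u / X $ v) = (rr a u - rr a v) * ram P a"
proof -
 let ?b = "%i. (if i = u then 1 else 0) - (if i = v then 1 else (0::int))"
 have b0: "(SUM i:UNIV. ?b i) = 0" by(simp add: sum_subtractf)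
 have "lmon ?b = (PROD i:UNIV. X $ i powi (if i = u then 1 else 0)) / (PROD i:UNIV. X $ i powi (if i = v then 1 else 0))"
  unfolding lmon_eq[OF b0] by(simp add: power_int_diff X_nonzero prod_dividef)
 also have "... = X $ u / X $ v" by(simp add: if_distrib[of "%n. _ powi n"] cong: if_cong)
 finally have l: "lmon ?b = X $ u / X $ v" .
 have "wt ?b l = int (r l u) - int (r l v)" for l
  by(simp add: wt_def right_diff_distrib sum_subtractf if_distrib[of "%n. _ * n"] cong: if_cong)
 hence "cw a ?b = rr a u - rr a v" by(simp add: cw_def rr_def split: option.split)
 thus ?thesis using ord_lmon[OF P b0] l by simp
qed

lemma rr_nonneg: "0 <= rr a v" by(simp add: rr_def split: option.split)

lemma rr_zero: "EX v. rr a v = 0"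
 using r_zero[of x] r_zero[of y] r_zero[of z] by(cases a) (auto simp: rr_def)

lemma rr_sum: "(SUM a:{None, Some 0, Some (- 1)}. rr a v) = int d"
proof -
 have "int d = int (r x v) + int (r y v) + int (r z v)"
  using r_sum[of v] by(simp add: sum_xyz del: of_nat_sum flip: of_nat_add)
 thus ?thesis by(simp add: rr_def)
qed

lemma exists_top: "P : pts ==> EX i. ALL j. X $ j / X $ i : P"
 and W_stalk_sub: "lies_over \<iota> h P c ==> curve_local_ring \<iota> c <= P"
 and W_top: "lies_over \<iota> h P c ==> EX i. ALL j. X $ j / X $ i : curve_local_ring \<iota> c"
proof -
 show sub: "curve_local_ring \<iota> c <= P" if lo: "lies_over \<iota> h P c" for P c
 proof -
  obtain I where b: "on_curve h c" and I: "maximal_ideal_of (integral_closure_in K (lr c)) I"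
   and P: "P = localization_at (integral_closure_in K (lr c)) I"
   using lo unfolding lies_over_def Let_def by blast
  show ?thesis unfolding P by(rule localization_props(7)[OF local_ring_lr[OF b] refl I])
 qed
 show top: "EX i. ALL j. X $ j / X $ i : curve_local_ring \<iota> c" if lo: "lies_over \<iota> h P c" for P c
 proof -
  have "c ~= 0" using lo unfolding lies_over_def on_curve_def by blast
  then obtain i where i: "c $ i ~= 0" by(auto simp: fvec_eq_iff)
  have h1: "homogeneous 1 (Var3 v :: 'k poly3)" for v
   unfolding Var3_def by(rule homogeneous_monom3) (simp add: deg3_axis)
  have "eval3 (Var3 i) c ~= 0" using i by(simp add: Var3_def eval3_monom3 mon3_axis)
  hence "X $ j / X $ i : lr c" for j using lrI[OF h1[of j] h1[of i]] by(simp add: X_def)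
  thus ?thesis by blast
 qed
 show "EX i. ALL j. X $ j / X $ i : P" if "P : pts" for P
  using that top sub unfolding pts_def by blast
qed

definition top :: "'l set => 3" where
 "top P = (SOME i. ALL j. X $ j / X $ i : P)"

lemma top: "P : pts ==> X $ j / X $ top P : P"
 unfolding top_def using someI_ex[OF exists_top] by blast

text \<open>\<open>X $ top P\<close> generates the stalk of O(1) at P, so \<open>- zm P\<close> is
  the order of the section z of O(1). Hence the sum in \<open>psum_zm\<close> is minus the degree d
  of O(1).\<close>

definition zm :: "'l set => int" where
 "zm P = ord_at P (X $ top P / X $ z)"

lemma zm_fib:
 assumes P: "P : fib a" shows "int lam * zm P = - rr a z * ram P a"
proof -
 note D = fib_dvr[OF P] and Pp = fib_pts[OF P]
 obtain v where v: "rr a v = 0" using rr_zero by blast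
 have "0 <= ord_at P (X $ v / X $ top P)"
  using mem_iff_ord[OF D X_ratio_K] top[OF Pp, of v] X_nonzero by simp
 hence "0 <= (rr a v - rr a (top P)) * ram P a" unfolding ord_X_ratio[OF P, symmetric] by simp
 hence "rr a (top P) <= 0" using v ram_pos[OF P] by(simp add: mult_le_0_iff)
 hence "rr a (top P) = 0" using rr_nonneg[of a "top P"] by simp
 thus ?thesis unfolding zm_def ord_X_ratio[OF P] by simp
qed

lemma fsupp_zm: "fsupp zm" and psum_zm: "psum zm = - int d"
proof -
 let ?A = "{None, Some 0, Some (- 1)} :: 'k option set"
 have z: "zm P = 0" if P: "P : fib a" and a: "a ~: ?A" for P a
 proof -
  have "rr a z = 0" using a by(cases a) (auto simp: rr_def)
  thus ?thesis using zm_fib[OF P] lam_pos by simp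
 qed
 have fin: "finite ?A" by simp
 show "fsupp zm" by(rule psum_fibres(1)[OF fin z])
 have "psum zm = (SUM a:?A. SUM P:fib a. zm P)" by(rule psum_fibres(2)[OF fin z])
 hence "int lam * psum zm = (SUM a:?A. SUM P:fib a. int lam * zm P)" by(simp only: sum_distrib_left)
 also have "... = (SUM a:?A. SUM P:fib a. - rr a z * ram P a)" by(intro sum.cong refl zm_fib)
 also have "... = (SUM a:?A. - rr a z * int lam)" by(simp only: sum_distrib_left[symmetric] sum_ram)
 also have "... = int lam * (- (SUM a:?A. rr a z))" unfolding sum_distrib_right[symmetric] sum_negf by(rule mult.commute)
 finally have "int lam * psum zm = int lam * - int d" unfolding rr_sum .
 thus "psum zm = - int d" using lam_pos by(simp only: mult_cancel_left) simp
qed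

section \<open>Stalks and Frobenius pullbacks of the syzygy bundles\<close>

abbreviation V :: "nat => ('l, 3) vbundle" where
 "V N \<equiv> V_bundle \<iota> h N"

definition Vs :: "'l set => nat => ('l ^ 3) set" where
 "Vs A N = {u. (ALL i. u $ i : A) & (SUM i:UNIV. u $ i * X $ i ^ N) = 0}"

lemma Vs_0: "is_subring A ==> 0 : Vs A N" by(simp add: Vs_def subringD)

lemma Vs_add: "is_subring A ==> u : Vs A N ==> v : Vs A N ==> u + v : Vs A N"
 by(simp add: Vs_def subringD sum.distrib distrib_right)

lemma Vs_scale: "is_subring A ==> a : A ==> v : Vs A N ==> a *s v : Vs A N"
 by(simp add: Vs_def subringD mult.assoc sum_distrib_left[symmetric])

text \<open>The syzygy with entry 1 at j and 0 at the third index, solved for the entry at i. The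
  two of them with a common i form a basis over every subring that contains the ratios of the other
  variables to X i, see \<open>sy_basis\<close>.\<close>

definition sy :: "nat => 3 => 3 => 'l ^ 3" where
 "sy N i j = (\<chi> v. if v = j then 1 else if v = i then - ((X $ j / X $ i) ^ N) else 0)"

lemma sum_ijk:
 assumes "distinct [i, j, k :: 3]" shows "(SUM v:UNIV. f v) = f i + f j + (f k :: 'b::comm_monoid_add)"
 unfolding UNIV3_eq[OF assms] using assms by(simp add: add.assoc)

lemma Vs_expand:
 assumes ijk: "distinct [i, j, k]" and v: "v : Vs UNIV N"
 shows "v = v $ j *s sy N i j + v $ k *s sy N i k"
proof -
 have "v $ i * X $ i ^ N + v $ j * X $ j ^ N + v $ k * X $ k ^ N = 0"
  using v sum_ijk[OF ijk, of "%i. v $ i * X $ i ^ N"] by(simp add: Vs_def)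
 hence "v $ i * X $ i ^ N = - v $ j * X $ j ^ N - v $ k * X $ k ^ N"
  by(simp add: add_eq_0_iff2 algebra_simps)
 hence i: "v $ i = - (v $ j * (X $ j / X $ i) ^ N) - v $ k * (X $ k / X $ i) ^ N"
  using X_nonzero[of i] by(simp add: field_simps power_divide)
 show ?thesis unfolding fvec_eq_iff
 proof
  fix u
  have "u : {i, j, k}" unfolding UNIV3_eq[OF ijk, symmetric] by(rule UNIV_I)
  then consider "u = i" | "u = j" | "u = k" by blast
  thus "v $ u = (v $ j *s sy N i j + v $ k *s sy N i k) $ u"
  proof cases
   case 1
   show ?thesis unfolding 1 using ijk by(subst i) (simp add: sy_def)
  qed (use ijk in \<open>auto simp: sy_def\<close>)
 qed
qed

lemma sy_Vs:
 assumes A: "is_subring A" and ij: "i ~= j" and X: "X $ j / X $ i : A" shows "sy N i j : Vs A N"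
proof -
 obtain k where k: "distinct [i, j, k]"
  using ij xyz by(metis (full_types) distinct_length_2_or_more distinct_singleton)
 have "(SUM v:UNIV. sy N i j $ v * X $ v ^ N) = 0"
  unfolding sum_ijk[OF k] using k X_nonzero[of i] by(auto simp: sy_def power_divide)
 moreover have "sy N i j $ v : A" for v using subringD[OF A] subring_power[OF A X] by(auto simp: sy_def)
 ultimately show ?thesis by(simp add: Vs_def)
qed

definition syb :: "nat => 3 => 3 => 3 => nat => 'l ^ 3" where
 "syb N i j k n = (if n = 0 then sy N i j else sy N i k)"

lemma sum_lessThan_2: "(SUM n<2::nat. f n) = f 0 + (f 1 :: 'b::comm_monoid_add)"
 by(simp add: numeral_2_eq_2)

lemma sy_basis:
 assumes A: "is_subring A" and ijk: "distinct [i, j, k]" and X: "X $ j / X $ i : A" "X $ k / X $ i : A"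
 shows "is_basis A 2 (syb N i j k) (Vs A N)"
proof -
 have "sy N i j : Vs A N" "sy N i k : Vs A N" using sy_Vs[OF A] ijk X by auto
 hence 1: "(SUM n<2. c n *s syb N i j k n) : Vs A N" if "ALL n<2. c n : A" for c
  using that unfolding sum_lessThan_2 by(auto simp: syb_def intro!: Vs_add[OF A] Vs_scale[OF A])
 have 2: "EX c. (ALL n<2. c n : A) & v = (SUM n<2. c n *s syb N i j k n)" if v: "v : Vs A N" for v
 proof (intro exI[of _ "%n. if n = 0 then v $ j else v $ k"] conjI)
  show "ALL n<2. (if n = 0 then v $ j else v $ k) : A" using v by(simp add: Vs_def)
  have "v : Vs UNIV N" using v by(simp add: Vs_def)
  from Vs_expand[OF ijk this]
  show "v = (SUM n<2. (if n = 0 then v $ j else v $ k) *s syb N i j k n)"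
   unfolding sum_lessThan_2 by(simp add: syb_def)
 qed
 have 3: "ALL n<2. c n = 0" if c: "(SUM n<2. c n *s syb N i j k n) = 0" for c
 proof -
  have "(SUM n<2. c n *s syb N i j k n) $ v = 0" for v unfolding c by simp
  from this[of j] this[of k] have "c 0 = 0" "c 1 = 0"
   using ijk unfolding sum_lessThan_2 by(auto simp: syb_def sy_def)
  thus ?thesis by(auto simp: less_2_cases_iff)
 qed
 have "Vs A N = {SUM n<2. c n *s syb N i j k n |c. ALL n<2. c n : A}" using 1 2 by blast
 thus ?thesis unfolding is_basis_def using 3 by blast
qed

lemma V_generic: "generic_stalk (V N) = Vs K N" by(simp add: V_bundle_def Vs_def X_def)

lemma other_indices: "EX j k. distinct [i, j, k :: 3]"
 by(metis (full_types) dist distinct_length_2_or_more distinct_singleton)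

text \<open>At c some variable X i does not vanish, so the two syzygies solved for i already lie in
  the stalk of W at c and generate everything over P.\<close>

lemma V_stalk:
 assumes P: "P : pts" shows "stalk (V N) P = Vs P N"
proof
 note R = dvrD(2)[OF pts_dvr[OF P]]
 have st: "stalk (V N) P = lin_span P (UN c:{c. lies_over \<iota> h P c}. W_stalk \<iota> N c)" by(simp add: V_bundle_def)
 have W: "W_stalk \<iota> N c = Vs (lr c) N" for c by(simp add: W_stalk_def Vs_def X_def)
 show "stalk (V N) P <= Vs P N" unfolding st
 proof (rule lin_span_least)
  show "(UN c:{c. lies_over \<iota> h P c}. W_stalk \<iota> N c) <= Vs P N"
   unfolding W Vs_def using W_stalk_sub by blast
 qed (use Vs_0[OF R] Vs_add[OF R] Vs_scale[OF R] in auto)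
 obtain c where c: "lies_over \<iota> h P c" using P unfolding pts_def by blast
 hence oc: "on_curve h c" unfolding lies_over_def by blast
 obtain i where i: "!!j. X $ j / X $ i : lr c" using W_top[OF c] by blast
 obtain j k where ijk: "distinct [i, j, k]" using other_indices by blast
 show "Vs P N <= stalk (V N) P"
 proof
  fix v assume v: "v : Vs P N"
  hence "v = v $ j *s sy N i j + v $ k *s sy N i k" by(intro Vs_expand[OF ijk]) (simp add: Vs_def)
  moreover have "sy N i j : W_stalk \<iota> N c" "sy N i k : W_stalk \<iota> N c"
   unfolding W using sy_Vs[OF lr_subring[OF oc]] ijk i by auto
  hence "sy N i j : stalk (V N) P" "sy N i k : stalk (V N) P"
   unfolding st using c by(auto intro!: lin_span_base[OF R])
  moreover have "v $ u : P" for u using v by(simp add: Vs_def)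
  ultimately show "v : stalk (V N) P"
   unfolding st using lin_span_add[OF R lin_span_scale[OF R] lin_span_scale[OF R]] by metis
 qed
qed

text \<open>Bundles are compared as records, so for the equation \<open>frobenius_pullback_V\<close>
  the stalks have to agree also at sets P that are not points.\<close>

lemma V_stalk_outside: "P ~: pts ==> stalk (V N) P = {0}"
proof -
 assume "P ~: pts"
 hence U: "{c. lies_over \<iota> h P c} = {}" unfolding pts_def by blast
 have "lin_span P {} = {0 :: 'l ^ 3}" by(auto simp: lin_span_def)
 thus ?thesis unfolding V_bundle_def by(simp only: vbundle.simps U UN_empty)
qed

lemma V_stalk_coord: "P : pts ==> stalk (V N) P = {v : generic_stalk (V N). ALL i. v $ i : P}"
 unfolding V_stalk V_generic using dvrD(3)[OF pts_dvr] by(auto simp: Vs_def)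

lemma uminus_power_char: "(- a) ^ CHAR('k) = - (a ^ CHAR('k) :: 'l)"
proof -
 have "(a + - a) ^ CHAR('l) = a ^ CHAR('l) + (- a) ^ CHAR('l)"
  using char_prime by(intro freshmans_dream) (simp_all add: CHAR_l)
 thus ?thesis using char_prime prime_gt_0_nat unfolding CHAR_l
  by(simp add: eq_neg_iff_add_eq_0 add.commute zero_power)
qed

lemma power_char_sum: "(SUM i:I. f i) ^ CHAR('k) = (SUM i:I. (f i :: 'l) ^ CHAR('k))"
 using char_prime unfolding CHAR_l[symmetric] by(intro freshmans_dream_sum) simp_all

text \<open>Raising coordinates to the power p = \<open>CHAR('k)\<close> is additive and sends the
  basis syzygies for N to those for p N.\<close>

lemma frobenius_Vs:
 assumes A: "is_subring A" and i: "!!j. X $ j / X $ i : A"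
 shows "lin_span A ((%v. \<chi> i. (v $ i) ^ CHAR('k)) ` Vs A N) = Vs A (CHAR('k) * N)" (is "lin_span A (?F ` _) = _")
proof
 let ?p = "CHAR('k)"
 show "lin_span A (?F ` Vs A N) <= Vs A (?p * N)"
 proof (rule lin_span_least)
  have "?F v : Vs A (?p * N)" if v: "v : Vs A N" for v
  proof -
   have "(SUM i:UNIV. (v $ i) ^ ?p * X $ i ^ (?p * N)) = (SUM i:UNIV. v $ i * X $ i ^ N) ^ ?p"
    unfolding power_char_sum by(simp add: power_mult_distrib power_mult mult.commute[of ?p])
   also have "... = 0" using v char_prime prime_gt_0_nat by(simp add: Vs_def zero_power)
   finally show ?thesis using v subring_power[OF A] by(simp add: Vs_def)
  qed
  thus "?F ` Vs A N <= Vs A (?p * N)" by blast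
 qed (use Vs_0[OF A] Vs_add[OF A] Vs_scale[OF A] in auto)
 obtain j k where ijk: "distinct [i, j, k]" using other_indices by blast
 have F: "?F (sy N i u) = sy (?p * N) i u" for u using char_prime prime_gt_0_nat unfolding fvec_eq_iff
  by(auto simp: sy_def uminus_power_char zero_power power_mult mult.commute[of ?p])
 have "syb (?p * N) i j k n = ?F (syb N i j k n)" for n by(simp add: syb_def F)
 moreover have "syb N i j k n : Vs A N" for n using sy_Vs[OF A _ i] ijk by(auto simp: syb_def)
 ultimately have s: "syb (?p * N) i j k n : lin_span A (?F ` Vs A N)" for n
  by(auto intro: lin_span_base[OF A])
 show "Vs A (?p * N) <= lin_span A (?F ` Vs A N)"
  by(subst lin_span_basis[OF A sy_basis[OF A ijk i i], symmetric], rule lin_span_least) (use s lin_span_0 lin_span_add[OF A] lin_span_scale[OF A] in auto)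
qed

lemma frobenius_pullback_V: "frobenius_pullback CHAR('k) Crv (V N) = V (CHAR('k) * N)"
proof -
 have g: "lin_span K ((%v. \<chi> i. (v $ i) ^ CHAR('k)) ` Vs K N) = Vs K (CHAR('k) * N)"
  by(rule frobenius_Vs[OF K_subring X_ratio_K])
 have "lin_span P ((%v. \<chi> i. (v $ i) ^ CHAR('k)) ` stalk (V N) P) = stalk (V (CHAR('k) * N)) P" for P
 proof (cases "P : pts")
  case True
  show ?thesis unfolding V_stalk[OF True] by(rule frobenius_Vs[OF dvrD(2)[OF pts_dvr[OF True]] top[OF True]])
 next
  case False
  have "(\<chi> i. (0 :: 'l) ^ CHAR('k)) = (0 :: 'l ^ 3)"
   using char_prime prime_gt_0_nat by(auto simp: fvec_eq_iff zero_power)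
  moreover have "lin_span P {0 :: 'l ^ 3} = {0}" by(intro equalityI lin_span_least) (auto simp: lin_span_0)
  ultimately show ?thesis unfolding V_stalk_outside[OF False] by simp
 qed
 thus ?thesis unfolding frobenius_pullback_def Crv_simps V_generic g
  by(intro vbundle.equality) (simp_all add: V_generic)
qed

end

section \<open>The degree of V n and its quotients by lines\<close>

context trinomial_curve
begin

lemma zxy: "distinct [z, x, y]" and xyz': "distinct [x, y, z]" and yxz: "distinct [y, x, z]"
 using dist by auto

lemma top_cases: "top P = x | top P = y | top P = z" using UNIV_xyz by blast

definition loc :: "'l set => 3 \<times> 3" where
 "loc P = (if top P = x then (y, z) else if top P = y then (x, z) else (x, y))"

lemma loc_distinct: "distinct [top P, fst (loc P), snd (loc P)]"
 using top_cases[of P] xyz by(auto simp: loc_def)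

definition lbas :: "nat => 'l set => nat => 'l ^ 3" where
 "lbas N P = syb N (top P) (fst (loc P)) (snd (loc P))"

lemma V_local_basis:
 assumes P: "P : pts" shows "is_basis P 2 (lbas N P) (stalk (V N) P)" unfolding V_stalk[OF P] lbas_def
 by(rule sy_basis[OF dvrD(2)[OF pts_dvr[OF P]] loc_distinct top[OF P] top[OF P]])

lemma V_generic_basis: "is_basis K 2 (syb N z x y) (generic_stalk (V N))"
 unfolding V_generic by(rule sy_basis[OF K_subring zxy X_ratio_K X_ratio_K])

lemma V_vector_bundle: "vector_bundle Crv (V N)"
proof (rule crv.vector_bundleI[where e = "syb N z x y" and b = "lbas N"], unfold Crv_simps)
 show "is_basis K 2 (syb N z x y) (generic_stalk (V N))" by(rule V_generic_basis)
 show "v $ i : K" if "v : generic_stalk (V N)" for v i using that by(simp add: V_generic Vs_def)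
 show "is_basis K 2 (lbas N P) (generic_stalk (V N))" for P
  unfolding V_generic lbas_def by(rule sy_basis[OF K_subring loc_distinct X_ratio_K X_ratio_K])
 have "stalk (V N) P = lin_span P (syb N z x y ` {..<2})"
  if "P : pts" "X $ x / X $ z : P" "X $ y / X $ z : P" for P
  using lin_span_basis[OF dvrD(2) sy_basis[OF dvrD(2) zxy that(2,3)]] pts_dvr V_stalk that(1) by metis
 hence "{P : pts. stalk (V N) P ~= lin_span P (syb N z x y ` {..<2})} <=
   {P : pts. X $ x / X $ z ~: P} \<union> {P : pts. X $ y / X $ z ~: P}" by blast
 thus "finite {P : pts. stalk (V N) P ~= lin_span P (syb N z x y ` {..<2})}"
  by(rule finite_subset) (simp add: finite_poles[OF X_ratio_K])
qed (rule V_local_basis)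

lemma V_rank: "bundle_rank Crv (V N) = 2"
 by(rule crv.bundle_rank_eq[of 2 "syb N z x y"]) (unfold Crv_simps, rule V_generic_basis)

text \<open>The syzygies solved for z form a generic basis, those solved for \<open>top P\<close> a
  local one. Up to sign, the determinant of the transition is the N-th power of the ratio of
  \<open>X $ top P\<close> to \<open>X $ z\<close>, so each point contributes N times
  \<open>zm P\<close>.\<close>

lemma V_degree: "bundle_degree Crv (V N) = - int (N * d)"
proof -
 define A where "A P m n = syb N z x y m $ (if n = 0 then fst (loc P) else snd (loc P))" for P and m n :: nat
 have AK: "A P m n : K" for P m n
 proof -
  have "syb N z x y m : Vs K N" using sy_Vs[OF K_subring _ X_ratio_K] xyz by(auto simp: syb_def)
  thus ?thesis by(simp add: A_def Vs_def)
 qed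
 have e: "syb N z x y m = (SUM n<2. A P m n *s lbas N P n)" for P m
 proof -
  have "syb N z x y m : Vs UNIV N"
   using sy_Vs[OF K_subring _ X_ratio_K] xyz by(auto simp: syb_def Vs_def)
  from Vs_expand[OF loc_distinct[of P] this] show ?thesis
   unfolding sum_lessThan_2 by(simp add: A_def lbas_def syb_def)
 qed
 have dd: "crv.deg_data (V N) 2 (syb N z x y) (lbas N) A"
  unfolding crv.deg_data_def Crv_simps using V_generic_basis V_local_basis AK e by blast
 have "ord_at P (leibniz_det 2 (A P)) = int N * zm P" if P: "P : pts" for P
 proof -
  note D = pts_dvr[OF P]
  have pw: "ord_at P ((X $ i / X $ z) ^ N) = int N * ord_at P (X $ i / X $ z)" for i
   by(rule ord_power[OF D X_ratio_K]) (simp add: X_nonzero)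
  have nK: "(X $ i / X $ z) ^ N : K" for i by(rule KR(8)[OF X_ratio_K])
  consider "top P = x" | "top P = y" | "top P = z" using top_cases by blast
  thus ?thesis
  proof cases
   case 1
   have "leibniz_det 2 (A P) = (X $ x / X $ z) ^ N"
    unfolding leibniz_det_2 using 1 xyz by(simp add: A_def loc_def syb_def sy_def)
   thus ?thesis using pw[of x] 1 by(simp add: zm_def)
  next
   case 2
   have "leibniz_det 2 (A P) = - ((X $ y / X $ z) ^ N)"
    unfolding leibniz_det_2 using 2 xyz by(simp add: A_def loc_def syb_def sy_def)
   thus ?thesis using pw[of y] 2 ord_uminus[OF D nK] by(simp add: zm_def)
  next
   case 3
   have "leibniz_det 2 (A P) = 1"
    unfolding leibniz_det_2 using 3 xyz by(simp add: A_def loc_def syb_def sy_def)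
   thus ?thesis using 3 ord_1[OF D] by(simp add: zm_def X_nonzero)
  qed
 qed
 hence "bundle_degree Crv (V N) = psum (%P. int N * zm P)"
  unfolding crv.bundle_degree_eq[OF V_vector_bundle dd] Crv_simps by(rule psum_cong)
 also have "... = int N * psum zm" using psum_sum[of "{..<N}" pts "%_. zm"] fsupp_zm by simp
 finally show ?thesis by(simp add: psum_zm)
qed

text \<open>For \<open>u\<close> in the generic stalk of \<open>V N\<close>, all components of the cross product of \<open>u\<close> and \<open>v\<close> in \<open>V N\<close> are
 multiples of one of them, since both are orthogonal to the vector of the powers of the coordinates.\<close>

lemma cross_eq:
 assumes ijk: "distinct [i, j, k]" and u: "u : Vs UNIV N" and v: "v : Vs UNIV N"
 shows "(v $ i * u $ j - v $ j * u $ i) * X $ i ^ N = (v $ j * u $ k - v $ k * u $ j) * X $ k ^ N"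
proof -
 have e: "a $ i * X $ i ^ N = - (a $ j * X $ j ^ N + a $ k * X $ k ^ N)" if "a : Vs UNIV N" for a
  using that sum_ijk[OF ijk, of "%i. a $ i * X $ i ^ N"]
  unfolding eq_neg_iff_add_eq_0 by(simp add: Vs_def add.assoc)
 have "(v $ i * u $ j - v $ j * u $ i) * X $ i ^ N = v $ i * X $ i ^ N * u $ j - v $ j * (u $ i * X $ i ^ N)"
  by(simp add: algebra_simps)
 thus ?thesis unfolding e[OF u] e[OF v] by(simp add: algebra_simps)
qed

text \<open>A component of the cross product of u and v, up to sign. For fixed u \<noteq> 0 it is a
  linear form on the generic stalk of V N with the line through u as kernel, so it describes the
  quotient by this line.\<close>

definition \<phi> :: "'l ^ 3 => 'l ^ 3 => 'l" where
 "\<phi> u v = v $ x * u $ y - v $ y * u $ x"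

lemma \<phi>_top:
 "EX j k \<epsilon>. distinct [top P, j, k] & (\<epsilon> = 1 | \<epsilon> = - 1) & (ALL u:Vs UNIV N. ALL v:Vs UNIV N.
   \<phi> u v * (X $ top P / X $ z) ^ N = \<epsilon> * (v $ j * u $ k - v $ k * u $ j))"
proof -
 consider "top P = x" | "top P = y" | "top P = z" using top_cases by blast
 thus ?thesis
 proof cases
  case 1
  have "\<phi> u v * (X $ x / X $ z) ^ N = 1 * (v $ y * u $ z - v $ z * u $ y)"
   if "u : Vs UNIV N" "v : Vs UNIV N" for u v
   using cross_eq[OF xyz' that] X_nonzero[of z] by(simp add: \<phi>_def power_divide divide_eq_eq)
  thus ?thesis unfolding 1 using xyz' by blast
 next
  case 2
  have "\<phi> u v * (X $ y / X $ z) ^ N = - 1 * (v $ x * u $ z - v $ z * u $ x)"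
   if uv: "u : Vs UNIV N" "v : Vs UNIV N" for u v
  proof -
   have "\<phi> u v * X $ y ^ N = - ((v $ x * u $ z - v $ z * u $ x) * X $ z ^ N)"
    unfolding cross_eq[OF yxz uv, symmetric] \<phi>_def by(simp add: algebra_simps)
   thus ?thesis using X_nonzero[of z] by(simp add: power_divide divide_eq_eq)
  qed
  thus ?thesis unfolding 2 using yxz by blast
 next
  case 3
  have "\<phi> u v * (X $ z / X $ z) ^ N = 1 * (v $ x * u $ y - v $ y * u $ x)" for u v
   using X_nonzero[of z] by(simp add: \<phi>_def)
  thus ?thesis unfolding 3 using zxy by blast
 qed
qed

lemma \<phi>_kernel:
 assumes u: "u : Vs K N" "u ~= 0" and v: "v : Vs K N"
 shows "\<phi> u v = 0 \<longleftrightarrow> (EX c:K. v = c *s u)"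
proof
 assume "EX c:K. v = c *s u"
 thus "\<phi> u v = 0" by(auto simp: \<phi>_def)
next
 assume 0: "\<phi> u v = 0"
 have UK: "u : Vs UNIV N" "v : Vs UNIV N" using u v by(auto simp: Vs_def)
 have uK: "u $ i : K" "v $ i : K" for i using u v by(auto simp: Vs_def)
 have ext: "a = b" if "a : Vs UNIV N" "b : Vs UNIV N" "a $ x = b $ x" "a $ y = b $ y" for a b
  using Vs_expand[OF zxy that(1)] Vs_expand[OF zxy that(2)] that(3,4) by simp
 have "u $ x ~= 0 | u $ y ~= 0" using ext[OF UK(1), of 0] u(2) by(auto simp: Vs_def)
 thus "EX c:K. v = c *s u"
 proof
  assume ux: "u $ x ~= 0"
  have "(v $ x / u $ x) *s u : Vs UNIV N" using Vs_scale[of UNIV] UK(1) by(auto simp: is_subring_def)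
  from ext[OF UK(2) this] have "v = (v $ x / u $ x) *s u" using 0 ux by(simp add: \<phi>_def field_simps)
  thus ?thesis using KR(7)[OF uK(2,1)] by blast
 next
  assume uy: "u $ y ~= 0"
  have "(v $ y / u $ y) *s u : Vs UNIV N" using Vs_scale[of UNIV] UK(1) by(auto simp: is_subring_def)
  from ext[OF UK(2) this] have "v = (v $ y / u $ y) *s u" using 0 uy by(simp add: \<phi>_def field_simps)
  thus ?thesis using KR(7)[OF uK(2,1)] by blast
 qed
qed

text \<open>After multiplication by q the form is a combination of two entries u j and u k of u with
  coefficients that range over P. As the third entry is a combination of these two over P, one of
  them has the least order \<open>line_ord u P\<close>, and the image is the full fractional ideal
  of that order; undoing the multiplication by q shifts it.\<close>

lemma \<phi>_stalk:
 assumes u: "u : Vs K N" "u ~= 0" and P: "P : pts"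
 shows "\<phi> u ` Vs P N = {c : K. ord_ge P c (crv.line_ord u P - int N * zm P)}"
proof -
 note D = pts_dvr[OF P]
 note R = dvrD(2)[OF D] and PK = dvrD(3)[OF D]
 let ?n = "crv.line_ord u P"
 have UK: "u : Vs UNIV N" using u by(auto simp: Vs_def)
 have uK: "u $ i : K" for i using u by(auto simp: Vs_def)
 define q where "q = (X $ top P / X $ z) ^ N"
 have q: "q : K" "q ~= 0" "ord_at P q = int N * zm P"
  using KR(8)[OF X_ratio_K] X_nonzero ord_power[OF D X_ratio_K] by(auto simp: q_def zm_def)
 have shift: "ord_ge P c (?n - int N * zm P) \<longleftrightarrow> ord_ge P (c * q) ?n" if "c : K" for c
  using ord_mult[OF D that _ q(1,2)] q(2,3) by(cases "c = 0") auto
 have n: "ord_ge P (u $ i) ?n" for i using crv.line_ord_le_iff[OF u(2), of ?n P] by simp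
 have ge: "ord_ge P (u $ i * a) m" if a: "a : P" and i: "ord_ge P (u $ i) m" for a i m
  using i mem_iff_ord[OF D, of a] ord_mult[OF D uK, of i a] a PK by(cases "a = 0 | u $ i = 0") (auto intro: add_increasing2)
 have mK: "u $ i * a : K" if "a : P" for i a using KR(5)[OF uK] that PK by blast
 have "EX j k \<epsilon>. distinct [top P, j, k] & (\<epsilon> = 1 | \<epsilon> = - 1) & u $ k ~= 0 & ord_at P (u $ k) = ?n &
   (ALL v:Vs UNIV N. \<phi> u v * q = \<epsilon> * (u $ k * v $ j + u $ j * - v $ k))"
 proof -
  obtain j k \<epsilon> where ijk: "distinct [top P, j, k]" and \<epsilon>: "\<epsilon> = 1 | \<epsilon> = - 1"
   and f: "!!v. v : Vs UNIV N ==> \<phi> u v * q = \<epsilon> * (v $ j * u $ k - v $ k * u $ j)"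
   using \<phi>_top[of P N] UK unfolding q_def by blast
  have "u $ k ~= 0 & ord_at P (u $ k) = ?n | u $ j ~= 0 & ord_at P (u $ j) = ?n"
  proof (rule ccontr)
   assume "~ ?thesis"
   hence g: "ord_ge P (u $ j) (?n + 1)" "ord_ge P (u $ k) (?n + 1)" using n[of j] n[of k] by auto
   have p: "- ((X $ i / X $ top P) ^ N) : P" for i using subringD(3)[OF R subring_power[OF R top[OF P]]] .
   have "u $ top P = u $ j * - ((X $ j / X $ top P) ^ N) + u $ k * - ((X $ k / X $ top P) ^ N)"
    using arg_cong[OF Vs_expand[OF ijk UK], of "%v. v $ top P"] ijk by(simp add: sy_def)
   hence "ord_ge P (u $ top P) (?n + 1)" using ord_ge_add[OF D mK mK ge ge, OF p p p g(1) p g(2)] by simp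
   hence "ord_ge P (u $ i) (?n + 1)" for i
    using g UNIV3_eq[OF ijk] by(metis (full_types) UNIV_I empty_iff insert_iff)
   thus False using crv.line_ord_le_iff[OF u(2), of "?n + 1" P] by simp
  qed
  thus ?thesis
  proof
   assume "u $ k ~= 0 & ord_at P (u $ k) = ?n"
   thus ?thesis using ijk \<epsilon> f by(intro exI[of _ j] exI[of _ k] exI[of _ \<epsilon>]) (auto simp: mult.commute)
  next
   assume "u $ j ~= 0 & ord_at P (u $ j) = ?n"
   thus ?thesis using ijk \<epsilon> f
    by(intro exI[of _ k] exI[of _ j] exI[of _ "- \<epsilon>"]) (auto simp: mult.commute)
  qed
 qed
 moreover have "Vs P N <= Vs UNIV N" by(auto simp: Vs_def)
 ultimately obtain j k \<epsilon> where ijk: "distinct [top P, j, k]" and \<epsilon>: "\<epsilon> = 1 | \<epsilon> = - 1"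
  and k: "u $ k ~= 0" "ord_at P (u $ k) = ?n"
  and f: "!!v. v : Vs P N ==> \<phi> u v * q = \<epsilon> * (u $ k * v $ j + u $ j * - v $ k)"
  by blast
 show ?thesis
 proof (intro equalityI subsetI)
  fix c assume "c : \<phi> u ` Vs P N"
  then obtain v where v: "v : Vs P N" "c = \<phi> u v" by blast
  have vP: "v $ i : P" "- v $ i : P" for i using v(1) subringD(3)[OF R] by(auto simp: Vs_def)
  hence cK: "c : K" unfolding v(2) \<phi>_def using PK uK by(blast intro: KR(10) KR(5))
  let ?w = "u $ k * v $ j + u $ j * - v $ k"
  have "ord_ge P ?w ?n" by(rule ord_ge_add[OF D mK mK ge ge]) (rule vP n)+
  moreover have "?w : K" by(intro KR(4) mK vP)
  ultimately have "ord_ge P (c * q) ?n" using f[OF v(1)] \<epsilon> ord_uminus[OF D, of ?w] unfolding v(2)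
   by(metis mult_1 mult_minus1 neg_equal_0_iff_equal)
  thus "c : {c : K. ord_ge P c (?n - int N * zm P)}" using shift[OF cK] cK by blast
 next
  fix c assume "c : {c : K. ord_ge P c (?n - int N * zm P)}"
  hence c: "c * q : K" "ord_ge P (c * q) ?n" using shift KR(5)[OF _ q(1)] by blast+
  \<comment> \<open>Since u k has the least order, a multiple of the single syzygy with entry at j
    suffices as preimage.\<close>
  define v where "v = (\<epsilon> * (c * q / u $ k)) *s sy N (top P) j"
  have "c * q / u $ k : P"
   using ord_divide[OF D c(1) _ uK k(1)] c(2) k mem_iff_ord[OF D KR(7)[OF c(1) uK], of k] subringD(1)[OF R]
   by(cases "c * q = 0") auto
  hence v: "v : Vs P N" unfolding v_def using \<epsilon> subringD(3)[OF R] ijk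
   by(intro Vs_scale[OF R] sy_Vs[OF R] top[OF P]) auto
  have "\<phi> u v * q = c * q" unfolding f[OF v] using \<epsilon> k(1) ijk by(auto simp: v_def sy_def)
  thus "c : \<phi> u ` Vs P N" using v q(2) by force
 qed
qed

text \<open>The form \<open>\<phi> u\<close> realizes the quotient inside a coordinate axis, so that
  it is again a bundle in K^3. Its stalks are those in \<open>\<phi>_stalk\<close>, and the degrees
  add up because the sum of \<open>zm\<close> is - d.\<close>

lemma V_quotient:
 assumes u: "u : Vs K N" "u ~= 0"
 shows "EX Q. quotient_bundle Crv (V N) (crv.line u) Q & bundle_rank Crv Q = 1 &
  bundle_degree Crv Q + bundle_degree Crv (crv.line u) = bundle_degree Crv (V N)"
proof -
 define a where "a = (axis x 1 :: 'l ^ 3)"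
 have a: "a ~= 0" "a $ i : K" for i using KR(1,2) by(auto simp: a_def axis_def fvec_eq_iff)
 have inj: "c *s a = 0 \<longleftrightarrow> c = 0" for c by(auto simp: a_def axis_def fvec_eq_iff)
 have uK: "u $ i : K" for i using u by(simp add: Vs_def)
 define m where "m P = crv.line_ord u P - int N * zm P" for P
 define Q where "Q = \<lparr>generic_stalk = {c *s a | c. c : K}, stalk = (%P. {c *s a | c. c : K & ord_ge P c (m P)})\<rparr>"
 have fn: "fsupp (crv.line_ord u)" using crv.line_ord_fsupp[of u] u(2) uK by(simp add: Crv_simps)
 have Nz: "fsupp (%P. int N * zm P)" "psum (%P. int N * zm P) = int N * psum zm"
  using fsupp_sum[of "{..<N}" pts "%_. zm"] psum_sum[of "{..<N}" pts "%_. zm"] fsupp_zm by simp_all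
 have Nz': "fsupp (%P. - (int N * zm P))" by(simp only: fsupp_uminus Nz(1))
 have me: "m = (%P. crv.line_ord u P + - (int N * zm P))" by(simp add: m_def fun_eq_iff)
 have m: "fsupp m" "psum m = psum (crv.line_ord u) - int N * psum zm"
  unfolding me by(rule fsupp_add[OF fn Nz'], simp only: psum_add[OF fn Nz'] psum_uminus Nz(2) diff_conv_add_uminus)
 have "vector_bundle Crv Q & bundle_rank Crv Q = 1 & bundle_degree Crv Q = - psum m"
  using crv.rank_one_bundle[of a Q m, unfolded Crv_simps] a m(1) by(simp add: Q_def)
 hence Q: "vector_bundle Crv Q" "bundle_rank Crv Q = 1" "bundle_degree Crv Q = - psum m" by auto
 have L: "vector_bundle Crv (crv.line u)" "bundle_degree Crv (crv.line u) = psum (crv.line_ord u)"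
  using crv.line_props[of u] u(2) uK by(simp_all add: Crv_simps)
 have sub: "subsheaf Crv (crv.line u) (V N)" by(rule crv.line_subsheaf[OF V_vector_bundle])
   (use u(1) V_stalk_coord in \<open>auto simp: V_generic Crv_simps\<close>)
 define F where "F v = \<phi> u v *s a" for v
 have \<phi>K: "\<phi> u v : K" if "v : Vs K N" for v
  using that uK by(auto simp: Vs_def \<phi>_def intro!: KR(10) KR(5))
 have \<phi>_scale: "\<phi> u (c *s v) = c * \<phi> u v" for c v by(simp add: \<phi>_def algebra_simps)
 have \<phi>_add: "\<phi> u (v + v') = \<phi> u v + \<phi> u v'" for v v' by(simp add: \<phi>_def algebra_simps)
 have ker: "{v : Vs K N. F v = 0} = {c *s u | c. c : K}"
  unfolding F_def inj using \<phi>_kernel[OF u] Vs_scale[OF K_subring _ u(1)] by blast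
 have "EX v:Vs K N. \<phi> u v ~= 0"
 proof (rule ccontr)
  assume "~ ?thesis"
  moreover have sK: "sy N z x : Vs K N" "sy N z y : Vs K N" using sy_Vs[OF K_subring _ X_ratio_K] xyz by auto
  ultimately have "\<phi> u (sy N z x) = 0" "\<phi> u (sy N z y) = 0" by auto
  hence "u $ x = 0" "u $ y = 0" using xyz by(auto simp: \<phi>_def sy_def)
  moreover have "u : Vs UNIV N" using u(1) by(simp add: Vs_def)
  ultimately show False using Vs_expand[OF zxy, of u N] u(2) by simp
 qed
 then obtain v0 where v0: "v0 : Vs K N" "\<phi> u v0 ~= 0" by blast
 have im: "F ` Vs K N = {c *s a | c. c : K}"
 proof (intro equalityI subsetI)
  fix b assume "b : F ` Vs K N"
  thus "b : {c *s a | c. c : K}" using \<phi>K by(auto simp: F_def)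
 next
  fix b assume "b : {c *s a | c. c : K}"
  then obtain c where c: "c : K" "b = c *s a" by blast
  have "(c / \<phi> u v0) *s v0 : Vs K N" by(rule Vs_scale[OF K_subring KR(7)[OF c(1) \<phi>K[OF v0(1)]] v0(1)])
  moreover have "F ((c / \<phi> u v0) *s v0) = b" unfolding F_def \<phi>_scale c(2) using v0(2) by simp
  ultimately show "b : F ` Vs K N" by blast
 qed
 have "quotient_bundle Crv (V N) (crv.line u) Q" unfolding quotient_bundle_def
 proof (intro conjI L(1) V_vector_bundle Q(1) sub exI[of _ F] ballI)
  show "F (v + v') = F v + F v'" for v v' unfolding F_def \<phi>_add by(rule vector_sadd_rdistrib)
  show "F (c *s v) = c *s F v" for c v unfolding F_def \<phi>_scale by(simp add: vector_smult_assoc)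
  show "F ` generic_stalk (V N) = generic_stalk Q" unfolding V_generic im by(simp add: Q_def)
  show "{v : generic_stalk (V N). F v = 0} = generic_stalk (crv.line u)"
   unfolding V_generic ker crv.line_def by(simp add: Crv_simps)
  fix P assume "P : points Crv"
  hence P: "P : pts" by(simp add: Crv_simps)
  have "F ` Vs P N = (%c. c *s a) ` \<phi> u ` Vs P N" unfolding F_def image_image ..
  thus "F ` stalk (V N) P = stalk Q P"
   unfolding V_stalk[OF P] \<phi>_stalk[OF u P] by(auto simp: Q_def m_def)
  have "{v : stalk (V N) P. F v = 0} = {v : {v : Vs K N. F v = 0}. ALL i. v $ i : P}"
   unfolding V_stalk_coord[OF P] V_generic by blast
  thus "{v : stalk (V N) P. F v = 0} = stalk (crv.line u) P"
   unfolding ker crv.line_def by(simp add: Crv_simps)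
 qed
 moreover have "bundle_degree Crv Q + bundle_degree Crv (crv.line u) = bundle_degree Crv (V N)"
  unfolding Q(3) L(2) m(2) V_degree psum_zm by simp
 ultimately show ?thesis using Q(2) by blast
qed

lemma semistable_V:
 assumes "!!u. u : Vs K N ==> u ~= 0 ==> 2 * psum (crv.line_ord u) <= - int (N * d)"
 shows "semistable Crv (V N)"
proof (rule crv.rank_two_semistable[OF V_vector_bundle V_rank])
 show "stalk (V N) P = {v : generic_stalk (V N). ALL i. v $ i : P}" if "P : points Crv" for P
  using V_stalk_coord that by(simp add: Crv_simps)
 show "2 * sum_on (points Crv) (crv.line_ord u) <= bundle_degree Crv (V N)"
  if "u : generic_stalk (V N)" "u ~= 0" for u
  using assms[of u] that by(simp add: V_generic V_degree Crv_simps)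
qed

lemma HN_V:
 assumes u: "u : Vs K N" "u ~= 0" and gt: "- int (N * d) < 2 * psum (crv.line_ord u)"
 shows "HN_filtration Crv (V N) [zero_bundle, crv.line u, V N]" "~ semistable Crv (V N)"
  "bundle_degree Crv (crv.line u) = psum (crv.line_ord u)"
proof -
 obtain Q where Q: "quotient_bundle Crv (V N) (crv.line u) Q" "bundle_rank Crv Q = 1"
  "bundle_degree Crv Q + bundle_degree Crv (crv.line u) = bundle_degree Crv (V N)"
  using V_quotient[OF u] by blast
 have g: "u : generic_stalk (V N)" using u(1) by(simp add: V_generic)
 have st: "stalk (V N) P = {v : generic_stalk (V N). ALL i. v $ i : P}" if "P : points Crv" for P
  using V_stalk_coord that by(simp add: Crv_simps)
 have "2 * sum_on (points Crv) (crv.line_ord u) > bundle_degree Crv (V N)"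
  using gt by(simp add: V_degree Crv_simps)
 note H = crv.HN_line[OF V_vector_bundle V_rank g u(2) st Q this]
 show "HN_filtration Crv (V N) [zero_bundle, crv.line u, V N]" "~ semistable Crv (V N)" using H by auto
 show "bundle_degree Crv (crv.line u) = psum (crv.line_ord u)"
  using crv.line_props(3)[OF u(2)] u(1) by(simp add: Crv_simps Vs_def)
qed

end

section \<open>Galois descent of destabilizing sections\<close>

lemma remove_common_roots:
 fixes q :: "'i => 'a::field poly"
 assumes "q i0 ~= 0"
 shows "EX g q'. g ~= 0 & (ALL i. q i = g * q' i) & (ALL c. EX i. poly (q' i) c ~= 0)"
 using assms
proof (induction "degree (q i0)" arbitrary: q rule: less_induct)
 case less
 show ?case
 proof (cases "ALL c. EX i. poly (q i) c ~= 0")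
  case True
  thus ?thesis by(intro exI[of _ 1] exI[of _ q]) simp
 next
  case False
  then obtain c where "!!i. poly (q i) c = 0" by blast
  hence "EX f. q i = [:- c, 1:] * f" for i by(simp add: poly_eq_0_iff_dvd dvd_def)
  then obtain f where f: "!!i. q i = [:- c, 1:] * f i" by metis
  have f0: "f i0 ~= 0" using less.prems f[of i0] by auto
  have "degree (q i0) = Suc (degree (f i0))" unfolding f using f0 by(subst degree_mult_eq) auto
  then obtain g q' where g: "g ~= 0" "!!i. f i = g * q' i" "ALL c. EX i. poly (q' i) c ~= 0"
   using less.hyps[of f] f0 by auto
  have "q i = ([:- c, 1:] * g) * q' i" for i unfolding f[of i] g(2)[of i] by(simp only: mult.assoc)
  moreover have "[:- c, 1:] * g ~= 0" using g(1) by(simp only: mult_eq_0_iff pCons_eq_0_iff) simp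
  ultimately show ?thesis using g(3) by blast
 qed
qed

context trinomial_curve
begin

text \<open>By \<open>\<phi>_stalk\<close>, the order of \<open>\<phi> u v\<close> at P is at least
  the sum of the two line orders minus N times \<open>zm P\<close>, while its total order is 0. So
  two independent sections cannot both be destabilizing, which makes a destabilizing line
  unique.\<close>

lemma line_ord_pair:
 assumes u: "u : Vs K N" and v: "v : Vs K N" and f: "\<phi> u v ~= 0"
 shows "psum (crv.line_ord u) + psum (crv.line_ord v) <= - int (N * d)"
proof -
 have u0: "u ~= 0" and v0: "v ~= 0" using f by(auto simp: \<phi>_def)
 have uK: "u $ i : K" "v $ i : K" for i using u v by(auto simp: Vs_def)
 have fK: "\<phi> u v : K" unfolding \<phi>_def by(intro KR(10) KR(5) uK)
 have le: "crv.line_ord u P + crv.line_ord v P <= ord_at P (\<phi> u v) + int N * zm P" if P: "P : pts" for P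
 proof -
  note D = pts_dvr[OF P]
  obtain t where t: "t : K" "t ~= 0" "ord_at P t = 1" using exists_uniformizer[OF D] by blast
  define c where "c = t powi (- crv.line_ord v P)"
  have c: "c : K" "c ~= 0" "ord_at P c = - crv.line_ord v P"
   using t ord_powi[OF D t(1,2)] KR(9) by(auto simp: c_def)
  have "ALL i. c * v $ i : P" using crv.line_stalk[OF v0, of P c] uK(2) P c by(simp add: Crv_simps)
  hence "c *s v : Vs P N" using Vs_scale[OF K_subring c(1) v] by(simp add: Vs_def)
  hence "\<phi> u (c *s v) : {c : K. ord_ge P c (crv.line_ord u P - int N * zm P)}"
   unfolding \<phi>_stalk[OF u u0 P, symmetric] by(rule imageI)
  moreover have "\<phi> u (c *s v) = c * \<phi> u v" by(simp add: \<phi>_def algebra_simps)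
  ultimately have "crv.line_ord u P - int N * zm P <= ord_at P (c * \<phi> u v)" using c(2) f by simp
  thus ?thesis unfolding ord_mult[OF D c(1,2) fK f] c(3) by simp
 qed
 have fu: "fsupp (crv.line_ord u)" "fsupp (crv.line_ord v)"
  using crv.line_ord_fsupp[OF u0] crv.line_ord_fsupp[OF v0] uK by(simp_all add: Crv_simps)
 have Nz: "fsupp (%P. int N * zm P)" "psum (%P. int N * zm P) = int N * psum zm"
  using fsupp_sum[of "{..<N}" pts "%_. zm"] psum_sum[of "{..<N}" pts "%_. zm"] fsupp_zm by simp_all
 note ff = fsupp_ord[OF fK f]
 have "psum (crv.line_ord u) + psum (crv.line_ord v) = psum (%P. crv.line_ord u P + crv.line_ord v P)"
  by(rule psum_add[OF fu, symmetric])
 also have "... <= psum (%P. ord_at P (\<phi> u v) + int N * zm P)"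
  by(rule psum_mono[OF fsupp_add[OF fu] fsupp_add[OF ff Nz(1)] le])
 also have "... = - int (N * d)"
  unfolding psum_add[OF ff Nz(1)] Nz(2) psum_zm product_formula[OF fK f] by simp
 finally show ?thesis .
qed

text \<open>Multiplying the i-th entry by the N-th power of X i / X z turns a syzygy into a triple
  of functions in K with sum 0, a condition that is preserved when the Galois group acts on each
  entry.\<close>

definition tw :: "nat => 'l ^ 3 => 3 => 'l" where
 "tw N u i = u $ i * (X $ i / X $ z) ^ N"

lemma tw_sum: "u : Vs A N ==> (SUM i:UNIV. tw N u i) = 0"
 using X_nonzero[of z] by(simp add: Vs_def tw_def power_divide sum_divide_distrib[symmetric])

lemma untw_Vs:
 assumes "!!i. f i : K" "(SUM i:UNIV. f i) = 0"
 shows "(\<chi> i. f i * (X $ z / X $ i) ^ N) : Vs K N"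
proof -
 have "(SUM i:UNIV. f i * (X $ z / X $ i) ^ N * X $ i ^ N) = (SUM i:UNIV. f i) * X $ z ^ N"
  unfolding sum_distrib_right using X_nonzero by(intro sum.cong) (simp_all add: power_divide)
 thus ?thesis using assms KR(5,8) X_ratio_K by(simp add: Vs_def)
qed

text \<open>Each entry of u' differs from the conjugate of the entry of u by a nonzero constant
  only, since ratios of variables are eigenfunctions; so the orders of u' are those of u at the
  permuted points.\<close>

lemma sig_section:
 assumes g: "g : Gam" and u: "u : Vs K N" "u ~= 0"
 defines "u' \<equiv> (\<chi> i. sig (cc g) (tw N u i) * (X $ z / X $ i) ^ N)"
 shows "u' : Vs K N" "psum (crv.line_ord u') = psum (crv.line_ord u)"
proof -
 note a = cc_admissible[OF g]
 note T = sig_autom[OF a]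
 have uK: "u $ i : K" for i using u by(auto simp: Vs_def)
 have tK: "tw N u i : K" for i unfolding tw_def by(rule KR(5)[OF uK KR(8)[OF X_ratio_K]])
 have "(SUM i:UNIV. sig (cc g) (tw N u i)) = sig (cc g) (SUM i:UNIV. tw N u i)"
  by(rule autom_sum[OF K_subfield T tK, symmetric])
 also have "... = 0" unfolding tw_sum[OF u(1)] by(rule autom_0[OF K_subfield T])
 finally show "u' : Vs K N" unfolding u'_def using sig_K[OF a tK] by(intro untw_Vs)
 define e where "e i = (cc g $ i / cc g $ z) ^ N" for i
 have e0: "e i ~= 0" for i using a by(simp add: e_def admissible_def)
 have ke: "kap (e i) = kap (cc g $ i / cc g $ z) ^ N" for i by(simp only: e_def kap_power)
 have u': "u' $ i = kap (e i) * sig (cc g) (u $ i)" for i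
 proof -
  have "sig (cc g) (tw N u i) = sig (cc g) (u $ i) * (kap (cc g $ i / cc g $ z) * (X $ i / X $ z)) ^ N"
   unfolding tw_def autom_mult[OF K_subfield T uK KR(8)[OF X_ratio_K]]
    autom_power[OF K_subfield T X_ratio_K] sig_X_ratio[OF a] ..
  thus ?thesis using X_nonzero[of z] X_nonzero[of i] by(simp add: u'_def ke power_mult_distrib power_divide)
 qed
 have z: "u' $ i = 0 \<longleftrightarrow> u $ i = 0" for i
  unfolding u' using e0 autom_eq_0_iff[OF K_subfield T uK] by(simp add: kap_eq_0_iff)
 have "crv.line_ord u' (sig (cc g) ` P) = crv.line_ord u P" if P: "P : pts" for P
 proof -
  have "ord_at (sig (cc g) ` P) (u' $ i) = ord_at P (u $ i)" if i: "u $ i ~= 0" for i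
  proof -
   have sP: "sig (cc g) ` P : pts" by(rule sig_maps(1)[OF g P])
   have s0: "sig (cc g) (u $ i) ~= 0" using z[of i] i unfolding u' by auto
   have k0: "kap (e i) ~= 0" using e0 by(simp add: kap_eq_0_iff)
   show ?thesis unfolding u' ord_mult[OF pts_dvr[OF sP] kap_K k0 sig_K[OF a uK] s0]
    kap_ord[OF sP e0] sig_maps(2)[OF g P uK i] by simp
  qed
  thus ?thesis unfolding crv.line_ord_def z by(intro arg_cong[where f = Min] image_cong) auto
 qed
 thus "psum (crv.line_ord u') = psum (crv.line_ord u)" by(rule psum_reindex(1)[OF sig_bij_pts[OF g]])
qed

lemma K0_common_denominator:
 assumes \<kappa>: "!!i::3. \<kappa> i : K0" and "\<kappa> i0 ~= 0"
 shows "EX c q. c : K & c ~= 0 & (ALL i. \<kappa> i = c * evp w (q i)) & (ALL b. EX i. poly (q i) b ~= 0)"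
proof -
 have ex: "EX p s. \<kappa> i = evp w p / evp w s & s ~= 0" for i using \<kappa>[of i] unfolding ratfun_def by blast
 then obtain p s where ps: "!!i. \<kappa> i = evp w (p i) / evp w (s i) & s i ~= 0" by metis
 define t where "t = (PROD i:UNIV. s i)"
 have t0: "t ~= 0" using ps by(simp add: t_def)
 define q where "q i = p i * (PROD j:UNIV - {i}. s j)" for i
 have e0: "evp w f ~= 0 \<longleftrightarrow> f ~= 0" for f using evp_eq_0_iff[OF transc_w] by simp
 have \<kappa>q: "\<kappa> i = inverse (evp w t) * evp w (q i)" for i
 proof -
  have "t = s i * (PROD j:UNIV - {i}. s j)" unfolding t_def by(rule prod.remove) auto
  moreover have "(PROD j:UNIV - {i}. s j) ~= 0" using ps by simp
  ultimately show ?thesis using ps[of i] e0 by(simp add: q_def evp_mult field_simps)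
 qed
 hence "q i0 ~= 0" using assms(2) by(auto simp: evp_0)
 from remove_common_roots[of q i0, OF this] obtain g q' where g: "g ~= 0" "ALL i. q i = g * q' i"
  "ALL c. EX i. poly (q' i) c ~= 0" by(elim exE conjE)
 have "\<kappa> i = (inverse (evp w t) * evp w g) * evp w (q' i)" for i
  using \<kappa>q[of i] g(2) by(simp add: evp_mult)
 moreover have "evp w f : K" for f by(rule evp_in_subfield[OF K_subfield kap_K w_K])
 ultimately show ?thesis using g t0 e0 KR(5,6)
  by(intro exI[of _ "inverse (evp w t) * evp w g"] exI[of _ q']) simp
qed

definition section_of :: "nat => (3 => 'k poly) => 'l ^ 3" where
 "section_of N q = (\<chi> i. evp w (q i) * (X $ z / X $ i) ^ N)"

lemma section_of_Vs:
 assumes "(SUM i:UNIV. q i) = 0" shows "section_of N q : Vs K N" unfolding section_of_def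
proof (rule untw_Vs)
 show "evp w (q i) : K" for i by(rule evp_in_subfield[OF K_subfield kap_K w_K])
 have "evp w (q x + q y + q z) = 0" using assms by(simp add: sum_xyz evp_0)
 thus "(SUM i:UNIV. evp w (q i)) = 0" by(simp add: sum_xyz evp_add)
qed

lemma line_ord_scale:
 assumes c: "c : K" "c ~= 0" and u: "!!i. u $ i : K" "u ~= 0"
 shows "psum (crv.line_ord (c *s u)) = psum (crv.line_ord u)"
proof -
 have "crv.line_ord (c *s u) P = crv.line_ord u P + ord_at P c" if P: "P : pts" for P
 proof (rule antisym)
  note D = pts_dvr[OF P]
  have cu: "c *s u ~= 0" using c(2) u(2) by(auto simp: fvec_eq_iff)
  have o: "ord_at P (c * u $ i) = ord_at P c + ord_at P (u $ i)" if "u $ i ~= 0" for i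
   by(rule ord_mult[OF D c u(1) that])
  obtain i where i: "u $ i ~= 0" "crv.line_ord u P = ord_at P (u $ i)" using crv.line_ord_attained[OF u(2)] by blast
  show "crv.line_ord (c *s u) P <= crv.line_ord u P + ord_at P c"
   using crv.line_ord_le[of "c *s u" i P] i c(2) o[OF i(1)] by simp
  obtain i where i: "c * u $ i ~= 0" "crv.line_ord (c *s u) P = ord_at P (c * u $ i)"
   using crv.line_ord_attained[OF cu] by auto
  hence "u $ i ~= 0" by auto
  thus "crv.line_ord u P + ord_at P c <= crv.line_ord (c *s u) P"
   using crv.line_ord_le[of u i P] i o by simp
 qed
 hence "psum (crv.line_ord (c *s u)) = psum (%P. crv.line_ord u P + ord_at P c)" by(rule psum_cong)
 also have "... = psum (crv.line_ord u) + psum (%P. ord_at P c)"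
  using crv.line_ord_fsupp[OF u(2)] u(1) by(intro psum_add fsupp_ord c) (simp add: Crv_simps)
 finally show ?thesis by(simp add: product_formula[OF c])
qed

text \<open>By uniqueness each conjugate section is a multiple of u, so the ratios of the twisted
  entries are invariant and lie in k(w). Clearing denominators and common roots leaves polynomials,
  and a common factor from K does not change the degree.\<close>

theorem descent:
 assumes u: "u : Vs K N" "u ~= 0" and gt: "- int (N * d) < 2 * psum (crv.line_ord u)"
 shows "EX q. (SUM i:UNIV. q i) = 0 & (ALL b. EX i. poly (q i) b ~= 0) &
  psum (crv.line_ord u) = psum (crv.line_ord (section_of N q))"
proof -
 have uK: "u $ i : K" for i using u by(auto simp: Vs_def)
 have tK: "tw N u i : K" for i unfolding tw_def by(rule KR(5)[OF uK KR(8)[OF X_ratio_K]])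
 have ut: "u $ i = tw N u i * (X $ z / X $ i) ^ N" for i
  using X_nonzero[of i] X_nonzero[of z] by(simp add: tw_def power_divide)
 obtain i0 where i0: "u $ i0 ~= 0" using u(2) by(auto simp: fvec_eq_iff)
 have t0: "tw N u i0 ~= 0" using i0 X_nonzero by(simp add: tw_def)
 define \<kappa> where "\<kappa> i = tw N u i / tw N u i0" for i
 have "\<kappa> i : K0" for i
 proof (rule invariant_K0)
  show "\<kappa> i : K" unfolding \<kappa>_def by(rule KR(7)[OF tK tK])
  fix g assume g: "g : Gam"
  note T = sig_autom[OF cc_admissible[OF g]]
  define u' where "u' = (\<chi> i. sig (cc g) (tw N u i) * (X $ z / X $ i) ^ N)"
  note S = sig_section[OF g u, folded u'_def]
  have "\<phi> u u' = 0"
  proof (rule ccontr)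
   assume "\<phi> u u' ~= 0"
   from line_ord_pair[OF u(1) S(1) this] gt show False unfolding S(2) by simp
  qed
  then obtain c where c: "c : K" "u' = c *s u" using \<phi>_kernel[OF u S(1)] by blast
  have st: "sig (cc g) (tw N u i) = c * tw N u i" for i
  proof -
   have "sig (cc g) (tw N u i) * (X $ z / X $ i) ^ N = c * u $ i"
    using arg_cong[OF c(2), of "%v. v $ i"] by(simp add: u'_def)
   thus ?thesis using ut[of i] X_nonzero[of i] X_nonzero[of z] by simp
  qed
  have "c ~= 0" using st[of i0] t0 autom_eq_0_iff[OF K_subfield T tK, of i0] by auto
  thus "sig (cc g) (\<kappa> i) = \<kappa> i"
   unfolding \<kappa>_def autom_divide[OF K_subfield T tK tK] st by simp
 qed
 then obtain c q where cq: "c : K" "c ~= 0" "!!i. \<kappa> i = c * evp w (q i)" "ALL b. EX i. poly (q i) b ~= 0"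
  using K0_common_denominator[of \<kappa> i0] t0 by(auto simp: \<kappa>_def)
 define e where "e = tw N u i0 * c"
 have e: "e : K" "e ~= 0" using KR(5)[OF tK cq(1)] t0 cq(2) by(auto simp: e_def)
 have te: "tw N u i = e * evp w (q i)" for i
  using cq(3)[of i] t0 by(simp add: \<kappa>_def e_def divide_eq_eq mult_ac)
 have "e * evp w (q x + q y + q z) = 0"
  using tw_sum[OF u(1)] unfolding te by(simp add: sum_xyz evp_add distrib_left)
 hence sum: "(SUM i:UNIV. q i) = 0" using e(2) evp_eq_0_iff[OF transc_w] by(simp add: sum_xyz)
 have us: "u = e *s section_of N q" unfolding fvec_eq_iff
 proof
  fix i
  show "u $ i = (e *s section_of N q) $ i" using ut[of i] te[of i] by(simp add: section_of_def mult.assoc)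
 qed
 have "section_of N q $ i : K" for i using section_of_Vs[OF sum] by(simp add: Vs_def)
 moreover have "section_of N q ~= 0" using us u(2) by auto
 ultimately have "psum (crv.line_ord u) = psum (crv.line_ord (section_of N q))"
  unfolding us using line_ord_scale[OF e] by blast
 thus ?thesis using sum cq(4) by blast
qed

end

section \<open>Degrees of sections given by polynomial triples\<close>

context trinomial_curve
begin

definition dl :: "(3 => 'k poly) => nat" where
 "dl q = Max (range (%i. degree (q i)))"

definition coprime_triple :: "(3 => 'k poly) => bool" where
 "coprime_triple q \<longleftrightarrow> (SUM i:UNIV. q i) = 0 & (ALL b. EX i. poly (q i) b ~= 0)"

text \<open>The place at which \<open>M\<^sub>l\<close> vanishes on the line \<open>\<Sum>M\<^sub>l = 0\<close>, with coordinate \<open>w = M\<^sub>x / M\<^sub>z\<close>.\<close>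

definition pl :: "3 => 'k option" where
 "pl l = (if l = x then Some 0 else if l = y then Some (- 1) else None)"

text \<open>The least order over a among the nonzero entries of a coprime triple.\<close>

definition base :: "(3 => 'k poly) => 'k option => int" where
 "base q a = (if a = None then - int (dl q) else 0)"

text \<open>The excess vanishing of the entry l at the place of M l; for destabilizing triples these
  are the coordinates of the odd lattice point.\<close>

definition kk :: "(3 => 'k poly) => 3 => int" where
 "kk q l = vord (pl l) (q l) - base q (pl l)"

text \<open>At the place of M l the variable l has a weight that exceeds the second largest by
  \<open>gap l\<close>, so the entry l, divided by its N-th power, may have smaller order than the
  other two. This is lam times the drop, which vanishing of the polynomial reduces.\<close>

definition ex :: "nat => (3 => 'k poly) => 3 => int" where
 "ex N q l = (if q l = 0 then 0 else max 0 (int (N * gap l) - int lam * kk q l))"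

definition lead :: "(3 => 'k poly) => 'k option => 3 => 'k" where
 "lead q a i = (case a of Some c => poly (q i) c | None => coeff (q i) (dl q))"

lemma degree_le_dl: "degree (q i) <= dl q" unfolding dl_def by(rule Max_ge) auto

lemma vord_ge_base: "base q a <= vord a (q i)"
 using degree_le_dl[of q i] by(cases a) (simp_all add: base_def)

lemma lead_nonzero_iff: "q i ~= 0 ==> lead q a i ~= 0 \<longleftrightarrow> vord a (q i) = base q a"
proof (cases a)
 case None
 assume "q i ~= 0"
 moreover have "coeff (q i) (dl q) ~= 0 \<longleftrightarrow> degree (q i) = dl q" if "q i ~= 0"
  using that degree_le_dl[of q i] le_degree[of "q i" "dl q"] by(metis leading_coeff_0_iff le_antisym)
 ultimately show ?thesis using None by(simp add: lead_def base_def)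
next
 case (Some c)
 assume "q i ~= 0"
 thus ?thesis using Some order_root[of "q i" c] by(auto simp: lead_def base_def)
qed

lemma lead_imp_nonzero: "lead q a i ~= 0 ==> q i ~= 0"
 by(auto simp: lead_def split: option.splits)

lemma lead_sum: "coprime_triple q ==> (SUM i:UNIV. lead q a i) = 0"
proof (cases a)
 case None
 assume "coprime_triple q"
 hence "coeff (SUM i:UNIV. q i) (dl q) = 0" by(simp add: coprime_triple_def)
 thus ?thesis using None by(simp add: lead_def coeff_sum)
next
 case (Some c)
 assume "coprime_triple q"
 hence "poly (SUM i:UNIV. q i) c = 0" by(simp add: coprime_triple_def)
 thus ?thesis using Some by(simp add: lead_def poly_sum)
qed

lemma lead_ex: "coprime_triple q ==> EX i. lead q a i ~= 0"
proof (cases a)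
 case None
 assume q: "coprime_triple q"
 have "dl q : range (%i. degree (q i))" unfolding dl_def by(rule Max_in) auto
 then obtain i where i: "dl q = degree (q i)" by blast
 show ?thesis
 proof (cases "q i = 0")
  case False
  thus ?thesis using None i by(intro exI[of _ i]) (simp add: lead_def)
 next
  case True
  hence d0: "dl q = 0" using i by simp
  obtain j where "poly (q j) 0 ~= 0" using q unfolding coprime_triple_def by blast
  thus ?thesis using None d0 by(auto simp: lead_def poly_0_coeff_0)
 qed
next
 case (Some c)
 assume "coprime_triple q"
 thus ?thesis using Some by(auto simp: lead_def coprime_triple_def)
qed

text \<open>The leading terms at a have sum 0 and are not all 0, so if one of them is 0, the other
  two are not.\<close>

lemma lead_others:
 assumes q: "coprime_triple q" and l: "lead q a l = 0" and i: "i ~= l"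
 shows "q i ~= 0" "vord a (q i) = base q a"
proof -
 obtain j where ij: "distinct [l, i, j]"
  using i xyz by(metis (full_types) distinct_length_2_or_more distinct_singleton)
 have "lead q a i + lead q a j = 0" using lead_sum[OF q, of a] l unfolding sum_ijk[OF ij] by simp
 moreover obtain j' where "lead q a j' ~= 0" using lead_ex[OF q] by blast
 moreover have "j' : {l, i, j}" unfolding UNIV3_eq[OF ij, symmetric] by(rule UNIV_I)
 ultimately have "lead q a i ~= 0" using l by auto
 moreover from this show "q i ~= 0" by(rule lead_imp_nonzero)
 ultimately show "vord a (q i) = base q a" using lead_nonzero_iff by blast
qed

text \<open>lam times the least order of the entries of the section over a, measured on the line and
  up to the contribution of z^N, see \<open>line_ord_section\<close>.\<close>

definition \<mu> :: "nat => (3 => 'k poly) => 'k option => int" where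
 "\<mu> N q a = Min ((%i. int lam * vord a (q i) - int N * rr a i) ` {i. q i ~= 0})"

lemma \<mu>_eqI:
 assumes "!!i. q i ~= 0 ==> b <= int lam * vord a (q i) - int N * rr a i"
  and "q j ~= 0" "int lam * vord a (q j) - int N * rr a j <= b" shows "\<mu> N q a = b"
 unfolding \<mu>_def
proof (rule Min_eqI)
 show "finite ((%i. int lam * vord a (q i) - int N * rr a i) ` {i. q i ~= 0})" by simp
 have "int lam * vord a (q j) - int N * rr a j = b" using assms(1)[OF assms(2)] assms(3) by simp
 thus "b : (%i. int lam * vord a (q i) - int N * rr a i) ` {i. q i ~= 0}" using assms(2) by force
qed (use assms(1) in auto)

lemma rr_pl: "rr (pl l) i = int (r l i)" using xyz UNIV_xyz by(auto simp: rr_def pl_def)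

text \<open>The entries other than l are bounded below through the weight \<open>mid l\<close>. If
  entry l has leading term 0 and \<open>ex\<close> is 0, the variable of weight \<open>mid l\<close>
  attains this bound, because its polynomial does not vanish at the place; in all other cases the
  minimum is attained by the entry l.\<close>

lemma \<mu>_pl:
 assumes q: "coprime_triple q" shows "\<mu> N q (pl l) = int lam * base q (pl l) - int (N * mid l) - ex N q l"
proof -
 let ?a = "pl l" and ?b = "base q (pl l)"
 have others: "int lam * ?b - int (N * mid l) <= int lam * vord ?a (q i) - int N * rr ?a i" if "i ~= l" for i
 proof -
  have "int lam * ?b <= int lam * vord ?a (q i)" using vord_ge_base[of q ?a i] by(simp add: mult_left_mono)
  moreover have "int N * rr ?a i <= int (N * mid l)" unfolding rr_pl using r_mid[OF that] by(simp add: mult_left_mono)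
  ultimately show ?thesis by simp
 qed
 have self: "int lam * vord ?a (q l) - int N * rr ?a l =
   int lam * ?b - int (N * mid l) - (int (N * gap l) - int lam * kk q l)"
  unfolding rr_pl r_top kk_def by(simp add: algebra_simps)
 obtain m where m: "m ~= l" "r l m = mid l" using r_mid_ex by blast
 have mval: "int lam * vord ?a (q m) - int N * rr ?a m = int lam * ?b - int (N * mid l)"
  and m0: "q m ~= 0" if "lead q ?a l = 0"
  using lead_others[OF q that m(1)] by(simp_all add: rr_pl m(2))
 have ge: "int lam * ?b - int (N * mid l) - ex N q l <= int lam * vord ?a (q i) - int N * rr ?a i" if "q i ~= 0" for i
  using others[of i] self that by(cases "i = l") (auto simp: ex_def)
 show ?thesis
 proof (cases "lead q ?a l = 0 & ex N q l = 0")
  case True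
  thus ?thesis by(intro \<mu>_eqI[where j = m] ge m0) (use mval in auto)
 next
  case False
  hence "q l ~= 0 & ex N q l <= int (N * gap l) - int lam * kk q l"
   using lead_imp_nonzero[of q ?a l] lead_nonzero_iff[of q l ?a] by(auto simp: ex_def kk_def split: if_splits)
  thus ?thesis by(intro \<mu>_eqI[where j = l] ge) (use self in auto)
 qed
qed

lemma line_ord_section:
 assumes q: "coprime_triple q" and P: "P : fib a"
 shows "int lam * crv.line_ord (section_of N q) P = (int N * rr a z + \<mu> N q a) * ram P a"
proof -
 note D = fib_dvr[OF P]
 have eK: "evp w f : K" for f by(rule evp_in_subfield[OF K_subfield kap_K w_K])
 have e0: "evp w f ~= 0 \<longleftrightarrow> f ~= 0" for f using evp_eq_0_iff[OF transc_w] by simp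
 have nz: "section_of N q $ i ~= 0 \<longleftrightarrow> q i ~= 0" for i using e0 X_nonzero by(simp add: section_of_def)
 define val where "val i = int lam * vord a (q i) - int N * rr a i" for i
 have o: "int lam * ord_at P (section_of N q $ i) = (int N * rr a z + val i) * ram P a" if "q i ~= 0" for i
 proof -
  have "ord_at P (section_of N q $ i) = ord_at P (evp w (q i)) + int N * ord_at P (X $ z / X $ i)"
   using ord_mult[OF D eK _ KR(8)[OF X_ratio_K]] ord_power[OF D X_ratio_K] e0 that X_nonzero
   by(simp add: section_of_def)
  hence "int lam * ord_at P (section_of N q $ i) =
    int lam * (vord a (q i) * ram P a) + int N * (int lam * ord_at P (X $ z / X $ i))"
   unfolding ord_evp[OF P that] by(simp add: algebra_simps)
  thus ?thesis unfolding ord_X_ratio[OF P] val_def by(simp add: algebra_simps)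
 qed
 obtain i0 where i0: "q i0 ~= 0" using lead_ex[OF q, of a] lead_imp_nonzero by blast
 hence s0: "section_of N q ~= 0" using nz[of i0] by(auto simp: fvec_eq_iff)
 have \<mu>_mem: "\<mu> N q a : val ` {i. q i ~= 0}" and \<mu>_le: "!!i. q i ~= 0 ==> \<mu> N q a <= val i"
  unfolding \<mu>_def val_def[symmetric] using i0 by(auto intro!: Min_in)
 obtain i where i: "section_of N q $ i ~= 0" "crv.line_ord (section_of N q) P = ord_at P (section_of N q $ i)"
  using crv.line_ord_attained[OF s0] by blast
 obtain j where j: "q j ~= 0" "\<mu> N q a = val j" using \<mu>_mem by blast
 have "(int N * rr a z + \<mu> N q a) * ram P a <= int lam * crv.line_ord (section_of N q) P"
  unfolding i(2) using o[of i] \<mu>_le[of i] i(1) nz[of i] ram_pos[OF P] by(simp add: mult_right_mono)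
 moreover have "int lam * crv.line_ord (section_of N q) P <= (int N * rr a z + \<mu> N q a) * ram P a"
  unfolding j(2) o[OF j(1), symmetric] using crv.line_ord_le[of "section_of N q" j P] nz[of j] j(1)
  by(simp add: mult_left_mono)
 ultimately show ?thesis by simp
qed

text \<open>Each weight vector consists of \<open>mid l + gap l\<close>, \<open>mid l\<close> and 0,
  while the weights of each variable add up to d.\<close>

lemma gap_mid_sum: "2 * (SUM l:UNIV. mid l) + (SUM l:UNIV. gap l) = 3 * d"
proof -
 have "(SUM i:UNIV. r l i) = 2 * mid l + gap l" for l
 proof -
  obtain m where m: "m ~= l" "r l m = mid l" using r_mid_ex by blast
  obtain i where i: "i ~= l" "r l i = 0" using r_zero by blast
  show ?thesis
  proof (cases "i = m")
   case False
   hence d3: "distinct [l, m, i]" using m i by auto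
   show ?thesis unfolding sum_ijk[OF d3] using m i r_top by simp
  next
   case True
   obtain j where d3: "distinct [l, m, j]"
    using m(1) xyz by(metis (full_types) distinct_length_2_or_more distinct_singleton)
   have "mid l = 0" using True m i by simp
   moreover from this have "r l j = 0" using r_mid[of j l] d3 by auto
   ultimately show ?thesis unfolding sum_ijk[OF d3] using m r_top by simp
  qed
 qed
 hence "(SUM l:UNIV. SUM i:UNIV. r l i) = (SUM l:UNIV. 2 * mid l + gap l)" by simp
 moreover have "(SUM l:UNIV. SUM i:UNIV. r l i) = 3 * d"
  by(subst sum.swap) (simp add: r_sum sum_xyz)
 ultimately show ?thesis by(simp add: sum.distrib sum_distrib_left)
qed

text \<open>Only the three branch fibres contribute, each with its order on the line times lam by
  \<open>sum_ram\<close>. The factor 2 avoids halves: \<open>gap_mid_sum\<close> expresses twice the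
  sum of the \<open>mid l\<close> by the gaps.\<close>

theorem psum_section:
 assumes q: "coprime_triple q" shows "2 * psum (crv.line_ord (section_of N q)) =
  int N * (SUM l:UNIV. int (gap l)) - int (N * d) - 2 * int lam * int (dl q) - 2 * (SUM l:UNIV. ex N q l)"
proof -
 let ?A = "{None, Some 0, Some (- 1)} :: 'k option set" and ?L = "crv.line_ord (section_of N q)"
 have z: "?L P = 0" if P: "P : fib a" and a: "a ~: ?A" for P a
 proof -
  obtain c where c: "a = Some c" using a by(cases a) auto
  have rr0: "rr a i = 0" for i using a c by(auto simp: rr_def)
  obtain i where i: "lead q a i ~= 0" using lead_ex[OF q] by blast
  hence qi: "q i ~= 0" using c by(auto simp: lead_def)
  have "\<mu> N q a = 0"
  proof (rule \<mu>_eqI[where j = i])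
   show "q i ~= 0" by(rule qi)
   show "0 <= int lam * vord a (q i) - int N * rr a i" for i using rr0 c by simp
  qed (use lead_nonzero_iff[of q i a] qi i rr0 c in \<open>simp add: base_def\<close>)
  thus ?thesis using line_ord_section[OF q P, of N] rr0 lam_pos by simp
 qed
 have fin: "finite ?A" by simp
 have "psum ?L = (SUM a:?A. SUM P:fib a. ?L P)" by(rule psum_fibres(2)[OF fin z])
 hence "int lam * psum ?L = (SUM a:?A. SUM P:fib a. int lam * ?L P)" by(simp only: sum_distrib_left)
 also have "... = (SUM a:?A. SUM P:fib a. (int N * rr a z + \<mu> N q a) * ram P a)"
  by(intro sum.cong refl line_ord_section[OF q])
 also have "... = (SUM a:?A. (int N * rr a z + \<mu> N q a) * int lam)"
  by(simp only: sum_distrib_left[symmetric] sum_ram)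
 also have "... = int lam * (SUM a:?A. int N * rr a z + \<mu> N q a)"
  unfolding sum_distrib_right[symmetric] by(rule mult.commute)
 finally have "psum ?L = (SUM a:?A. int N * rr a z + \<mu> N q a)" using lam_pos by(simp only: mult_cancel_left) simp
 also have "... = int N * (SUM a:?A. rr a z) + (SUM a:?A. \<mu> N q a)"
  by(simp only: sum.distrib sum_distrib_left)
 also have "(SUM a:?A. rr a z) = int d" by(rule rr_sum)
 also have "(SUM a:?A. \<mu> N q a) = (SUM l:UNIV. \<mu> N q (pl l))"
  using xyz by(simp add: sum_xyz pl_def)
 also have "... = (SUM l:UNIV. int lam * base q (pl l) - int (N * mid l) - ex N q l)"
  by(simp only: \<mu>_pl[OF q])
 also have "... = - (int lam * int (dl q)) - int N * (SUM l:UNIV. int (mid l)) - (SUM l:UNIV. ex N q l)"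
  using xyz by(simp add: sum_xyz base_def pl_def algebra_simps)
 finally have e: "psum ?L = int N * int d + (- (int lam * int (dl q)) - int N * (SUM l:UNIV. int (mid l)) -
   (SUM l:UNIV. ex N q l))" .
 have "2 * (SUM l:UNIV. int (mid l)) = 3 * int d - (SUM l:UNIV. int (gap l))"
  using gap_mid_sum by(simp flip: of_nat_sum)
 hence "int N * (2 * (SUM l:UNIV. int (mid l))) = int N * (3 * int d - (SUM l:UNIV. int (gap l)))" by simp
 thus ?thesis unfolding e by(simp add: algebra_simps)
qed

end

section \<open>The Mason-Stothers argument\<close>

lemma degree_pderiv_le: "degree (pderiv p) <= degree (p :: 'a::field poly) - 1"
 by(rule degree_le) (auto simp: coeff_pderiv coeff_eq_0)

lemma pderiv_eq_0_const: "degree (p :: 'a::field poly) = 0 ==> pderiv p = 0"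
 by(auto elim!: degree_eq_zeroE simp: pderiv_pCons)

lemma degree_mult_pderiv_le: "degree (f * pderiv g) <= degree f + degree (g :: 'a::field poly) - 1"
proof (cases "degree g = 0")
 case True
 thus ?thesis by(simp add: pderiv_eq_0_const)
next
 case False
 have "degree (f * pderiv g) <= degree f + degree (pderiv g)" by(rule degree_mult_le)
 thus ?thesis using degree_pderiv_le[of g] False by linarith
qed

lemma power_dvd_pderiv:
 fixes f :: "'a::field poly"
 assumes "[:- c, 1:] ^ k dvd f" shows "[:- c, 1:] ^ (k - 1) dvd pderiv f"
proof (cases k)
 case (Suc m)
 then obtain h where "f = [:- c, 1:] ^ Suc m * h" using assms by blast
 hence "pderiv f = [:- c, 1:] ^ Suc m * pderiv h + Polynomial.smult (of_nat (Suc m)) ([:- c, 1:] ^ m) * pderiv [:- c, 1:] * h"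
  by(simp only: pderiv_mult pderiv_power_Suc mult.commute[of h])
 moreover have "[:- c, 1:] ^ m dvd ..."
  by(intro dvd_add dvd_mult2 dvd_smult dvd_refl le_imp_power_dvd) simp
 ultimately show ?thesis using Suc by simp
qed simp

lemma dvd_cancel_no_common_root:
 fixes f g A :: "'a::alg_closed_field poly"
 assumes "f ~= 0" "!!c. poly f c = 0 ==> poly g c ~= 0" "f dvd A * g"
 shows "f dvd A" using assms
proof (induction f arbitrary: A rule: alg_closed_poly_induct)
 case (const e)
 have "is_unit [:e:]" using const.hyps by(simp add: is_unit_iff_degree)
 thus ?case by(rule unit_imp_dvd)
next
 case (factor c f')
 obtain k where "A * g = [:- c, 1:] * f' * k" using factor.prems(2) by blast
 hence "poly (A * g) c = 0" by(simp only: poly_mult) simp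
 hence "poly A c = 0" using factor.prems(1)[of c] by simp
 then obtain A' where A': "A = [:- c, 1:] * A'" by(auto simp: poly_eq_0_iff_dvd)
 have "[:- c, 1:] * f' dvd [:- c, 1:] * (A' * g)" using factor.prems(2) unfolding A' by(simp only: mult.assoc)
 hence "f' dvd A' * g" by(subst (asm) dvd_mult_cancel_left) auto
 moreover have "poly g b ~= 0" if "poly f' b = 0" for b using factor.prems(1)[of b] that by simp
 ultimately have "f' dvd A'" using factor.IH by blast
 thus ?case unfolding A' by(rule mult_dvd_mono[OF dvd_refl])
qed

text \<open>Only exponents divisible by the characteristic occur, and over an algebraically closed
  field the coefficients have roots of that degree.\<close>

lemma pderiv_0_imp_power:
 fixes q :: "'a::alg_closed_field poly"
 assumes p: "prime CHAR('a)" and q: "pderiv q = 0" shows "EX r. q = r ^ CHAR('a)"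
proof -
 let ?p = "CHAR('a)"
 have p0: "0 < ?p" using p by(rule prime_gt_0_nat)
 have c0: "coeff q i = 0" if i: "~ ?p dvd i" for i
 proof -
  obtain j where j: "i = Suc j" using i by(cases i) auto
  have "of_nat (Suc j) * coeff q (Suc j) = 0" using q coeff_pderiv[of q j] by simp
  thus ?thesis using i j by(simp add: of_nat_eq_0_iff_char_dvd del: of_nat_Suc)
 qed
 have "EX b. b ^ ?p = coeff q (j * ?p)" for j using nth_root_exists[OF p0] by blast
 then obtain b where b: "!!j. b j ^ ?p = coeff q (j * ?p)" by metis
 define r where "r = (SUM j<=degree q. monom (b j) j)"
 have "r ^ ?p = (SUM j<=degree q. monom (b j) j ^ ?p)"
  unfolding r_def using p by(intro freshmans_dream_sum) simp_all
 also have "... = (SUM j<=degree q. monom (coeff q (j * ?p)) (j * ?p))" by(simp add: monom_power b)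
 also have "... = q"
 proof (rule poly_eqI)
  fix i
  have "coeff (SUM j<=degree q. monom (coeff q (j * ?p)) (j * ?p)) i =
    (SUM j<=degree q. if j * ?p = i then coeff q i else 0)" unfolding coeff_sum by(intro sum.cong) auto
  also have "... = coeff q i"
  proof (cases "?p dvd i & i <= degree q")
   case True
   then obtain j where j: "i = ?p * j" by blast
   have "j <= degree q" using True j p0 by(metis le_trans mult_le_mono1 nat_mult_1 Suc_leI One_nat_def)
   moreover have "k * ?p = i \<longleftrightarrow> k = j" for k using j p0 by(simp add: mult.commute)
   ultimately show ?thesis by(simp add: sum.delta cong: if_cong)
  next
   case False
   hence "coeff q i = 0" using c0 coeff_eq_0 by(metis not_le)
   thus ?thesis by(simp cong: if_cong)
  qed
  finally show "coeff (SUM j<=degree q. monom (coeff q (j * ?p)) (j * ?p)) i = coeff q i" .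
 qed
 finally show ?thesis by metis
qed

lemma order_power: "f ~= 0 ==> order c (f ^ n) = n * order c (f :: 'a::field poly)"
 by(induction n) (simp_all add: order_mult)

lemma order_add_le_degree:
 fixes W :: "'a::field poly"
 assumes W: "W ~= 0" and ab: "a ~= b" and d: "[:- a, 1:] ^ m dvd W" "[:- b, 1:] ^ n dvd W"
 shows "m + n <= degree W"
proof -
 obtain V where V: "W = [:- a, 1:] ^ m * V" using d(1) by blast
 have V0: "V ~= 0" using W V by auto
 have "order b ([:- a, 1:] ^ m) = 0" using ab by(intro order_0I) simp
 hence "order b W = order b V" unfolding V using W V by(subst order_mult) auto
 hence "n <= order b V" using d(2) W by(simp add: order_divides)
 hence "[:- b, 1:] ^ n dvd V" by(simp add: order_divides)
 hence "n <= degree V" using dvd_imp_degree_le[of "[:- b, 1:] ^ n" V] V0 by(simp add: degree_linear_power)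
 thus ?thesis unfolding V using V0 by(simp add: degree_mult_eq degree_linear_power)
qed

context trinomial_curve
begin

definition exr :: "(3 => real) => (3 => 'k poly) => 3 => real" where
 "exr \<theta> q l = (if q l = 0 then 0 else max 0 (\<theta> l - of_int (kk q l)))"

text \<open>For \<theta> = \<open>tau N\<close>, twice the degree of the section is lam times this
  number minus N d, see \<open>psum_val\<close>; so sections are destabilizing exactly where it is
  positive. A real argument \<theta> permits division by the characteristic.\<close>

definition val :: "(3 => real) => (3 => 'k poly) => real" where
 "val \<theta> q = (SUM l:UNIV. \<theta> l) - 2 * real (dl q) - 2 * (SUM l:UNIV. exr \<theta> q l)"

definition good :: "(3 => real) => bool" where
 "good \<theta> \<longleftrightarrow> (ALL q. coprime_triple q --> val \<theta> q <= 0)"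

text \<open>For triples of positive degree the bound 2 on the sum suffices. For constant triples at
  most one entry is 0, the others subtract their full \<theta>, and the triangle inequality for the
  remaining one decides.\<close>

lemma good_base:
 assumes pos: "!!l. 0 <= \<theta> l" and sum: "(SUM l:UNIV. \<theta> l) <= 2"
  and tri: "!!l. 2 * \<theta> l <= (SUM l:UNIV. \<theta> l)" shows "good \<theta>"
 unfolding good_def
proof (intro allI impI)
 fix q assume q: "coprime_triple q"
 have e0: "0 <= exr \<theta> q l" for l by(simp add: exr_def)
 show "val \<theta> q <= 0"
 proof (cases "dl q = 0")
  case False
  thus ?thesis using sum sum_nonneg[of UNIV "exr \<theta> q"] e0 by(simp add: val_def)
 next
  case True
  have k0: "kk q l = 0" if "q l ~= 0" for l
  proof -
   have "degree (q l) = 0" using degree_le_dl[of q l] True by simp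
   then obtain b where "q l = [:b:]" using degree_eq_zeroE by blast
   thus ?thesis using that True by(simp add: kk_def base_def pl_def order_0I)
  qed
  have e: "exr \<theta> q l = (if q l = 0 then 0 else \<theta> l)" for l using k0 pos by(simp add: exr_def)
  obtain l where l: "ALL i. i ~= l --> q i ~= 0"
  proof (cases "EX l. q l = 0")
   case True
   then obtain l where "q l = 0" by blast
   hence "lead q (Some 0) l = 0" by(simp add: lead_def)
   thus thesis using lead_others(1)[OF q] by(intro that[of l]) blast
  next
   case False
   thus thesis by(intro that[of x]) blast
  qed
  have "(SUM i:UNIV. \<theta> i) = (SUM i:UNIV - {l}. \<theta> i) + \<theta> l" by(subst sum.remove[of _ l]) auto
  moreover have "(SUM i:UNIV - {l}. \<theta> i) = (SUM i:UNIV - {l}. exr \<theta> q i)"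
   using l by(intro sum.cong) (auto simp: e)
  moreover have "(SUM i:UNIV - {l}. exr \<theta> q i) <= (SUM i:UNIV. exr \<theta> q i)"
   using e0 by(intro sum_mono2) auto
  ultimately show ?thesis using tri[of l] by(simp add: val_def)
 qed
qed

definition Wr :: "(3 => 'k poly) => 'k poly" where
 "Wr q = q x * pderiv (q y) - pderiv (q x) * q y"

lemma Wr_eq:
 assumes q: "coprime_triple q"
 shows "Wr q = q y * pderiv (q z) - pderiv (q y) * q z" "Wr q = q z * pderiv (q x) - pderiv (q z) * q x"
proof -
 have "q x + q y + q z = 0" using q by(simp add: coprime_triple_def sum_xyz)
 hence "q z = - (q x + q y)" unfolding eq_neg_iff_add_eq_0 by(simp add: ac_simps)
 hence z: "q z = - q x - q y" by simp
 show "Wr q = q y * pderiv (q z) - pderiv (q y) * q z" "Wr q = q z * pderiv (q x) - pderiv (q z) * q x"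
  unfolding Wr_def z by(simp_all add: pderiv_diff pderiv_minus algebra_simps)
qed

text \<open>If q x and q y vanish to orders m at 0 and n at - 1, the Wronskian vanishes there to
  orders at least m - 1 and n - 1. Their sum is at most its degree, which is smaller than the sum of
  the degrees of q z and q x. As \<open>kk q z\<close> is the drop of the degree of q z below
  \<open>dl q\<close>, that degree cancels.\<close>

lemma mason:
 assumes q: "coprime_triple q" and W: "Wr q ~= 0"
 shows "q l ~= 0" "(SUM l:UNIV. kk q l) <= 2 * int (dl q) + 1"
proof -
 have nz: "q x ~= 0" "q y ~= 0" "q z ~= 0" using W Wr_eq[OF q] by(auto simp: Wr_def)
 have "l : {x, y, z}" unfolding UNIV_xyz[symmetric] by(rule UNIV_I)
 thus "q l ~= 0" using nz by auto
 define m where "m = order 0 (q x)"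
 define n where "n = order (- 1) (q y)"
 have mx: "[:- 0, 1:] ^ m dvd q x" and ny: "[:- (- 1), 1:] ^ n dvd q y"
  unfolding m_def n_def by(rule order_1)+
 have "[:- 0, 1:] ^ (m - 1) dvd Wr q" unfolding Wr_def
  using power_dvd_pderiv[OF mx] dvd_trans[OF le_imp_power_dvd mx, of "m - 1"] by(intro dvd_diff dvd_mult2) auto
 moreover have "[:- (- 1), 1:] ^ (n - 1) dvd Wr q" unfolding Wr_def
  using power_dvd_pderiv[OF ny] dvd_trans[OF le_imp_power_dvd ny, of "n - 1"] by(intro dvd_diff dvd_mult) auto
 ultimately have "(m - 1) + (n - 1) <= degree (Wr q)" by(intro order_add_le_degree[OF W, of 0 "- 1"]) auto
 moreover have "degree (Wr q) <= degree (q z) + degree (q x) - 1"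
  unfolding Wr_eq(2)[OF q] using degree_mult_pderiv_le[of "q z" "q x"] degree_mult_pderiv_le[of "q x" "q z"]
  by(intro degree_diff_le) (simp_all add: mult.commute add.commute)
 moreover have "0 < degree (q z) + degree (q x)"
 proof (rule ccontr)
  assume "~ ?thesis"
  hence "pderiv (q z) = 0" "pderiv (q x) = 0" by(simp_all add: pderiv_eq_0_const)
  thus False using W Wr_eq(2)[OF q] by simp
 qed
 moreover have "degree (q x) <= dl q" by(rule degree_le_dl)
 moreover have "kk q x = int m" "kk q y = int n" "kk q z = int (dl q) - int (degree (q z))"
  using xyz by(simp_all add: kk_def pl_def base_def m_def n_def)
 ultimately show "(SUM l:UNIV. kk q l) <= 2 * int (dl q) + 1" unfolding sum_xyz by linarith
qed

lemma val_mason: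
 assumes q: "coprime_triple q" and W: "Wr q ~= 0"
 shows "val \<theta> q = of_int (SUM l:UNIV. kk q l) - 2 * real (dl q) - (SUM l:UNIV. \<bar>\<theta> l - of_int (kk q l)\<bar>)"
proof -
 have "2 * exr \<theta> q l = \<bar>\<theta> l - of_int (kk q l)\<bar> + (\<theta> l - of_int (kk q l))" for l
  using mason(1)[OF q W] by(simp add: exr_def max_def abs_if)
 hence "2 * (SUM l:UNIV. exr \<theta> q l) = (SUM l:UNIV. \<bar>\<theta> l - of_int (kk q l)\<bar> + (\<theta> l - of_int (kk q l)))"
  by(simp add: sum_distrib_left)
 thus ?thesis by(simp add: val_def sum.distrib sum_subtractf)
qed

text \<open>Positivity requires that the orders add up to more than 2 \<open>dl q\<close>, and
  Mason-Stothers then leaves only the value 2 \<open>dl q\<close> + 1. Here the odd lattice appears,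
  and with it the taxicab distance.\<close>

lemma val_mason_pos:
 assumes q: "coprime_triple q" and W: "Wr q ~= 0" and v: "0 < val \<theta> q"
 shows "(SUM l:UNIV. kk q l) = 2 * int (dl q) + 1" "val \<theta> q = 1 - (SUM l:UNIV. \<bar>\<theta> l - of_int (kk q l)\<bar>)"
proof -
 have n: "0 <= (SUM l:UNIV. \<bar>\<theta> l - of_int (kk q l)\<bar>)" by(intro sum_nonneg) simp
 have "real_of_int (SUM l:UNIV. kk q l) > 2 * real (dl q)" using v n unfolding val_mason[OF q W] by linarith
 hence "2 * int (dl q) < (SUM l:UNIV. kk q l)" by linarith
 thus s: "(SUM l:UNIV. kk q l) = 2 * int (dl q) + 1" using mason(2)[OF q W] by linarith
 show "val \<theta> q = 1 - (SUM l:UNIV. \<bar>\<theta> l - of_int (kk q l)\<bar>)" unfolding val_mason[OF q W] s by simp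
qed

lemma no_common_root:
 assumes q: "coprime_triple q" and ij: "i ~= j" and r: "poly (q i) c = 0"
 shows "poly (q j) c ~= 0"
 using lead_others[OF q, of "Some c" i j] lead_nonzero_iff[of q j "Some c"] ij r by(auto simp: lead_def)

text \<open>If the Wronskian vanishes, coprimality makes each entry divide its own derivative, which
  is then 0 for reasons of degree. So the entries are p-th powers, and passing to the roots divides
  the degree and all orders by p.\<close>

lemma Wr_0_power:
 assumes q: "coprime_triple q" and W: "Wr q = 0"
 shows "EX f. coprime_triple f & (ALL \<theta>. val \<theta> q = real CHAR('k) * val (%l. \<theta> l / real CHAR('k)) f)"
proof -
 let ?p = "CHAR('k)"
 have p0: "0 < ?p" using char_prime by(rule prime_gt_0_nat)
 have pd: "pderiv f = 0" if e: "f * pderiv g = pderiv f * g" and n: "!!c. poly f c = 0 ==> poly g c ~= 0"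
  for f g :: "'k poly"
 proof (cases "f = 0")
  case False
  have dv: "f dvd pderiv f"
  proof (rule dvd_cancel_no_common_root[where g = g])
   show "f dvd pderiv f * g" unfolding e[symmetric] by simp
  qed (use False n in auto)
  show ?thesis
  proof (rule ccontr)
   assume a: "pderiv f ~= 0"
   hence "degree f <= degree (pderiv f)" using dvd_imp_degree_le[OF dv] by blast
   moreover have "degree f ~= 0" using a pderiv_eq_0_const by blast
   ultimately show False using degree_pderiv_le[of f] by linarith
  qed
 qed simp
 have "pderiv (q x) = 0" using W no_common_root[OF q] xyz by(intro pd[of _ "q y"]) (auto simp: Wr_def)
 moreover have "pderiv (q y) = 0"
  using W Wr_eq(1)[OF q] no_common_root[OF q] xyz by(intro pd[of _ "q z"]) auto
 moreover have "pderiv (q z) = 0"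
  using W Wr_eq(2)[OF q] no_common_root[OF q] xyz by(intro pd[of _ "q x"]) auto
 moreover have "i : {x, y, z}" for i unfolding UNIV_xyz[symmetric] by(rule UNIV_I)
 ultimately have "pderiv (q i) = 0" for i by(metis insertE emptyE)
 hence "EX f. q i = f ^ ?p" for i by(rule pderiv_0_imp_power[OF char_prime])
 then obtain f where f: "!!i. q i = f i ^ ?p" by metis
 have "(SUM i:UNIV. f i) ^ ?p = (SUM i:UNIV. f i ^ ?p)"
  using char_prime by(intro freshmans_dream_sum) simp_all
 also have "... = 0" using q unfolding f[symmetric] by(simp add: coprime_triple_def)
 finally have "(SUM i:UNIV. f i) = 0" using p0 by simp
 moreover have "EX i. poly (f i) b ~= 0" for b
 proof -
  obtain i where "poly (q i) b ~= 0" using q unfolding coprime_triple_def by blast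
  thus ?thesis using p0 unfolding f by(intro exI[of _ i]) auto
 qed
 ultimately have cf: "coprime_triple f" by(simp add: coprime_triple_def)
 have f0: "q i = 0 \<longleftrightarrow> f i = 0" for i unfolding f using p0 by simp
 have dg: "degree (q i) = ?p * degree (f i)" for i
  unfolding f using p0 by(cases "f i = 0") (simp_all add: degree_power_eq zero_power)
 have "range (%i. degree (q i)) = (%d. ?p * d) ` range (%i. degree (f i))" unfolding dg by auto
 moreover have "mono (%d. ?p * d)" by(simp add: mono_def)
 ultimately have d: "dl q = ?p * dl f" unfolding dl_def by(simp add: mono_Max_commute)
 have k: "kk q l = int ?p * kk f l" if "q l ~= 0" for l
 proof -
  have "order c (q l) = ?p * order c (f l)" for c unfolding f using that f0[of l] by(intro order_power) simp
  thus ?thesis unfolding kk_def base_def d by(cases "pl l") (simp_all add: dg algebra_simps)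
 qed
 have e: "exr \<theta> q l = real ?p * exr (%l. \<theta> l / real ?p) f l" for \<theta> l
 proof (cases "q l = 0")
  case False
  have "\<theta> l - of_int (kk q l) = real ?p * (\<theta> l / real ?p - of_int (kk f l))"
   unfolding k[OF False] using p0 by(simp add: algebra_simps)
  thus ?thesis using False f0[of l] p0 by(simp add: exr_def max_mult_distrib_left)
 qed (use f0 in \<open>simp add: exr_def\<close>)
 have "val \<theta> q = real ?p * val (%l. \<theta> l / real ?p) f" for \<theta>
  unfolding val_def e d using p0 by(simp add: sum_distrib_left[symmetric] sum_divide_distrib[symmetric] algebra_simps)
 thus ?thesis using cf by blast
qed

text \<open>A triple with positive \<open>val\<close> either comes by Frobenius from one at \<theta>
  / p or yields an odd lattice point at distance below 1 from \<theta>.\<close>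

lemma good_step:
 assumes g: "good (%l. \<theta> l / real CHAR('k))"
  and far: "!!k. odd (SUM l:UNIV. k l) ==> 1 <= (SUM l:UNIV. \<bar>\<theta> l - real_of_int (k l)\<bar>)"
 shows "good \<theta>" unfolding good_def
proof (intro allI impI, rule ccontr)
 fix q assume q: "coprime_triple q" and "~ val \<theta> q <= 0"
 hence v: "0 < val \<theta> q" by simp
 show False
 proof (cases "Wr q = 0")
  case True
  then obtain f where f: "coprime_triple f" "val \<theta> q = real CHAR('k) * val (%l. \<theta> l / real CHAR('k)) f"
   using Wr_0_power[OF q] by blast
  have "val (%l. \<theta> l / real CHAR('k)) f <= 0" using g f(1) unfolding good_def by blast
  thus False using v unfolding f(2) by(simp add: zero_less_mult_iff)
 next
  case False
  have "odd (SUM l:UNIV. kk q l)" unfolding val_mason_pos(1)[OF q False v] by simp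
  from far[OF this] v show False unfolding val_mason_pos(2)[OF q False v] by linarith
 qed
qed

end

section \<open>Semistability of the syzygy bundles\<close>

context trinomial_curve
begin

definition tau :: "nat => 3 => real" where
 "tau N l = real (gap l) * real N / real lam"

lemma tau_nonneg: "0 <= tau N l" by(simp add: tau_def)

lemma psum_val:
 assumes q: "coprime_triple q"
 shows "2 * real_of_int (psum (crv.line_ord (section_of N q))) = real lam * val (tau N) q - real N * real d"
proof -
 have e: "real_of_int (ex N q l) = real lam * exr (tau N) q l" for l
  using lam_pos by(simp add: ex_def exr_def tau_def max_mult_distrib_left of_int_max algebra_simps)
 have "2 * real_of_int (psum (crv.line_ord (section_of N q))) =
   real N * (SUM l:UNIV. real (gap l)) - real N * real d - 2 * real lam * real (dl q) -
   2 * (SUM l:UNIV. real_of_int (ex N q l))"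
  using arg_cong[OF psum_section[OF q, of N], of real_of_int] by simp
 also have "real N * (SUM l:UNIV. real (gap l)) = real lam * (SUM l:UNIV. tau N l)"
  using lam_pos by(simp add: sum_distrib_left tau_def mult.commute)
 finally show ?thesis unfolding e val_def by(simp add: sum_distrib_left algebra_simps)
qed

lemma good_semistable:
 assumes "good (tau N)" shows "semistable Crv (V N)"
proof (rule semistable_V, rule ccontr)
 fix u assume u: "u : Vs K N" "u ~= 0" and "~ 2 * psum (crv.line_ord u) <= - int (N * d)"
 hence gt: "- int (N * d) < 2 * psum (crv.line_ord u)" by simp
 from descent[OF u gt] obtain q where q: "coprime_triple q"
  and e: "psum (crv.line_ord u) = psum (crv.line_ord (section_of N q))" unfolding coprime_triple_def by blast
 have "val (tau N) q <= 0" using assms q unfolding good_def by blast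
 hence "real lam * val (tau N) q <= 0" by(simp add: mult_nonneg_nonpos)
 hence "2 * real_of_int (psum (crv.line_ord u)) <= - (real N * real d)" unfolding e psum_val[OF q] by simp
 moreover have "real_of_int (- int (N * d)) < real_of_int (2 * psum (crv.line_ord u))" using gt by(simp only: of_int_less_iff)
 ultimately show False by simp
qed

lemma frobenius_iterate: "(frobenius_pullback CHAR('k) Crv ^^ m) (V n) = V (CHAR('k) ^ m * n)"
 by(induction m) (simp_all add: frobenius_pullback_V mult.assoc)

definition far :: "(3 => real) => bool" where
 "far \<theta> \<longleftrightarrow> (ALL k. odd (SUM l:UNIV. k l) --> 1 <= (SUM l:UNIV. \<bar>\<theta> l - real_of_int (k l)\<bar>))"

text \<open>A common change of sign and translations by even vectors preserve the odd lattice points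
  and their distances.\<close>

lemma far_shift:
 assumes far: "far \<theta>" and \<epsilon>: "\<epsilon> = 1 | \<epsilon> = - 1" and \<theta>': "!!l. \<theta>' l = of_int \<epsilon> * \<theta> l + 2 * of_int (m l)"
 shows "far \<theta>'" unfolding far_def
proof (intro allI impI)
 fix k :: "3 => int" assume k: "odd (SUM l:UNIV. k l)"
 have "(SUM l:UNIV. \<epsilon> * (k l - 2 * m l)) = \<epsilon> * ((SUM l:UNIV. k l) - 2 * (SUM l:UNIV. m l))"
  by(simp add: sum_subtractf sum_distrib_left[symmetric])
 hence "odd (SUM l:UNIV. \<epsilon> * (k l - 2 * m l))" using k \<epsilon> by auto
 hence "1 <= (SUM l:UNIV. \<bar>\<theta> l - real_of_int (\<epsilon> * (k l - 2 * m l))\<bar>)" using far unfolding far_def by blast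
 also have "... = (SUM l:UNIV. \<bar>\<theta>' l - real_of_int (k l)\<bar>)"
  using \<epsilon> by(intro sum.cong) (auto simp: \<theta>')
 finally show "1 <= (SUM l:UNIV. \<bar>\<theta>' l - real_of_int (k l)\<bar>)" .
qed

text \<open>Powers of p are congruent to \<epsilon> = 1 or \<epsilon> = - 1 modulo 2 lh, and each
  gap divided by lam can be written with denominator lh. So multiplication by a power of p moves the
  point to \<epsilon> times itself plus an even integral vector.\<close>

lemma far_power:
 assumes far: "far (tau n)" and a: "!!l. a dvd int (gap l)" "int lam = a * lh"
  and p: "[int CHAR('k) = 1] (mod (2 * lh)) | [int CHAR('k) = - 1] (mod (2 * lh))"
 shows "far (tau (CHAR('k) ^ m * n))"
proof -
 have "EX \<epsilon>. (\<epsilon> = 1 | \<epsilon> = - 1) & [int CHAR('k) ^ m = \<epsilon>] (mod (2 * lh))"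
 proof (induction m)
  case (Suc m)
  then obtain \<epsilon> where e: "\<epsilon> = 1 | \<epsilon> = - 1" "[int CHAR('k) ^ m = \<epsilon>] (mod (2 * lh))" by blast
  from p show ?case
  proof
   assume "[int CHAR('k) = 1] (mod (2 * lh))"
   from cong_mult[OF this e(2)] show ?thesis using e(1) by(intro exI[of _ \<epsilon>]) simp
  next
   assume "[int CHAR('k) = - 1] (mod (2 * lh))"
   from cong_mult[OF this e(2)] show ?thesis using e(1) by(intro exI[of _ "- \<epsilon>"]) auto
  qed
 qed auto
 then obtain \<epsilon> where \<epsilon>: "\<epsilon> = 1 | \<epsilon> = - 1" and c: "[int CHAR('k) ^ m = \<epsilon>] (mod (2 * lh))" by blast
 then obtain j where j: "int CHAR('k) ^ m = \<epsilon> + 2 * lh * j"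
  by(metis cong_iff_lin cong_sym mult.commute mult.left_commute)
 have "EX b. int (gap l) = a * b" for l using a(1)[of l] by(auto simp: dvd_def)
 then obtain b where b: "!!l. int (gap l) = a * b l" by metis
 have "a ~= 0" "lh ~= 0" using a(2) lam_pos by auto
 show ?thesis
 proof (rule far_shift[OF far \<epsilon>])
  fix l
  have pw: "real (CHAR('k) ^ m) = of_int \<epsilon> + 2 * of_int lh * of_int j"
   using arg_cong[OF j, of real_of_int] by simp
  have g: "real (gap l) = of_int a * of_int (b l)" using arg_cong[OF b[of l], of real_of_int] by simp
  have lm: "real lam = of_int a * of_int lh" using arg_cong[OF a(2), of real_of_int] by simp
  have "tau (CHAR('k) ^ m * n) l = of_int (b l) * (of_int \<epsilon> + 2 * of_int lh * of_int j) * real n / of_int lh"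
   unfolding tau_def of_nat_mult pw g lm using \<open>a \<noteq> 0\<close> by simp
  also have "... = of_int \<epsilon> * tau n l + 2 * of_int (j * int n * b l)"
   unfolding tau_def g lm using \<open>a \<noteq> 0\<close> \<open>lh \<noteq> 0\<close> by(simp add: field_simps)
  finally show "tau (CHAR('k) ^ m * n) l = of_int \<epsilon> * tau n l + 2 * of_int (j * int n * b l)" .
 qed
qed

lemma tau_sum:
 assumes sum: "(SUM i:UNIV. gap i) <= 2 * lam" shows "(SUM l:UNIV. tau n l) <= 2 * real n"
proof -
 have "real (SUM i:UNIV. gap i) <= 2 * real lam" using sum by(metis of_nat_le_iff of_nat_mult of_nat_numeral)
 hence "real (SUM i:UNIV. gap i) / real lam <= 2" using lam_pos by(simp add: divide_le_eq)
 from mult_right_mono[OF this, of "real n"]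
 show ?thesis by(simp add: tau_def sum_divide_distrib[symmetric] sum_distrib_right[symmetric])
qed

lemma tau_tri:
 assumes tri: "!!l. 2 * gap l <= (SUM i:UNIV. gap i)"
 shows "2 * tau n l <= (SUM i:UNIV. tau n i)"
proof -
 have "2 * real (gap l) <= real (SUM i:UNIV. gap i)" using tri[of l] by(metis of_nat_le_iff of_nat_mult of_nat_numeral)
 hence "2 * real (gap l) * (real n / real lam) <= real (SUM i:UNIV. gap i) * (real n / real lam)"
  by(rule mult_right_mono) simp
 thus ?thesis by(simp add: tau_def sum_divide_distrib[symmetric] sum_distrib_right[symmetric])
qed

text \<open>Here n \<le> p enters: the coordinates of the point divided by p add up to at most
  2.\<close>

lemma good_tau_div:
 assumes tri: "!!l. 2 * gap l <= (SUM i:UNIV. gap i)" and sum: "(SUM i:UNIV. gap i) <= 2 * lam"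
  and n: "n <= CHAR('k)" shows "good (%l. tau n l / real CHAR('k))"
proof (rule good_base)
 have p0: "0 < CHAR('k)" using char_prime by(rule prime_gt_0_nat)
 have s: "(SUM l:UNIV. tau n l / real CHAR('k)) = (SUM l:UNIV. tau n l) / real CHAR('k)"
  by(simp only: sum_divide_distrib)
 have "(SUM l:UNIV. tau n l) <= 2 * real CHAR('k)" using tau_sum[OF sum, of n] n by linarith
 thus "(SUM l:UNIV. tau n l / real CHAR('k)) <= 2" unfolding s using p0 by(simp add: divide_le_eq)
 show "0 <= tau n l / real CHAR('k)" for l by(simp add: tau_nonneg)
 show "2 * (tau n l / real CHAR('k)) <= (SUM l:UNIV. tau n l / real CHAR('k))" for l
  unfolding s using divide_right_mono[OF tau_tri[OF tri, of n l], of "real CHAR('k)"] by simp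
qed

text \<open>Induction on the number of Frobenius pullbacks: the point of the next pullback, divided
  by p, is the point of the present one, and \<open>far\<close> excludes new destabilizing triples
  at each stage.\<close>

lemma strongly_semistable_V:
 assumes tri: "!!l. 2 * gap l <= (SUM i:UNIV. gap i)" and sum: "(SUM i:UNIV. gap i) <= 2 * lam"
  and n: "n <= CHAR('k)" and a: "!!l. a dvd int (gap l)" "int lam = a * lh"
  and p: "[int CHAR('k) = 1] (mod (2 * lh)) | [int CHAR('k) = - 1] (mod (2 * lh))" and far: "far (tau n)"
 shows "strongly_semistable CHAR('k) Crv (V n)" unfolding strongly_semistable_def frobenius_iterate
proof
 fix m
 have p0: "0 < CHAR('k)" using char_prime by(rule prime_gt_0_nat)
 have "good (tau (CHAR('k) ^ m * n))"
 proof (induction m)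
  case 0
  show ?case using good_step[OF good_tau_div[OF tri sum n]] far unfolding far_def by simp
 next
  case (Suc m)
  have "tau (CHAR('k) ^ Suc m * n) l / real CHAR('k) = tau (CHAR('k) ^ m * n) l" for l
   using p0 by(simp add: tau_def)
  hence "good (%l. tau (CHAR('k) ^ Suc m * n) l / real CHAR('k))" using Suc by simp
  from good_step[OF this] show ?case using far_power[OF far a p, of "Suc m"] unfolding far_def by blast
 qed
 thus "semistable Crv (V (CHAR('k) ^ m * n))" by(rule good_semistable)
qed

text \<open>The triangle inequalities of \<theta> carry over to k with an error below 1, and as the
  sum of k is odd they become strict. Adding the two inequalities for the other indices gives k l
  \<ge> 1.\<close>

lemma odd_near:
 fixes \<theta> :: "3 => real" and k :: "3 => int"
 assumes tri: "!!l. 2 * \<theta> l <= (SUM i:UNIV. \<theta> i)" and k: "odd (SUM i:UNIV. k i)"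
  and near: "(SUM l:UNIV. \<bar>\<theta> l - real_of_int (k l)\<bar>) < 1"
 shows "1 <= k l" "2 * k l + 1 <= (SUM i:UNIV. k i)"
proof -
 have *: "2 * k l + 1 <= (SUM i:UNIV. k i)" for l :: 3
 proof -
  have "(SUM i:UNIV. f i) = (SUM i:UNIV - {l}. f i) + (f l :: real)" for f :: "3 => real" by(subst sum.remove[of _ l]) auto
  note rem = this
  have "(SUM i:UNIV - {l}. \<theta> i - real_of_int (k i)) <= (SUM i:UNIV - {l}. \<bar>\<theta> i - real_of_int (k i)\<bar>)"
   by(intro sum_mono) simp
  hence "2 * real_of_int (k l) - (SUM i:UNIV. real_of_int (k i)) < 1"
   using near tri[of l] rem[of \<theta>] rem[of "%i. real_of_int (k i)"] rem[of "%l. \<bar>\<theta> l - real_of_int (k l)\<bar>"]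
   by(simp add: sum_subtractf abs_real_def split: if_splits)
  hence "real_of_int (2 * k l - (SUM i:UNIV. k i)) < 1" by simp
  hence "2 * k l <= (SUM i:UNIV. k i)" by linarith
  moreover have "2 * k l ~= (SUM i:UNIV. k i)" using k by(metis dvd_triv_left)
  ultimately show ?thesis by linarith
 qed
 show "2 * k l + 1 <= (SUM i:UNIV. k i)" by(rule *)
 obtain i j where ij: "distinct [l, i, j]" using other_indices by blast
 show "1 <= k l" using *[of i] *[of j] unfolding sum_ijk[OF ij] by linarith
qed

text \<open>An odd point at distance below 1 would have all coordinates at least 1, so sum at least
  3, while the coordinates of \<open>tau 1\<close> add up to at most 2.\<close>

lemma far_tau_1:
 assumes tri: "!!l. 2 * gap l <= (SUM i:UNIV. gap i)" and sum: "(SUM i:UNIV. gap i) <= 2 * lam"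
 shows "far (tau 1)" unfolding far_def
proof (intro allI impI, rule ccontr)
 fix k :: "3 => int" assume k: "odd (SUM l:UNIV. k l)" and "~ 1 <= (SUM l:UNIV. \<bar>tau 1 l - real_of_int (k l)\<bar>)"
 hence near: "(SUM l:UNIV. \<bar>tau 1 l - real_of_int (k l)\<bar>) < 1" by simp
 note s = tau_sum[OF sum, of 1] and t = tau_tri[OF tri, of 1]
 have "3 <= (SUM l:UNIV. k l)"
  using odd_near(1)[OF t k near, of x] odd_near(1)[OF t k near, of y] odd_near(1)[OF t k near, of z]
  by(simp add: sum_xyz)
 hence "3 <= (SUM l:UNIV. real_of_int (k l))" by(simp flip: of_int_sum)
 moreover have "(SUM l:UNIV. real_of_int (k l) - tau 1 l) <= (SUM l:UNIV. \<bar>tau 1 l - real_of_int (k l)\<bar>)"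
  by(intro sum_mono) simp
 ultimately show False using s near by(simp add: sum_subtractf)
qed

end

section \<open>Construction of destabilizing sections\<close>

context trinomial_curve
begin

text \<open>The prescribed zeros at w = 0 and w = - 1; the order at infinity is prescribed through
  the degree of the cofactor instead.\<close>

definition fac :: "(3 => nat) => 3 => 'k poly" where
 "fac k l = (if l = x then [:0, 1:] ^ k x else if l = y then [:1, 1:] ^ k y else 1)"

text \<open>Prescribing the orders \<open>k l\<close> at the three places for a triple of degree \<open>\<delta>\<close> with sum zero leaves more
 coefficients than equations.\<close>

lemma triple_with_orders:
 assumes le: "!!l. k l <= \<delta>" and sum: "(SUM l:UNIV. k l) = 2 * \<delta> + 1"
 shows "EX q :: 3 => 'k poly. (SUM l:UNIV. q l) = 0 & (EX l. q l ~= 0) & (ALL l. degree (q l) <= \<delta>) &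
  [:0, 1:] ^ k x dvd q x & [:1, 1:] ^ k y dvd q y & degree (q z) <= \<delta> - k z"
proof -
 define I where "I = (SIGMA l:(UNIV :: 3 set). {..<\<delta> + 1 - k l})"
 have "card I = (SUM l:UNIV. \<delta> + 1 - k l)" by(simp add: I_def)
 also have "... = \<delta> + 2" using sum le[of x] le[of y] le[of z] by(simp add: sum_xyz)
 finally have "card {..\<delta>} < card I" by simp
 moreover have UN: "is_subfield (UNIV :: 'k set)" by(simp add: is_subfield_def is_subring_def)
 moreover have "finite I" by(simp add: I_def)
 ultimately obtain c where c: "EX i:I. c i ~= 0"
  "ALL j:{..\<delta>}. (SUM i:I. coeff (fac k (fst i) * monom 1 (snd i)) j * c i) = 0"
  using nontrivial_solution[OF UN, of "{..\<delta>}" I "%j i. coeff (fac k (fst i) * monom 1 (snd i)) j"] by auto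
 define pol where "pol l = (SUM i<\<delta> + 1 - k l. monom (c (l, i)) i)" for l
 define q where "q l = fac k l * pol l" for l
 have dpol: "degree (pol l) <= \<delta> - k l" for l
  unfolding pol_def by(intro degree_sum_le) (auto intro: order_trans[OF degree_monom_le])
 have dfac: "degree (fac k l) <= k l" for l by(simp add: fac_def degree_linear_power)
 have dq: "degree (q l) <= \<delta>" for l
  using degree_mult_le[of "fac k l" "pol l"] dpol[of l] dfac[of l] le[of l] unfolding q_def by linarith
 have mc: "coeff (F * monom b i) j = coeff (F * monom 1 i) j * b" for F :: "'k poly" and b i j
 proof -
  have "F * monom b i = Polynomial.smult b (F * monom 1 i)"
   by(simp add: mult_smult_right[symmetric] smult_monom)
  thus ?thesis by simp
 qed
 have "(SUM l:UNIV. q l) = 0"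
 proof (rule poly_eqI)
  fix j
  show "coeff (SUM l:UNIV. q l) j = coeff 0 j"
  proof (cases "j <= \<delta>")
   case True
   have "coeff (SUM l:UNIV. q l) j = (SUM l:UNIV. SUM i<\<delta> + 1 - k l. coeff (fac k l * monom 1 i) j * c (l, i))"
    unfolding q_def pol_def coeff_sum sum_distrib_left by(intro sum.cong refl) (rule mc)
   also have "... = (SUM i:I. coeff (fac k (fst i) * monom 1 (snd i)) j * c i)"
    unfolding I_def by(subst sum.Sigma) (auto simp: case_prod_beta)
   finally show ?thesis using c(2) True by simp
  next
   case False
   hence "coeff (q l) j = 0" for l using dq[of l] by(intro coeff_eq_0) linarith
   thus ?thesis by(simp add: coeff_sum)
  qed
 qed
 moreover have "EX l. q l ~= 0"
 proof -
  obtain l i where li: "i < \<delta> + 1 - k l" "c (l, i) ~= 0" using c(1) by(auto simp: I_def)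
  have "coeff (pol l) i = c (l, i)" unfolding pol_def coeff_sum using li(1) by(simp add: sum.delta)
  hence "pol l ~= 0" using li(2) by auto
  moreover have "fac k l ~= 0" by(simp add: fac_def)
  ultimately show ?thesis unfolding q_def by(intro exI[of _ l]) simp
 qed
 moreover have "[:0, 1:] ^ k x dvd q x" "[:1, 1:] ^ k y dvd q y" "degree (q z) <= \<delta> - k z"
  using xyz dpol[of z] by(auto simp: q_def fac_def)
 ultimately show ?thesis using dq by blast
qed

text \<open>The triple f has the prescribed orders but may have a common factor g. Removing it costs
  at most \<open>e l\<close> of the order at each place, while the degree is below \<delta> by at
  least the sum of the \<open>e l\<close>; in \<open>val\<close> the two effects cancel.\<close>

lemma val_ge:
 assumes q: "coprime_triple q" and g: "g ~= 0" and f: "!!l. f l = g * q l"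
  and deg: "!!l. degree (f l) <= \<delta>" and k: "(SUM l:UNIV. k l) = 2 * \<delta> + 1" "k z <= \<delta>"
  and ord: "[:0, 1:] ^ k x dvd f x" "[:1, 1:] ^ k y dvd f y" "degree (f z) <= \<delta> - k z"
 shows "1 - (SUM l:UNIV. \<bar>\<theta> l - real (k l)\<bar>) <= val \<theta> q"
proof -
 \<comment> \<open>At infinity the loss is the part of the degree bound \<delta> that is used
   neither by g nor by the triple q.\<close>
 define e where "e l = (if l = x then int (order 0 g) else if l = y then int (order (- 1) g)
  else int \<delta> - int (degree g) - int (dl q))" for l
 have df: "degree (f l) = degree g + degree (q l)" if "q l ~= 0" for l
  unfolding f using g that by(rule degree_mult_eq)
 have "dl q : range (%i. degree (q i))" unfolding dl_def by(rule Max_in) auto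
 then obtain m where m: "dl q = degree (q m)" by blast
 have ez: "int (degree g) + int (dl q) <= int \<delta>"
 proof (cases "q m = 0")
  case False
  thus ?thesis using df[OF False] deg[of m] m by simp
 next
  case True
  obtain l where "lead q None l ~= 0" using lead_ex[OF q] by blast
  hence "q l ~= 0" by(rule lead_imp_nonzero)
  thus ?thesis using df[of l] deg[of l] m True by simp
 qed
 have e0: "0 <= e l" for l using ez by(simp add: e_def)
 have "order 0 g + order (- 1) g <= degree g"
  by(rule order_add_le_degree[OF g, of 0 "- 1"]) (use order_1[of 0 g] order_1[of "- 1" g] in auto)
 hence dle: "int (dl q) <= int \<delta> - (SUM l:UNIV. e l)" using xyz by(simp add: sum_xyz e_def)
 have kke: "int (k l) - e l <= kk q l" if ql: "q l ~= 0" for l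
 proof -
  have f0: "f l ~= 0" unfolding f using g ql by simp
  have o: "order c (f l) = order c g + order c (q l)" for c unfolding f using g ql by(intro order_mult) simp
  have "l : {x, y, z}" unfolding UNIV_xyz[symmetric] by(rule UNIV_I)
  then consider "l = x" | "l = y" | "l = z" by blast
  thus ?thesis
  proof cases
   case 1
   have "k x <= order 0 (f x)" using ord(1) f0 order_divides[of 0 "k x" "f x"] by(simp add: 1)
   thus ?thesis using o[of 0] by(simp add: 1 kk_def pl_def base_def e_def)
  next
   case 2
   have "k y <= order (- 1) (f y)" using ord(2) f0 order_divides[of "- 1" "k y" "f y"] by(simp add: 2)
   thus ?thesis using o[of "- 1"] xyz by(simp add: 2 kk_def pl_def base_def e_def)
  next
   case 3
   have "int (degree g) + int (degree (q z)) <= int \<delta> - int (k z)"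
    using df[OF ql] ord(3) k(2) by(simp add: 3)
   thus ?thesis using xyz by(simp add: 3 kk_def pl_def base_def e_def)
  qed
 qed
 have ex_le: "2 * exr \<theta> q l <= \<bar>\<theta> l - real (k l)\<bar> + (\<theta> l - real (k l)) + 2 * of_int (e l)" for l
 proof (cases "q l = 0")
  case True
  thus ?thesis using e0[of l] by(simp add: exr_def abs_if)
 next
  case False
  have "real (k l) - of_int (e l) <= of_int (kk q l)" using kke[OF False] by linarith
  thus ?thesis using False e0[of l] by(simp add: exr_def abs_if max_def)
 qed
 have "2 * (SUM l:UNIV. exr \<theta> q l) <=
   (SUM l:UNIV. \<bar>\<theta> l - real (k l)\<bar> + (\<theta> l - real (k l)) + 2 * of_int (e l))"
  unfolding sum_distrib_left by(rule sum_mono[OF ex_le])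
 also have "... = (SUM l:UNIV. \<bar>\<theta> l - real (k l)\<bar>) + (SUM l:UNIV. \<theta> l) - real (SUM l:UNIV. k l)
   + 2 * of_int (SUM l:UNIV. e l)" by(simp add: sum.distrib sum_subtractf sum_distrib_left)
 also have "real (SUM l:UNIV. k l) = 2 * real \<delta> + 1" unfolding k(1) by simp
 finally show ?thesis using of_int_le_iff[of "int (dl q)" "int \<delta> - (SUM l:UNIV. e l)", where 'a = real] dle
  unfolding val_def by simp
qed

text \<open>Two such points have distance below 2, and the coordinates of their difference have an
  even sum.\<close>

lemma near_unique:
 fixes \<theta> :: "3 => real"
 assumes k: "odd (SUM l:UNIV. k l)" "(SUM l:UNIV. \<bar>\<theta> l - real_of_int (k l)\<bar>) < 1"
  and k': "odd (SUM l:UNIV. k' l)" "(SUM l:UNIV. \<bar>\<theta> l - real_of_int (k' l)\<bar>) < 1"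
 shows "k = k'"
proof
 have "real_of_int (\<bar>k x - k' x\<bar> + \<bar>k y - k' y\<bar> + \<bar>k z - k' z\<bar>) < 2"
  using k(2) k'(2) unfolding sum_xyz by simp
 hence "\<bar>k x - k' x\<bar> + \<bar>k y - k' y\<bar> + \<bar>k z - k' z\<bar> < 2" by linarith
 moreover have "even ((k x - k' x) + (k y - k' y) + (k z - k' z))"
  using k(1) k'(1) unfolding sum_xyz by presburger
 moreover have "a = 0 & b = 0 & c = 0" if abc: "\<bar>a\<bar> + \<bar>b\<bar> + \<bar>c\<bar> < 2" "even (a + b + c)" for a b c :: int
 proof -
  have "a = 0 | a = 1 | a = - 1" "b = 0 | b = 1 | b = - 1" "c = 0 | c = 1 | c = - 1"
   using abc(1) by linarith+
  thus ?thesis using abc by(elim disjE) simp_all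
 qed
 ultimately have "k x - k' x = 0 & k y - k' y = 0 & k z - k' z = 0" by blast
 moreover fix l
 have "l : {x, y, z}" unfolding UNIV_xyz[symmetric] by(rule UNIV_I)
 ultimately show "k l = k' l" by auto
qed

text \<open>Counting coefficients yields a triple whose \<open>val\<close> is at least 1 minus the
  distance, hence positive. Its Wronskian is nonzero, since p-th powers would contradict
  \<open>good_tau_div\<close>; so its orders form an odd point near \<open>tau n\<close>. By
  uniqueness this point is k, and the bound for \<open>val\<close> becomes an equation.\<close>

lemma destabilizing_section:
 assumes tri: "!!l. 2 * gap l <= (SUM i:UNIV. gap i)" and sum: "(SUM i:UNIV. gap i) <= 2 * lam"
  and n: "n <= CHAR('k)"
  and k: "odd (SUM l:UNIV. k l)" and near: "(SUM l:UNIV. \<bar>tau n l - real_of_int (k l)\<bar>) < 1"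
 shows "EX u. u : Vs K n & u ~= 0 & 2 * real_of_int (psum (crv.line_ord u)) =
  real lam * (1 - (SUM l:UNIV. \<bar>tau n l - real_of_int (k l)\<bar>)) - real n * real d"
proof -
 note B = odd_near[OF tau_tri[OF tri, of n] k near]
 define ku where "ku l = nat (k l)" for l
 have ku: "int (ku l) = k l" for l using B(1)[of l] by(simp add: ku_def)
 obtain j where j: "(SUM l:UNIV. k l) = 2 * j + 1" using k by(rule oddE)
 have "0 <= j" using B(2)[of x] B(1)[of x] j by linarith
 then obtain \<delta> where \<delta>: "j = int \<delta>" using nonneg_int_cases by blast
 have "int (SUM l:UNIV. ku l) = int (2 * \<delta> + 1)" unfolding of_nat_sum ku j \<delta> by simp
 hence s: "(SUM l:UNIV. ku l) = 2 * \<delta> + 1" by(simp only: of_nat_eq_iff)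
 have le: "ku l <= \<delta>" for l using B(2)[of l] ku[of l] unfolding j \<delta> by linarith
 obtain f :: "3 => 'k poly" where f: "(SUM l:UNIV. f l) = 0" "EX l. f l ~= 0" "ALL l. degree (f l) <= \<delta>"
  "[:0, 1:] ^ ku x dvd f x" "[:1, 1:] ^ ku y dvd f y" "degree (f z) <= \<delta> - ku z"
  using triple_with_orders[OF le s] by blast
 obtain l0 where "f l0 ~= 0" using f(2) by blast
 from remove_common_roots[of f l0, OF this] obtain g q where g: "g ~= 0" "ALL i. f i = g * q i"
  "ALL c. EX i. poly (q i) c ~= 0" by(elim exE conjE)
 have "g * (SUM i:UNIV. q i) = 0" using f(1) g(2) by(simp add: sum_distrib_left)
 hence q: "coprime_triple q" using g(1,3) by(simp add: coprime_triple_def)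
 have "1 - (SUM l:UNIV. \<bar>tau n l - real (ku l)\<bar>) <= val (tau n) q"
 proof (rule val_ge[OF q g(1)])
  show "f l = g * q l" for l using g(2) by blast
  show "degree (f l) <= \<delta>" for l using f(3) by blast
 qed (fact s le f(4) f(5) f(6))+
 moreover have kr: "real (ku l) = real_of_int (k l)" for l unfolding ku[symmetric] by simp
 ultimately have v0: "0 < val (tau n) q" using near by simp
 have W: "Wr q ~= 0"
 proof
  assume "Wr q = 0"
  then obtain r' where r: "coprime_triple r'" "val (tau n) q = real CHAR('k) * val (%l. tau n l / real CHAR('k)) r'"
   using Wr_0_power[OF q] by blast
  have "val (%l. tau n l / real CHAR('k)) r' <= 0" using good_tau_div[OF tri sum n] r(1) unfolding good_def by blast
  thus False using v0 unfolding r(2) by(simp add: zero_less_mult_iff)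
 qed
 note M = val_mason_pos[OF q W v0]
 have "odd (SUM l:UNIV. kk q l)" unfolding M(1) by simp
 moreover have "(SUM l:UNIV. \<bar>tau n l - of_int (kk q l)\<bar>) < 1" using v0 unfolding M(2) by simp
 ultimately have "kk q = k" using near_unique[OF _ _ k near] by blast
 hence v: "val (tau n) q = 1 - (SUM l:UNIV. \<bar>tau n l - real_of_int (k l)\<bar>)" using M(2) by simp
 have "section_of n q : Vs K n" by(rule section_of_Vs) (use q in \<open>simp add: coprime_triple_def\<close>)
 moreover have "section_of n q ~= 0"
 proof
  assume "section_of n q = 0"
  hence "section_of n q $ x = 0" by simp
  thus False using mason(1)[OF q W, of x] X_nonzero evp_eq_0_iff[OF transc_w] by(simp add: section_of_def)
 qed
 ultimately show ?thesis using psum_val[OF q, of n] unfolding v by blast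
qed

end

context trinomial_curve
begin

text \<open>The coordinates are listed in the order z, y, x because the gaps at these places are
  \<alpha>, \<beta>, \<nu> for both types of trinomials.\<close>

lemma stability_dichotomy:
 fixes a lh :: int
 assumes tri: "!!l. 2 * gap l <= (SUM i:UNIV. gap i)" and sum: "(SUM i:UNIV. gap i) <= 2 * lam"
  and a: "!!l. a dvd int (gap l)" "int lam = a * lh"
  and p: "[int CHAR('k) = 1] (mod (2 * lh)) | [int CHAR('k) = - 1] (mod (2 * lh))"
 defines "t \<equiv> (%n::nat. taxicab (real (gap z) * real n / real lam, real (gap y) * real n / real lam,
  real (gap x) * real n / real lam))"
 shows "strongly_semistable CHAR('k) Crv (V 1) & (ALL n. 1 <= n & n <= CHAR('k) -->
    strongly_semistable CHAR('k) Crv (V n) | (~ semistable Crv (V n) &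
    (EX \<L> u. HN_filtration Crv (V n) [zero_bundle, \<L>, V n] &
      u : L_odd & t n u < 1 & (ALL u':L_odd. t n u' < 1 --> u' = u) &
      of_int (bundle_degree Crv \<L>) = - (real n * real d / 2) + real lam / 2 * (1 - t n u))))"
proof (intro conjI allI impI)
 have p1: "1 <= CHAR('k)" using char_prime prime_ge_1_nat by blast
 show "strongly_semistable CHAR('k) Crv (V 1)"
  by(rule strongly_semistable_V[OF tri sum p1 a p far_tau_1[OF tri sum]])
 fix n assume "1 <= n & n <= CHAR('k)"
 hence n: "n <= CHAR('k)" by simp
 have t: "t n (k z, k y, k x) = (SUM l:UNIV. \<bar>tau n l - real_of_int (k l)\<bar>)" for k
  by(simp add: t_def taxicab_def tau_def sum_xyz)
 have odd: "(k z, k y, k x) : L_odd \<longleftrightarrow> odd (SUM l:UNIV. k l)" for k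
  by(auto simp: L_odd_def sum_xyz)
 show "strongly_semistable CHAR('k) Crv (V n) | (~ semistable Crv (V n) &
    (EX \<L> u. HN_filtration Crv (V n) [zero_bundle, \<L>, V n] &
      u : L_odd & t n u < 1 & (ALL u':L_odd. t n u' < 1 --> u' = u) &
      of_int (bundle_degree Crv \<L>) = - (real n * real d / 2) + real lam / 2 * (1 - t n u)))"
 proof (cases "far (tau n)")
  case True
  thus ?thesis using strongly_semistable_V[OF tri sum n a p] by blast
 next
  case False
  then obtain k where k: "odd (SUM l:UNIV. k l)" "(SUM l:UNIV. \<bar>tau n l - real_of_int (k l)\<bar>) < 1"
   unfolding far_def by(auto simp: not_le)
  from destabilizing_section[OF tri sum n k] obtain u where u: "u : Vs K n" "u ~= 0"
   and du: "2 * real_of_int (psum (crv.line_ord u)) =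
    real lam * (1 - (SUM l:UNIV. \<bar>tau n l - real_of_int (k l)\<bar>)) - real n * real d" by blast
  have "0 < real lam * (1 - (SUM l:UNIV. \<bar>tau n l - real_of_int (k l)\<bar>))" using lam_pos k(2) by simp
  hence "real_of_int (- int (n * d)) < real_of_int (2 * psum (crv.line_ord u))" using du by simp
  hence gt: "- int (n * d) < 2 * psum (crv.line_ord u)" by(simp only: of_int_less_iff)
  note H = HN_V[OF u gt]
  have uniq: "u' = (k z, k y, k x)" if u': "u' : L_odd" "t n u' < 1" for u'
  proof -
   obtain u1 u2 u3 where e: "u' = (u1, u2, u3)" by(cases u')
   define k' where "k' l = (if l = z then u1 else if l = y then u2 else u3)" for l
   have e': "u' = (k' z, k' y, k' x)" using xyz by(simp add: e k'_def)
   have "k' = k" using u' unfolding e' odd t by(intro near_unique[OF _ _ k]) auto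
   thus ?thesis unfolding e' by simp
  qed
  have "real_of_int (bundle_degree Crv (crv.line u)) =
    - (real n * real d / 2) + real lam / 2 * (1 - t n (k z, k y, k x))"
   using du unfolding H(3) t by(simp add: field_simps)
  hence "EX \<L> u. HN_filtration Crv (V n) [zero_bundle, \<L>, V n] &
      u : L_odd & t n u < 1 & (ALL u':L_odd. t n u' < 1 --> u' = u) &
      of_int (bundle_degree Crv \<L>) = - (real n * real d / 2) + real lam / 2 * (1 - t n u)"
   using H(1) k unfolding t[symmetric] odd[symmetric] using uniq
   by(intro exI[of _ "crv.line u"] exI[of _ "(k z, k y, k x)"] conjI ballI impI) blast+
  thus ?thesis using H(2) by blast
 qed
qed

end

section \<open>The two types of regular trinomials\<close>

text \<open>A function on the three indices given by its table of values; nested, it displays the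
  matrices E and r.\<close>

definition v3 :: "3 => 3 => 'a => 'a => 'a => 3 => 'a" where
 "v3 x y u v w i = (if i = x then u else if i = y then v else w)"

lemma v3_simps:
 assumes "distinct [x, y, z]" shows "v3 x y u v w x = u" "v3 x y u v w y = v" "v3 x y u v w z = w"
 using assms by(auto simp: v3_def)

lemma sum3:
 assumes "distinct [x, y, z :: 3]" shows "(SUM i:UNIV. f i) = f x + f y + (f z :: 'b::comm_monoid_add)"
 unfolding UNIV3_eq[OF assms] using assms by(simp add: add.assoc)

lemma index3:
 assumes "distinct [x, y, z :: 3]" shows "l = x | l = y | l = z"
 using UNIV3_eq[OF assms] UNIV_I[of l] by blast

lemma ex3:
 assumes "distinct [x, y, z :: 3]" shows "(EX l. P l) \<longleftrightarrow> P x | P y | P z"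
 using index3[OF assms] by metis

lemma convex_combinationI:
 fixes E :: "3 => 3 => nat"
 assumes "distinct [i, j, l]" "0 < m + n" "ALL v:Z. (m + n) * E j v <= m * E i v + n * E l v"
 shows "EX i j l m n. distinct [i, j, l] & 0 < m + n & (ALL v:Z. (m + n) * E j v <= m * E i v + n * E l v)"
 using assms by blast

lemma Var3_monomial:
 assumes d: "distinct [x, y, z]"
 shows "Var3 x ^ u * Var3 y ^ v * Var3 z ^ w = (monom3 (\<chi> i. v3 x y u v w i) :: 'k::comm_ring_1 poly3)"
proof -
 have "(axis x u + axis y v + axis z w) $ i = v3 x y u v w i" for i
  using index3[OF d, of i] d by(elim disjE) (auto simp: v3_def axis_def)
 hence "axis x u + axis y v + axis z w = (\<chi> i. v3 x y u v w i)" by(simp add: fvec_eq_iff)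
 thus ?thesis by(simp only: Var3_power monom3_add[symmetric])
qed

text \<open>A square is not prime, so the inequality between d^2 and p is strict.\<close>

lemma lam_less_prime:
 assumes "prime (p :: nat)" "d\<^sup>2 <= p" "lam <= d * d" shows "lam < p"
proof -
 have "~ prime (d\<^sup>2)" by(simp add: prime_power_iff)
 hence "d\<^sup>2 ~= p" using assms(1) by blast
 thus ?thesis using assms(2,3) by(simp add: power2_eq_square)
qed

text \<open>The condition is inherited by subsets, so the three pairs of variables, which correspond
  to the coordinate points, suffice.\<close>

lemma convex_cases:
 fixes E :: "3 => 3 => nat"
 defines "C Z \<equiv> EX i j l m n. distinct [i, j, l] & 0 < m + n & (ALL v:Z. (m + n) * E j v <= m * E i v + n * E l v)"
 assumes "distinct [x, y, z :: 3]" "Z ~= UNIV" "C {x, y}" "C {y, z}" "C {x, z}" shows "C Z"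
proof -
 obtain l where "l ~: Z" using assms(3) by blast
 moreover have "Z <= {x, y, z}" using UNIV3_eq[OF assms(2)] by blast
 ultimately have "Z <= {x, y} | Z <= {y, z} | Z <= {x, z}" using index3[OF assms(2), of l] by auto
 moreover have "C W" if "C W'" "W <= W'" for W W' using that unfolding C_def by(meson subsetD)
 ultimately show ?thesis using assms(4-) by blast
qed

text \<open>The weights r l give the two monomials other than M l the same weight, and their least
  member is 0. For l = x the weights b1, c2, 0 give y^b1 z^b2 and z^c1 x^c2 the weight b1 c2, which
  x^a1 y^a2 exceeds by lam. The gaps b1 - c2, c1 - a2 and a1 - b2 are \<nu>, \<beta> and
  \<alpha>.\<close>

lemma trinomial_curve_I:
 fixes h :: "'k::alg_closed_field poly3" and \<iota> :: "'k poly3 => 'l::field"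
 assumes p: "prime CHAR('k)" "d\<^sup>2 <= CHAR('k)" and d2: "2 <= d" and \<iota>: "coordinate_ring_map h \<iota>"
  and dist: "distinct [x, y, z]"
  and h: "h = Var3 x ^ a1 * Var3 y ^ a2 + Var3 y ^ b1 * Var3 z ^ b2 + Var3 z ^ c1 * Var3 x ^ c2"
  and deg: "a1 + a2 = d" "b1 + b2 = d" "c1 + c2 = d" and big: "d < 2 * a1" "d < 2 * b1" "d < 2 * c1"
  and lam: "lam + b1 * c2 = a1 * b1 + a2 * c2" shows "trinomial_curve h \<iota> d lam
   (v3 x y (v3 x y a1 a2 0) (v3 x y 0 b1 b2) (v3 x y c2 0 c1))
   (v3 x y (v3 x y b1 c2 0) (v3 x y 0 c1 a2) (v3 x y b2 0 a1))
   (v3 x y (b1 * c2) (a2 * c1) (a1 * b2)) (v3 x y (a1 * c2) (a2 * b1) (b2 * c1))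
   (v3 x y c2 a2 b2) (v3 x y (b1 - c2) (c1 - a2) (a1 - b2)) x y z"
  (is "trinomial_curve h \<iota> d lam ?E ?r ?s ?s' ?mid ?gap x y z")
  and "0 < lam" and "2 * (b1 - c2) <= lam" "2 * (c1 - a2) <= lam" "2 * (a1 - b2) <= lam"
proof -
 note V = v3_simps[OF dist] sum3[OF dist]
 note mem = index3[OF dist]
 have ne: "x ~= y" "x ~= z" "y ~= z" "y ~= x" "z ~= x" "z ~= y" using dist by auto
 have small: "a2 < a1" "a2 < b1" "a2 < c1" "b2 < a1" "b2 < b1" "b2 < c1" "c2 < a1" "c2 < b1" "c2 < c1"
  using deg big by auto
 have i: "int a2 = int d - int a1" "int b2 = int d - int b1" "int c2 = int d - int c1" using deg by auto
 have L: "int lam = int a1 * int b1 + int a2 * int c2 - int b1 * int c2"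
  using arg_cong[OF lam, of int] by simp
 have Li: "int lam + int a2 * int c1 = int b1 * int c1 + int b2 * int a2"
  "int lam + int a1 * int b2 = int c1 * int a1 + int c2 * int b2"
  "int lam + int a1 * int c2 = int b1 * int a1 + int b2 * int c2"
  "int lam + int a2 * int b1 = int c2 * int a2 + int c1 * int b1"
  "int lam + int b2 * int c1 = int a2 * int b2 + int a1 * int c1"
  unfolding L i by(simp_all add: algebra_simps)
 have Ln: "lam + a2 * c1 = b1 * c1 + b2 * a2" "lam + a1 * b2 = c1 * a1 + c2 * b2"
  "lam + a1 * c2 = b1 * a1 + b2 * c2" "lam + a2 * b1 = c2 * a2 + c1 * b1" "lam + b2 * c1 = a2 * b2 + a1 * c1"
  using Li by(simp_all flip: of_nat_add of_nat_mult)
 have lower: "b1 * (a1 - c2) <= lam" "c1 * (b1 - a2) <= lam" "a1 * (c1 - b2) <= lam"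
  using lam Ln(1,2) small by(simp_all add: diff_mult_distrib2 mult_ac)
 have two: "2 <= a1" "2 <= b1" "2 <= c1" using big d2 by auto
 have gaps: "a1 - c2 = c1 - a2" "b1 - a2 = a1 - b2" "c1 - b2 = b1 - c2" using deg small by auto
 \<comment> \<open>Each bound in \<open>lower\<close> is a gap times an exponent that is at least 2;
   this is the source of the bound on the sum of the gaps.\<close>
 have "2 * (c1 - a2) <= b1 * (a1 - c2)" "2 * (a1 - b2) <= c1 * (b1 - a2)" "2 * (b1 - c2) <= a1 * (c1 - b2)"
  unfolding gaps using two by(simp_all add: mult_right_mono)
 thus bounds: "2 * (b1 - c2) <= lam" "2 * (c1 - a2) <= lam" "2 * (a1 - b2) <= lam" using lower by linarith+
 thus pos: "0 < lam" using small(9) small(2) by linarith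
 have "a2 * c2 <= b1 * c2" using small by(simp add: mult_right_mono)
 hence "lam <= a1 * b1" using lam by linarith
 also have "... <= d * d" using deg by(intro mult_mono) auto
 finally have lp: "lam < CHAR('k)" using lam_less_prime p by blast
 have hE: "h = (SUM l:UNIV. monom3 (\<chi> i. ?E l i))"
  unfolding h sum3[OF dist] v3_simps[OF dist] Var3_monomial[OF dist, symmetric] by(simp add: mult.commute)
 show "trinomial_curve h \<iota> d lam ?E ?r ?s ?s' ?mid ?gap x y z"
 proof (unfold_locales)
  show "(SUM i:UNIV. ?E l i) = d" for l using mem[of l] deg by(elim disjE) (simp_all add: V)
  show "(SUM i:UNIV. ?E j i * ?r l i) = ?s l + (if j = l then lam else 0)" for j l
   using mem[of j] mem[of l] lam Ln ne by(elim disjE) (simp_all add: V mult_ac add_ac)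
  show "(SUM l:UNIV. ?r l k * ?E l i) = ?s' i + (if k = i then lam else 0)" for k i
   using mem[of k] mem[of i] lam Ln ne by(elim disjE) (simp_all add: V mult_ac add_ac)
  show "(SUM l:UNIV. ?r l i) = d" for i using mem[of i] deg by(elim disjE) (simp_all add: V)
  show "?r l l = ?mid l + ?gap l" for l using mem[of l] small by(elim disjE) (simp_all add: V)
  show "0 < ?gap l" for l using mem[of l] small by(elim disjE) (simp_all add: V)
  show "?r l i <= ?mid l" if "i ~= l" for l i using mem[of l] mem[of i] that by(elim disjE) (simp_all add: V)
  show "EX i. i ~= l & ?r l i = ?mid l" for l
   unfolding ex3[OF dist] using mem[of l] ne by(elim disjE) (simp_all add: V)
  show "EX i. i ~= l & ?r l i = 0" for l
   unfolding ex3[OF dist] using mem[of l] ne by(elim disjE) (simp_all add: V)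
  show "\<bar>(int (?E x y) - int (?E z y)) * (int (?E y z) - int (?E z z)) -
    (int (?E x z) - int (?E z z)) * (int (?E y y) - int (?E z y))\<bar> = int lam"
   using Li(1) by(simp add: V algebra_simps)
  \<comment> \<open>At each coordinate point one monomial is dominated by a single other one on the
    two variables that vanish, so the weights 1 and 0 suffice.\<close>
  show "EX i j l m n. distinct [i, j, l] & 0 < m + n & (ALL v:Z. (m + n) * ?E j v <= m * ?E i v + n * ?E l v)"
   if ZU: "Z ~= UNIV" for Z
   by(rule convex_cases[OF dist ZU, OF convex_combinationI[of x z y 1 0] convex_combinationI[of y x z 1 0]
    convex_combinationI[of z y x 1 0]]) (use dist small in \<open>auto simp: V\<close>)
 qed (fact p(1) \<iota> dist hE d2 pos lp)+
qed

text \<open>The weights follow the same rule as for the first type; for l = x they are c - a3, 0,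
  a1, with the common weight a1 c for the other two monomials. The gaps a2 + c - d, c and a2 are
  \<nu>, \<beta> and \<alpha>.\<close>

lemma trinomial_curve_II:
 fixes h :: "'k::alg_closed_field poly3" and \<iota> :: "'k poly3 => 'l::field"
 assumes p: "prime CHAR('k)" "d\<^sup>2 <= CHAR('k)" and d2: "2 <= d" and \<iota>: "coordinate_ring_map h \<iota>"
  and dist: "distinct [x, y, z]"
  and h: "h = Var3 x ^ d + Var3 x ^ a1 * Var3 y ^ a2 * Var3 z ^ a3 + Var3 y ^ b * Var3 z ^ c"
  and deg: "a1 + a2 + a3 = d" "b + c = d" and big: "d < 2 * a2" "d < 2 * c" and lam: "lam + a3 * b = a2 * c"
 shows "trinomial_curve h \<iota> d lam (v3 x y (v3 x y d 0 0) (v3 x y a1 a2 a3) (v3 x y 0 b c))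
   (v3 x y (v3 x y (c - a3) 0 a1) (v3 x y b d 0) (v3 x y a3 0 (d - a1)))
   (v3 x y (a1 * c) (b * d) (a3 * d)) (v3 x y (a1 * d) (b * (d - a1)) (a3 * d))
   (v3 x y a1 b a3) (v3 x y (a2 + c - d) c a2) x y z"
  (is "trinomial_curve h \<iota> d lam ?E ?r ?s ?s' ?mid ?gap x y z")
  and "0 < lam" and "2 * (a2 + c) <= 2 * lam + d"
proof -
 note V = v3_simps[OF dist] sum3[OF dist]
 note mem = index3[OF dist]
 have ne: "x ~= y" "x ~= z" "y ~= z" "y ~= x" "z ~= x" "z ~= y" using dist by auto
 have small: "a3 < c" "b < a2" "d < a2 + c" "a1 <= d" using deg big by auto
 define m where "m = c - a3"
 define g where "g = a2 + c - d"
 have e: "c - a3 = m" "a2 + c - d = g" "d - a1 = a2 + a3" using deg by(simp_all add: m_def g_def)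
 have i: "int a1 = int d - int a2 - int a3" "int b = int d - int c" "int m = int c - int a3"
  "int g = int a2 + int c - int d" using deg small by(auto simp: m_def g_def)
 have L: "int lam = int a2 * int c - int a3 * int b" using arg_cong[OF lam, of int] by simp
 have Li: "int lam + int a1 * int c = int d * int m" "int a1 * int m + int a1 * int a3 = int a1 * int c"
  "int lam + int b * int d = int a1 * int b + int a2 * int d"
  "int a1 * int a3 + int a3 * (int a2 + int a3) = int a3 * int d"
  "int lam + int a3 * int d = int c * (int a2 + int a3)"
  "int lam + int a1 * int d = int m * int d + int b * int a1"
  "int b * int a3 + int a3 * int c = int a3 * int d" "int lam + int b * (int a2 + int a3) = int d * int a2"
  "int lam = int d * int g + int a1 * int b" unfolding L i by(simp_all add: algebra_simps)
 have Ln: "lam + a1 * c = d * m" "a1 * m + a1 * a3 = a1 * c" "lam + b * d = a1 * b + a2 * d"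
  "a1 * a3 + a3 * (a2 + a3) = a3 * d" "lam + a3 * d = c * (a2 + a3)" "lam + a1 * d = m * d + b * a1"
  "b * a3 + a3 * c = a3 * d" "lam + b * (a2 + a3) = d * a2"
  using Li by(simp_all flip: of_nat_add of_nat_mult)
 \<comment> \<open>Here lam = d g + a1 b with d and g at least 1, which bounds lam below by d and by
   d + g - 1.\<close>
 have gd: "d <= lam" "d + g <= lam + 1"
 proof -
  have "int lam = int (d * g + a1 * b)" using Li(9) by simp
  hence lg: "lam = d * g + a1 * b" by(simp only: of_nat_eq_iff)
  obtain d' g' where "d = Suc d'" "g = Suc g'" using d2 small(3) by(cases d; cases g) (auto simp: g_def)
  thus "d <= lam" "d + g <= lam + 1" unfolding lg by simp_all
 qed
 show pos: "0 < lam" using gd(1) d2 by simp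
 show "2 * (a2 + c) <= 2 * lam + d" using gd(2) d2 small(3) by(simp add: g_def)
 have "lam <= a2 * c" using lam by linarith
 also have "... <= d * d" using deg by(intro mult_mono) auto
 finally have lp: "lam < CHAR('k)" using lam_less_prime p by blast
 have hE: "h = (SUM l:UNIV. monom3 (\<chi> i. ?E l i))"
  unfolding h sum3[OF dist] v3_simps[OF dist] Var3_monomial[OF dist, symmetric] by simp
 show "trinomial_curve h \<iota> d lam ?E ?r ?s ?s' ?mid ?gap x y z" unfolding e
 proof (unfold_locales)
  let ?r = "v3 x y (v3 x y m 0 a1) (v3 x y b d 0) (v3 x y a3 0 (a2 + a3))"
  let ?s' = "v3 x y (a1 * d) (b * (a2 + a3)) (a3 * d)" and ?gap = "v3 x y g c a2"
  have mc: "m + a3 = c" "a3 <= c" "m = a1 + g" using small deg by(auto simp: m_def g_def)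
  show "(SUM i:UNIV. ?E l i) = d" for l using mem[of l] deg by(elim disjE) (simp_all add: V)
  show "(SUM i:UNIV. ?E j i * ?r l i) = ?s l + (if j = l then lam else 0)" for j l
   using mem[of j] mem[of l] Ln ne by(elim disjE) (simp_all add: V algebra_simps)
  show "(SUM l:UNIV. ?r l k * ?E l i) = ?s' i + (if k = i then lam else 0)" for k i
   using mem[of k] mem[of i] Ln ne by(elim disjE) (simp_all add: V algebra_simps)
  show "(SUM l:UNIV. ?r l i) = d" for i using mem[of i] deg mc by(elim disjE) (simp_all add: V)
  show "?r l l = ?mid l + ?gap l" for l using mem[of l] mc deg by(elim disjE) (simp_all add: V)
  show "0 < ?gap l" for l using mem[of l] small by(elim disjE) (simp_all add: V g_def)
  show "?r l i <= ?mid l" if "i ~= l" for l i using mem[of l] mem[of i] that by(elim disjE) (simp_all add: V)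
  show "EX i. i ~= l & ?r l i = ?mid l" for l
   unfolding ex3[OF dist] using mem[of l] ne by(elim disjE) (simp_all add: V)
  show "EX i. i ~= l & ?r l i = 0" for l
   unfolding ex3[OF dist] using mem[of l] ne by(elim disjE) (simp_all add: V)
  show "\<bar>(int (?E x y) - int (?E z y)) * (int (?E y z) - int (?E z z)) -
    (int (?E x z) - int (?E z z)) * (int (?E y y) - int (?E z y))\<bar> = int lam"
  proof -
   have "(int 0 - int b) * (int a3 - int c) - (int 0 - int c) * (int a2 - int b) = int lam"
    unfolding L by(simp add: algebra_simps)
   thus ?thesis by(simp add: V)
  qed
  show "EX i j l m n. distinct [i, j, l] & 0 < m + n & (ALL v:Z. (m + n) * ?E j v <= m * ?E i v + n * ?E l v)"
   if ZU: "Z ~= UNIV" for Z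
  proof -
   \<comment> \<open>At the point where x and z vanish, neither M x nor M z alone need dominate M y;
     their mean with weights a1 and a2 + a3 does so by this inequality.\<close>
   have "d * a3 <= (a2 + a3) * c" using Ln(5) by(simp add: mult.commute)
   thus ?thesis using dist small d2 deg
    by(intro convex_cases[OF dist ZU, OF convex_combinationI[of y z x 1 0] convex_combinationI[of y x z 1 0]
     convex_combinationI[of x y z a1 "a2 + a3"]]) (auto simp: V add.assoc)
  qed
 qed (fact p(1) \<iota> dist hE d2 pos lp)+
qed

lemma stability_of_trinomial_curve:
 fixes h :: "'k::alg_closed_field poly3" and \<iota> :: "'k poly3 => 'l::field"
  and \<alpha> \<beta> \<nu> lam a lam_h :: int and gap :: "3 => nat"
 assumes tc: "trinomial_curve h \<iota> d lam' E r s s' mid gap x y z"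
  and inv: "\<alpha> = int (gap z)" "\<beta> = int (gap y)" "\<nu> = int (gap x)" "lam = int lam'"
  and tri: "gap x <= gap y + gap z" "gap y <= gap x + gap z" "gap z <= gap x + gap y"
  and sum: "gap x + gap y + gap z <= 2 * lam'"
  and a: "a = Gcd {\<alpha>, \<beta>, \<nu>, lam}" "lam_h = lam div a"
  and p: "[int CHAR('k) = 1] (mod (2 * lam_h)) | [int CHAR('k) = - 1] (mod (2 * lam_h))"
 defines "X \<equiv> normalized_curve \<iota> h" and "V \<equiv> V_bundle \<iota> h"
  and "t \<equiv> (%n::nat. taxicab (of_int \<alpha> * real n / of_int lam, of_int \<beta> * real n / of_int lam,
               of_int \<nu> * real n / of_int lam))" shows "strongly_semistable CHAR('k) X (V 1) &
  (ALL n. 1 <= n & n <= CHAR('k) -->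
    strongly_semistable CHAR('k) X (V n) | (~ semistable X (V n) &
    (EX \<L> u. HN_filtration X (V n) [zero_bundle, \<L>, V n] &
      u : L_odd & t n u < 1 & (ALL u':L_odd. t n u' < 1 --> u' = u) &
      of_int (bundle_degree X \<L>) = - (real n * real d / 2) + of_int lam / 2 * (1 - t n u))))"
proof -
 have dist: "distinct [x, y, z]" by(rule trinomial_curve.dist[OF tc])
 have tri': "2 * gap l <= (SUM i:UNIV. gap i)" for l
  unfolding sum3[OF dist] using index3[OF dist, of l] tri by(elim disjE) simp_all
 have sum': "(SUM i:UNIV. gap i) <= 2 * lam'" unfolding sum3[OF dist] by(rule sum)
 have "a dvd \<alpha>" "a dvd \<beta>" "a dvd \<nu>" "a dvd lam" unfolding a(1) by(rule Gcd_dvd, simp)+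
 hence ad: "a dvd int (gap l)" for l unfolding inv using index3[OF dist, of l] by(elim disjE) simp_all
 have al: "int lam' = a * lam_h" using \<open>a dvd lam\<close> unfolding a(2) inv(4) by simp
 note T = trinomial_curve.stability_dichotomy[OF tc tri' sum' ad al p]
 show ?thesis unfolding X_def V_def t_def inv of_int_of_nat_eq by(rule T)
qed

theorem theorem5p6:
  fixes h :: "'k::alg_closed_field poly3"
    and \<iota> :: "'k poly3 \<Rightarrow> 'l::field"
    and d p :: nat
    and \<alpha> \<beta> \<nu> lam a lam_h :: int
  assumes "CHAR('k) = p" and "p > 0"
    and "regular_trinomial d h" and "d \<ge> 2"
    and "trinomial_invariants d h \<alpha> \<beta> \<nu> lam"
    and "a = Gcd {\<alpha>, \<beta>, \<nu>, lam}" and "lam_h = lam div a"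
    and "coordinate_ring_map h \<iota>"
    and "[int p = 1] (mod (2 * lam_h)) \<or> [int p = - 1] (mod (2 * lam_h))"
    and "p \<ge> d\<^sup>2"
  defines "X \<equiv> normalized_curve \<iota> h"
    and "V \<equiv> V_bundle \<iota> h"
    and "t \<equiv> (\<lambda>n::nat. taxicab (of_int \<alpha> * real n / of_int lam, of_int \<beta> * real n / of_int lam,
                             of_int \<nu> * real n / of_int lam))"
  shows "strongly_semistable p X (V 1) \<and>
    (\<forall>n. 1 \<le> n \<and> n \<le> p \<longrightarrow>
       strongly_semistable p X (V n) \<or>
       (\<not> semistable X (V n) \<and>
        (\<exists>\<L> u. HN_filtration X (V n) [zero_bundle, \<L>, V n] \<and>
           u \<in> L_odd \<and> t n u < 1 \<and> (\<forall>u'\<in>L_odd. t n u' < 1 \<longrightarrow> u' = u) \<and>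
           of_int (bundle_degree X \<L>) = - (real n * real d / 2) + of_int lam / 2 * (1 - t n u))))"
proof -
 have p: "prime CHAR('k)" using assms(1,2) by(intro prime_CHAR_semidom) simp
 have pd: "d\<^sup>2 <= CHAR('k)" using assms(1,10) by simp
 note p1 = assms(9)[folded assms(1)]
 from assms(5) show ?thesis
 proof cases
  case (type_I x y z a1 a2 b1 b2 c1 c2)
  have big: "d < 2 * a1" "d < 2 * b1" "d < 2 * c1" using type_I(6-8) by linarith+
  have small: "b2 <= a1" "a2 <= c1" "c2 <= b1" "c2 <= a1" using big type_I(3-5) by linarith+
  \<comment> \<open>The locale takes lam as a natural number; the value in the theorem is an
    integer, shown to be nonnegative next.\<close>
  define l where "l = nat lam"
  have "int b1 * int c2 <= int b1 * int a1" using small(4) by(intro mult_left_mono) auto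
  hence "0 <= lam" unfolding type_I(12) by(simp add: mult.commute add_increasing2)
  hence l: "lam = int l" by(simp add: l_def)
  have "int (l + b1 * c2) = int (a1 * b1 + a2 * c2)" using type_I(12) unfolding l by simp
  hence l': "l + b1 * c2 = a1 * b1 + a2 * c2" by(simp only: of_nat_eq_iff)
  note C = trinomial_curve_I[OF p pd assms(4,8) type_I(1-5) big l']
  note v = v3_simps[OF type_I(1)]
  let ?gap = "v3 x y (b1 - c2) (c1 - a2) (a1 - b2)"
  have inv: "\<alpha> = int (?gap z)" "\<beta> = int (?gap y)" "\<nu> = int (?gap x)"
   using type_I(3-5,9-11) small by(simp_all add: v of_nat_diff)
  have gaps: "?gap x <= ?gap y + ?gap z" "?gap y <= ?gap x + ?gap z" "?gap z <= ?gap x + ?gap y"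
   "?gap x + ?gap y + ?gap z <= 2 * l" using type_I(3-5) big C(2-5) by(simp_all add: v)
  show ?thesis unfolding X_def V_def t_def assms(1)[symmetric]
   by(rule stability_of_trinomial_curve[OF C(1) inv l gaps assms(6,7) p1])
 next
  case (type_II x y z a1 a2 a3 b c)
  have big: "d < 2 * a2" "d < 2 * c" using type_II(5,6) by linarith+
  have small: "a3 <= c" "b <= a2" "d <= a2 + c" using big type_II(3,4) by linarith+
  define l where "l = nat lam"
  have "int a3 * int b <= int c * int a2" using small(1,2) by(intro mult_mono) auto
  hence "0 <= lam" unfolding type_II(10) by(simp add: mult.commute)
  hence l: "lam = int l" by(simp add: l_def)
  have "int (l + a3 * b) = int (a2 * c)" using type_II(10) unfolding l by simp
  hence l': "l + a3 * b = a2 * c" by(simp only: of_nat_eq_iff)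
  note C = trinomial_curve_II[OF p pd assms(4,8) type_II(1-4) big l']
  note v = v3_simps[OF type_II(1)]
  let ?gap = "v3 x y (a2 + c - d) c a2"
  have inv: "\<alpha> = int (?gap z)" "\<beta> = int (?gap y)" "\<nu> = int (?gap x)"
   using type_II(3,4,7-9) small by(simp_all add: v of_nat_diff)
  \<comment> \<open>The sum of the gaps is 2(a2 + c) - d, which \<open>trinomial_curve_II\<close>
    bounds by twice lam.\<close>
  have gaps: "?gap x <= ?gap y + ?gap z" "?gap y <= ?gap x + ?gap z" "?gap z <= ?gap x + ?gap y"
   "?gap x + ?gap y + ?gap z <= 2 * l" using type_II(3,4) small big C(2,3) by(simp_all add: v)
  show ?thesis unfolding X_def V_def t_def assms(1)[symmetric]
   by(rule stability_of_trinomial_curve[OF C(1) inv l gaps assms(6,7) p1])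
 qed
qed

end
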